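(* Let $S=\{2,3,4,5,6,7,8,9,10,12,13,16,18,25\}$ and, for $N\in S$, let $t_N$ and $h_N$ be the Hauptmodul of $\Gamma_0(N)$ and the function holomorphic near $0$ defined in the context. Let $\hat h_1(x)={}_2F_1(\tfrac1{12},\tfrac5{12};1;x)$. All fractional powers below denote the branch equal to $1$ at $t=0$. (1) Let $M\in S$ and write, in lowest terms, $j(\tau)=P(t_M(\tau))/Q(t_M(\tau))$ and $j(M\tau)=P'(t_M(\tau))/Q'(t_M(\tau))$ with polynomials $P,Q,P',Q'$ ($P',Q'$ do not denote derivatives). Then for all $t$ in a neighborhood of $0$, $$h_M(t)=\left[\frac{P(t)}{P(0)}\right]^{-1/12}\hat h_1\!\left(\frac{12^3Q(t)}{P(t)}\right)=\left[\frac{P'(t)}{P'(0)}\right]^{-1/12}\hat h_1\!\left(\frac{12^3Q'(t)}{P'(t)}\right).$$ (2) Let $M$ and $NM$ both be in $S$ ($N$ a positive integer) and write, in lowest terms, $t_M(\tau)=P(t_{NM}(\tau))/Q(t_{NM}(\tau))$ and $t_M(N\tau)=P'(t_{NM}(\tau))/Q'(t_{NM}(\tau))$ with polynomials $P,Q,P',Q'$. Then for all $t$ in a neighborhood of $0$, $$h_{NM}(t)=\left[\frac{Q(t)}{Q(0)}\right]^{-\psi(M)/12}h_M\!\left(\frac{P(t)}{Q(t)}\right)=\left[\frac{Q'(t)}{Q'(0)}\right]^{-\psi(M)/12}h_M\!\left(\frac{P'(t)}{Q'(t)}\right).$$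
   Context: $j$ is the elliptic modular invariant $j(\tau)=q^{-1}+744+\cdots$, $q=e^{2\pi i\tau}$, $\tau$ in the upper half plane $\mathcal H$. $\psi(N)=N\prod_{p\mid N}(1+1/p)$ (product over primes). The set $S$ consists of the $N>1$ for which $X_0(N)=\Gamma_0(N)\setminus\mathcal H^*$ has genus zero. Write $[m]$ for $\eta(m\tau)$, $\eta$ the Dedekind eta function. The canonical Hauptmodul $t_N$ (a generator of the function field of $X_0(N)$, with a simple zero at the cusp $i\infty$ and a simple pole at the cusp $0$) is: $t_2=2^{12}[2]^{24}/[1]^{24}$, $t_3=3^6[3]^{12}/[1]^{12}$, $t_4=2^8[4]^8/[1]^8$, $t_5=5^3[5]^6/[1]^6$, $t_6=2^33^2[2][6]^5/([1]^5[3])$, $t_7=7^2[7]^4/[1]^4$, $t_8=2^5[2]^2[8]^4/([1]^4[4]^2)$, $t_9=3^3[9]^3/[1]^3$, $t_{10}=2^2\cdot5\,[2][10]^3/([1]^3[5])$, $t_{12}=2^2\cdot3\,[2]^2[3][12]^3/([1]^3[4][6]^2)$, $t_{13}=13[13]^2/[1]^2$, $t_{16}=2^3[2][16]^2/([1]^2[8])$, $t_{18}=2\cdot3\,[2][3][18]^2/([1]^2[6][9])$, $t_{25}=5[25]/[1]$. Since $t_N$ generates the function field of $X_0(N)$, $j=P_N(t_N)/Q_N(t_N)$ with coprime polynomials $P_N,Q_N$, and $Q_N(0)=0$. The function $h_N$ is defined near $t=0$ by $h_N(t)=[P_N(t)/P_N(0)]^{-1/12}\,{}_2F_1\bigl(\tfrac1{12},\tfrac5{12};1;12^3Q_N(t)/P_N(t)\bigr)$,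 the branch of the power being $1$ at $t=0$. *)

theory Defs
  imports "HOL-Analysis.Analysis" "HOL-Computational_Algebra.Computational_Algebra"
begin

text \<open>The lattice invariants \<open>g2\<close>, \<open>g3\<close> of \<open>\<int> + \<int>\<tau>\<close> and the elliptic modular invariant
  \<open>j = 1728 g2^3 / (g2^3 - 27 g3^2) = 1/q + 744 + \<dots>\<close>. These functions, like \<open>dedekind_eta\<close>
  and \<open>hauptmodul\<close> below, are meaningful for \<open>Im \<tau> > 0\<close> only.\<close>

definition g2_inv :: "complex \<Rightarrow> complex" where
  "g2_inv \<tau> = 60 * (\<Sum>\<^sub>\<infinity>(m, n)\<in>UNIV - {(0, 0)}. 1 / (of_int m + of_int n * \<tau>) ^ 4)"

definition g3_inv :: "complex \<Rightarrow> complex" where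
  "g3_inv \<tau> = 140 * (\<Sum>\<^sub>\<infinity>(m, n)\<in>UNIV - {(0, 0)}. 1 / (of_int m + of_int n * \<tau>) ^ 6)"

definition modular_j :: "complex \<Rightarrow> complex" where
  "modular_j \<tau> = 12 ^ 3 * g2_inv \<tau> ^ 3 / (g2_inv \<tau> ^ 3 - 27 * g3_inv \<tau> ^ 2)"

definition dedekind_eta :: "complex \<Rightarrow> complex" where
  "dedekind_eta \<tau> =
     exp (2 * of_real pi * \<i> * \<tau> / 24) * (\<Prod>n. 1 - exp (2 * of_real pi * \<i> * \<tau>) ^ Suc n)"

definition dedekind_psi :: "nat \<Rightarrow> real" where
  "dedekind_psi N = real N * (\<Prod>p | prime p \<and> p dvd N. 1 + 1 / real p)"

text \<open>The levels \<open>N > 1\<close> for which \<open>X\<^sub>0(N)\<close> has genus zero.\<close>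

definition genus0_levels :: "nat set" where
  "genus0_levels = {2, 3, 4, 5, 6, 7, 8, 9, 10, 12, 13, 16, 18, 25}"

text \<open>The canonical Hauptmodul \<open>t\<^sub>N\<close>; the value \<open>0\<close> for \<open>N\<close> outside \<open>genus0_levels\<close> is a dummy.\<close>

definition hauptmodul :: "nat \<Rightarrow> complex \<Rightarrow> complex" where
  "hauptmodul N \<tau> = (let e = (\<lambda>m::nat. dedekind_eta (of_nat m * \<tau>)) in
     if N = 2 then 2^12 * e 2 ^ 24 / e 1 ^ 24
     else if N = 3 then 3^6 * e 3 ^ 12 / e 1 ^ 12
     else if N = 4 then 2^8 * e 4 ^ 8 / e 1 ^ 8
     else if N = 5 then 5^3 * e 5 ^ 6 / e 1 ^ 6
     else if N = 6 then 2^3 * 3^2 * (e 2 * e 6 ^ 5) / (e 1 ^ 5 * e 3)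
     else if N = 7 then 7^2 * e 7 ^ 4 / e 1 ^ 4
     else if N = 8 then 2^5 * (e 2 ^ 2 * e 8 ^ 4) / (e 1 ^ 4 * e 4 ^ 2)
     else if N = 9 then 3^3 * e 9 ^ 3 / e 1 ^ 3
     else if N = 10 then 2^2 * 5 * (e 2 * e 10 ^ 3) / (e 1 ^ 3 * e 5)
     else if N = 12 then 2^2 * 3 * (e 2 ^ 2 * e 3 * e 12 ^ 3) / (e 1 ^ 3 * e 4 * e 6 ^ 2)
     else if N = 13 then 13 * e 13 ^ 2 / e 1 ^ 2
     else if N = 16 then 2^3 * (e 2 * e 16 ^ 2) / (e 1 ^ 2 * e 8)
     else if N = 18 then 2 * 3 * (e 2 * e 3 * e 18 ^ 2) / (e 1 ^ 2 * e 6 * e 9)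
     else if N = 25 then 5 * e 25 / e 1
     else 0)"

text \<open>\<open>f = P(t)/Q(t)\<close> in lowest terms, as functions on the upper half plane. For holomorphic \<open>f\<close>
  and holomorphic nonconstant \<open>t\<close> the denominator cannot vanish there, because \<open>P\<close> and \<open>Q\<close> are
  coprime; saying so explicitly keeps the convention \<open>x / 0 = 0\<close> out of play.\<close>

definition lowest_terms ::
  "(complex \<Rightarrow> complex) \<Rightarrow> (complex \<Rightarrow> complex) \<Rightarrow> complex poly \<Rightarrow> complex poly \<Rightarrow> bool" where
  "lowest_terms f t P Q \<longleftrightarrow> coprime P Q \<and>
     (\<forall>\<tau>. Im \<tau> > 0 \<longrightarrow> poly Q (t \<tau>) \<noteq> 0 \<and> f \<tau> = poly P (t \<tau>) / poly Q (t \<tau>))"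

text \<open>\<open>eval_fps\<close> sums the power series, so this is Gauss's function on its disc of convergence.\<close>

definition hyp2F1 :: "complex \<Rightarrow> complex \<Rightarrow> complex \<Rightarrow> complex \<Rightarrow> complex" where
  "hyp2F1 a b c x = eval_fps (fps_hypergeo [a, b] [c] 1) x"

definition h1_hat :: "complex \<Rightarrow> complex" where
  "h1_hat x = hyp2F1 (1/12) (5/12) 1 x"

text \<open>The pair \<open>(P\<^sub>N, Q\<^sub>N)\<close> is determined up to a common nonzero constant factor, which cancels in
  \<open>h_fun\<close>. Since \<open>P(t)/P(0)\<close> is close to \<open>1\<close> for \<open>t\<close> near \<open>0\<close>, the principal branch of \<open>powr\<close> is
  the one with value \<open>1\<close> at \<open>t = 0\<close>.\<close>

definition j_frac :: "nat \<Rightarrow> complex poly \<times> complex poly" where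
  "j_frac N = (SOME (P, Q). lowest_terms modular_j (hauptmodul N) P Q)"

definition h_fun :: "nat \<Rightarrow> complex \<Rightarrow> complex" where
  "h_fun N t = (let (P, Q) = j_frac N in
     (poly P t / poly P 0) powr (-1/12) * h1_hat (12^3 * poly Q t / poly P t))"

end

theory Submission
  imports Defs "HOL-Complex_Analysis.Complex_Analysis"
begin

text \<open>Near the cusp, \<open>h1_hat (1728 / j)\<close> is \<open>E4 powr (1/4)\<close>, and \<open>E4\<^sup>3 = j Delta\<close>. So the twelfth power of
  \<open>[P(t)/P(0)] powr (-1/12) * h1_hat (1728 Q(t)/P(t))\<close> is a constant times \<open>Delta / Q(t)\<close>, and (1) amounts to
  \<open>Delta (M\<tau>) Q(t) / (Delta \<tau> Q'(t))\<close> being constant, which holds because it is a rational function of \<open>t\<close>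
  without zeros and poles. For (2), substitute \<open>t\<^sub>M = P/Q\<close> into \<open>j = A(t\<^sub>M)/B(t\<^sub>M)\<close>: when \<open>deg A = \<psi>(M) > deg B\<close>,
  the fractions stay in lowest terms after clearing denominators by \<open>Q ^ \<psi>(M)\<close>, and (2) reduces to (1).
  Explicit \<open>A, B\<close> are needed only for \<open>M \<in> {2, 3, 4, 5, 6, 8, 9}\<close>. At levels 2, 3 and 5 they come from the product
  of the relation over the cosets of \<open>\<Gamma>\<^sub>0(p)\<close>, a modular function of level one vanishing at the cusp.
  At levels 4, 6, 8 and 9, a local solution \<open>y\<close> of the expected relation near the cusp has the same
  twenty-fourth power as \<open>t\<^sub>M\<close>.\<close>

section \<open>The Eisenstein series of weights 2, 4 and 6\<close>

text \<open>The hypotheses \<open>lowest_terms\<close> take the place of the theory of X_0(N): they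
  say that j is a rational function of t, and from there the argument stays on the half plane. Only
  finitely many functions arise from t by words in the two generators, so t omits exactly the zeros
  of Q, and divisors on a curve become orders of polynomials. The sixth power of j' has weight 12,
  that of Delta, and turns E4 and E6 into powers of j and j - 1728. Twelfth powers remove the
  fractional exponents; the lost root of unity is recovered from the value 1 at t = 0. The obstacle
  in (2) is the exponent: lowest terms alone do not reveal that deg A = psi(M) > deg B, which is
  what fixes the power of Q. A proper multiple of M lies in S only for the seven listed M, so these
  degrees can be read off explicit formulas; for N = 1 the claim is immediate. The maximum principle
  does the work of the valence formula: a level one function vanishing at the cusp is zero.\<close>

lemma sin_pi_nonzero:
  assumes "(z::complex) \<notin> \<int>"
  shows "sin (of_real pi * z) \<noteq> 0"
proof
  assume "sin (of_real pi * z) = 0"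
  then obtain n :: int where "of_real pi * z = of_real (of_int n * pi)" by (auto simp: sin_eq_0)
  hence "z = of_int n" by simp
  thus False using assms by simp
qed

text \<open>Logarithmic derivative of the reflection formula of Gamma.\<close>

lemma Digamma_reflection:
  fixes z :: complex
  assumes "z \<notin> \<int>"
  shows "Digamma (1 - z) - Digamma z = of_real pi * cot (of_real pi * z)"
proof -
  have z1: "1 - z \<notin> \<int>" using assms by (metis Ints_1 Ints_diff minus_diff_eq diff_add_cancel add_diff_cancel_left' diff_diff_eq2)
  have nz: "z \<notin> \<int>\<^sub>\<le>\<^sub>0" "1 - z \<notin> \<int>\<^sub>\<le>\<^sub>0" using assms z1 nonpos_Ints_Int by auto
  have s: "sin (of_real pi * z) \<noteq> 0"
    using sin_pi_nonzero[OF assms] .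
  have fe: "Gamma w * Gamma (1 - w) = of_real pi / sin (of_real pi * w)" for w :: complex
    using Gamma_reflection_complex .
  have "((\<lambda>w. Gamma w * Gamma (1 - w)) has_field_derivative
      (Gamma z * Digamma z * Gamma (1 - z) - Gamma z * (Gamma (1 - z) * Digamma (1 - z)))) (at z)"
    using nz by (auto intro!: derivative_eq_intros)
  moreover have "((\<lambda>w. Gamma w * Gamma (1 - w)) has_field_derivative
      (- of_real pi * (cos (of_real pi * z) * of_real pi) / (sin (of_real pi * z))\<^sup>2)) (at z)"
    unfolding fe using s by (auto intro!: derivative_eq_intros simp: power2_eq_square)
  ultimately have "Gamma z * Digamma z * Gamma (1 - z) - Gamma z * (Gamma (1 - z) * Digamma (1 - z))
     = (- of_real pi * (cos (of_real pi * z) * of_real pi) / (sin (of_real pi * z))\<^sup>2)"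
    by (rule DERIV_unique)
  also have "Gamma z * Digamma z * Gamma (1 - z) - Gamma z * (Gamma (1 - z) * Digamma (1 - z))
     = - (Gamma z * Gamma (1 - z)) * (Digamma (1 - z) - Digamma z)" by (simp add: algebra_simps)
  also have "\<dots> = - (of_real pi / sin (of_real pi * z)) * (Digamma (1 - z) - Digamma z)"
    by (simp add: fe)
  finally have "of_real pi / sin (of_real pi * z) * (Digamma (1 - z) - Digamma z) =
     of_real pi / sin (of_real pi * z) * (of_real pi * cot (of_real pi * z))"
    by (simp add: cot_def power2_eq_square)
  thus ?thesis using s by simp
qed

text \<open>Links unconditional sums with the cotangent series, which converges only through
  symmetric partial sums. The half-open range splits into equally long parts n >= 0 and n <=
  -1.\<close>

lemma has_sum_imp_symmetric_limit:
  fixes f :: "int \<Rightarrow> 'a :: real_normed_vector"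
  assumes "(f has_sum s) UNIV"
  shows "(\<lambda>K. \<Sum>n\<in>{-int K..<int K}. f n) \<longlonglongrightarrow> s"
proof -
  have "filterlim (\<lambda>K. {-int K..<int K}) (finite_subsets_at_top UNIV) sequentially"
    unfolding filterlim_finite_subsets_at_top
  proof (intro allI impI)
    fix X :: "int set" assume X: "finite X \<and> X \<subseteq> UNIV"
    define B where "B = nat (Max (insert 0 (abs ` X))) + 1"
    have "\<bar>x\<bar> < int B" if "x \<in> X" for x
    proof -
      have "\<bar>x\<bar> \<le> Max (insert 0 (abs ` X))" using X that by (intro Max_ge) auto
      moreover have "0 \<le> Max (insert 0 (abs ` X))" using X by (intro Max_ge) auto
      ultimately show ?thesis by (simp add: B_def)
    qed
    then show "\<forall>\<^sub>F K in sequentially. finite {-int K..<int K} \<and> X \<subseteq> {-int K..<int K} \<and> {-int K..<int K} \<subseteq> UNIV"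
      by (intro eventually_mono[OF eventually_ge_at_top[of B]]) (force)
  qed
  then show ?thesis using assms unfolding has_sum_def
    by (rule filterlim_compose[rotated])
qed

lemma sum_int_split:
  fixes f :: "int \<Rightarrow> 'a :: ab_group_add"
  shows "(\<Sum>n\<in>{-int K..<int K}. f n) = (\<Sum>k<K. f (int k)) + (\<Sum>k<K. f (- 1 - int k))"
proof (induction K)
  case (Suc K)
  have "{-int (Suc K)..<int (Suc K)} = insert (int K) (insert (-1 - int K) {-int K..<int K})" by auto
  moreover have "int K \<notin> insert (-1 - int K) {-int K..<int K}" "-1 - int K \<notin> {-int K..<int K}" by auto
  ultimately show ?case using Suc by (simp add: algebra_simps)
qed auto

text \<open>The limit formulas for Digamma at z and at 1 - z are subtracted, and the logarithms
  cancel. The case z = 0 is included for the column m = 0 of the weight two lattice sum; there 1/0 =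
  0 and cot 0 = 0.\<close>

lemma cot_partial_fractions:
  fixes z :: complex
  assumes "z \<notin> \<int> \<or> z = 0"
  shows "(\<lambda>K. \<Sum>n\<in>{-int K..<int K}. 1 / (z + of_int n)) \<longlonglongrightarrow> of_real pi * cot (of_real pi * z)"
proof (cases "z = 0")
  case True
  \<comment> \<open>Opposite terms cancel, except for n = -K, which the half-open range leaves
    unpaired.\<close>
  have "(\<Sum>k<K. 1 / of_int (int k)) + (\<Sum>k<K. 1 / of_int (- 1 - int k)) = (- (1 / of_nat K) :: complex)" for K
  proof (induction K)
    case (Suc K)
    have [simp]: "1 / (-1 - of_nat K :: complex) = - (1 / (1 + of_nat K))"
      by (metis (no_types, opaque_lifting) add_uminus_conv_diff divide_minus_right minus_add_distrib)
    show ?case using Suc by (cases "K = 0") (simp_all add: algebra_simps)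
  qed simp
  moreover have "(\<lambda>K. - (1 / of_nat K) :: complex) \<longlonglongrightarrow> - 0"
    by (intro tendsto_minus lim_1_over_n)
  ultimately show ?thesis using True by (simp add: sum_int_split)
next
  case False
  with assms have z: "z \<notin> \<int>" by auto
  hence "1 - z \<noteq> 0" by auto
  have "(\<lambda>m. (of_real (ln (real m)) - (\<Sum>n<m. inverse ((1 - z) + of_nat n))) - (of_real (ln (real m)) - (\<Sum>n<m. inverse (z + of_nat n)))) \<longlonglongrightarrow> Digamma (1 - z) - Digamma z"
    using \<open>1 - z \<noteq> 0\<close> False by (intro tendsto_diff Digamma_LIMSEQ)
  moreover have "(of_real (ln (real m)) - (\<Sum>n<m. inverse ((1 - z) + of_nat n))) - (of_real (ln (real m)) - (\<Sum>n<m. inverse (z + of_nat n))) = (\<Sum>n\<in>{-int m..<int m}. 1 / (z + of_int n))" for m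
  proof -
    have "- inverse ((1 - z) + of_nat n) = 1 / (z + of_int (-1 - int n))" for n
      by (simp add: divide_inverse flip: inverse_minus_eq)
    hence "(\<Sum>n<m. 1 / (z + of_int (-1 - int n))) = - (\<Sum>n<m. inverse ((1 - z) + of_nat n))"
      by (simp add: sum_negf[symmetric] del: of_int_diff)
    thus ?thesis by (subst sum_int_split) (simp add: divide_inverse del: of_int_diff)
  qed
  ultimately show ?thesis using Digamma_reflection[OF z] by simp
qed

lemma open_non_Ints: "open (- (\<int>::complex set))"
  using closed_Ints by blast

text \<open>Differentiation of a reflection formula; the sign alternates because of the inner
  derivative of 1 - z.\<close>

lemma Polygamma_reflection_step:
  fixes F :: "complex \<Rightarrow> complex"
  assumes "\<And>z. z \<notin> \<int> \<Longrightarrow> Polygamma n z - (-1)^n * Polygamma n (1 - z) = F z"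
    and "\<And>z. z \<notin> \<int> \<Longrightarrow> (F has_field_derivative F' z) (at z)"
    and z: "z \<notin> \<int>"
  shows "Polygamma (Suc n) z - (-1)^Suc n * Polygamma (Suc n) (1 - z) = F' z"
proof -
  have z1: "1 - z \<notin> \<int>" using z by (metis Ints_1 Ints_diff minus_diff_eq diff_add_cancel add_diff_cancel_left' diff_diff_eq2)
  have nz: "z \<notin> \<int>\<^sub>\<le>\<^sub>0" "1 - z \<notin> \<int>\<^sub>\<le>\<^sub>0" using z z1 nonpos_Ints_Int by auto
  have "((\<lambda>z. Polygamma n z - (-1)^n * Polygamma n (1 - z)) has_field_derivative
     Polygamma (Suc n) z - (-1)^Suc n * Polygamma (Suc n) (1 - z)) (at z)"
    using nz by (auto intro!: derivative_eq_intros)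
  moreover have "((\<lambda>z. Polygamma n z - (-1)^n * Polygamma n (1 - z)) has_field_derivative F' z) (at z)"
    by (rule has_field_derivative_transform_within_open[OF assms(2)[OF z] open_non_Ints])
       (use z assms(1) in auto)
  ultimately show ?thesis by (rule DERIV_unique)
qed

lemma has_derivative_pi_cot:
  assumes "(z::complex) \<notin> \<int>"
  shows "((\<lambda>z. of_real pi * cot (of_real pi * z)) has_field_derivative
     - (of_real pi ^ 2 + (of_real pi * cot (of_real pi * z))^2)) (at z)"
proof -
  define s c where "s = sin (of_real pi * z)" and "c = cos (of_real pi * z)"
  have s: "s \<noteq> 0" "s\<^sup>2 + c\<^sup>2 = 1" using sin_pi_nonzero[OF assms] by (auto simp: s_def c_def)
  have "((\<lambda>z. of_real pi * cot (of_real pi * z)) has_field_derivative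
     of_real pi * (- inverse (s\<^sup>2) * of_real pi)) (at z)"
    using s(1) unfolding s_def by (auto intro!: derivative_eq_intros DERIV_chain2[OF DERIV_cot])
  also have "of_real pi * (- inverse (s\<^sup>2) * of_real pi) = - (of_real pi ^ 2 * ((s\<^sup>2 + c\<^sup>2) / s\<^sup>2))"
    using s by (simp add: power2_eq_square divide_inverse)
  also have "\<dots> = - (of_real pi ^ 2 + (of_real pi * (c / s))^2)"
    using s(1) by (simp add: field_simps)
  finally show ?thesis by (simp add: s_def c_def cot_def)
qed

lemma Polygamma_1_reflection:
  fixes z :: complex
  assumes "z \<notin> \<int>"
  shows "Polygamma 1 z + Polygamma 1 (1 - z) = of_real pi ^ 2 + (of_real pi * cot (of_real pi * z))^2"
proof -
  have "Polygamma (Suc 0) z - (-1)^Suc 0 * Polygamma (Suc 0) (1 - z) = - (- (of_real pi ^ 2 + (of_real pi * cot (of_real pi * z))^2))"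
  proof (rule Polygamma_reflection_step[OF _ _ assms])
    show "Polygamma 0 z - (-1)^0 * Polygamma 0 (1 - z) = - (of_real pi * cot (of_real pi * z))" if "z \<notin> \<int>" for z :: complex
      using Digamma_reflection[OF that] by (metis minus_diff_eq mult_1 power_0)
  next
    show "((\<lambda>z. - (of_real pi * cot (of_real pi * z))) has_field_derivative - (- (of_real pi ^ 2 + (of_real pi * cot (of_real pi * z))^2))) (at z)"
       if "z \<notin> \<int>" for z :: complex
      using DERIV_minus[OF has_derivative_pi_cot[OF that]] .
  qed
  thus ?thesis by simp
qed

lemma half_not_Int: "(1/2::complex) \<notin> \<int>"
proof
  assume "(1/2::complex) \<in> \<int>"
  then obtain n :: int where "(1/2::complex) = of_int n" by (auto elim: Ints_cases)
  hence "of_int (2 * n) = (of_int 1 :: complex)" by (simp add: field_simps)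
  hence "2 * n = 1" by (simp only: of_int_eq_iff)
  thus False by presburger
qed

text \<open>At z = 1/2 the two Polygamma values of the reflection formula coincide and cot vanishes.
  The formulas of higher order are obtained by differentiating polynomials in c = pi cot(pi z),
  where c' = -(pi^2 + c^2).\<close>

lemma Polygamma_3_5_half:
  "Polygamma 3 (1/2 :: complex) = of_real pi ^ 4"
  "Polygamma 5 (1/2 :: complex) = 8 * of_real pi ^ 6"
proof -
  define c where "c = (\<lambda>z. of_real pi * cot (of_real pi * z) :: complex)"
  define p :: complex where "p = of_real pi"
  have step: "Polygamma (Suc n) z - (-1)^Suc n * Polygamma (Suc n) (1 - z) = G' (c z) * (-(p^2 + c z ^2))"
    if "\<And>z. z \<notin> \<int> \<Longrightarrow> Polygamma n z - (-1)^n * Polygamma n (1 - z) = G (c z)"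
      "\<And>w. (G has_field_derivative G' w) (at w)" "z \<notin> \<int>" for n G G' and z
  proof (rule Polygamma_reflection_step[OF that(1) _ that(3)])
    show "((\<lambda>z. G (c z)) has_field_derivative G' (c z) * (-(p^2 + c z ^2))) (at z)" if "z \<notin> \<int>" for z
      using DERIV_chain2[OF \<open>\<And>w. (G has_field_derivative G' w) (at w)\<close> has_derivative_pi_cot[OF that]]
      unfolding c_def p_def .
  qed
  have 1: "Polygamma 1 z - (-1)^1 * Polygamma 1 (1 - z) = p^2 + c z ^2" if "z \<notin> \<int>" for z
    unfolding c_def p_def using Polygamma_1_reflection[OF that] by simp
  have 2: "Polygamma (Suc 1) z - (-1)^Suc 1 * Polygamma (Suc 1) (1 - z) = (2 * c z) * (-(p^2 + c z ^2))" if "z \<notin> \<int>" for z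
    by (rule step[where G = "\<lambda>w. p^2 + w^2" and G' = "\<lambda>w. 2*w", OF 1 _ that]) (auto intro!: derivative_eq_intros)
  have 3: "Polygamma (Suc (Suc 1)) z - (-1)^Suc (Suc 1) * Polygamma (Suc (Suc 1)) (1 - z) = (-2*p^2 - 6 * c z^2) * (-(p^2 + c z ^2))" if "z \<notin> \<int>" for z
    by (rule step[where G = "\<lambda>w. (2*w) * (-(p^2+w^2))" and G' = "\<lambda>w. -2*p^2 - 6*w^2", OF 2 _ that])
       (auto intro!: derivative_eq_intros simp: algebra_simps power2_eq_square)
  have 4: "Polygamma (Suc (Suc (Suc 1))) z - (-1)^Suc (Suc (Suc 1)) * Polygamma (Suc (Suc (Suc 1))) (1 - z) = (16 * p^2 * c z + 24 * c z ^ 3) * (-(p^2 + c z ^2))" if "z \<notin> \<int>" for z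
    by (rule step[where G = "\<lambda>w. (-2*p^2 - 6*w^2) * (-(p^2+w^2))" and G' = "\<lambda>w. 16*p^2*w + 24*w^3", OF 3 _ that])
       (auto intro!: derivative_eq_intros simp: algebra_simps power2_eq_square power3_eq_cube)
  have 5: "Polygamma (Suc (Suc (Suc (Suc 1)))) z - (-1)^Suc (Suc (Suc (Suc 1))) * Polygamma (Suc (Suc (Suc (Suc 1)))) (1 - z) = ((16*p^2+72*c z^2) * (-(p^2+c z^2)) - (16*p^2*c z+24*c z^3)*(2*c z)) * (-(p^2 + c z ^2))" if "z \<notin> \<int>" for z
    by (rule step[where G = "\<lambda>w. (16*p^2*w + 24*w^3) * (-(p^2+w^2))" and G' = "\<lambda>w. (16*p^2+72*w^2) * (-(p^2+w^2)) - (16*p^2*w+24*w^3)*(2*w)", OF 4 _ that])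
       (auto intro!: derivative_eq_intros simp: algebra_simps power2_eq_square power3_eq_cube)
  have c0: "c (1/2) = 0"
    using cos_of_real[of "pi/2", where 'a=complex] by (simp add: c_def cot_def)
  have "2 * Polygamma 3 (1/2::complex) = 2 * p^4"
    using 3[OF half_not_Int] by (simp add: c0 eval_nat_numeral)
  thus "Polygamma 3 (1/2 :: complex) = of_real pi ^ 4" by (simp add: p_def)
  have "2 * Polygamma 5 (1/2::complex) = 2 * (8 * p^6)"
    using 5[OF half_not_Int] by (simp add: c0 eval_nat_numeral)
  thus "Polygamma 5 (1/2 :: complex) = 8 * of_real pi ^ 6" by (simp add: p_def)
qed

lemma has_sum_int_split:
  fixes f :: "int \<Rightarrow> 'a :: real_normed_vector"
  assumes "((\<lambda>k. f (int k)) has_sum a) UNIV" "((\<lambda>k. f (- 1 - int k)) has_sum b) UNIV"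
  shows "(f has_sum (a + b)) UNIV"
proof -
  have "(f has_sum a) (range int)"
    using assms(1) by (subst has_sum_reindex) (auto simp: o_def)
  moreover have "(f has_sum b) (range (\<lambda>k. - 1 - int k))"
    using assms(2) by (subst has_sum_reindex) (auto simp: o_def inj_on_def)
  moreover have "range int \<inter> range (\<lambda>k. - 1 - int k) = {}" by auto
  moreover have "range int \<union> range (\<lambda>k. - 1 - int k) = UNIV"
  proof -
    have "x \<in> range int \<union> range (\<lambda>k. - 1 - int k)" for x
      by (cases "x \<ge> 0") (auto simp: image_iff intro: exI[of _ "nat x"] exI[of _ "nat (-1 - x)"])
    thus ?thesis by auto
  qed
  ultimately show ?thesis using has_sum_Un_disjoint by metis
qed

lemma summable_inverse_shift_power:
  fixes z :: complex
  assumes k: "k \<ge> 2"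
  shows "summable (\<lambda>n. norm (inverse ((z + of_nat n) ^ k)))"
proof (rule summable_comparison_test_ev)
  show "summable (\<lambda>n. 2^k * inverse (real n ^ k))"
    using inverse_power_summable[OF k] by (intro summable_mult)
  show "\<forall>\<^sub>F n in sequentially. norm (norm (inverse ((z + of_nat n) ^ k))) \<le> 2^k * inverse (real n ^ k)"
    using eventually_gt_at_top[of "nat \<lceil>2 * norm z + 1\<rceil>"]
  proof eventually_elim
    case (elim n)
    hence n: "real n > 2 * norm z + 1" by linarith
    have "norm (z + of_nat n) \<ge> norm (of_nat n :: complex) - norm z" by (metis add.commute norm_diff_ineq)
    hence "norm (z + of_nat n) \<ge> real n / 2" using n by simp
    hence "norm (z + of_nat n) ^ k \<ge> (real n / 2) ^ k" by (intro power_mono) auto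
    moreover have "(real n / 2) ^ k > 0" using n norm_ge_zero[of z] by (intro zero_less_power) linarith
    ultimately have "inverse (norm (z + of_nat n) ^ k) \<le> inverse ((real n / 2) ^ k)" by (intro le_imp_inverse_le)
    also have "inverse ((real n / 2) ^ k) = 2^k * inverse (real n ^ k)" by (simp add: power_divide inverse_eq_divide)
    finally show ?case by (simp add: norm_inverse norm_power)
  qed
qed

text \<open>Separating even and odd n in z = zeta(k) gives z - z/2^k = s/2^k. Evenness of k accounts
  for the factor 2, and the term n = 0 is 1/0 = 0.\<close>

lemma has_sum_zeta_int:
  fixes s :: complex
  assumes k: "k \<ge> 2" "even k" and s: "(\<lambda>n. inverse ((1/2 + of_nat n) ^ k)) sums s"
  shows "((\<lambda>n::int. 1 / of_int n ^ k) has_sum (2 * s / (2^k - 1))) UNIV"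
proof -
  define z where "z = (\<Sum>n. inverse ((1 + of_nat n) ^ k) :: complex)"
  have sm: "summable (\<lambda>n. norm (inverse ((1 + of_nat n) ^ k) :: complex))"
    using summable_inverse_shift_power[OF k(1), of 1] .
  have z: "(\<lambda>n. inverse ((1 + of_nat n) ^ k) :: complex) sums z"
    unfolding z_def by (rule summable_sums[OF summable_norm_cancel[OF sm]])
  have "(\<lambda>n. \<Sum>i\<in>{n*2..<n*2+2}. inverse ((1 + of_nat i) ^ k) :: complex) sums z"
    by (rule sums_group[OF z]) simp
  moreover have "(\<Sum>i\<in>{n*2..<n*2+2}. inverse ((1 + of_nat i) ^ k)) =
      (inverse ((1 + 2 * of_nat n) ^ k) + inverse ((2 + 2 * of_nat n) ^ k) :: complex)" for n
  proof -
    have "{n*2..<n*2+2} = {2*n, 2*n+1}" by auto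
    moreover have "1 + of_nat (2 * n + 1) = (2 + 2 * of_nat n :: complex)" by simp
    ultimately show ?thesis by simp
  qed
  ultimately have "(\<lambda>n. inverse ((1 + 2 * of_nat n) ^ k) + inverse ((2 + 2 * of_nat n) ^ k) :: complex) sums z"
    by simp
  moreover have "(\<lambda>n. inverse ((2 + 2 * of_nat n) ^ k) :: complex) sums (inverse (2^k) * z)"
  proof -
    have "inverse (2 ^ k) * inverse ((1 + of_nat n) ^ k) = (inverse ((2 + 2 * of_nat n) ^ k) :: complex)" for n
    proof -
      have "(2 + 2 * of_nat n :: complex) = 2 * (1 + of_nat n)" by (simp add: field_simps)
      thus ?thesis by (simp only: power_mult_distrib inverse_mult_distrib)
    qed
    thus ?thesis using sums_mult[OF z, of "inverse (2^k)"] by simp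
  qed
  ultimately have "(\<lambda>n. inverse ((1 + 2 * of_nat n) ^ k) :: complex) sums (z - inverse (2^k) * z)"
    using sums_diff by fastforce
  moreover have "(\<lambda>n. inverse ((1 + 2 * of_nat n) ^ k) :: complex) sums (inverse (2^k) * s)"
  proof -
    have "inverse (2 ^ k) * inverse ((1 / 2 + of_nat n) ^ k) = (inverse ((1 + 2 * of_nat n) ^ k) :: complex)" for n
    proof -
      have "(1 + 2 * of_nat n :: complex) = 2 * (1/2 + of_nat n)" by (simp add: field_simps)
      thus ?thesis by (simp only: power_mult_distrib inverse_mult_distrib)
    qed
    thus ?thesis using sums_mult[OF s, of "inverse (2^k)"] by simp
  qed
  ultimately have eq: "z - inverse (2^k) * z = inverse (2^k) * s" by (rule sums_unique2)
  have k1: "(2::complex)^k \<noteq> 1"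
  proof -
    have "(2::complex)^k = of_nat (2^k)" by simp
    moreover have "(2::nat)^k \<noteq> 1" using k by simp
    ultimately show ?thesis by (metis of_nat_1 of_nat_eq_iff)
  qed
  have zs: "z = s / (2^k - 1)"
  proof -
    have "2^k * (z - inverse (2^k) * z) = 2^k * (inverse (2^k) * s)" using eq by simp
    hence "2^k * z - z = s" by (simp add: algebra_simps)
    thus ?thesis using k1 by (simp add: field_simps)
  qed
  have hz: "((\<lambda>n. inverse ((1 + of_nat n) ^ k) :: complex) has_sum z) UNIV"
    using norm_summable_imp_has_sum[OF sm z] .
  have neg: "((\<lambda>m. 1 / of_int (- 1 - int m) ^ k :: complex) has_sum z) UNIV"
  proof -
    have "(1 / of_int (- 1 - int m) ^ k :: complex) = inverse ((1 + of_nat m) ^ k)" for m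
    proof -
      have "(of_int (- 1 - int m) :: complex) = - (1 + of_nat m)" by simp
      thus ?thesis using k(2) by (simp only: power_minus_even) (simp add: divide_inverse)
    qed
    thus ?thesis using hz by simp
  qed
  have "((\<lambda>m. 1 / of_int (int m) ^ k :: complex) has_sum z) UNIV"
  proof -
    have "((\<lambda>m. 1 / of_nat m ^ k :: complex) has_sum z) (range Suc)"
      using hz by (subst has_sum_reindex) (auto simp: o_def divide_inverse)
    also have "?this \<longleftrightarrow> ?thesis"
      by (rule has_sum_cong_neutral) (use k not0_implies_Suc in \<open>auto simp: image_iff\<close>)
    finally show ?thesis .
  qed
  from has_sum_int_split[OF this neg] show ?thesis by (simp add: zs)
qed

text \<open>These are the numbers 2 zeta(k), the constant terms of the lattice sums of weight
  k.\<close>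

lemma zeta_int_values:
  "((\<lambda>n::int. 1 / of_int n ^ 2 :: complex) has_sum (of_real pi ^ 2 / 3)) UNIV"
  "((\<lambda>n::int. 1 / of_int n ^ 4 :: complex) has_sum (of_real pi ^ 4 / 45)) UNIV"
  "((\<lambda>n::int. 1 / of_int n ^ 6 :: complex) has_sum (2 * of_real pi ^ 6 / 945)) UNIV"
proof -
  have "cot (of_real pi / 2 :: complex) = 0"
    using cos_of_real[of "pi/2", where 'a=complex] by (simp add: cot_def)
  hence P1: "Polygamma 1 (1/2::complex) = of_real pi ^ 2 / 2"
    using Polygamma_1_reflection[OF half_not_Int] by (simp add: field_simps)
  have "(\<lambda>n. inverse ((1/2 + of_nat n) ^ 2) :: complex) sums (of_real pi ^ 2 / 2)"
    using Polygamma_LIMSEQ[of "1/2::complex" 1] unfolding P1 by (simp add: numeral_2_eq_2)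
  from has_sum_zeta_int[OF _ _ this]
  show "((\<lambda>n::int. 1 / of_int n ^ 2 :: complex) has_sum (of_real pi ^ 2 / 3)) UNIV" by simp
  have "(\<lambda>n. inverse ((1/2 + of_nat n) ^ 4) :: complex) sums (of_real pi ^ 4 / 6)"
    using Polygamma_LIMSEQ[of "1/2::complex" 3] Polygamma_3_5_half by (simp add: eval_nat_numeral)
  from has_sum_zeta_int[OF _ _ this]
  show "((\<lambda>n::int. 1 / of_int n ^ 4 :: complex) has_sum (of_real pi ^ 4 / 45)) UNIV" by simp
  have "(\<lambda>n. inverse ((1/2 + of_nat n) ^ 6) :: complex) sums (of_real pi ^ 6 / 15)"
    using Polygamma_LIMSEQ[of "1/2::complex" 5] Polygamma_3_5_half by (simp add: eval_nat_numeral)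
  from has_sum_zeta_int[OF _ _ this]
  show "((\<lambda>n::int. 1 / of_int n ^ 6 :: complex) has_sum (2 * of_real pi ^ 6 / 945)) UNIV" by simp
qed

lemma has_sum_inverse_square_shift:
  fixes z :: complex
  assumes "z \<notin> \<int>"
  shows "((\<lambda>n::int. 1 / (z + of_int n) ^ 2) has_sum
     (of_real pi ^ 2 + (of_real pi * cot (of_real pi * z))^2)) UNIV"
proof -
  have z1: "1 - z \<noteq> 0" "z \<noteq> 0" using assms by auto
  have s: "(\<lambda>n. inverse ((w + of_nat n) ^ 2)) sums (Polygamma 1 w)" if "w \<noteq> 0" for w :: complex
    using Polygamma_LIMSEQ[of w 1] that by (simp add: numeral_2_eq_2)
  have h: "((\<lambda>n. inverse ((w + of_nat n) ^ 2)) has_sum (Polygamma 1 w)) UNIV" if "w \<noteq> 0" for w :: complex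
    by (rule norm_summable_imp_has_sum[OF summable_inverse_shift_power s[OF that]]) simp
  have "((\<lambda>n. 1 / (z + of_int (int n)) ^ 2) has_sum (Polygamma 1 z)) UNIV"
    using h[OF z1(2)] by (simp add: divide_inverse)
  moreover have "((\<lambda>n. 1 / (z + of_int (-1 - int n)) ^ 2) has_sum (Polygamma 1 (1 - z))) UNIV"
  proof -
    have "1 / (z + of_int (-1 - int n)) ^ 2 = inverse ((1 - z + of_nat n) ^ 2)" for n
    proof -
      have "z + of_int (-1 - int n) = - (1 - z + of_nat n)" by simp
      thus ?thesis by (simp only: power2_minus) (simp add: divide_inverse)
    qed
    thus ?thesis using h[OF z1(1)] by simp
  qed
  ultimately have "((\<lambda>n::int. 1 / (z + of_int n) ^ 2) has_sum (Polygamma 1 z + Polygamma 1 (1 - z))) UNIV"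
    by (rule has_sum_int_split)
  thus ?thesis by (simp only: Polygamma_1_reflection[OF assms])
qed

section \<open>Lattice sums of weight at least 3\<close>

text \<open>The imaginary part controls n, and then the triangle inequality controls m. The constant
  depends on y and R only, so the estimates built on it are locally uniform in \<tau>.\<close>

lemma lattice_norm_bound:
  fixes \<tau> :: complex
  assumes y: "y > 0" "Im \<tau> \<ge> y" "norm \<tau> \<le> R"
  shows "real_of_int (\<bar>m\<bar> + \<bar>n\<bar>) \<le> (1 + (R + 1) / y) * norm (of_int m + of_int n * \<tau>)"
proof -
  define v where "v = norm (of_int m + of_int n * \<tau>)"
  have "\<bar>Im (of_int m + of_int n * \<tau>)\<bar> \<le> v" unfolding v_def by (rule abs_Im_le_cmod)
  hence "\<bar>of_int n\<bar> * Im \<tau> \<le> v" using y by (simp add: abs_mult)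
  hence n: "\<bar>of_int n\<bar> * y \<le> v" using y by (meson abs_ge_zero mult_left_mono order_trans)
  hence n': "\<bar>of_int n\<bar> \<le> v / y" using y by (simp add: field_simps)
  have "norm (of_int m :: complex) \<le> v + norm (of_int n * \<tau>)"
    unfolding v_def by (metis add_diff_cancel_right' norm_triangle_ineq4)
  also have "norm (of_int n * \<tau>) = \<bar>of_int n\<bar> * norm \<tau>" by (simp add: norm_mult)
  also have "\<dots> \<le> (v / y) * R" using n' y by (intro mult_mono) auto
  finally have m: "\<bar>real_of_int m\<bar> \<le> v + v / y * R" by simp
  have "real_of_int (\<bar>m\<bar> + \<bar>n\<bar>) \<le> v + v / y * R + v / y" using m n' by simp
  also have "\<dots> = (1 + (R + 1) / y) * v" by (simp add: algebra_simps add_divide_distrib)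
  finally show ?thesis unfolding v_def .
qed

lemma summable_on_product_abs:
  fixes f :: "'a \<Rightarrow> real" and g :: "'b \<Rightarrow> real"
  assumes "f summable_on A" "g summable_on B" "\<And>x. f x \<ge> 0" "\<And>x. g x \<ge> 0"
  shows "(\<lambda>(x,y). f x * g y) summable_on (A \<times> B)"
proof -
  have "(\<lambda>z. norm ((\<lambda>(x,y). f x * g y) z)) summable_on (A \<times> B)"
    unfolding Infinite_Sum.abs_summable_on_Sigma_iff
  proof (intro conjI ballI)
    fix x show "(\<lambda>y. norm (case (x, y) of (x, y) \<Rightarrow> f x * g y)) summable_on B"
      using assms by (simp add: abs_mult summable_on_cmult_right)
    show "(\<lambda>x. norm (\<Sum>\<^sub>\<infinity>y\<in>B. norm (case (x, y) of (x, y) \<Rightarrow> f x * g y))) summable_on A"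
      using assms by (simp add: abs_mult infsum_cmult_right' infsum_nonneg summable_on_cmult_left)
  qed
  thus ?thesis using abs_summable_summable by blast
qed

lemma summable_on_int_powr:
  "(\<lambda>n::int. (1 + \<bar>real_of_int n\<bar>) powr (-3/2)) summable_on UNIV"
proof -
  have "summable (\<lambda>n. real (n + 1) powr (-3/2))"
    by (subst summable_iff_shift) (simp add: summable_real_powr_iff)
  hence s: "(\<lambda>n. (1 + real n) powr (-3/2)) summable_on UNIV"
    by (intro norm_summable_imp_summable_on) (simp add: algebra_simps)
  have s': "(\<lambda>n. (2 + real n) powr (-3/2)) summable_on UNIV"
    by (rule summable_on_comparison_test[OF s]) (auto intro!: powr_mono2')
  obtain a where a: "((\<lambda>n. (1 + real n) powr (-3/2)) has_sum a) UNIV" using s by (auto simp: summable_on_def)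
  obtain b where b: "((\<lambda>n. (2 + real n) powr (-3/2)) has_sum b) UNIV" using s' by (auto simp: summable_on_def)
  have "((\<lambda>n::int. (1 + \<bar>real_of_int n\<bar>) powr (-3/2)) has_sum (a + b)) UNIV"
  proof (rule has_sum_int_split)
    show "((\<lambda>k. (1 + \<bar>real_of_int (int k)\<bar>) powr (-3/2)) has_sum a) UNIV" using a by simp
    have "1 + \<bar>real_of_int (- 1 - int k)\<bar> = 2 + real k" for k by simp
    thus "((\<lambda>k. (1 + \<bar>real_of_int (- 1 - int k)\<bar>) powr (-3/2)) has_sum b) UNIV" using b by simp
  qed
  thus ?thesis by (auto simp: summable_on_def)
qed

text \<open>From (1 + |m|)(1 + |n|) <= 4 (|m| + |n|)^2, raised to the power -3/2: the cube is shared
  evenly between the coordinates, and 3/2 > 1 makes both one-dimensional series converge.\<close>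

lemma summable_on_lattice_cube:
  "(\<lambda>(m::int, n::int). 1 / real_of_int (\<bar>m\<bar> + \<bar>n\<bar>) ^ 3) summable_on UNIV"
proof -
  let ?p = "\<lambda>n::int. (1 + \<bar>real_of_int n\<bar>) powr (-3/2)"
  have "(\<lambda>(x,y). ?p x * ?p y) summable_on (UNIV \<times> UNIV)"
    by (rule summable_on_product_abs) (use summable_on_int_powr in auto)
  hence "(\<lambda>z. 8 * (\<lambda>(x,y). ?p x * ?p y) z) summable_on UNIV"
    by (simp add: summable_on_cmult_right)
  thus ?thesis
  proof (rule summable_on_comparison_test)
    fix z :: "int \<times> int"
    obtain m n where z: "z = (m, n)" by (cases z)
    show "(case z of (m, n) \<Rightarrow> 1 / real_of_int (\<bar>m\<bar> + \<bar>n\<bar>) ^ 3) \<le> 8 * (\<lambda>(x,y). ?p x * ?p y) z"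
    proof (cases "m = 0 \<and> n = 0")
      case False
      define L where "L = real_of_int (\<bar>m\<bar> + \<bar>n\<bar>)"
      have L: "L \<ge> 1" using False unfolding L_def by linarith
      let ?a = "1 + \<bar>real_of_int m\<bar>" and ?b = "1 + \<bar>real_of_int n\<bar>"
      have "?a \<le> 2 * L" "?b \<le> 2 * L" using L unfolding L_def by auto
      hence "?a * ?b \<le> (2 * L) * (2 * L)" by (intro mult_mono) auto
      hence "(2 * L * (2 * L)) powr (-3/2) \<le> (?a * ?b) powr (-3/2)" by (intro powr_mono2') auto
      also have "(2 * L * (2 * L)) powr (-3/2) = (2 * L) powr (-3)"
      proof -
        have "2 * L * (2 * L) = (2 * L) powr 2" using L by (subst powr_numeral) (auto simp: power2_eq_square)
        thus ?thesis by (simp only: powr_powr) simp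
      qed
      also have "\<dots> = 1 / (2 * L) ^ 3"
        using L powr_numeral[of "2 * L" "num.Bit1 num.One"] by (subst powr_minus_divide) simp
      also have "(?a * ?b) powr (-3/2) = ?a powr (-3/2) * ?b powr (-3/2)" by (subst powr_mult) auto
      finally have "1 / (8 * L ^ 3) \<le> ?a powr (-3/2) * ?b powr (-3/2)" by (simp add: power_mult_distrib)
      hence "1 / L ^ 3 \<le> 8 * (?a powr (-3/2) * ?b powr (-3/2))" by simp
      thus ?thesis unfolding z L_def by simp
    qed (simp add: z)
  qed auto
qed

lemma lattice_nonzero:
  assumes "Im \<tau> > 0" "(m, n) \<noteq> (0, 0)"
  shows "of_int m + of_int n * \<tau> \<noteq> 0"
proof
  assume z: "of_int m + of_int n * \<tau> = 0"
  hence "Im (of_int m + of_int n * \<tau>) = 0" by simp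
  hence "n = 0" using assms(1) by simp
  with z assms(2) show False by auto
qed

lemma lattice_term_bound:
  fixes \<tau> :: complex
  assumes y: "y > 0" "Im \<tau> \<ge> y" "norm \<tau> \<le> R" and k: "k \<ge> 3"
  shows "norm (1 / (of_int m + of_int n * \<tau>) ^ k) \<le>
    (1 + (R + 1) / y) ^ k * (1 / real_of_int (\<bar>m\<bar> + \<bar>n\<bar>) ^ 3)"
proof (cases "(m, n) = (0, 0)")
  case False
  define L where "L = real_of_int (\<bar>m\<bar> + \<bar>n\<bar>)"
  define C where "C = 1 + (R + 1) / y"
  have L: "L \<ge> 1" using False unfolding L_def by (cases "m = 0") auto
  have "R \<ge> 0" using y(3) norm_ge_zero order_trans by blast
  hence C: "C \<ge> 1" using y unfolding C_def by simp
  have "L \<le> C * norm (of_int m + of_int n * \<tau>)"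
    using lattice_norm_bound[OF y] unfolding L_def C_def .
  hence "L ^ k \<le> C ^ k * norm ((of_int m + of_int n * \<tau>) ^ k)"
    using L power_mono[of L "C * norm (of_int m + of_int n * \<tau>)" k] by (simp add: norm_power power_mult_distrib)
  moreover have "L ^ 3 \<le> L ^ k" using L k by (intro power_increasing) auto
  ultimately have "L ^ 3 \<le> C ^ k * norm ((of_int m + of_int n * \<tau>) ^ k)" by linarith
  moreover have "norm ((of_int m + of_int n * \<tau>) ^ k) > 0"
    using lattice_nonzero[OF _ False, of \<tau>] y by (simp add: norm_power)
  ultimately show ?thesis using L unfolding L_def[symmetric] C_def[symmetric]
    by (simp add: norm_divide field_simps)
qed (use k in auto)

lemma lattice_abs_summable:
  assumes "Im \<tau> > 0" "k \<ge> 3"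
  shows "(\<lambda>(m, n). norm (1 / (of_int m + of_int n * \<tau>) ^ k)) summable_on UNIV"
proof -
  let ?C = "(1 + (norm \<tau> + 1) / Im \<tau>) ^ k"
  have "(\<lambda>z. ?C * (\<lambda>(m, n). 1 / real_of_int (\<bar>m\<bar> + \<bar>n\<bar>) ^ 3) z) summable_on UNIV"
    using summable_on_lattice_cube by (rule summable_on_cmult_right)
  thus ?thesis
    by (rule summable_on_comparison_test)
       (use lattice_term_bound[OF assms(1) order_refl order_refl assms(2)] in auto)
qed

lemma lattice_summable:
  assumes "Im \<tau> > 0" "k \<ge> 3"
  shows "(\<lambda>(m, n). 1 / (of_int m + of_int n * \<tau>) ^ k) summable_on UNIV"
  by (rule abs_summable_summable) (use lattice_abs_summable[OF assms] in \<open>simp add: case_prod_unfold\<close>)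

text \<open>The origin is kept in the index set, its term being 1/0 = 0 for k > 0, so that a change
  of lattice basis is a bijection of the whole index set.\<close>

definition eisenstein_G :: "nat \<Rightarrow> complex \<Rightarrow> complex" where
  "eisenstein_G k \<tau> = (\<Sum>\<^sub>\<infinity>(m, n)\<in>UNIV. 1 / (of_int m + of_int n * \<tau>) ^ k)"

lemma eisenstein_G_Diff:
  assumes "k > 0"
  shows "(\<Sum>\<^sub>\<infinity>(m, n)\<in>UNIV - {(0, 0)}. 1 / (of_int m + of_int n * \<tau>) ^ k) = eisenstein_G k \<tau>"
  unfolding eisenstein_G_def by (rule infsum_cong_neutral) (use assms in auto)

lemma Im_moebius:
  fixes a b c d :: int
  assumes "a * d - b * c = 1" "Im \<tau> > 0"
  shows "of_int c * \<tau> + of_int d \<noteq> 0" "Im ((of_int a * \<tau> + of_int b) / (of_int c * \<tau> + of_int d)) > 0"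
proof -
  have "(d, c) \<noteq> (0, 0)" using assms(1) by auto
  from lattice_nonzero[OF assms(2) this] show nz: "of_int c * \<tau> + of_int d \<noteq> 0"
    by (simp add: add.commute)
  have "Im ((of_int a * \<tau> + of_int b) / (of_int c * \<tau> + of_int d)) =
    (of_int (a * d - b * c) * Im \<tau>) / (norm (of_int c * \<tau> + of_int d))\<^sup>2"
    by (simp add: Im_complex_div_eq_0 complex_div_cnj[of "of_int a * \<tau> + of_int b"] Im_divide cmod_power2 algebra_simps)
  thus "Im ((of_int a * \<tau> + of_int b) / (of_int c * \<tau> + of_int d)) > 0"
    using assms nz by simp
qed

text \<open>The matrix changes the basis of the lattice, and the inverse matrix gives the inverse
  reindexing; only the common factor c \<tau> + d remains.\<close>

lemma eisenstein_G_moebius: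
  fixes a b c d :: int
  assumes det: "a * d - b * c = 1" and \<tau>: "Im \<tau> > 0"
  shows "eisenstein_G k ((of_int a * \<tau> + of_int b) / (of_int c * \<tau> + of_int d)) =
    (of_int c * \<tau> + of_int d) ^ k * eisenstein_G k \<tau>"
proof -
  let ?w = "of_int c * \<tau> + of_int d"
  have nz: "?w \<noteq> 0" by (rule Im_moebius[OF det \<tau>])
  have inv: "a * (m * d + n * b) - b * (m * c + n * a) = m" "d * (m * c + n * a) - c * (m * d + n * b) = n"
    "(a * m - b * n) * d + (d * n - c * m) * b = m" "(a * m - b * n) * c + (d * n - c * m) * a = n" for m n
  proof -
    have "a * (m * d + n * b) - b * (m * c + n * a) = m * (a * d - b * c)" by algebra
    thus "a * (m * d + n * b) - b * (m * c + n * a) = m" by (simp add: det)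
    have "d * (m * c + n * a) - c * (m * d + n * b) = n * (a * d - b * c)" by algebra
    thus "d * (m * c + n * a) - c * (m * d + n * b) = n" by (simp add: det)
    have "(a * m - b * n) * d + (d * n - c * m) * b = m * (a * d - b * c)" by algebra
    thus "(a * m - b * n) * d + (d * n - c * m) * b = m" by (simp add: det)
    have "(a * m - b * n) * c + (d * n - c * m) * a = n * (a * d - b * c)" by algebra
    thus "(a * m - b * n) * c + (d * n - c * m) * a = n" by (simp add: det)
  qed
  have "eisenstein_G k ((of_int a * \<tau> + of_int b) / ?w) =
     (\<Sum>\<^sub>\<infinity>(m, n)\<in>UNIV. ?w ^ k * (1 / (of_int m + of_int n * \<tau>) ^ k))"
    unfolding eisenstein_G_def
  proof (rule infsum_reindex_bij_witness[where j = "\<lambda>(m, n). (m * d + n * b, m * c + n * a)"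
        and i = "\<lambda>(m, n). (a * m - b * n, d * n - c * m)"])
    fix z :: "int \<times> int"
    obtain m n where z: "z = (m, n)" by (cases z)
    have "of_int m + of_int n * ((of_int a * \<tau> + of_int b) / ?w) =
       (of_int (m * d + n * b) + of_int (m * c + n * a) * \<tau>) / ?w"
      using nz by (simp add: field_simps)
    thus "(case case z of (m, n) \<Rightarrow> (m * d + n * b, m * c + n * a) of
          (m, n) \<Rightarrow> ?w ^ k * (1 / (of_int m + of_int n * \<tau>) ^ k)) =
         (case z of (m, n) \<Rightarrow> 1 / (of_int m + of_int n * ((of_int a * \<tau> + of_int b) / ?w)) ^ k)"
      by (simp add: z power_divide del: of_int_add of_int_mult)
  qed (use inv in auto)
  also have "\<dots> = ?w ^ k * eisenstein_G k \<tau>"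
    unfolding eisenstein_G_def case_prod_unfold by (subst infsum_cmult_right') simp
  finally show ?thesis .
qed

lemma eisenstein_G_holomorphic:
  assumes k: "k \<ge> 3"
  shows "eisenstein_G k holomorphic_on {\<tau>. Im \<tau> > 0}"
proof -
  let ?f = "\<lambda>\<tau> (m, n). 1 / (of_int m + of_int n * \<tau> :: complex) ^ k"
  have "\<exists>r>0. eisenstein_G k holomorphic_on ball \<tau>0 r" if \<tau>0: "Im \<tau>0 > 0" for \<tau>0
  proof -
    define r where "r = Im \<tau>0 / 2"
    have r: "r > 0" using \<tau>0 by (simp add: r_def)
    have im: "Im \<tau> \<ge> r" "norm \<tau> \<le> norm \<tau>0 + r" if "\<tau> \<in> cball \<tau>0 r" for \<tau>
    proof -
      have d: "norm (\<tau>0 - \<tau>) \<le> r" using that by (simp add: dist_norm)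
      have "\<bar>Im (\<tau>0 - \<tau>)\<bar> \<le> r" using d abs_Im_le_cmod order_trans by blast
      hence "Im \<tau>0 - Im \<tau> \<le> r" by simp
      thus "Im \<tau> \<ge> r" by (simp add: r_def)
      show "norm \<tau> \<le> norm \<tau>0 + r" using d by (metis add.commute diff_add_cancel norm_minus_commute norm_triangle_mono order_refl)
    qed
    let ?C = "(1 + (norm \<tau>0 + r + 1) / r) ^ k"
    have ul: "uniform_limit (cball \<tau>0 r) (\<lambda>X \<tau>. \<Sum>z\<in>X. ?f \<tau> z) (\<lambda>\<tau>. \<Sum>\<^sub>\<infinity>z\<in>UNIV. ?f \<tau> z) (finite_subsets_at_top UNIV)"
    proof (rule Weierstrass_m_test_general)
      show "(\<lambda>z. ?C * (\<lambda>(m, n). 1 / real_of_int (\<bar>m\<bar> + \<bar>n\<bar>) ^ 3) z) summable_on UNIV"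
        using summable_on_lattice_cube by (rule summable_on_cmult_right)
      fix z :: "int \<times> int" and \<tau> assume t: "\<tau> \<in> cball \<tau>0 r"
      show "norm (?f \<tau> z) \<le> ?C * (\<lambda>(m, n). 1 / real_of_int (\<bar>m\<bar> + \<bar>n\<bar>) ^ 3) z"
        using lattice_term_bound[OF r im[OF t] k] by (cases z) auto
    qed
    have hol: "(\<lambda>\<tau>. \<Sum>z\<in>X. ?f \<tau> z) holomorphic_on cball \<tau>0 r" for X
    proof (intro holomorphic_on_sum)
      fix z :: "int \<times> int" assume "z \<in> X"
      obtain m n where z: "z = (m, n)" by (cases z)
      show "(\<lambda>\<tau>. ?f \<tau> z) holomorphic_on cball \<tau>0 r"
      proof (cases "z = (0, 0)")
        case True
        thus ?thesis using k by simp
      next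
        case False
        have "of_int m + of_int n * \<tau> \<noteq> 0" if "\<tau> \<in> cball \<tau>0 r" for \<tau>
          using lattice_nonzero[of \<tau> m n] im(1)[OF that] r False z by auto
        thus ?thesis unfolding z by (auto intro!: holomorphic_intros)
      qed
    qed
    obtain "(\<lambda>\<tau>. \<Sum>\<^sub>\<infinity>z\<in>UNIV. ?f \<tau> z) holomorphic_on ball \<tau>0 r"
    proof (rule holomorphic_uniform_limit[OF _ ul])
      show "\<forall>\<^sub>F X in finite_subsets_at_top UNIV. continuous_on (cball \<tau>0 r) (\<lambda>\<tau>. \<Sum>z\<in>X. ?f \<tau> z) \<and>
        (\<lambda>\<tau>. \<Sum>z\<in>X. ?f \<tau> z) holomorphic_on ball \<tau>0 r"
        using hol holomorphic_on_imp_continuous_on holomorphic_on_subset ball_subset_cball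
        by (intro always_eventually allI conjI) blast+
    qed auto
    thus ?thesis using r unfolding eisenstein_G_def by blast
  qed
  hence "eisenstein_G k field_differentiable (at \<tau>)" if "Im \<tau> > 0" for \<tau>
    using that by (meson holomorphic_on_imp_differentiable_at open_ball centre_in_ball)
  thus ?thesis unfolding holomorphic_on_def
    by (auto intro: field_differentiable_at_within)
qed

lemma eisenstein_G_shift:
  assumes "Im \<tau> > 0"
  shows "eisenstein_G k (\<tau> + of_int b) = eisenstein_G k \<tau>"
  using eisenstein_G_moebius[of 1 1 b 0 \<tau> k] assms by simp

text \<open>Off the row \<open>n = 0\<close> each term is \<open>O(1 / Im \<tau>)\<close> times a summable majorant.\<close>

lemma eisenstein_G_at_infinity:
  assumes k: "k \<ge> 4" and A: "((\<lambda>n::int. 1 / of_int n ^ k) has_sum A) UNIV" and e: "e > 0"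
  shows "\<exists>Y. \<forall>\<tau>. Im \<tau> > Y \<longrightarrow> norm (eisenstein_G k \<tau> - A) < e"
proof -
  define B where "B = (\<Sum>\<^sub>\<infinity>(m::int, n::int)\<in>UNIV. 1 / real_of_int (\<bar>m\<bar> + \<bar>n\<bar>) ^ 3)"
  have B: "B \<ge> 0" unfolding B_def by (intro infsum_nonneg) auto
  define M where "M = (5/2) ^ (k - 1) * B"
  have M: "M \<ge> 0" using B by (simp add: M_def)
  have key: "norm (eisenstein_G k \<tau> - A) \<le> M / Im \<tau>" if y: "Im \<tau> \<ge> 1" and re: "\<bar>Re \<tau>\<bar> \<le> 1/2" for \<tau>
  proof -
    let ?f = "\<lambda>(m, n). 1 / (of_int m + of_int n * \<tau>) ^ k"
    let ?g = "\<lambda>(m::int, n::int). if n = 0 then 1 / of_int m ^ k else 0 :: complex"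
    have f: "(?f has_sum eisenstein_G k \<tau>) UNIV"
      unfolding eisenstein_G_def using lattice_summable[of \<tau> k] y k by (intro has_sum_infsum) auto
    have "((\<lambda>z. ?g z) has_sum A) ((\<lambda>m. (m, 0)) ` UNIV)"
      using A by (subst has_sum_reindex) (auto simp: inj_on_def o_def)
    hence g: "(?g has_sum A) UNIV"
      by (subst (asm) has_sum_cong_neutral[where T = UNIV and g = ?g]) auto
    have fg: "((\<lambda>z. ?f z - ?g z) has_sum (eisenstein_G k \<tau> - A)) UNIV"
      using has_sum_add[OF f has_sum_uminusI[OF g]] by simp
    have bd: "norm (?f z - ?g z) \<le> (5/2)^(k-1) / Im \<tau> * (\<lambda>(m, n). 1 / real_of_int (\<bar>m\<bar> + \<bar>n\<bar>) ^ 3) z" for z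
    proof (cases z)
      case (Pair m n)
      show ?thesis
      proof (cases "n = 0")
        case True
        thus ?thesis using Pair y by auto
      next
        case False
        define v where "v = norm (of_int m + of_int n * \<tau>)"
        define L where "L = real_of_int (\<bar>m\<bar> + \<bar>n\<bar>)"
        have L: "L \<ge> 1" using False unfolding L_def by auto
        have "\<bar>Im (of_int m + of_int n * \<tau>)\<bar> \<le> v" unfolding v_def by (rule abs_Im_le_cmod)
        hence n: "\<bar>of_int n\<bar> * Im \<tau> \<le> v" using y by (simp add: abs_mult)
        moreover have "\<bar>of_int n\<bar> \<ge> (1::real)" using False by linarith
        ultimately have vy: "v \<ge> Im \<tau>" using y by (smt (verit) mult_le_cancel_right1)
        have n1: "\<bar>of_int n\<bar> \<le> v" using n y by (smt (verit) mult_le_cancel_left1 abs_ge_zero)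
        have "\<bar>Re (of_int m + of_int n * \<tau>)\<bar> \<le> v" unfolding v_def by (rule abs_Re_le_cmod)
        moreover have "\<bar>of_int n * Re \<tau>\<bar> \<le> v * (1/2)" unfolding abs_mult using n1 re by (intro mult_mono) auto
        ultimately have "\<bar>real_of_int m\<bar> \<le> v + v / 2" by simp
        hence Lv: "L \<le> 5/2 * v" using n1 unfolding L_def by simp
        \<comment> \<open>Of the k factors v only k - 1 are spent on the summable majorant; the last
          is at least Im \<tau> and yields the decay. This is where k >= 4 enters.\<close>
        have "L ^ 3 \<le> L ^ (k - 1)" using L k by (intro power_increasing) auto
        also have "\<dots> \<le> (5/2 * v) ^ (k - 1)" using Lv L by (intro power_mono) auto
        also have "\<dots> = (5/2) ^ (k-1) * v ^ (k - 1)" by (rule power_mult_distrib)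
        finally have "Im \<tau> * L ^ 3 \<le> v * ((5/2) ^ (k-1) * v ^ (k - 1))"
          using vy y L by (intro mult_mono) auto
        also have "\<dots> = (5/2) ^ (k-1) * v ^ k" using k by (cases k) auto
        finally have "Im \<tau> * L ^ 3 \<le> (5/2) ^ (k-1) * v ^ k" .
        moreover have "v > 0" using vy y by linarith
        ultimately have "1 / v ^ k \<le> (5/2)^(k-1) / Im \<tau> * (1 / L ^ 3)"
          using L y by (simp add: field_simps)
        thus ?thesis using False Pair by (simp add: norm_divide norm_power v_def L_def)
      qed
    qed
    have "norm (eisenstein_G k \<tau> - A) \<le> (5/2)^(k-1) / Im \<tau> * B"
    proof (rule norm_infsum_le[OF fg _ bd])
      show "((\<lambda>z. (5/2)^(k-1) / Im \<tau> * (\<lambda>(m, n). 1 / real_of_int (\<bar>m\<bar> + \<bar>n\<bar>) ^ 3) z) has_sum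
         (5/2)^(k-1) / Im \<tau> * B) UNIV"
        unfolding B_def by (intro has_sum_cmult_right has_sum_infsum summable_on_lattice_cube)
    qed
    thus ?thesis by (simp add: M_def)
  qed
  show ?thesis
  proof (intro exI allI impI)
    fix \<tau> :: complex assume y: "Im \<tau> > max 1 (M / e)"
    \<comment> \<open>The estimate \<open>key\<close> asks for a bounded real part; periodicity
      provides it.\<close>
    define \<tau>' where "\<tau>' = \<tau> + of_int (- round (Re \<tau>))"
    have re: "\<bar>Re \<tau>'\<bar> \<le> 1/2" unfolding \<tau>'_def using of_int_round_abs_le[of "Re \<tau>"] by (simp add: abs_minus_commute)
    have im: "Im \<tau>' = Im \<tau>" by (simp add: \<tau>'_def)
    have "eisenstein_G k \<tau> = eisenstein_G k \<tau>'"
      unfolding \<tau>'_def using y by (subst eisenstein_G_shift) auto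
    hence "norm (eisenstein_G k \<tau> - A) \<le> M / Im \<tau>" using key[of \<tau>'] re im y by auto
    also have "\<dots> < e" using y e M by (simp add: field_simps)
    finally show "norm (eisenstein_G k \<tau> - A) < e" .
  qed
qed

section \<open>The weight two series and its inversion\<close>

lemma cot_exp_eq:
  assumes "exp (2 * \<i> * z) \<noteq> 1"
  shows "cot z = \<i> * (exp (2 * \<i> * z) + 1) / (exp (2 * \<i> * z) - 1)"
proof -
  define u where "u = exp (\<i> * z)"
  have u: "u \<noteq> 0" "exp (2 * \<i> * z) = u ^ 2"
    by (simp_all add: u_def mult.assoc flip: exp_double)
  have "exp (- (\<i> * z)) = 1 / u" by (simp add: u_def exp_minus divide_inverse)
  hence sc: "sin z = (u - 1 / u) / (2 * \<i>)" "cos z = (u + 1 / u) / 2"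
    by (simp_all add: sin_exp_eq cos_exp_eq u_def)
  have "u - 1 / u = (u ^ 2 - 1) / u" "u + 1 / u = (u ^ 2 + 1) / u"
    using u(1) by (simp_all add: field_simps power2_eq_square)
  hence "cot z = ((u ^ 2 + 1) / u / 2) / ((u ^ 2 - 1) / u / (2 * \<i>))"
    unfolding cot_def sc by simp
  also have "\<dots> = \<i> * (u ^ 2 + 1) / (u ^ 2 - 1)" using u(1) assms unfolding u(2)
    by (simp add: divide_simps)
  finally show ?thesis unfolding u(2) .
qed

abbreviation nome :: "complex \<Rightarrow> complex" where
  "nome \<tau> \<equiv> exp (2 * of_real pi * \<i> * \<tau>)"

lemma norm_nome: "norm (nome \<tau>) = exp (- 2 * pi * Im \<tau>)"
  by (simp add: norm_exp_eq_Re)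

lemma norm_nome_less_1: "Im \<tau> > 0 \<Longrightarrow> norm (nome \<tau>) < 1"
  by (simp add: norm_nome)

lemma nome_ne_1: "Im \<tau> > 0 \<Longrightarrow> nome \<tau> \<noteq> 1"
  using norm_nome_less_1[of \<tau>] by (metis less_irrefl norm_one)

lemma cot_nome:
  assumes "Im \<tau> > 0"
  shows "of_real pi * cot (of_real pi * \<tau>) = - of_real pi * \<i> * (1 + nome \<tau>) / (1 - nome \<tau>)"
proof -
  have ne: "nome \<tau> \<noteq> 1" by (rule nome_ne_1[OF assms])
  have e: "exp (2 * \<i> * (of_real pi * \<tau>)) = nome \<tau>" by (simp add: mult_ac)
  have "cot (of_real pi * \<tau>) = \<i> * (nome \<tau> + 1) / (nome \<tau> - 1)"
    using cot_exp_eq[of "of_real pi * \<tau>"] ne unfolding e by simp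
  also have "\<dots> = - \<i> * (1 + nome \<tau>) / (1 - nome \<tau>)"
    using ne by (simp add: divide_simps) (simp add: algebra_simps)
  finally show ?thesis by simp
qed

lemma cot_square_nome:
  assumes "Im \<tau> > 0"
  shows "of_real pi ^ 2 + (of_real pi * cot (of_real pi * \<tau>)) ^ 2 =
    - 4 * of_real pi ^ 2 * (nome \<tau> / (1 - nome \<tau>) ^ 2)"
proof -
  have ne: "1 - nome \<tau> \<noteq> 0" using nome_ne_1[OF assms] by simp
  have "(- of_real pi * \<i> * (1 + nome \<tau>)) ^ 2 = - (of_real pi ^ 2 * (1 + nome \<tau>) ^ 2)"
    by (simp add: power_mult_distrib)
  hence "of_real pi ^ 2 + (of_real pi * cot (of_real pi * \<tau>)) ^ 2 =
     of_real pi ^ 2 - of_real pi ^ 2 * (1 + nome \<tau>) ^ 2 / (1 - nome \<tau>) ^ 2"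
    unfolding cot_nome[OF assms] power_divide by simp
  also have "\<dots> = of_real pi ^ 2 * ((1 - nome \<tau>)^2 - (1 + nome \<tau>)^2) / (1 - nome \<tau>) ^ 2"
    using ne by (simp add: diff_divide_distrib right_diff_distrib)
  also have "(1 - nome \<tau>)^2 - (1 + nome \<tau>)^2 = - 4 * nome \<tau>"
    by (simp add: power2_eq_square algebra_simps)
  finally show ?thesis by simp
qed

lemma nome_mult_nat: "nome (of_nat n * \<tau>) = nome \<tau> ^ n"
  by (simp add: exp_of_nat_mult[symmetric] mult_ac)

text \<open>The Lambert series whose power series is the sum of sigma(n) q^n, sigma being the
  divisor sum. In this form it comes directly out of the rows of the lattice sum.\<close>

definition lambert_S :: "complex \<Rightarrow> complex" where
  "lambert_S q = (\<Sum>n. q ^ Suc n / (1 - q ^ Suc n) ^ 2)"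

lemma lambert_term_bound:
  fixes q :: complex
  assumes "norm q \<le> r" "r < 1"
  shows "norm (q ^ Suc n / (1 - q ^ Suc n) ^ k) \<le> r ^ Suc n / (1 - r) ^ k"
proof -
  have r0: "r \<ge> 0" using assms norm_ge_zero order_trans by blast
  have a: "norm (q ^ Suc n) \<le> r ^ Suc n" unfolding norm_power using assms by (intro power_mono) auto
  also have "r ^ Suc n \<le> r" using r0 assms mult_left_le[of "r ^ n" r] by (simp add: power_le_one)
  finally have "1 - r \<le> norm (1 - q ^ Suc n)"
    using norm_triangle_ineq2[of 1 "q ^ Suc n"] by simp
  hence "(1 - r) ^ k \<le> norm ((1 - q ^ Suc n) ^ k)"
    unfolding norm_power using assms by (intro power_mono) auto
  thus ?thesis unfolding norm_divide using a r0 assms by (intro frac_le) auto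
qed

lemma lambert_summable:
  fixes q :: complex
  assumes "norm q < 1"
  shows "summable (\<lambda>n. norm (q ^ Suc n / (1 - q ^ Suc n) ^ k))"
proof (rule summable_comparison_test')
  show "summable (\<lambda>n. norm q ^ Suc n / (1 - norm q) ^ k)"
    using assms by (intro summable_divide) (simp add: summable_mult summable_geometric)
  show "norm (norm (q ^ Suc n / (1 - q ^ Suc n) ^ k)) \<le> norm q ^ Suc n / (1 - norm q) ^ k" for n
    using lambert_term_bound[OF order_refl assms, of n k] by (simp add: norm_divide)
qed

lemma non_Ints_Im: "Im z \<noteq> 0 \<Longrightarrow> z \<notin> \<int>"
  by (auto elim!: Ints_cases)

lemma inner_sum:
  fixes z :: complex
  assumes "z \<notin> \<int> \<or> z = 0"
  shows "(\<lambda>n::int. 1 / (z + of_int n) ^ 2) summable_on UNIV"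
  using assms has_sum_inverse_square_shift[of z] zeta_int_values(1) by (auto simp: summable_on_def)

text \<open>In weight two the double series converges only conditionally, so the order of summation
  belongs to the definition: m runs first, along each row.\<close>

definition eisenstein_G2 :: "complex \<Rightarrow> complex" where
  "eisenstein_G2 \<tau> = (\<Sum>\<^sub>\<infinity>n::int. \<Sum>\<^sub>\<infinity>m::int. 1 / (of_int n * \<tau> + of_int m) ^ 2)"

text \<open>Row n is pi^2 / sin^2(pi n \<tau>), which in terms of q is -4 pi^2 q^n / (1 - q^n)^2.
  Rows n and -n agree, and row 0 is 2 zeta(2).\<close>

lemma eisenstein_G2_has_sum:
  assumes \<tau>: "Im \<tau> > 0"
  shows "((\<lambda>n::int. \<Sum>\<^sub>\<infinity>m::int. 1 / (of_int n * \<tau> + of_int m) ^ 2) has_sum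
      (of_real pi ^ 2 / 3 - 8 * of_real pi ^ 2 * lambert_S (nome \<tau>))) UNIV"
proof -
  define Q where "Q = (\<lambda>n::int. \<Sum>\<^sub>\<infinity>m::int. 1 / (of_int n * \<tau> + of_int m) ^ 2)"
  let ?q = "nome \<tau>"
  have q: "norm ?q < 1" by (rule norm_nome_less_1[OF \<tau>])
  define t where "t = (\<lambda>n. - 4 * of_real pi ^ 2 * (?q ^ Suc n / (1 - ?q ^ Suc n) ^ 2))"
  have Qpos: "Q (int (Suc n)) = t n" for n
  proof -
    have im: "Im (of_nat (Suc n) * \<tau>) > 0" using \<tau> by (simp del: of_nat_Suc)
    have "Q (int (Suc n)) = of_real pi ^ 2 + (of_real pi * cot (of_real pi * (of_nat (Suc n) * \<tau>))) ^ 2"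
    proof -
      have "of_nat (Suc n) * \<tau> \<notin> \<int>" using im by (intro non_Ints_Im) linarith
      from has_sum_inverse_square_shift[OF this] show ?thesis
        unfolding Q_def by (intro infsumI) (simp del: of_nat_Suc)
    qed
    thus ?thesis unfolding cot_square_nome[OF im] t_def nome_mult_nat .
  qed
  have Qeven: "Q (- n) = Q n" for n
    unfolding Q_def
  proof (rule infsum_reindex_bij_witness[where i = uminus and j = uminus])
    fix m :: int
    have "of_int n * \<tau> + of_int (- m) = - (of_int (- n) * \<tau> + of_int m)" by simp
    thus "1 / (of_int n * \<tau> + of_int (- m))\<^sup>2 = 1 / (of_int (- n) * \<tau> + of_int m)\<^sup>2"
      by (simp only: power2_minus)
  qed auto
  have Q0: "Q 0 = of_real pi ^ 2 / 3"
    unfolding Q_def using zeta_int_values(1) by (intro infsumI) simp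
  have "t sums (- 4 * of_real pi ^ 2 * lambert_S ?q)"
    unfolding t_def lambert_S_def
    using lambert_summable[OF q, of 2] by (intro sums_mult summable_sums summable_norm_cancel[OF lambert_summable[OF q]])
  moreover have "summable (\<lambda>n. norm (t n))"
  proof -
    have "summable (\<lambda>n. norm (- 4 * of_real pi ^ 2 :: complex) * norm (?q ^ Suc n / (1 - ?q ^ Suc n) ^ 2))"
      by (intro summable_mult lambert_summable[OF q])
    thus ?thesis unfolding t_def norm_mult .
  qed
  ultimately have ht: "(t has_sum (- 4 * of_real pi ^ 2 * lambert_S ?q)) UNIV"
    by (rule norm_summable_imp_has_sum[rotated])
  have neg: "((\<lambda>k. Q (- 1 - int k)) has_sum (- 4 * of_real pi ^ 2 * lambert_S ?q)) UNIV"
  proof -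
    have "Q (- 1 - int k) = t k" for k using Qeven[of "int (Suc k)"] Qpos[of k] by (simp add: algebra_simps)
    thus ?thesis using ht by simp
  qed
  have "((\<lambda>k. Q (int k)) has_sum (- 4 * of_real pi ^ 2 * lambert_S ?q)) (range Suc)"
    using ht by (subst has_sum_reindex) (simp, simp only: o_def Qpos)
  moreover have "((\<lambda>k. Q (int k)) has_sum (of_real pi ^ 2 / 3)) {0}"
    using has_sum_finite[of "{0::nat}" "\<lambda>k. Q (int k)"] by (simp add: Q0)
  ultimately have "((\<lambda>k. Q (int k)) has_sum (- 4 * of_real pi ^ 2 * lambert_S ?q + of_real pi ^ 2 / 3)) (range Suc \<union> {0})"
    by (intro has_sum_Un_disjoint) auto
  also have "range Suc \<union> {0} = UNIV" using not0_implies_Suc by auto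
  finally have "(Q has_sum (- 4 * of_real pi ^ 2 * lambert_S ?q + of_real pi ^ 2 / 3 + - 4 * of_real pi ^ 2 * lambert_S ?q)) UNIV"
    using neg by (rule has_sum_int_split)
  thus ?thesis unfolding Q_def by (simp add: algebra_simps)
qed

lemma eisenstein_G2_eq:
  "Im \<tau> > 0 \<Longrightarrow> eisenstein_G2 \<tau> = of_real pi ^ 2 / 3 - 8 * of_real pi ^ 2 * lambert_S (nome \<tau>)"
  unfolding eisenstein_G2_def by (intro infsumI eisenstein_G2_has_sum)

lemma infsum_telescope_int:
  fixes g :: "int \<Rightarrow> complex"
  assumes "(\<lambda>m. g m - g (m + 1)) summable_on UNIV"
    and "(\<lambda>K. g (- int K)) \<longlonglongrightarrow> L1" "(\<lambda>K. g (int K)) \<longlonglongrightarrow> L2"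
  shows "(\<Sum>\<^sub>\<infinity>m. g m - g (m + 1)) = L1 - L2"
proof -
  have "(\<lambda>K. \<Sum>m\<in>{-int K..<int K}. g m - g (m + 1)) \<longlonglongrightarrow> (\<Sum>\<^sub>\<infinity>m. g m - g (m + 1))"
    by (rule has_sum_imp_symmetric_limit[OF has_sum_infsum[OF assms(1)]])
  moreover have "(\<Sum>m\<in>{-int K..<int K}. g m - g (m + 1)) = g (- int K) - g (int K)" for K
    unfolding sum_int_split
  proof (induction K)
    case (Suc K)
    have "- 1 - int K + 1 = - int K" "- int (Suc K) = - 1 - int K" "int (Suc K) = int K + 1" by auto
    thus ?case using Suc by (simp add: algebra_simps)
  qed simp
  moreover have "(\<lambda>K. g (- int K) - g (int K)) \<longlonglongrightarrow> L1 - L2" by (intro tendsto_diff assms)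
  ultimately show ?thesis using LIMSEQ_unique by simp
qed

lemma summable_on_remove_finite:
  fixes f :: "'a \<Rightarrow> 'b :: banach"
  assumes "f summable_on (A - E)" "finite E" "E \<subseteq> A"
  shows "f summable_on A"
proof -
  have "f summable_on ((A - E) \<union> E)"
    by (intro summable_on_Un_disjoint assms(1) summable_on_finite assms(2)) auto
  thus ?thesis using assms(3) by (simp add: Un_absorb2)
qed

lemma has_sum_diff_complex:
  fixes f g :: "'a \<Rightarrow> complex"
  assumes "(f has_sum a) A" "(g has_sum b) A"
  shows "((\<lambda>x. f x - g x) has_sum (a - b)) A"
  using has_sum_add[OF assms(1) has_sum_uminusI[OF assms(2)]] by simp

lemma summable_on_diff_complex:
  fixes f g :: "'a \<Rightarrow> complex"
  assumes "f summable_on A" "g summable_on A"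
  shows "(\<lambda>x. f x - g x) summable_on A"
  using has_sum_diff_complex assms unfolding summable_on_def by blast

lemma infsum_diff_complex:
  fixes f g :: "'a \<Rightarrow> complex"
  assumes "f summable_on A" "g summable_on A"
  shows "(\<Sum>\<^sub>\<infinity>x\<in>A. f x - g x) = infsum f A - infsum g A"
  by (intro infsumI has_sum_diff_complex has_sum_infsum assms)

text \<open>Eisenstein's device: subtract from 1/x^2, x = m + n \<tau>, the telescoping term a = 1/x
  - 1/(x + 1). The remainder b = 1/(x^2 (x + 1)) is absolutely summable, so it may be summed by rows
  or by columns. The rows of a sum to 0, while its columns give differences of cotangents that
  telescope to the extra term.\<close>

theorem eisenstein_G2_inversion:
  assumes \<tau>: "Im \<tau> > 0"
  shows "eisenstein_G2 (- 1 / \<tau>) = \<tau> ^ 2 * eisenstein_G2 \<tau> - 2 * of_real pi * \<i> * \<tau>"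
proof -
  have t0: "\<tau> \<noteq> 0" using \<tau> by auto
  define \<sigma> where "\<sigma> = - 1 / \<tau>"
  have \<sigma>: "Im \<sigma> > 0" using Im_moebius(2)[of 0 0 "-1" 1 \<tau>] \<tau> by (simp add: \<sigma>_def)
  define x where "x = (\<lambda>m n::int. of_int m + of_int n * \<tau>)"
  define a where "a = (\<lambda>m n. 1 / x m n - 1 / x (m + 1) n)"
  define b where "b = (\<lambda>m n. 1 / x m n ^ 2 - a m n)"
  \<comment> \<open>At these two points x or x + 1 is zero and the closed form of b fails.\<close>
  define E where "E = {(0::int, 0::int), (-1, 0)}"
  define C where "C = 1 + (norm \<tau> + 1) / Im \<tau>"
  have C: "C \<ge> 1" using \<tau> by (simp add: C_def)
  have xb: "real_of_int (\<bar>m\<bar> + \<bar>n\<bar>) \<le> C * norm (x m n)" for m n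
    unfolding C_def x_def by (rule lattice_norm_bound[OF \<tau> order_refl order_refl])
  have "(\<lambda>(m, n). b m n) summable_on (UNIV - E)"
  proof (rule abs_summable_summable, rule summable_on_comparison_test)
    show "(\<lambda>z. 2 * C ^ 3 * (\<lambda>(m, n). 1 / real_of_int (\<bar>m\<bar> + \<bar>n\<bar>) ^ 3) z) summable_on (UNIV - E)"
      using summable_on_subset_banach[OF summable_on_lattice_cube, of "UNIV - E"]
      by (intro summable_on_cmult_right) auto
    fix z assume z: "z \<in> UNIV - E"
    obtain m n where mn: "z = (m, n)" by (cases z)
    define L where "L = real_of_int (\<bar>m\<bar> + \<bar>n\<bar>)"
    have ne: "(m, n) \<noteq> (0, 0)" "(m + 1, n) \<noteq> (0, 0)" using z mn unfolding E_def by auto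
    hence nz: "x m n \<noteq> 0" "x (m + 1) n \<noteq> 0" unfolding x_def using lattice_nonzero[OF \<tau>] by blast+
    have L1: "L \<ge> 1" using ne unfolding L_def by auto
    have "x (m + 1) n = x m n + 1" by (simp add: x_def)
    hence "b m n = ((x m n + 1) - (x m n * (x m n + 1) - x m n ^ 2)) / (x m n ^ 2 * x (m + 1) n)"
      using nz unfolding b_def a_def by (simp add: diff_divide_distrib power2_eq_square)
    also have "(x m n + 1) - (x m n * (x m n + 1) - x m n ^ 2) = 1"
      by (simp add: power2_eq_square algebra_simps)
    finally have b_eq: "b m n = 1 / (x m n ^ 2 * x (m + 1) n)" .
    \<comment> \<open>Off the two excluded points, passing from m to m + 1 costs at most a factor 2,
      whence \<open>2 * C ^ 3\<close> in the majorant.\<close>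
    have "\<bar>m\<bar> + \<bar>n\<bar> \<le> 2 * (\<bar>m + 1\<bar> + \<bar>n\<bar>)" using ne by (auto simp: abs_if)
    hence "L \<le> 2 * real_of_int (\<bar>m + 1\<bar> + \<bar>n\<bar>)" unfolding L_def by linarith
    also have "\<dots> \<le> 2 * (C * norm (x (m + 1) n))" using xb[of "m + 1" n] by simp
    finally have 1: "L \<le> 2 * C * norm (x (m + 1) n)" by simp
    have 2: "L \<le> C * norm (x m n)" using xb[of m n] unfolding L_def .
    have "L ^ 2 * L \<le> (C * norm (x m n)) ^ 2 * (2 * C * norm (x (m + 1) n))"
      using 1 2 L1 by (intro mult_mono power_mono) auto
    hence "L ^ 3 \<le> 2 * C ^ 3 * norm (x m n ^ 2 * x (m + 1) n)"
      by (simp add: norm_mult norm_power power_mult_distrib power2_eq_square power3_eq_cube mult_ac)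
    moreover have "norm (x m n ^ 2 * x (m + 1) n) > 0" using nz by simp
    ultimately have "1 / norm (x m n ^ 2 * x (m + 1) n) \<le> 2 * C ^ 3 * (1 / L ^ 3)"
      using L1 by (simp add: divide_simps)
    hence "norm (b m n) \<le> 2 * C ^ 3 * (1 / L ^ 3)"
      unfolding b_eq by (simp only: norm_divide norm_one)
    thus "norm (case z of (m, n) \<Rightarrow> b m n) \<le> 2 * C ^ 3 * (\<lambda>(m, n). 1 / real_of_int (\<bar>m\<bar> + \<bar>n\<bar>) ^ 3) z"
      by (simp add: mn L_def)
  qed auto
  hence bs: "(\<lambda>(m, n). b m n) summable_on UNIV"
    by (rule summable_on_remove_finite) (auto simp: E_def)
  have bs': "(\<lambda>(n, m). b m n) summable_on UNIV"
    using bs summable_on_reindex_bij_betw[of prod.swap UNIV UNIV "\<lambda>(m, n). b m n"]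
    by (simp add: case_prod_unfold)
  have bn: "(\<lambda>n. b m n) summable_on UNIV" for m
    using summable_on_SigmaD1[of "\<lambda>m n. b m n" UNIV "\<lambda>_. UNIV" m] bs by (simp add: summable_on_Sigma_banach)
  have bm: "(\<lambda>m. b m n) summable_on UNIV" for n
    using summable_on_SigmaD1[of "\<lambda>n m. b m n" UNIV "\<lambda>_. UNIV" n] bs' by (simp add: summable_on_Sigma_banach)
  have rowZ: "of_int n * \<tau> \<notin> \<int> \<or> of_int n * \<tau> = 0" for n
    using \<tau> non_Ints_Im[of "of_int n * \<tau>"] by auto
  have colZ: "of_int m * \<sigma> \<notin> \<int> \<or> of_int m * \<sigma> = 0" for m
    using \<sigma> non_Ints_Im[of "of_int m * \<sigma>"] by auto
  have sqm: "(\<lambda>m. 1 / x m n ^ 2) summable_on UNIV" for n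
    using inner_sum[OF rowZ[of n]] by (simp add: x_def add.commute)
  \<comment> \<open>A column of the lattice of \<tau> is \<tau> times a row of the lattice of
    \<sigma> = -1/\<tau>, so the columns of 1/x^2 reassemble
    \<open>eisenstein_G2 \<sigma>\<close>.\<close>
  have xcol: "x m n = \<tau> * (of_int (- m) * \<sigma> + of_int n)" for m n
    using t0 by (simp add: x_def \<sigma>_def field_simps)
  have sqn: "(\<lambda>n. 1 / x m n ^ 2) summable_on UNIV" for m
    using summable_on_cmult_right[OF inner_sum[OF colZ[of "- m"]], of "1 / \<tau> ^ 2"]
    unfolding xcol power_mult_distrib by (simp add: divide_simps)
  have am: "(\<lambda>m. a m n) summable_on UNIV" for n
    using summable_on_diff_complex[OF sqm[of n] bm[of n]] by (simp add: b_def)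
  have an: "(\<lambda>n. a m n) summable_on UNIV" for m
    using summable_on_diff_complex[OF sqn[of m] bn[of m]] by (simp add: b_def)
  have row0: "(\<Sum>\<^sub>\<infinity>m. a m n) = 0" for n
  proof -
    have lim: "(\<lambda>K. 1 / x (s * int K) n) \<longlonglongrightarrow> 0" if s: "\<bar>s\<bar> = 1" for s
    proof (rule Lim_null_comparison)
      show "\<forall>\<^sub>F K in sequentially. norm (1 / x (s * int K) n) \<le> C * (1 / real K)"
        using eventually_gt_at_top[of 0]
      proof eventually_elim
        case (elim K)
        have "real K \<le> real_of_int (\<bar>s * int K\<bar> + \<bar>n\<bar>)" using s by (simp add: abs_mult)
        also have "\<dots> \<le> C * norm (x (s * int K) n)" by (rule xb)
        finally have "real K \<le> C * norm (x (s * int K) n)" .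
        moreover have "norm (x (s * int K) n) > 0" using calculation elim C
          by (smt (verit) mult_eq_0_iff norm_ge_zero of_nat_0_less_iff)
        ultimately show ?case using elim by (simp add: norm_divide field_simps)
      qed
      show "(\<lambda>K. C * (1 / real K)) \<longlonglongrightarrow> 0"
        using tendsto_mult_right_zero[OF lim_1_over_n] by blast
    qed
    have "(\<Sum>\<^sub>\<infinity>m. 1 / x m n - 1 / x (m + 1) n) = 0 - 0"
      using am[of n] lim[of "-1"] lim[of 1] unfolding a_def
      by (intro infsum_telescope_int) auto
    thus ?thesis by (simp add: a_def)
  qed
  define c where "c = (\<lambda>z. of_real pi * cot (of_real pi * z) :: complex)"
  define g where "g = (\<lambda>m::int. c (of_int (- m) * \<sigma>) / \<tau>)"
  have col: "(\<Sum>\<^sub>\<infinity>n. a m n) = g m - g (m + 1)" for m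
  proof -
    have lim: "(\<lambda>K. \<Sum>n\<in>{-int K..<int K}. 1 / x m n) \<longlonglongrightarrow> g m" for m
    proof -
      have "(\<lambda>K. (\<Sum>n\<in>{-int K..<int K}. 1 / (of_int (- m) * \<sigma> + of_int n)) / \<tau>) \<longlonglongrightarrow> g m"
        unfolding g_def c_def by (intro tendsto_divide cot_partial_fractions colZ tendsto_const t0)
      thus ?thesis unfolding xcol by (simp add: sum_divide_distrib mult.commute)
    qed
    have "(\<lambda>K. \<Sum>n\<in>{-int K..<int K}. a m n) \<longlonglongrightarrow> (\<Sum>\<^sub>\<infinity>n. a m n)"
      by (rule has_sum_imp_symmetric_limit[OF has_sum_infsum[OF an]])
    moreover have "(\<lambda>K. \<Sum>n\<in>{-int K..<int K}. a m n) \<longlonglongrightarrow> g m - g (m + 1)"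
      unfolding a_def sum_subtractf by (intro tendsto_diff lim)
    ultimately show ?thesis by (rule LIMSEQ_unique)
  qed
  have rows: "(\<Sum>\<^sub>\<infinity>n. \<Sum>\<^sub>\<infinity>m. b m n) = eisenstein_G2 \<tau>"
  proof -
    have "(\<Sum>\<^sub>\<infinity>m. b m n) = (\<Sum>\<^sub>\<infinity>m. 1 / (of_int n * \<tau> + of_int m) ^ 2)" for n
      using infsum_diff_complex[OF sqm[of n] am[of n]] row0[of n] unfolding b_def by (simp add: x_def add.commute)
    thus ?thesis by (simp add: eisenstein_G2_def)
  qed
  have colsum: "(\<Sum>\<^sub>\<infinity>n. b m n) = (1 / \<tau> ^ 2) * (\<Sum>\<^sub>\<infinity>n. 1 / (of_int (- m) * \<sigma> + of_int n) ^ 2) - (g m - g (m + 1))" for m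
  proof -
    have "(\<Sum>\<^sub>\<infinity>n. 1 / x m n ^ 2) = (\<Sum>\<^sub>\<infinity>n. (1 / \<tau> ^ 2) * (1 / (of_int (- m) * \<sigma> + of_int n) ^ 2))"
      unfolding xcol power_mult_distrib by simp
    also have "\<dots> = (1 / \<tau> ^ 2) * (\<Sum>\<^sub>\<infinity>n. 1 / (of_int (- m) * \<sigma> + of_int n) ^ 2)"
      by (rule infsum_cmult_right')
    finally show ?thesis using infsum_diff_complex[OF sqn[of m] an[of m]] col[of m] unfolding b_def by simp
  qed
  have Gs: "((\<lambda>n::int. \<Sum>\<^sub>\<infinity>m::int. 1 / (of_int n * \<sigma> + of_int m) ^ 2) has_sum eisenstein_G2 \<sigma>) UNIV"
    unfolding eisenstein_G2_eq[OF \<sigma>] by (rule eisenstein_G2_has_sum[OF \<sigma>])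
  also have "?this \<longleftrightarrow> ((\<lambda>m::int. \<Sum>\<^sub>\<infinity>n::int. 1 / (of_int (- m) * \<sigma> + of_int n) ^ 2) has_sum eisenstein_G2 \<sigma>) UNIV"
    by (rule has_sum_reindex_bij_witness[where i = uminus and j = uminus]) auto
  finally have Gs': "((\<lambda>m::int. (1 / \<tau> ^ 2) * (\<Sum>\<^sub>\<infinity>n::int. 1 / (of_int (- m) * \<sigma> + of_int n) ^ 2)) has_sum ((1 / \<tau> ^ 2) * eisenstein_G2 \<sigma>)) UNIV"
    by (rule has_sum_cmult_right)
  have cs: "(\<lambda>m. \<Sum>\<^sub>\<infinity>n. b m n) summable_on UNIV"
    using summable_on_Sigma_banach[of b UNIV "\<lambda>_. UNIV"] bs by simp
  have gs: "(\<lambda>m. g m - g (m + 1)) summable_on UNIV"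
    using summable_on_diff_complex[OF has_sum_imp_summable[OF Gs'] cs] unfolding colsum by simp
  have nl: "(\<lambda>K. nome (of_nat K * \<sigma>)) \<longlonglongrightarrow> 0"
    unfolding nome_mult_nat by (intro LIMSEQ_power_zero norm_nome_less_1 \<sigma>)
  \<comment> \<open>High in the half plane cot tends to -\<i>. Since cot is odd, the two ends of the
    telescoping sum have opposite limits, and their difference does not cancel.\<close>
  have cl: "(\<lambda>K. c (of_nat K * \<sigma>)) \<longlonglongrightarrow> - of_real pi * \<i>"
  proof (rule Lim_transform_eventually)
    show "(\<lambda>K. - of_real pi * \<i> * (1 + nome (of_nat K * \<sigma>)) / (1 - nome (of_nat K * \<sigma>))) \<longlonglongrightarrow> - of_real pi * \<i>"
      using tendsto_divide[OF tendsto_mult[OF tendsto_const tendsto_add[OF tendsto_const nl]] tendsto_diff[OF tendsto_const nl], of 1 "- of_real pi * \<i>" 1] by simp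
    show "\<forall>\<^sub>F K in sequentially. - of_real pi * \<i> * (1 + nome (of_nat K * \<sigma>)) / (1 - nome (of_nat K * \<sigma>)) = c (of_nat K * \<sigma>)"
      using eventually_gt_at_top[of 0] by eventually_elim (use \<sigma> in \<open>simp add: c_def cot_nome\<close>)
  qed
  have "(\<lambda>K. g (- int K)) \<longlonglongrightarrow> - of_real pi * \<i> / \<tau>"
    unfolding g_def using tendsto_divide[OF cl tendsto_const t0] by simp
  moreover have "(\<lambda>K. g (int K)) \<longlonglongrightarrow> of_real pi * \<i> / \<tau>"
  proof -
    have "c (of_int (- int K) * \<sigma>) = - c (of_nat K * \<sigma>)" for K by (simp add: c_def)
    thus ?thesis unfolding g_def using tendsto_divide[OF tendsto_minus[OF cl] tendsto_const t0] by simp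
  qed
  ultimately have "(\<Sum>\<^sub>\<infinity>m. g m - g (m + 1)) = - of_real pi * \<i> / \<tau> - of_real pi * \<i> / \<tau>"
    by (rule infsum_telescope_int[OF gs])
  hence "(\<Sum>\<^sub>\<infinity>m. \<Sum>\<^sub>\<infinity>n. b m n) = (1 / \<tau> ^ 2) * eisenstein_G2 \<sigma> + 2 * of_real pi * \<i> / \<tau>"
    unfolding colsum using infsum_diff_complex[OF has_sum_imp_summable[OF Gs'] gs] infsumI[OF Gs'] by simp
  moreover have "(\<Sum>\<^sub>\<infinity>m. \<Sum>\<^sub>\<infinity>n. b m n) = (\<Sum>\<^sub>\<infinity>n. \<Sum>\<^sub>\<infinity>m. b m n)"
    using infsum_swap_banach[of b UNIV UNIV] bs by simp
  ultimately have "eisenstein_G2 \<tau> = (1 / \<tau> ^ 2) * eisenstein_G2 \<sigma> + 2 * of_real pi * \<i> / \<tau>"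
    using rows by simp
  hence "\<tau> ^ 2 * eisenstein_G2 \<tau> = eisenstein_G2 \<sigma> + 2 * of_real pi * \<i> * \<tau>"
    using t0 by (simp add: field_simps power2_eq_square)
  thus ?thesis by (simp add: \<sigma>_def)
qed

section \<open>The discriminant\<close>

definition euler_prod :: "complex \<Rightarrow> complex" where
  "euler_prod q = (\<Prod>n. 1 - q ^ Suc n)"

text \<open>The sum of Ln (1 - q^n), each logarithm being expanded and the double series summed over
  n first. As a series of rational functions it is holomorphic in q without following a branch of
  the logarithm.\<close>

definition log_euler_prod :: "complex \<Rightarrow> complex" where
  "log_euler_prod q = - (\<Sum>m. (1 / of_nat (Suc m)) * (q ^ Suc m / (1 - q ^ Suc m)))"

lemma norm_power_less_1: "norm (q::complex) < 1 \<Longrightarrow> norm (q ^ Suc n) < 1"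
  by (metis norm_ge_zero norm_power power_less_one_iff zero_less_Suc)

text \<open>The double series of q^(n k)/k is absolutely summable, so its two iterated sums agree:
  one is the sum of the logarithms, the other is \<open>log_euler_prod\<close>, both up to
  sign.\<close>

lemma euler_prod_eq_exp:
  assumes q: "norm q < 1"
  shows "euler_prod q = exp (log_euler_prod q)"
proof -
  let ?F = "\<lambda>n k. q ^ (Suc n * Suc k) / of_nat (Suc k)"
  have q1: "norm (q ^ Suc n) < 1" for n by (rule norm_power_less_1[OF q])
  have sg: "(\<lambda>n. norm q ^ n) summable_on UNIV"
    using q by (intro norm_summable_imp_summable_on) (simp add: summable_geometric)
  have "(\<lambda>(n, k). norm q ^ n * norm q ^ k) summable_on (UNIV \<times> UNIV)"
    by (rule summable_on_product_abs) (use sg in auto)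
  hence abs: "(\<lambda>z. norm ((\<lambda>(n, k). ?F n k) z)) summable_on UNIV"
    unfolding UNIV_Times_UNIV
  proof (rule summable_on_comparison_test)
    fix z :: "nat \<times> nat"
    obtain n k where z: "z = (n, k)" by (cases z)
    have "norm (?F n k) \<le> norm (q ^ (Suc n * Suc k)) / 1"
      unfolding norm_divide by (intro frac_le) (auto simp del: of_nat_Suc simp: norm_of_nat)
    also have "\<dots> = norm q ^ (Suc n * Suc k)" by (simp only: norm_power)
    also have "\<dots> \<le> norm q ^ (n + k)" using q by (intro power_decreasing) auto
    finally show "norm ((\<lambda>(n, k). ?F n k) z) \<le> (\<lambda>(n, k). norm q ^ n * norm q ^ k) z"
      by (simp add: z power_add)
  qed auto
  hence F: "(\<lambda>(n, k). ?F n k) summable_on UNIV \<times> UNIV"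
    unfolding UNIV_Times_UNIV by (rule abs_summable_summable)
  have row: "(\<Sum>\<^sub>\<infinity>k. ?F n k) = - Ln (1 - q ^ Suc n)" and rows: "(\<lambda>k. ?F n k) summable_on UNIV" for n
  proof -
    let ?x = "q ^ Suc n"
    have "(\<lambda>k. (-1)^Suc k / of_nat k * (- ?x)^k) sums ln (1 + - ?x)"
      using q1[of n] by (intro Ln_series) simp
    hence "(\<lambda>k. (-1)^Suc (Suc k) / of_nat (Suc k) * (- ?x)^Suc k) sums ln (1 + - ?x)"
      by (subst sums_Suc_iff) simp
    hence "(\<lambda>k. - ((-1)^Suc (Suc k) / of_nat (Suc k) * (- ?x)^Suc k)) sums - ln (1 + - ?x)"
      by (rule sums_minus)
    moreover have "- ((-1)^Suc (Suc k) / of_nat (Suc k) * (- ?x)^Suc k) = ?F n k" for k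
    proof -
      define y where "y = ?x ^ Suc k"
      define u :: complex where "u = (-1) ^ Suc k"
      have u: "u * u = 1" by (simp add: u_def flip: power_mult_distrib)
      have "(- ?x) ^ Suc k = u * y" unfolding u_def y_def by (rule power_minus)
      moreover have "(-1) ^ Suc (Suc k) = - u" by (simp add: u_def)
      moreover have "q ^ (Suc n * Suc k) = y" unfolding y_def by (rule power_mult)
      moreover have "- (- u / c * (u * y)) = (u * u) * y / c" for c by simp
      ultimately show ?thesis unfolding u by (simp only: mult_1)
    qed
    ultimately have s: "(\<lambda>k. ?F n k) sums - ln (1 - ?x)" by (simp only: diff_conv_add_uminus)
    have nn: "summable (\<lambda>k. norm (?F n k))"
    proof (rule summable_comparison_test')
      show "summable (\<lambda>k. norm ?x ^ Suc k)"
        using q1[of n] by (simp add: summable_mult summable_geometric)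
      show "norm (norm (?F n k)) \<le> norm ?x ^ Suc k" for k
      proof -
        have "norm (?F n k) \<le> norm (q ^ (Suc n * Suc k)) / 1"
          unfolding norm_divide by (intro frac_le) (auto simp del: of_nat_Suc simp: norm_of_nat)
        thus ?thesis unfolding norm_power power_mult by simp
      qed
    qed
    have "((\<lambda>k. ?F n k) has_sum (- Ln (1 - ?x))) UNIV"
      using norm_summable_imp_has_sum[OF nn s] .
    thus "(\<Sum>\<^sub>\<infinity>k. ?F n k) = - Ln (1 - ?x)" "(\<lambda>k. ?F n k) summable_on UNIV"
      by (auto simp: infsumI summable_on_def)
  qed
  have col: "((\<lambda>n. ?F n k) has_sum ((1 / of_nat (Suc k)) * (q ^ Suc k / (1 - q ^ Suc k)))) UNIV" for k
  proof -
    let ?y = "q ^ Suc k"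
    have "(\<lambda>n. ?y ^ n) sums (1 / (1 - ?y))" using q1[of k] by (rule geometric_sums)
    moreover have "summable (\<lambda>n. norm (?y ^ n))" using q1[of k] by (simp only: norm_power summable_geometric real_norm_def abs_norm_cancel) (simp add: norm_power)
    ultimately have "((\<lambda>n. ?y ^ n) has_sum (1 / (1 - ?y))) UNIV" by (rule norm_summable_imp_has_sum[rotated])
    hence "((\<lambda>n. (?y / of_nat (Suc k)) * ?y ^ n) has_sum ((?y / of_nat (Suc k)) * (1 / (1 - ?y)))) UNIV"
      by (rule has_sum_cmult_right)
    moreover have "(?y / of_nat (Suc k)) * ?y ^ n = ?F n k" for n
      unfolding mult.commute[of "Suc n" "Suc k"] power_mult power_Suc[of _ n] by simp
    ultimately show ?thesis by (simp add: mult.commute del: of_nat_Suc power_Suc)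
  qed
  have swap: "(\<Sum>\<^sub>\<infinity>n. \<Sum>\<^sub>\<infinity>k. ?F n k) = (\<Sum>\<^sub>\<infinity>k. \<Sum>\<^sub>\<infinity>n. ?F n k)"
    by (rule infsum_swap_banach[OF F])
  have R: "(\<lambda>n. \<Sum>\<^sub>\<infinity>k. ?F n k) summable_on UNIV"
    by (rule summable_on_Sigma_banach[OF F])
  have F': "(\<lambda>(k, n). ?F n k) summable_on UNIV \<times> UNIV"
    using F summable_on_reindex_bij_betw[of prod.swap "UNIV \<times> UNIV" "UNIV \<times> UNIV" "\<lambda>(n, k). ?F n k"]
    by (simp add: case_prod_unfold del: of_nat_Suc)
  have Cc: "(\<lambda>k. \<Sum>\<^sub>\<infinity>n. ?F n k) summable_on UNIV"
    by (rule summable_on_Sigma_banach[OF F'])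
  have "(\<lambda>k. \<Sum>\<^sub>\<infinity>n. ?F n k) sums (\<Sum>\<^sub>\<infinity>k. \<Sum>\<^sub>\<infinity>n. ?F n k)"
    by (rule has_sum_imp_sums[OF has_sum_infsum[OF Cc]])
  hence "(\<lambda>k. (1 / of_nat (Suc k)) * (q ^ Suc k / (1 - q ^ Suc k))) sums (\<Sum>\<^sub>\<infinity>k. \<Sum>\<^sub>\<infinity>n. ?F n k)"
    by (simp only: infsumI[OF col])
  hence L: "log_euler_prod q = - (\<Sum>\<^sub>\<infinity>k. \<Sum>\<^sub>\<infinity>n. ?F n k)"
    unfolding log_euler_prod_def by (simp only: sums_unique[symmetric])
  have "(\<lambda>n. - Ln (1 - q ^ Suc n)) sums (\<Sum>\<^sub>\<infinity>n. \<Sum>\<^sub>\<infinity>k. ?F n k)"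
    using has_sum_imp_sums[OF has_sum_infsum[OF R]] by (simp only: row)
  hence S: "(\<lambda>n. Ln (1 - q ^ Suc n)) sums log_euler_prod q"
    unfolding L swap using sums_minus by fastforce
  have "exp (Ln (1 - q ^ Suc n)) = 1 - q ^ Suc n" for n
    using q1[of n] by (intro exp_Ln) auto
  hence "euler_prod q = (\<Prod>n. exp (Ln (1 - q ^ Suc n)))"
    by (simp add: euler_prod_def del: power_Suc)
  also have "\<dots> = exp (log_euler_prod q)"
    using S by (subst prodinf_exp) (auto simp: sums_iff)
  finally show ?thesis .
qed

lemma log_euler_prod_deriv:
  assumes q: "norm q < 1"
  shows "(log_euler_prod has_field_derivative - (\<Sum>m. q ^ m / (1 - q ^ Suc m) ^ 2)) (at q)"
proof -
  let ?f = "\<lambda>m q. (1 / of_nat (Suc m)) * (q ^ Suc m / (1 - q ^ Suc m)) :: complex"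
  let ?f' = "\<lambda>m q. q ^ m / (1 - q ^ Suc m) ^ 2 :: complex"
  have "\<exists>g g'. \<forall>x \<in> ball 0 1. ((\<lambda>n. ?f n x) sums g x) \<and> ((\<lambda>n. ?f' n x) sums g' x) \<and> (g has_field_derivative g' x) (at x)"
  proof (rule series_and_derivative_comparison_complex)
    fix n and x :: complex assume x: "x \<in> ball 0 1"
    have ne: "1 - x ^ Suc n \<noteq> 0" using norm_power_less_1[of x n] x by auto
    have "((\<lambda>q. q ^ Suc n / (1 - q ^ Suc n)) has_field_derivative of_nat (Suc n) * ?f' n x) (at x)"
      using ne by (auto intro!: derivative_eq_intros simp: power2_eq_square divide_simps simp del: power_Suc of_nat_Suc) (simp add: algebra_simps)
    from DERIV_cmult[OF this, of "1 / of_nat (Suc n)"]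
    show "(?f n has_field_derivative ?f' n x) (at x)" by (simp del: of_nat_Suc power_Suc)
  next
    fix x :: complex assume x: "x \<in> ball 0 1"
    \<comment> \<open>The disc of radius d around x lies in |y| <= r < 1, which makes r^n / (1 - r)
      a majorant on the whole disc.\<close>
    define d r where "d = (1 - norm x) / 2" and "r = (1 + norm x) / 2"
    have d: "d > 0" "r < 1" "norm x + d = r" "r \<ge> 0" using x by (auto simp: d_def r_def field_simps)
    define h where "h = (\<lambda>n. complex_of_real (r ^ Suc n / (1 - r)))"
    have "summable (\<lambda>n. r ^ Suc n / (1 - r))"
      using d by (intro summable_divide) (simp add: summable_mult summable_geometric)
    hence "summable h" unfolding h_def by (rule summable_of_real)
    moreover have "r ^ Suc n / (1 - r) \<ge> 0" for n using d by simp
    hence "range h \<subseteq> \<real>\<^sub>\<ge>\<^sub>0" unfolding h_def using nonneg_Reals_of_real_iff by blast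
    moreover have "norm (?f n y) \<le> norm (h n)" if "y \<in> ball x d \<inter> ball 0 1" for n y
    proof -
      have "norm y \<le> norm x + norm (y - x)" by (metis add_diff_cancel_left' diff_add_cancel norm_triangle_ineq add.commute)
      also have "\<dots> \<le> r" using that d by (auto simp: dist_norm norm_minus_commute)
      finally have y: "norm y \<le> r" .
      have "norm (?f n y) = norm (1 / of_nat (Suc n) :: complex) * norm (y ^ Suc n / (1 - y ^ Suc n) ^ 1)"
        by (simp only: norm_mult power_one_right)
      also have "\<dots> \<le> 1 * (r ^ Suc n / (1 - r) ^ 1)"
        using d by (intro mult_mono lambert_term_bound y) (auto simp: norm_divide norm_of_nat simp del: of_nat_Suc)
      also have "\<dots> = norm (h n)" using d by (simp add: h_def norm_divide norm_mult norm_power del: of_real_divide of_real_power of_real_mult)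
      finally show ?thesis .
    qed
    ultimately show "\<exists>d h. 0 < d \<and> summable h \<and> range h \<subseteq> \<real>\<^sub>\<ge>\<^sub>0 \<and> (\<forall>\<^sub>F n in sequentially. \<forall>y\<in>ball x d \<inter> ball 0 1. cmod (?f n y) \<le> cmod (h n))"
      using d(1) by (intro exI[of _ d] exI[of _ h]) auto
  qed auto
  then obtain g g' where g: "\<And>x. x \<in> ball 0 1 \<Longrightarrow> (\<lambda>n. ?f n x) sums g x"
    "\<And>x. x \<in> ball 0 1 \<Longrightarrow> (\<lambda>n. ?f' n x) sums g' x" "\<And>x. x \<in> ball 0 1 \<Longrightarrow> (g has_field_derivative g' x) (at x)"
    by blast
  have qb: "q \<in> ball 0 1" using q by simp
  have "((\<lambda>x. - g x) has_field_derivative - g' q) (at q)" using g(3)[OF qb] by (rule DERIV_minus)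
  hence "(log_euler_prod has_field_derivative - g' q) (at q)"
    by (rule has_field_derivative_transform_within_open[OF _ open_ball qb])
       (use g(1) in \<open>auto simp: log_euler_prod_def sums_iff simp del: power_Suc of_nat_Suc\<close>)
  thus ?thesis using g(2)[OF qb] by (simp add: sums_iff del: power_Suc)
qed

lemma log_euler_prod_holomorphic: "log_euler_prod holomorphic_on ball 0 1"
  unfolding holomorphic_on_def field_differentiable_def
  using log_euler_prod_deriv has_field_derivative_at_within by (metis dist_0_norm mem_ball)

text \<open>The logarithmic derivative of the Euler product is the weight two series. This carries
  the inversion of \<open>eisenstein_G2\<close> over to \<open>Delta\<close>.\<close>

lemma lambert_S_eq: "norm q < 1 \<Longrightarrow> lambert_S q = - q * deriv log_euler_prod q"
proof -
  assume q: "norm q < 1"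
  have sm: "summable (\<lambda>m. q ^ m / (1 - q ^ Suc m) ^ 2)"
  proof (cases "q = 0")
    case True
    thus ?thesis by (intro summable_finite[of "{0}"]) (auto simp: power_0_left)
  next
    case False
    have "summable (\<lambda>m. q ^ Suc m / (1 - q ^ Suc m) ^ 2)"
      using summable_norm_cancel[OF lambert_summable[OF q]] .
    hence "summable (\<lambda>m. q ^ Suc m / (1 - q ^ Suc m) ^ 2 / q)" by (rule summable_divide)
    thus ?thesis using False by simp
  qed
  have "lambert_S q = (\<Sum>m. q * (q ^ m / (1 - q ^ Suc m) ^ 2))"
    by (simp add: lambert_S_def)
  also have "\<dots> = q * (\<Sum>m. q ^ m / (1 - q ^ Suc m) ^ 2)"
    by (rule suminf_mult[OF sm])
  finally show ?thesis using DERIV_imp_deriv[OF log_euler_prod_deriv[OF q]] by simp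
qed

lemma lambert_S_holomorphic: "lambert_S holomorphic_on ball 0 1"
proof -
  have "(\<lambda>q. - q * deriv log_euler_prod q) holomorphic_on ball 0 1"
    by (intro holomorphic_intros holomorphic_deriv log_euler_prod_holomorphic open_ball)
  thus ?thesis by (rule holomorphic_transform) (simp add: lambert_S_eq)
qed

lemma lambert_S_0: "lambert_S 0 = 0" by (simp add: lambert_S_eq)

lemma deriv_log_euler_prod_0: "deriv log_euler_prod 0 = -1"
proof -
  have "(\<lambda>m. (0::complex) ^ m / (1 - 0 ^ Suc m) ^ 2) = (\<lambda>m. if m = 0 then 1 else 0)" by auto
  thus ?thesis using DERIV_imp_deriv[OF log_euler_prod_deriv[of 0]] sums_unique[OF sums_single[of 0 "\<lambda>_. 1 :: complex"]] by simp
qed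

lemma deriv_lambert_S_0: "deriv lambert_S 0 = 1"
proof -
  have "(deriv log_euler_prod) holomorphic_on ball 0 1"
    by (intro holomorphic_deriv log_euler_prod_holomorphic open_ball)
  hence "(deriv log_euler_prod has_field_derivative deriv (deriv log_euler_prod) 0) (at 0)"
    by (rule holomorphic_derivI) auto
  hence "((\<lambda>q. - q * deriv log_euler_prod q) has_field_derivative 1) (at 0)"
    by (auto intro!: derivative_eq_intros simp: deriv_log_euler_prod_0)
  hence "(lambert_S has_field_derivative 1) (at 0)"
    by (rule has_field_derivative_transform_within_open[of _ _ _ "ball 0 1"]) (auto simp: lambert_S_eq)
  thus ?thesis by (rule DERIV_imp_deriv)
qed

lemma euler_prod_nonzero: "norm q < 1 \<Longrightarrow> euler_prod q \<noteq> 0"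
  by (simp add: euler_prod_eq_exp)

lemma euler_prod_deriv:
  assumes q: "norm q < 1"
  shows "(euler_prod has_field_derivative euler_prod q * deriv log_euler_prod q) (at q)"
proof -
  have "(log_euler_prod has_field_derivative deriv log_euler_prod q) (at q)"
    using log_euler_prod_deriv[OF q] DERIV_imp_deriv by metis
  hence "((\<lambda>q. exp (log_euler_prod q)) has_field_derivative exp (log_euler_prod q) * deriv log_euler_prod q) (at q)"
    by (auto intro!: derivative_eq_intros)
  hence "(euler_prod has_field_derivative exp (log_euler_prod q) * deriv log_euler_prod q) (at q)"
    by (rule has_field_derivative_transform_within_open[of _ _ _ "ball 0 1"]) (use q in \<open>auto simp: euler_prod_eq_exp\<close>)
  thus ?thesis by (simp add: euler_prod_eq_exp[OF q])
qed

lemma euler_prod_holomorphic: "euler_prod holomorphic_on ball 0 1"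
  unfolding holomorphic_on_def field_differentiable_def
  using euler_prod_deriv has_field_derivative_at_within by (metis dist_0_norm mem_ball)

lemma euler_prod_0 [simp]: "euler_prod 0 = 1"
  by (simp add: euler_prod_def)

lemma dedekind_eta_eq: "dedekind_eta \<tau> = nome (\<tau> / 24) * euler_prod (nome \<tau>)"
  by (simp add: dedekind_eta_def euler_prod_def)

definition Delta :: "complex \<Rightarrow> complex" where
  "Delta \<tau> = nome \<tau> * euler_prod (nome \<tau>) ^ 24"

lemma nome_24: "nome (\<tau> / 24) ^ 24 = nome \<tau>"
proof -
  have "nome \<tau> = exp (of_nat 24 * (2 * of_real pi * \<i> * (\<tau> / 24)))" by (simp add: mult_ac)
  thus ?thesis by (simp only: exp_of_nat_mult)
qed

lemma eta_24: "dedekind_eta \<tau> ^ 24 = Delta \<tau>"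
  unfolding dedekind_eta_eq Delta_def power_mult_distrib nome_24 ..

definition E2 :: "complex \<Rightarrow> complex" where
  "E2 \<tau> = 1 - 24 * lambert_S (nome \<tau>)"

lemma nome_deriv: "(nome has_field_derivative (2 * of_real pi * \<i>) * nome \<tau>) (at \<tau>)"
  by (auto intro!: derivative_eq_intros)

lemma Delta_nonzero: "Im \<tau> > 0 \<Longrightarrow> Delta \<tau> \<noteq> 0"
  by (simp add: Delta_def euler_prod_nonzero norm_nome_less_1)

lemma Delta_deriv:
  assumes "Im \<tau> > 0"
  shows "(Delta has_field_derivative 2 * of_real pi * \<i> * (E2 \<tau> * Delta \<tau>)) (at \<tau>)"
proof -
  let ?q = "nome \<tau>"
  have q: "norm ?q < 1" by (rule norm_nome_less_1[OF assms])
  have "((\<lambda>\<tau>. euler_prod (nome \<tau>)) has_field_derivative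
      (euler_prod ?q * deriv log_euler_prod ?q) * ((2 * of_real pi * \<i>) * ?q)) (at \<tau>)"
    by (rule DERIV_chain2[OF euler_prod_deriv[OF q] nome_deriv])
  from DERIV_mult[OF nome_deriv DERIV_power[OF this, of 24]]
  have "((\<lambda>\<tau>. nome \<tau> * euler_prod (nome \<tau>) ^ 24) has_field_derivative
    (2 * of_real pi * \<i>) * ?q * euler_prod ?q ^ 24 + of_nat 24 *
     ((euler_prod ?q * deriv log_euler_prod ?q) * ((2 * of_real pi * \<i>) * ?q) * euler_prod ?q ^ (24 - Suc 0)) * ?q) (at \<tau>)" .
  also have "(2 * of_real pi * \<i>) * ?q * euler_prod ?q ^ 24 + of_nat 24 *
     ((euler_prod ?q * deriv log_euler_prod ?q) * ((2 * of_real pi * \<i>) * ?q) * euler_prod ?q ^ (24 - Suc 0)) * ?q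
     = 2 * of_real pi * \<i> * (E2 \<tau> * Delta \<tau>)"
  proof -
    have e: "x * D * (c * q) * x ^ (24 - Suc 0) = c * q * D * x ^ 24" for x D c q :: complex
    proof -
      have "x ^ 24 = x * x ^ (24 - Suc 0)" by (simp flip: power_Suc)
      thus ?thesis by (simp only: mult_ac)
    qed
    show ?thesis unfolding e E2_def Delta_def lambert_S_eq[OF q] by (simp add: algebra_simps)
  qed
  finally show ?thesis unfolding Delta_def .
qed

lemma E2_inversion:
  assumes "Im \<tau> > 0"
  shows "E2 (- 1 / \<tau>) = \<tau> ^ 2 * E2 \<tau> - 6 * \<i> * \<tau> / of_real pi"
proof -
  have "Im (- 1 / \<tau>) > 0" using Im_moebius(2)[of 0 0 "-1" 1 \<tau>] assms by simp
  hence "eisenstein_G2 (- 1 / \<tau>) = of_real pi ^ 2 / 3 * E2 (- 1 / \<tau>)" "eisenstein_G2 \<tau> = of_real pi ^ 2 / 3 * E2 \<tau>"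
    using assms by (simp_all add: eisenstein_G2_eq E2_def algebra_simps)
  with eisenstein_G2_inversion[OF assms] have eq: "of_real pi ^ 2 / 3 * E2 (- 1 / \<tau>) =
    \<tau> ^ 2 * (of_real pi ^ 2 / 3 * E2 \<tau>) - 2 * of_real pi * \<i> * \<tau>" by simp
  have "E2 (- 1 / \<tau>) = 3 / of_real pi ^ 2 * (of_real pi ^ 2 / 3 * E2 (- 1 / \<tau>))" by simp
  also have "\<dots> = \<tau> ^ 2 * E2 \<tau> - 6 * \<i> * \<tau> / of_real pi"
    unfolding eq by (simp add: right_diff_distrib power2_eq_square)
  finally show ?thesis .
qed

lemma Im_inversion: "Im \<tau> > 0 \<Longrightarrow> Im (- 1 / \<tau>) > 0"
  using Im_moebius(2)[of 0 0 "-1" 1 \<tau>] by simp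

text \<open>The quotient of both sides has derivative 0: the extra term in the inversion of E2 is
  exactly the 12/\<tau> contributed by \<tau>^12. The constant is read off at the fixed point \<i>,
  where \<i>^12 = 1.\<close>

theorem Delta_inversion:
  assumes \<tau>: "Im \<tau> > 0"
  shows "Delta (- 1 / \<tau>) = \<tau> ^ 12 * Delta \<tau>"
proof -
  define f where "f = (\<lambda>\<tau>. Delta (- 1 / \<tau>) / (\<tau> ^ 12 * Delta \<tau>))"
  have der: "(f has_field_derivative 0) (at \<tau>)" if \<tau>: "Im \<tau> > 0" for \<tau>
  proof -
    have t0: "\<tau> \<noteq> 0" using \<tau> by auto
    let ?c = "2 * of_real pi * \<i>"
    have 1: "((\<lambda>\<tau>. - 1 / \<tau>) has_field_derivative 1 / \<tau> ^ 2) (at \<tau>)"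
      using t0 by (auto intro!: derivative_eq_intros simp: power2_eq_square)
    have 2: "((\<lambda>\<tau>. Delta (- 1 / \<tau>)) has_field_derivative ?c * (E2 (- 1 / \<tau>) * Delta (- 1 / \<tau>)) * (1 / \<tau> ^ 2)) (at \<tau>)"
      by (rule DERIV_chain2[OF Delta_deriv[OF Im_inversion[OF \<tau>]] 1])
    have 3: "((\<lambda>\<tau>. \<tau> ^ 12 * Delta \<tau>) has_field_derivative 12 * \<tau> ^ 11 * Delta \<tau> + \<tau> ^ 12 * (?c * (E2 \<tau> * Delta \<tau>))) (at \<tau>)"
      by (auto intro!: derivative_eq_intros Delta_deriv[OF \<tau>])
    have nz: "\<tau> ^ 12 * Delta \<tau> \<noteq> 0" using t0 Delta_nonzero[OF \<tau>] by simp
    have e: "?c * (E2 (- 1 / \<tau>) * Delta (- 1 / \<tau>)) * (1 / \<tau> ^ 2) = Delta (- 1 / \<tau>) * (?c * E2 \<tau> + 12 / \<tau>)"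
    proof -
      have "?c * (E2 (- 1 / \<tau>) * (1 / \<tau> ^ 2)) = ?c * E2 \<tau> + 12 / \<tau>"
        unfolding E2_inversion[OF \<tau>] using t0 by (simp add: field_simps power2_eq_square)
      hence "Delta (- 1 / \<tau>) * (?c * (E2 (- 1 / \<tau>) * (1 / \<tau> ^ 2))) = Delta (- 1 / \<tau>) * (?c * E2 \<tau> + 12 / \<tau>)" by simp
      thus ?thesis by (simp only: mult_ac)
    qed
    have "(f has_field_derivative (Delta (- 1 / \<tau>) * (?c * E2 \<tau> + 12 / \<tau>) * (\<tau> ^ 12 * Delta \<tau>) -
       Delta (- 1 / \<tau>) * (12 * \<tau> ^ 11 * Delta \<tau> + \<tau> ^ 12 * (?c * (E2 \<tau> * Delta \<tau>)))) / ((\<tau> ^ 12 * Delta \<tau>) * (\<tau> ^ 12 * Delta \<tau>))) (at \<tau>)"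
      unfolding f_def using DERIV_divide[OF 2 3 nz] unfolding e .
    moreover have "Delta (- 1 / \<tau>) * (?c * E2 \<tau> + 12 / \<tau>) * (\<tau> ^ 12 * Delta \<tau>) -
       Delta (- 1 / \<tau>) * (12 * \<tau> ^ 11 * Delta \<tau> + \<tau> ^ 12 * (?c * (E2 \<tau> * Delta \<tau>))) = 0"
    proof -
      define u where "u = 12 / \<tau>"
      have u: "u * \<tau> ^ 12 = 12 * \<tau> ^ 11" using t0 by (simp add: u_def eval_nat_numeral)
      have "Delta (- 1 / \<tau>) * (?c * E2 \<tau> + u) * (\<tau> ^ 12 * Delta \<tau>) -
         Delta (- 1 / \<tau>) * (12 * \<tau> ^ 11 * Delta \<tau> + \<tau> ^ 12 * (?c * (E2 \<tau> * Delta \<tau>)))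
         = Delta (- 1 / \<tau>) * Delta \<tau> * (u * \<tau> ^ 12 - 12 * \<tau> ^ 11)" by (simp add: algebra_simps)
      also have "\<dots> = 0" unfolding u by simp
      finally show ?thesis unfolding u_def .
    qed
    ultimately show ?thesis by (simp only: div_0)
  qed
  have "convex {\<tau>. Im \<tau> > 0}" by (simp add: convex_halfspace_Im_gt)
  hence "\<exists>c. \<forall>x\<in>{\<tau>. Im \<tau> > 0}. f x = c"
    by (rule has_field_derivative_zero_constant) (use der has_field_derivative_at_within in blast)
  then obtain c where c: "\<And>\<tau>. Im \<tau> > 0 \<Longrightarrow> f \<tau> = c" by blast
  have "f \<i> = 1" using Delta_nonzero[of \<i>] by (simp add: f_def eval_nat_numeral)
  hence "f \<tau> = 1" using c[of \<i>] c[OF \<tau>] by simp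
  thus ?thesis using \<tau> Delta_nonzero[OF \<tau>] by (auto simp: f_def field_simps)
qed

section \<open>Modular forms of level one\<close>

abbreviation uhp :: "complex set" where "uhp \<equiv> {\<tau>. Im \<tau> > 0}"

lemma open_uhp: "open uhp" by (rule open_halfspace_Im_gt)
lemma convex_uhp: "convex uhp" by (rule convex_halfspace_Im_gt)
lemma connected_uhp: "connected uhp" by (intro convex_connected convex_uhp)

abbreviation cusp :: "complex filter" where "cusp \<equiv> filtercomap Im at_top"

lemma eventually_cusp: "eventually P cusp \<longleftrightarrow> (\<exists>Y. \<forall>\<tau>. Im \<tau> > Y \<longrightarrow> P \<tau>)"
  by (subst eventually_filtercomap_at_top_dense) auto

lemma eventually_cusp_uhp: "eventually (\<lambda>\<tau>. Im \<tau> > Y) cusp"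
  unfolding eventually_cusp by blast

lemma cusp_neq_bot [simp]: "cusp \<noteq> bot"
proof
  assume "cusp = bot"
  hence "eventually (\<lambda>_. False) cusp" by simp
  then obtain Y where "\<not> Im \<tau> > Y" for \<tau> unfolding eventually_cusp by blast
  from this[of "Complex 0 (Y + 1)"] show False by simp
qed

lemma tendsto_nome_cusp: "(nome \<longlongrightarrow> 0) cusp"
proof (rule tendsto_norm_zero_cancel)
  have "((\<lambda>y. exp (- 2 * pi * y)) \<longlongrightarrow> 0) at_top"
  proof -
    have "filterlim (\<lambda>y. 2 * pi * y) at_top at_top"
      by (rule filterlim_tendsto_pos_mult_at_top[OF tendsto_const]) (auto simp: filterlim_ident)
    hence "filterlim (\<lambda>y. - (2 * pi * y)) at_bot at_top" by (simp add: filterlim_uminus_at_bot)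
    thus ?thesis using filterlim_compose[OF exp_at_bot] by fastforce
  qed
  hence "((\<lambda>\<tau>. exp (- 2 * pi * Im \<tau>)) \<longlongrightarrow> 0) cusp"
    using filterlim_compose filterlim_filtercomap by blast
  thus "((\<lambda>\<tau>. norm (nome \<tau>)) \<longlongrightarrow> 0) cusp" by (simp only: norm_nome)
qed

lemma tendsto_hol_nome:
  assumes "g holomorphic_on ball 0 1"
  shows "((\<lambda>\<tau>. g (nome \<tau>)) \<longlongrightarrow> g 0) cusp"
proof -
  have "continuous (at 0) g"
    using assms holomorphic_on_imp_continuous_on continuous_on_interior by fastforce
  thus ?thesis using tendsto_nome_cusp isCont_tendsto_compose by blast
qed

lemma nome_holomorphic: "nome holomorphic_on A" by (intro holomorphic_intros)

lemma holomorphic_nome_compose: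
  assumes "g holomorphic_on ball 0 1"
  shows "(\<lambda>\<tau>. g (nome \<tau>)) holomorphic_on uhp"
proof -
  have "nome ` uhp \<subseteq> ball 0 1"
    by (intro image_subsetI) (simp only: mem_ball dist_0_norm mem_Collect_eq norm_nome_less_1)
  from holomorphic_on_compose_gen[OF nome_holomorphic assms this] show ?thesis by (simp only: o_def)
qed

lemma nome_plus_int: "nome (\<tau> + of_int n) = nome \<tau>"
proof -
  have "2 * of_real pi * \<i> * (\<tau> + of_int n) = 2 * of_real pi * \<i> * \<tau> + \<i> * (of_int n * (of_real pi * 2))"
    by (simp add: algebra_simps)
  thus ?thesis by (simp add: exp_plus_2pin)
qed

lemma nome_plus_1: "nome (\<tau> + 1) = nome \<tau>" using nome_plus_int[of \<tau> 1] by simp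

text \<open>This stands for the action of SL_2(Z), presented by translations and the inversion, so
  that invariance under the two generators passes to all words by induction.\<close>

inductive_set modular_words :: "(complex \<Rightarrow> complex) set" where
  id: "(\<lambda>\<tau>. \<tau>) \<in> modular_words"
| shift: "w \<in> modular_words \<Longrightarrow> (\<lambda>\<tau>. w \<tau> + of_int n) \<in> modular_words"
| inversion: "w \<in> modular_words \<Longrightarrow> (\<lambda>\<tau>. - 1 / w \<tau>) \<in> modular_words"

lemma modular_words_uhp: "w \<in> modular_words \<Longrightarrow> Im \<tau> > 0 \<Longrightarrow> Im (w \<tau>) > 0"
  by (induction rule: modular_words.induct) (use Im_inversion in auto)

lemma shift_int:
  assumes "\<And>\<tau>. Im \<tau> > 0 \<Longrightarrow> g (\<tau> + 1) = g \<tau>" and "Im \<tau> > 0"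
  shows "g (\<tau> + of_int n) = g (\<tau>::complex)"
proof (induction n rule: int_induct[where k = 0])
  case (step1 i)
  have "g (\<tau> + of_int i + 1) = g (\<tau> + of_int i)" using assms(2) by (intro assms(1)) simp
  thus ?case using step1 by (simp add: add.assoc)
next
  case (step2 i)
  have "g (\<tau> + of_int (i - 1) + 1) = g (\<tau> + of_int (i - 1))" using assms(2) by (intro assms(1)) simp
  thus ?case using step2 by simp
qed simp

lemma modular_words_invariant:
  assumes "\<And>\<tau>. Im \<tau> > 0 \<Longrightarrow> g (\<tau> + 1) = g \<tau>" "\<And>\<tau>. Im \<tau> > 0 \<Longrightarrow> g (- 1 / \<tau>) = g \<tau>"
    and "w \<in> modular_words" "Im \<tau> > 0"
  shows "g (w \<tau>) = g \<tau>"
  using assms(3)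
proof (induction rule: modular_words.induct)
  case (shift w n)
  thus ?case using shift_int[of g, OF assms(1)] modular_words_uhp[OF shift.hyps assms(4)] by simp
next
  case (inversion w)
  thus ?case using assms(2) modular_words_uhp[OF inversion.hyps assms(4)] by simp
qed simp

lemma modular_words_holomorphic: "w \<in> modular_words \<Longrightarrow> w holomorphic_on uhp"
proof (induction rule: modular_words.induct)
  case (inversion w)
  have "w \<tau> \<noteq> 0" if "\<tau> \<in> uhp" for \<tau> using modular_words_uhp[OF inversion.hyps, of \<tau>] that by auto
  thus ?case using inversion by (intro holomorphic_intros) auto
qed (auto intro!: holomorphic_intros)

text \<open>An inversion at least doubles the height of a point with \<open>\<bar>Re\<bar> \<le> 1/2\<close> and \<open>Im < 1/2\<close>.\<close>

lemma modular_words_strip: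
  assumes "Im \<tau> > 0"
  obtains w \<sigma> where "w \<in> modular_words" "\<tau> = w \<sigma>" "\<bar>Re \<sigma>\<bar> \<le> 1/2" "Im \<sigma> \<ge> 1/2"
proof -
  have "\<exists>w\<in>modular_words. \<exists>\<sigma>. \<tau> = w \<sigma> \<and> \<bar>Re \<sigma>\<bar> \<le> 1/2 \<and> Im \<sigma> \<ge> 1/2"
    if "Im \<tau> * 2 ^ n \<ge> 1/2" "Im \<tau> > 0" for n \<tau>
    using that
  proof (induction n arbitrary: \<tau>)
    case (0 \<tau>)
    have "(\<lambda>\<sigma>. \<sigma> + of_int (round (Re \<tau>))) \<in> modular_words" by (intro modular_words.intros)
    moreover have "\<bar>Re (\<tau> - of_int (round (Re \<tau>)))\<bar> \<le> 1/2"
      using of_int_round_abs_le[of "Re \<tau>"] by (simp add: abs_minus_commute)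
    ultimately show ?case using 0 by (intro bexI exI[of _ "\<tau> - of_int (round (Re \<tau>))"]) auto
  next
    case (Suc n \<tau>)
    define k where "k = round (Re \<tau>)"
    define \<tau>0 where "\<tau>0 = \<tau> - of_int k"
    have re: "\<bar>Re \<tau>0\<bar> \<le> 1/2"
      using of_int_round_abs_le[of "Re \<tau>"] by (simp add: abs_minus_commute \<tau>0_def k_def)
    have im: "Im \<tau>0 = Im \<tau>" by (simp add: \<tau>0_def)
    show ?case
    proof (cases "Im \<tau> \<ge> 1/2")
      case True
      have "(\<lambda>\<sigma>. \<sigma> + of_int k) \<in> modular_words" by (intro modular_words.intros)
      thus ?thesis using re im True by (intro bexI exI[of _ \<tau>0]) (auto simp: \<tau>0_def)
    next
      case False
      define \<tau>1 where "\<tau>1 = - 1 / \<tau>0"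
      have pos: "Im \<tau>1 > 0" unfolding \<tau>1_def using Suc.prems im by (intro Im_inversion) simp
      have "(Re \<tau>0)\<^sup>2 \<le> (1/2)\<^sup>2" using re by (simp add: abs_le_square_iff[symmetric])
      moreover have "(Im \<tau>0)\<^sup>2 \<le> (1/2)\<^sup>2" using False Suc.prems im by (intro power_mono) auto
      ultimately have n: "(norm \<tau>0)\<^sup>2 \<le> 1/2" by (simp add: cmod_power2 power_divide)
      have n0: "(norm \<tau>0)\<^sup>2 > 0" using Suc.prems im by auto
      have "Im \<tau>1 = Im \<tau> / (norm \<tau>0)\<^sup>2" by (simp add: \<tau>1_def Im_divide cmod_power2 im)
      also have "\<dots> \<ge> Im \<tau> / (1/2)" using n n0 Suc.prems by (intro divide_left_mono) auto
      finally have "Im \<tau>1 \<ge> 2 * Im \<tau>" by simp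
      hence "Im \<tau>1 * 2 ^ n \<ge> 2 * Im \<tau> * 2 ^ n" by (intro mult_right_mono) auto
      moreover have "Im \<tau> * 2 ^ Suc n = 2 * Im \<tau> * 2 ^ n" by simp
      ultimately have "Im \<tau>1 * 2 ^ n \<ge> 1/2" using Suc.prems by linarith
      from Suc.IH[OF this pos] obtain w \<sigma> where w: "w \<in> modular_words" "\<tau>1 = w \<sigma>" "\<bar>Re \<sigma>\<bar> \<le> 1/2" "Im \<sigma> \<ge> 1/2"
        by blast
      have "\<tau>0 \<noteq> 0" using n0 by auto
      hence "\<tau> = - 1 / w \<sigma> + of_int k" using w(2) unfolding \<tau>1_def
        by (metis \<tau>0_def add.commute diff_add_cancel div_by_1 divide_divide_eq_right minus_divide_left mult_1 nonzero_minus_divide_divide add_uminus_conv_diff minus_minus divide_minus_left)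
      moreover have "(\<lambda>\<sigma>. - 1 / w \<sigma> + of_int k) \<in> modular_words" using w(1) by (intro modular_words.intros)
      ultimately show ?thesis using w by (intro bexI exI[of _ \<sigma>]) auto
    qed
  qed
  moreover obtain n where "1 / (2 * Im \<tau>) < 2 ^ n" using real_arch_pow[of 2] by auto
  hence "Im \<tau> * 2 ^ n \<ge> 1/2" using assms by (simp add: field_simps)
  ultimately show ?thesis using that assms by blast
qed

text \<open>Every orbit meets the strip |Re| <= 1/2, Im >= 1/2. High up in it |g| is smaller than at
  \<tau>, so the maximum of |g| over the half plane is attained in a compact box. The maximum
  principle makes g constant, and the limit at the cusp makes the constant 0.\<close>

theorem modular_function_zero:
  assumes hol: "g holomorphic_on uhp"
    and T: "\<And>\<tau>. Im \<tau> > 0 \<Longrightarrow> g (\<tau> + 1) = g \<tau>" and S: "\<And>\<tau>. Im \<tau> > 0 \<Longrightarrow> g (- 1 / \<tau>) = g \<tau>"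
    and lim: "(g \<longlongrightarrow> 0) cusp" and \<tau>: "Im \<tau> > 0"
  shows "g \<tau> = 0"
proof (rule ccontr)
  assume nz: "g \<tau> \<noteq> 0"
  hence "eventually (\<lambda>\<sigma>. norm (g \<sigma>) < norm (g \<tau>)) cusp"
    using order_tendstoD(2)[OF tendsto_norm[OF lim]] by simp
  then obtain Y where Y: "\<And>\<sigma>. Im \<sigma> > Y \<Longrightarrow> norm (g \<sigma>) < norm (g \<tau>)" unfolding eventually_cusp by blast
  define K where "K = cbox (Complex (-1/2) (1/2)) (Complex (1/2) (max Y (1/2)))"
  have K: "compact K" "K \<subseteq> uhp" unfolding K_def by (auto simp: in_cbox_complex_iff)
  have inK: "\<sigma> \<in> K" if "\<bar>Re \<sigma>\<bar> \<le> 1/2" "Im \<sigma> \<ge> 1/2" "Im \<sigma> \<le> Y" for \<sigma>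
    using that unfolding K_def in_cbox_complex_iff by auto
  obtain w \<sigma> where w: "w \<in> modular_words" "\<tau> = w \<sigma>" "\<bar>Re \<sigma>\<bar> \<le> 1/2" "Im \<sigma> \<ge> 1/2"
    using modular_words_strip[OF \<tau>] by blast
  have gs: "g \<tau> = g \<sigma>" using modular_words_invariant[of g w \<sigma>] T S w by simp
  have sK: "\<sigma> \<in> K" using inK[OF w(3,4)] Y[of \<sigma>] gs by force
  have "continuous_on K (\<lambda>z. norm (g z))"
    using hol K(2) holomorphic_on_imp_continuous_on continuous_on_subset by (intro continuous_on_norm) blast
  then obtain \<xi> where \<xi>: "\<xi> \<in> K" "\<And>z. z \<in> K \<Longrightarrow> norm (g z) \<le> norm (g \<xi>)"
    using continuous_attains_sup[OF K(1)] sK by (metis empty_iff)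
  have max: "norm (g z) \<le> norm (g \<xi>)" if "z \<in> uhp" for z
  proof -
    obtain v s where v: "v \<in> modular_words" "z = v s" "\<bar>Re s\<bar> \<le> 1/2" "Im s \<ge> 1/2"
      using modular_words_strip \<open>z \<in> uhp\<close> by blast
    have "g z = g s" using modular_words_invariant[of g v s] T S v by simp
    moreover have "norm (g s) \<le> norm (g \<xi>)"
    proof (cases "Im s > Y")
      case True
      thus ?thesis using Y[of s] \<xi>(2)[OF sK] gs by simp
    qed (use inK[OF v(3,4)] \<xi>(2) in auto)
    ultimately show ?thesis by simp
  qed
  have "g constant_on uhp"
    by (rule maximum_modulus_principle[OF hol open_uhp connected_uhp open_uhp order_refl _ max])
       (use \<xi>(1) K(2) in auto)
  then obtain c where c: "\<And>z. z \<in> uhp \<Longrightarrow> g z = c" unfolding constant_on_def by blast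
  have "((\<lambda>z. c) \<longlongrightarrow> 0) cusp"
    using lim by (rule Lim_transform_eventually) (use c eventually_cusp_uhp[of 0] in \<open>auto elim!: eventually_mono\<close>)
  hence "c = 0" by (simp add: tendsto_const_iff)
  thus False using c nz \<tau> by simp
qed

text \<open>A function of period 1 descends to the punctured disc; the limit at the cusp makes the
  puncture removable.\<close>

lemma periodic_q_expansion:
  assumes hol: "f holomorphic_on uhp" and T: "\<And>\<tau>. Im \<tau> > 0 \<Longrightarrow> f (\<tau> + 1) = f \<tau>"
    and lim: "(f \<longlongrightarrow> c) cusp"
  obtains G where "G holomorphic_on ball 0 1" "G 0 = c" "\<And>\<tau>. Im \<tau> > 0 \<Longrightarrow> f \<tau> = G (nome \<tau>)"
proof -
  let ?k = "2 * of_real pi * \<i>"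
  define G where "G = (\<lambda>q. if q = 0 then c else f (Ln q / ?k))"
  have eq: "f \<tau> = G (nome \<tau>)" if "Im \<tau> > 0" for \<tau>
  proof -
    have "exp (Ln (nome \<tau>)) = exp (?k * \<tau>)" by simp
    then obtain n :: int where n: "Ln (nome \<tau>) = ?k * \<tau> + (of_int (2 * n) * of_real pi) * \<i>"
      by (subst (asm) exp_eq) auto
    have "Ln (nome \<tau>) / ?k = \<tau> + of_int n" unfolding n by (simp add: field_simps)
    thus ?thesis using shift_int[of f, OF T that] by (simp add: G_def)
  qed
  have im: "Im (z / ?k) = - Re z / (2 * pi)" for z
    by (simp add: Im_divide power2_eq_square)
  \<comment> \<open>Any local branch h of the logarithm shows differentiability of G, since by
    periodicity all branches give the same value.\<close>
  have local: "G field_differentiable (at q)" if q: "q \<noteq> 0" "norm q < 1"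
      and h: "h holomorphic_on A" "open A" "q \<in> A" "\<And>x. x \<in> A \<Longrightarrow> exp (h x) = x" for q h A
  proof -
    let ?B = "A \<inter> ball 0 1 - {0}"
    have imh: "Im (h x / ?k) > 0" if "x \<in> ?B" for x
    proof -
      have "norm x = exp (Re (h x))" using h(4)[of x] that norm_exp_eq_Re by (metis DiffE IntE)
      moreover have "norm x < 1" using that by auto
      ultimately have "Re (h x) < 0" by simp
      thus ?thesis unfolding im using pi_gt_zero by (simp add: divide_neg_pos)
    qed
    have "(\<lambda>x. f (h x / ?k)) holomorphic_on ?B"
      by (rule holomorphic_on_compose_gen[OF _ hol, unfolded o_def])
         (use imh in \<open>auto intro!: holomorphic_intros holomorphic_on_subset[OF h(1)]\<close>)
    moreover have "open ?B" using h(2) by auto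
    moreover have "f (h x / ?k) = G x" if "x \<in> ?B" for x
      using eq[OF imh[OF that]] h(4)[of x] that by auto
    ultimately have "G holomorphic_on ?B" using holomorphic_transform by blast
    thus ?thesis using \<open>open ?B\<close> q h(3) holomorphic_on_imp_differentiable_at by (metis Diff_iff IntI dist_0_norm mem_ball singletonD)
  qed
  have hol0: "G field_differentiable (at q)" if q: "q \<noteq> 0" "norm q < 1" for q
  proof (cases "q \<in> \<real>\<^sub>\<le>\<^sub>0")
    case False
    show ?thesis
      by (rule local[OF q, of Ln "- \<real>\<^sub>\<le>\<^sub>0"])
         (use False in \<open>auto intro!: holomorphic_intros exp_Ln simp: open_Compl\<close>)
  next
    case True
    \<comment> \<open>On the cut of Ln, the branch Ln(-x) + pi \<i> is used, which is cut along the
      positive axis instead.\<close>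
    have "- q \<notin> \<real>\<^sub>\<le>\<^sub>0" using True q by (auto simp: complex_nonpos_Reals_iff complex_eq_iff)
    show ?thesis
    proof (rule local[OF q, of "\<lambda>x. Ln (- x) + of_real pi * \<i>" "uminus ` (- \<real>\<^sub>\<le>\<^sub>0)"])
      show "(\<lambda>x. Ln (- x) + of_real pi * \<i>) holomorphic_on uminus ` (- \<real>\<^sub>\<le>\<^sub>0)"
        by (intro holomorphic_intros) auto
      show "open (uminus ` (- \<real>\<^sub>\<le>\<^sub>0) :: complex set)" by (intro open_negations open_Compl closed_nonpos_Reals_complex)
      show "q \<in> uminus ` (- \<real>\<^sub>\<le>\<^sub>0)" using \<open>- q \<notin> \<real>\<^sub>\<le>\<^sub>0\<close> by (metis ComplI image_eqI minus_minus)
      fix x :: complex assume "x \<in> uminus ` (- \<real>\<^sub>\<le>\<^sub>0)"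
      hence "- x \<noteq> 0" by auto
      thus "exp (Ln (- x) + of_real pi * \<i>) = x" by (simp add: exp_add)
    qed
  qed
  have limG: "(G \<longlongrightarrow> c) (at 0)"
  proof (rule Lim_transform_eventually)
    have "filterlim (\<lambda>q. Im (Ln q / ?k)) at_top (at 0)"
    proof -
      have "filterlim (\<lambda>q::complex. ln (norm q)) at_bot (at 0)"
        by (rule filterlim_compose[OF ln_at_0]) (use tendsto_norm_zero[OF tendsto_ident_at] in \<open>auto simp: filterlim_at eventually_at intro: exI[of _ 1]\<close>)
      hence "filterlim (\<lambda>q::complex. - ln (norm q)) at_top (at 0)" by (simp add: filterlim_uminus_at_top)
      hence lim: "filterlim (\<lambda>q::complex. 1 / (2 * pi) * (- ln (norm q))) at_top (at 0)"
        by (rule filterlim_tendsto_pos_mult_at_top[OF tendsto_const, rotated]) simp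
      have "eventually (\<lambda>q. 1 / (2 * pi) * (- ln (norm q)) = Im (Ln q / ?k)) (at 0)"
        unfolding im by (auto simp: eventually_at intro!: exI[of _ 1])
      from iffD1[OF filterlim_cong[OF refl refl this] lim] show ?thesis .
    qed
    hence "filterlim (\<lambda>q. Ln q / ?k) cusp (at 0)" by (simp add: filterlim_filtercomap_iff o_def)
    thus "((\<lambda>q. f (Ln q / ?k)) \<longlongrightarrow> c) (at 0)" using lim filterlim_compose by blast
    show "\<forall>\<^sub>F q in at 0. f (Ln q / ?k) = G q" by (auto simp: eventually_at G_def intro!: exI[of _ 1])
  qed
  have "G holomorphic_on ball 0 1"
  proof (rule no_isolated_singularity[where K = "{0}"])
    show "continuous_on (ball 0 1) G"
    proof (rule continuous_at_imp_continuous_on, rule ballI)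
      fix q :: complex assume "q \<in> ball 0 1"
      hence q: "norm q < 1" by simp
      show "isCont G q"
      proof (cases "q = 0")
        case True
        have "G 0 = c" by (simp add: G_def)
        thus ?thesis using limG True by (simp add: isCont_def)
      next
        case False
        from field_differentiable_imp_continuous_at[OF hol0[OF False q]] show ?thesis .
      qed
    qed
    show "G holomorphic_on (ball 0 1 - {0})"
      unfolding holomorphic_on_def
    proof
      fix x :: complex assume "x \<in> ball 0 1 - {0}"
      thus "G field_differentiable at x within ball 0 1 - {0}"
        using field_differentiable_at_within[OF hol0[of x]] by simp
    qed
  qed auto
  thus ?thesis using that[of G] eq by (simp add: G_def)
qed

lemma holomorphic_factor_zero:
  assumes "G holomorphic_on ball 0 1" "G (0::complex) = 0"
  obtains H where "H holomorphic_on ball 0 1" "\<And>q. G q = q * H q" "H 0 = deriv G 0"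
proof -
  define H where "H = (\<lambda>q. if q = 0 then deriv G 0 else G q / q)"
  have "H holomorphic_on ball 0 1"
    unfolding H_def using pole_lemma[OF assms(1), of 0] assms(2) by (simp add: interior_open cong: if_cong)
  thus ?thesis using that[of H] assms(2) by (auto simp: H_def)
qed

text \<open>The function f^r / Delta^s has weight 0 and vanishes at the cusp to order at least r - s
  > 0. The two numerical conditions say that k < 12: this is the absence of cusp forms below weight
  12.\<close>

theorem cusp_form_zero:
  assumes hol: "f holomorphic_on uhp" and T: "\<And>\<tau>. Im \<tau> > 0 \<Longrightarrow> f (\<tau> + 1) = f \<tau>"
    and S: "\<And>\<tau>. Im \<tau> > 0 \<Longrightarrow> f (- 1 / \<tau>) = \<tau> ^ k * f \<tau>"
    and lim: "(f \<longlongrightarrow> 0) cusp" and rs: "k * r = 12 * s" "r > s" and \<tau>: "Im \<tau> > 0"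
  shows "f \<tau> = 0"
proof -
  obtain G where G: "G holomorphic_on ball 0 1" "G 0 = 0" "\<And>\<tau>. Im \<tau> > 0 \<Longrightarrow> f \<tau> = G (nome \<tau>)"
    using periodic_q_expansion[OF hol T lim] by blast
  obtain H where H: "H holomorphic_on ball 0 1" "\<And>q. G q = q * H q"
    using holomorphic_factor_zero[OF G(1,2)] by blast
  define g where "g = (\<lambda>\<tau>. f \<tau> ^ r / Delta \<tau> ^ s)"
  have D: "Delta holomorphic_on uhp"
    unfolding holomorphic_on_def field_differentiable_def using Delta_deriv has_field_derivative_at_within by blast
  have DT: "Delta (\<tau> + 1) = Delta \<tau>" for \<tau> by (simp only: Delta_def nome_plus_1)
  have g0: "g \<tau> = 0"
  proof (rule modular_function_zero[OF _ _ _ _ \<tau>])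
    show "g holomorphic_on uhp" unfolding g_def
      by (intro holomorphic_intros hol D) (use Delta_nonzero in auto)
    fix \<tau> assume \<tau>: "Im \<tau> > 0"
    show "g (\<tau> + 1) = g \<tau>" using T[OF \<tau>] by (simp add: g_def DT)
    have "\<tau> \<noteq> 0" using \<tau> by auto
    have "(\<tau> ^ k * f \<tau>) ^ r = \<tau> ^ (k * r) * f \<tau> ^ r" "(\<tau> ^ 12 * Delta \<tau>) ^ s = \<tau> ^ (k * r) * Delta \<tau> ^ s"
      by (simp_all add: power_mult_distrib power_mult[symmetric] rs)
    thus "g (- 1 / \<tau>) = g \<tau>" using S[OF \<tau>] Delta_inversion[OF \<tau>] \<open>\<tau> \<noteq> 0\<close> by (simp add: g_def)
  next
    have "(\<lambda>q. q ^ (r - s) * H q ^ r / euler_prod q ^ (24 * s)) holomorphic_on ball 0 1"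
      by (intro holomorphic_intros H euler_prod_holomorphic) (auto simp: euler_prod_nonzero)
    from tendsto_hol_nome[OF this]
    have "((\<lambda>\<tau>. nome \<tau> ^ (r - s) * H (nome \<tau>) ^ r / euler_prod (nome \<tau>) ^ (24 * s)) \<longlongrightarrow> 0) cusp"
      using rs by (simp add: power_0_left)
    thus "(g \<longlongrightarrow> 0) cusp"
    proof (rule Lim_transform_eventually)
      show "\<forall>\<^sub>F \<tau> in cusp. nome \<tau> ^ (r - s) * H (nome \<tau>) ^ r / euler_prod (nome \<tau>) ^ (24 * s) = g \<tau>"
        using eventually_cusp_uhp[of 0]
      proof eventually_elim
        case (elim \<tau>)
        have "nome \<tau> ^ r = nome \<tau> ^ s * nome \<tau> ^ (r - s)" using rs by (simp flip: power_add)
        thus ?case using elim by (simp add: g_def G(3) H(2) Delta_def power_mult_distrib power_mult)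
      qed
    qed
  qed
  have "r > 0" using rs by simp
  thus ?thesis using g0 Delta_nonzero[OF \<tau>] by (simp add: g_def)
qed

section \<open>E4 and E6 as q-series; Ramanujan's differential equations\<close>

definition E4 :: "complex \<Rightarrow> complex" where "E4 \<tau> = 45 / of_real pi ^ 4 * eisenstein_G 4 \<tau>"
definition E6 :: "complex \<Rightarrow> complex" where "E6 \<tau> = 945 / (2 * of_real pi ^ 6) * eisenstein_G 6 \<tau>"

lemma modular_j_E: "modular_j \<tau> = 1728 * E4 \<tau> ^ 3 / (E4 \<tau> ^ 3 - E6 \<tau> ^ 2)"
proof -
  let ?p = "of_real pi :: complex"
  have g2: "g2_inv \<tau> = 4 * ?p ^ 4 / 3 * E4 \<tau>"
    unfolding g2_inv_def E4_def eisenstein_G_Diff[of 4, simplified] by (simp add: field_simps)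
  have g3: "g3_inv \<tau> = 8 * ?p ^ 6 / 27 * E6 \<tau>"
    unfolding g3_inv_def E6_def eisenstein_G_Diff[of 6, simplified] by (simp add: field_simps)
  have a: "g2_inv \<tau> ^ 3 = 64 * ?p ^ 12 / 27 * E4 \<tau> ^ 3"
    unfolding g2 by (simp add: power_mult_distrib power_divide power_mult[symmetric])
  have b: "27 * g3_inv \<tau> ^ 2 = 64 * ?p ^ 12 / 27 * E6 \<tau> ^ 2"
    unfolding g3 by (simp add: power_mult_distrib power_divide power_mult[symmetric])
  have c: "g2_inv \<tau> ^ 3 - 27 * g3_inv \<tau> ^ 2 = 64 * ?p ^ 12 / 27 * (E4 \<tau> ^ 3 - E6 \<tau> ^ 2)"
    unfolding a b by (simp add: right_diff_distrib)
  \<comment> \<open>The factor shared by both terms: (4/3)^3 and 27 * (8/27)^2 are both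
    64/27.\<close>
  define X where "X = 64 * ?p ^ 12 / 27"
  have "X \<noteq> 0" by (simp add: X_def)
  thus ?thesis unfolding modular_j_def c unfolding a X_def[symmetric] by simp
qed

lemma E4_holomorphic: "E4 holomorphic_on uhp" and E6_holomorphic: "E6 holomorphic_on uhp"
  unfolding E4_def E6_def by (intro holomorphic_intros eisenstein_G_holomorphic; simp)+

lemma eisenstein_G_inversion:
  assumes "Im \<tau> > 0"
  shows "eisenstein_G k (- 1 / \<tau>) = \<tau> ^ k * eisenstein_G k \<tau>"
  using eisenstein_G_moebius[of 0 0 "-1" 1 \<tau> k] assms by simp

lemma E4_inversion: "Im \<tau> > 0 \<Longrightarrow> E4 (- 1 / \<tau>) = \<tau> ^ 4 * E4 \<tau>"
  and E6_inversion: "Im \<tau> > 0 \<Longrightarrow> E6 (- 1 / \<tau>) = \<tau> ^ 6 * E6 \<tau>"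
  using eisenstein_G_inversion by (simp_all add: E4_def E6_def)

lemma E4_plus_1: "Im \<tau> > 0 \<Longrightarrow> E4 (\<tau> + 1) = E4 \<tau>"
  and E6_plus_1: "Im \<tau> > 0 \<Longrightarrow> E6 (\<tau> + 1) = E6 \<tau>"
  using eisenstein_G_shift[of \<tau> _ 1] by (simp_all add: E4_def E6_def)

lemma eisenstein_G_tendsto:
  assumes "k \<ge> 4" "((\<lambda>n::int. 1 / of_int n ^ k) has_sum A) UNIV"
  shows "(eisenstein_G k \<longlongrightarrow> A) cusp"
  unfolding tendsto_iff eventually_cusp dist_norm using eisenstein_G_at_infinity[OF assms] by blast

lemma E4_tendsto: "(E4 \<longlongrightarrow> 1) cusp"
proof -
  have "((\<lambda>\<tau>. 45 / of_real pi ^ 4 * eisenstein_G 4 \<tau>) \<longlongrightarrow> 45 / of_real pi ^ 4 * (of_real pi ^ 4 / 45)) cusp"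
    by (intro tendsto_intros eisenstein_G_tendsto zeta_int_values) simp
  thus ?thesis unfolding E4_def by simp
qed

lemma E6_tendsto: "(E6 \<longlongrightarrow> 1) cusp"
proof -
  have "((\<lambda>\<tau>. 945 / (2 * of_real pi ^ 6) * eisenstein_G 6 \<tau>) \<longlongrightarrow> 945 / (2 * of_real pi ^ 6) * (2 * of_real pi ^ 6 / 945)) cusp"
    by (intro tendsto_intros eisenstein_G_tendsto zeta_int_values) simp
  thus ?thesis unfolding E6_def by simp
qed

definition e2 :: "complex \<Rightarrow> complex" where "e2 q = 1 - 24 * lambert_S q"
text \<open>Here and in \<open>e6\<close>, Ramanujan's equations for the derivatives of E2 and E4
  serve as definitions. The lattice sums are identified with these q-series by the absence of cusp
  forms of small weight, so no Fourier expansion of a lattice sum is computed.\<close>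

definition e4 :: "complex \<Rightarrow> complex" where "e4 q = e2 q ^ 2 - 12 * (q * deriv e2 q)"
definition e6 :: "complex \<Rightarrow> complex" where "e6 q = e2 q * e4 q - 3 * (q * deriv e4 q)"

lemma e_holomorphic: "e2 holomorphic_on ball 0 1" "e4 holomorphic_on ball 0 1" "e6 holomorphic_on ball 0 1"
proof -
  show 2: "e2 holomorphic_on ball 0 1"
    unfolding e2_def by (intro holomorphic_intros lambert_S_holomorphic)
  show 4: "e4 holomorphic_on ball 0 1"
    unfolding e4_def by (intro holomorphic_intros 2 holomorphic_deriv open_ball)
  show "e6 holomorphic_on ball 0 1"
    unfolding e6_def by (intro holomorphic_intros 2 4 holomorphic_deriv open_ball)
qed

lemma e_0 [simp]: "e2 0 = 1" "e4 0 = 1" "e6 0 = 1"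
  by (simp_all add: e2_def e4_def e6_def lambert_S_0)

lemma deriv_times_id_0:
  assumes "g holomorphic_on ball 0 1"
  shows "((\<lambda>q. q * deriv g q) has_field_derivative deriv g 0) (at (0::complex))"
proof -
  have "deriv g holomorphic_on ball 0 1" by (intro holomorphic_deriv assms open_ball)
  hence "(deriv g has_field_derivative deriv (deriv g) 0) (at 0)" by (rule holomorphic_derivI) auto
  thus ?thesis by (auto intro!: derivative_eq_intros)
qed

lemma e2_deriv_0: "(e2 has_field_derivative - 24) (at 0)"
proof -
  have "(lambert_S has_field_derivative 1) (at 0)"
    using holomorphic_derivI[OF lambert_S_holomorphic open_ball, of 0] by (simp add: deriv_lambert_S_0)
  thus ?thesis unfolding e2_def by (auto intro!: derivative_eq_intros)
qed

lemma e4_deriv_0: "(e4 has_field_derivative 240) (at 0)"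
proof -
  have "((\<lambda>q. q * deriv e2 q) has_field_derivative - 24) (at 0)"
    using deriv_times_id_0[OF e_holomorphic(1)] DERIV_imp_deriv[OF e2_deriv_0] by simp
  from DERIV_diff[OF DERIV_power[OF e2_deriv_0, of 2] DERIV_cmult[OF this, of 12]]
  show ?thesis unfolding e4_def[abs_def] by (rule DERIV_cong) simp
qed

lemma e6_deriv_0: "(e6 has_field_derivative - 504) (at 0)"
proof -
  have "((\<lambda>q. q * deriv e4 q) has_field_derivative 240) (at 0)"
    using deriv_times_id_0[OF e_holomorphic(2)] DERIV_imp_deriv[OF e4_deriv_0] by simp
  from DERIV_diff[OF DERIV_mult[OF e2_deriv_0 e4_deriv_0] DERIV_cmult[OF this, of 3]]
  show ?thesis unfolding e6_def[abs_def] by (rule DERIV_cong) simp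
qed

lemma E2_eq: "E2 \<tau> = e2 (nome \<tau>)" by (simp add: E2_def e2_def)

lemma nome_compose_deriv:
  assumes "g holomorphic_on ball 0 1" "Im \<tau> > 0"
  shows "((\<lambda>\<tau>. g (nome \<tau>)) has_field_derivative 2 * of_real pi * \<i> * (nome \<tau> * deriv g (nome \<tau>))) (at \<tau>)"
proof -
  have "(g has_field_derivative deriv g (nome \<tau>)) (at (nome \<tau>))"
    by (rule holomorphic_derivI[OF assms(1) open_ball])
       (simp only: mem_ball dist_0_norm norm_nome_less_1[OF assms(2)])
  from DERIV_chain2[OF this nome_deriv] show ?thesis by (simp only: mult_ac)
qed

lemma deriv_inversion:
  assumes F: "\<And>\<tau>. Im \<tau> > 0 \<Longrightarrow> (F has_field_derivative 2 * of_real pi * \<i> * F' \<tau>) (at \<tau>)"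
    and S: "\<And>\<tau>. Im \<tau> > 0 \<Longrightarrow> F (- 1 / \<tau>) = H \<tau>"
    and H: "(H has_field_derivative 2 * of_real pi * \<i> * d) (at \<tau>)" and \<tau>: "Im \<tau> > 0"
  shows "F' (- 1 / \<tau>) = \<tau> ^ 2 * d"
proof -
  have t0: "\<tau> \<noteq> 0" using \<tau> by auto
  have 1: "((\<lambda>\<tau>. - 1 / \<tau>) has_field_derivative 1 / \<tau> ^ 2) (at \<tau>)"
    using t0 by (auto intro!: derivative_eq_intros simp: power2_eq_square)
  have "((\<lambda>\<tau>. F (- 1 / \<tau>)) has_field_derivative 2 * of_real pi * \<i> * F' (- 1 / \<tau>) * (1 / \<tau> ^ 2)) (at \<tau>)"
    by (rule DERIV_chain2[OF F[OF Im_inversion[OF \<tau>]] 1])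
  moreover have "((\<lambda>\<tau>. F (- 1 / \<tau>)) has_field_derivative 2 * of_real pi * \<i> * d) (at \<tau>)"
    by (rule has_field_derivative_transform_within_open[OF H open_uhp]) (use S \<tau> in auto)
  ultimately have "2 * of_real pi * \<i> * F' (- 1 / \<tau>) * (1 / \<tau> ^ 2) = 2 * of_real pi * \<i> * d"
    by (rule DERIV_unique)
  thus ?thesis using t0 by (simp add: field_simps)
qed

text \<open>The Serre derivative raises the weight by 2: the term from differentiating the power of
  \<tau> cancels against the extra term of E2. The weight is written \<open>Suc k\<close> because
  the exponent k appears after differentiation.\<close>

lemma serre_derivative_inversion:
  assumes F: "\<And>\<tau>. Im \<tau> > 0 \<Longrightarrow> (F has_field_derivative 2 * of_real pi * \<i> * F' \<tau>) (at \<tau>)"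
    and S: "\<And>\<tau>. Im \<tau> > 0 \<Longrightarrow> F (- 1 / \<tau>) = \<tau> ^ Suc k * F \<tau>" and \<tau>: "Im \<tau> > 0"
  shows "F' (- 1 / \<tau>) - of_nat (Suc k) / 12 * E2 (- 1 / \<tau>) * F (- 1 / \<tau>)
     = \<tau> ^ (k + 3) * (F' \<tau> - of_nat (Suc k) / 12 * E2 \<tau> * F \<tau>)"
proof -
  let ?c = "2 * of_real pi * \<i>"
  have "((\<lambda>\<tau>. \<tau> ^ Suc k * F \<tau>) has_field_derivative
      of_nat (Suc k) * (1 * \<tau> ^ (Suc k - Suc 0)) * F \<tau> + ?c * F' \<tau> * \<tau> ^ Suc k) (at \<tau>)"
    by (rule DERIV_mult[OF DERIV_power[OF DERIV_ident, of "Suc k" \<tau>] F[OF \<tau>]])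
  also have "of_nat (Suc k) * (1 * \<tau> ^ (Suc k - Suc 0)) * F \<tau> + ?c * F' \<tau> * \<tau> ^ Suc k =
     ?c * (\<tau> ^ Suc k * F' \<tau> + of_nat (Suc k) * \<tau> ^ k * F \<tau> / ?c)"
    by (simp add: distrib_left mult_ac del: of_nat_Suc power_Suc)
  finally have "F' (- 1 / \<tau>) = \<tau> ^ 2 * (\<tau> ^ Suc k * F' \<tau> + of_nat (Suc k) * \<tau> ^ k * F \<tau> / ?c)"
    using deriv_inversion[OF F S _ \<tau>] by blast
  also have "\<dots> = \<tau> ^ (k + 3) * F' \<tau> + of_nat (Suc k) * \<tau> ^ (k + 2) * F \<tau> / ?c"
    by (simp add: distrib_left power_add eval_nat_numeral mult_ac del: of_nat_Suc)
  finally have 1: "F' (- 1 / \<tau>) = \<tau> ^ (k + 3) * F' \<tau> + of_nat (Suc k) * \<tau> ^ (k + 2) * F \<tau> / ?c" .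
  have "1 / ?c = - (\<i> / (2 * of_real pi))"
    by (simp add: divide_simps)
  hence 2: "x / ?c = - (x * \<i> / (2 * of_real pi))" for x
    by (metis (no_types, opaque_lifting) mult.right_neutral mult_minus_right times_divide_eq_right)
  show ?thesis
    unfolding 1 2 E2_inversion[OF \<tau>] S[OF \<tau>]
    by (simp add: algebra_simps power_add eval_nat_numeral del: of_nat_Suc)
qed

text \<open>The analogue for E2 itself: in E2^2 - 12 D E2, with D = q d/dq, the extra terms cancel,
  both those linear and those quadratic in u = \<i>/pi.\<close>

lemma E2_Riccati_inversion:
  assumes \<tau>: "Im \<tau> > 0"
  shows "e4 (nome (- 1 / \<tau>)) = \<tau> ^ 4 * e4 (nome \<tau>)"
proof -
  define D where "D = (\<lambda>\<tau>. nome \<tau> * deriv e2 (nome \<tau>))"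
  have E2: "(E2 has_field_derivative 2 * of_real pi * \<i> * D \<tau>) (at \<tau>)" if "Im \<tau> > 0" for \<tau>
    using nome_compose_deriv[OF e_holomorphic(1) that] by (simp add: D_def E2_eq[abs_def])
  let ?c = "2 * of_real pi * \<i>"
  define u :: complex where "u = \<i> / of_real pi"
  have "((\<lambda>\<tau>. \<tau> ^ 2 * E2 \<tau> - 6 * \<i> * \<tau> / of_real pi) has_field_derivative
     2 * \<tau> * E2 \<tau> + \<tau> ^ 2 * (?c * D \<tau>) - 6 * \<i> / of_real pi) (at \<tau>)"
    by (auto intro!: derivative_eq_intros E2[OF \<tau>])
  also have "2 * \<tau> * E2 \<tau> + \<tau> ^ 2 * (?c * D \<tau>) - 6 * \<i> / of_real pi =
     ?c * (\<tau> ^ 2 * D \<tau> - u * \<tau> * E2 \<tau> + 3 * u ^ 2)"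
    by (simp add: u_def field_simps power2_eq_square)
  finally have D: "D (- 1 / \<tau>) = \<tau> ^ 2 * (\<tau> ^ 2 * D \<tau> - u * \<tau> * E2 \<tau> + 3 * u ^ 2)"
    using deriv_inversion[OF E2 E2_inversion _ \<tau>] by blast
  have "E2 (- 1 / \<tau>) = \<tau> ^ 2 * E2 \<tau> - 6 * u * \<tau>"
    unfolding E2_inversion[OF \<tau>] u_def by simp
  hence "E2 (- 1 / \<tau>) ^ 2 - 12 * D (- 1 / \<tau>) = \<tau> ^ 4 * (E2 \<tau> ^ 2 - 12 * D \<tau>)"
    unfolding D by (simp only:) (simp add: algebra_simps power2_eq_square eval_nat_numeral)
  thus ?thesis by (simp add: e4_def D_def E2_eq)
qed

text \<open>Both sides have weight 4 and limit 1 at the cusp, so their difference is a cusp form of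
  weight 4.\<close>

lemma E4_eq:
  assumes "Im \<tau> > 0"
  shows "E4 \<tau> = e4 (nome \<tau>)"
proof -
  have "E4 \<tau> - e4 (nome \<tau>) = 0"
  proof (rule cusp_form_zero[where f = "\<lambda>\<tau>. E4 \<tau> - e4 (nome \<tau>)" and k = 4 and r = 3 and s = 1])
    show "(\<lambda>\<tau>. E4 \<tau> - e4 (nome \<tau>)) holomorphic_on uhp"
      by (intro holomorphic_intros E4_holomorphic holomorphic_nome_compose e_holomorphic)
    show "((\<lambda>\<tau>. E4 \<tau> - e4 (nome \<tau>)) \<longlongrightarrow> 0) cusp"
      using tendsto_diff[OF E4_tendsto tendsto_hol_nome[OF e_holomorphic(2)]] by simp
    fix \<tau> assume \<tau>: "Im \<tau> > 0"
    show "E4 (\<tau> + 1) - e4 (nome (\<tau> + 1)) = E4 \<tau> - e4 (nome \<tau>)"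
      unfolding E4_plus_1[OF \<tau>] nome_plus_1 ..
    show "E4 (- 1 / \<tau>) - e4 (nome (- 1 / \<tau>)) = \<tau> ^ 4 * (E4 \<tau> - e4 (nome \<tau>))"
      unfolding E4_inversion[OF \<tau>] E2_Riccati_inversion[OF \<tau>] right_diff_distrib ..
  qed (use assms in auto)
  thus ?thesis by simp
qed

lemma E4_deriv_q:
  assumes "Im \<tau> > 0"
  shows "(E4 has_field_derivative 2 * of_real pi * \<i> * (nome \<tau> * deriv e4 (nome \<tau>))) (at \<tau>)"
  by (rule has_field_derivative_transform_within_open[OF nome_compose_deriv[OF e_holomorphic(2) assms] open_uhp])
     (use assms E4_eq in auto)

lemma E6_eq:
  assumes "Im \<tau> > 0"
  shows "E6 \<tau> = e6 (nome \<tau>)"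
proof -
  have inv: "e6 (nome (- 1 / \<tau>)) = \<tau> ^ 6 * e6 (nome \<tau>)" if "Im \<tau> > 0" for \<tau>
  proof -
    \<comment> \<open>This exhibits \<open>e6\<close> as -3 times the Serre derivative of E4, hence
      as a form of weight 6.\<close>
    have e: "e6 (nome \<tau>) = - 3 * (nome \<tau> * deriv e4 (nome \<tau>) - of_nat (Suc 3) / 12 * E2 \<tau> * E4 \<tau>)" if "Im \<tau> > 0" for \<tau>
      unfolding e6_def E2_eq E4_eq[OF that] by (simp add: algebra_simps)
    have "nome (- 1 / \<tau>) * deriv e4 (nome (- 1 / \<tau>)) - of_nat (Suc 3) / 12 * E2 (- 1 / \<tau>) * E4 (- 1 / \<tau>)
      = \<tau> ^ (3 + 3) * (nome \<tau> * deriv e4 (nome \<tau>) - of_nat (Suc 3) / 12 * E2 \<tau> * E4 \<tau>)"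
      by (rule serre_derivative_inversion[OF E4_deriv_q _ that]) (use E4_inversion in auto)
    thus ?thesis unfolding e[OF that] e[OF Im_inversion[OF that]] by (simp only: mult.left_commute[of "-3"]) simp
  qed
  have "E6 \<tau> - e6 (nome \<tau>) = 0"
  proof (rule cusp_form_zero[where f = "\<lambda>\<tau>. E6 \<tau> - e6 (nome \<tau>)" and k = 6 and r = 4 and s = 2])
    show "(\<lambda>\<tau>. E6 \<tau> - e6 (nome \<tau>)) holomorphic_on uhp"
      by (intro holomorphic_intros E6_holomorphic holomorphic_nome_compose e_holomorphic)
    show "((\<lambda>\<tau>. E6 \<tau> - e6 (nome \<tau>)) \<longlongrightarrow> 0) cusp"
      using tendsto_diff[OF E6_tendsto tendsto_hol_nome[OF e_holomorphic(3)]] by simp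
    fix \<tau> assume \<tau>: "Im \<tau> > 0"
    show "E6 (\<tau> + 1) - e6 (nome (\<tau> + 1)) = E6 \<tau> - e6 (nome \<tau>)"
      unfolding E6_plus_1[OF \<tau>] nome_plus_1 ..
    show "E6 (- 1 / \<tau>) - e6 (nome (- 1 / \<tau>)) = \<tau> ^ 6 * (E6 \<tau> - e6 (nome \<tau>))"
      unfolding E6_inversion[OF \<tau>] inv[OF \<tau>] right_diff_distrib ..
  qed (use assms in auto)
  thus ?thesis by simp
qed

lemma E6_deriv_q:
  assumes "Im \<tau> > 0"
  shows "(E6 has_field_derivative 2 * of_real pi * \<i> * (nome \<tau> * deriv e6 (nome \<tau>))) (at \<tau>)"
  by (rule has_field_derivative_transform_within_open[OF nome_compose_deriv[OF e_holomorphic(3) assms] open_uhp])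
     (use assms E6_eq in auto)

text \<open>The third equation is not a definition: the Serre derivative of E6 plus E4^2 / 2 is a
  form of weight 8 with constant term -1/2 + 1/2 = 0.\<close>

lemma E6_Ramanujan:
  assumes "Im \<tau> > 0"
  shows "nome \<tau> * deriv e6 (nome \<tau>) = (E2 \<tau> * E6 \<tau> - E4 \<tau> ^ 2) / 2"
proof -
  define R where "R = (\<lambda>\<tau>. nome \<tau> * deriv e6 (nome \<tau>) - of_nat (Suc 5) / 12 * E2 \<tau> * E6 \<tau> + E4 \<tau> ^ 2 / 2)"
  define r where "r = (\<lambda>q. q * deriv e6 q - 1 / 2 * e2 q * e6 q + e4 q ^ 2 / 2)"
  have rR: "R \<tau> = r (nome \<tau>)" if "Im \<tau> > 0" for \<tau>
    using that by (simp add: R_def r_def E4_eq E6_eq E2_eq)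
  have rh: "r holomorphic_on ball 0 1"
    unfolding r_def by (intro holomorphic_intros holomorphic_deriv e_holomorphic open_ball) auto
  have inv: "R (- 1 / \<tau>) = \<tau> ^ 8 * R \<tau>" if "Im \<tau> > 0" for \<tau>
  proof -
    have "nome (- 1 / \<tau>) * deriv e6 (nome (- 1 / \<tau>)) - of_nat (Suc 5) / 12 * E2 (- 1 / \<tau>) * E6 (- 1 / \<tau>)
      = \<tau> ^ (5 + 3) * (nome \<tau> * deriv e6 (nome \<tau>) - of_nat (Suc 5) / 12 * E2 \<tau> * E6 \<tau>)"
      by (rule serre_derivative_inversion[OF E6_deriv_q _ that]) (use E6_inversion in auto)
    moreover have "E4 (- 1 / \<tau>) ^ 2 = \<tau> ^ 8 * E4 \<tau> ^ 2"
      unfolding E4_inversion[OF that] by (simp add: power_mult_distrib flip: power_mult)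
    ultimately show ?thesis unfolding R_def by (simp only: distrib_left) simp
  qed
  have "R \<tau> = 0"
  proof (rule cusp_form_zero[where f = R and k = 8 and r = 3 and s = 2])
    have "(\<lambda>\<tau>. r (nome \<tau>)) holomorphic_on uhp" by (rule holomorphic_nome_compose[OF rh])
    thus "R holomorphic_on uhp" by (rule holomorphic_transform) (simp add: rR)
    have "((\<lambda>\<tau>. r (nome \<tau>)) \<longlongrightarrow> 0) cusp"
      using tendsto_hol_nome[OF rh] by (simp add: r_def)
    thus "(R \<longlongrightarrow> 0) cusp"
      by (rule Lim_transform_eventually) (use rR in \<open>auto intro!: eventually_mono[OF eventually_cusp_uhp[of 0]]\<close>)
    show "R (\<tau> + 1) = R \<tau>" if "Im \<tau> > 0" for \<tau>
      using that by (simp only: rR nome_plus_1) (simp add: rR nome_plus_1)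
  qed (use assms inv in auto)
  thus ?thesis unfolding R_def by (simp add: field_simps)
qed

lemma E4_Ramanujan:
  assumes "Im \<tau> > 0"
  shows "nome \<tau> * deriv e4 (nome \<tau>) = (E2 \<tau> * E4 \<tau> - E6 \<tau>) / 3"
  using assms by (simp add: E2_eq E4_eq E6_eq e6_def)

lemma E2_Ramanujan:
  assumes "Im \<tau> > 0"
  shows "nome \<tau> * deriv e2 (nome \<tau>) = (E2 \<tau> ^ 2 - E4 \<tau>) / 12"
  using assms by (simp add: E2_eq E4_eq e4_def)

lemma Delta_holomorphic: "Delta holomorphic_on uhp"
  unfolding holomorphic_on_def field_differentiable_def using Delta_deriv has_field_derivative_at_within by blast

lemma Delta_plus_1: "Delta (\<tau> + 1) = Delta \<tau>" by (simp only: Delta_def nome_plus_1)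

text \<open>The quotient (E4^3 - E6^2) / Delta is invariant, and its value at the cusp is the linear
  coefficient 3 * 240 + 2 * 504 = 1728 of the numerator.\<close>

theorem discriminant_eq:
  assumes \<tau>: "Im \<tau> > 0"
  shows "E4 \<tau> ^ 3 - E6 \<tau> ^ 2 = 1728 * Delta \<tau>"
proof -
  define d where "d = (\<lambda>q. e4 q ^ 3 - e6 q ^ 2)"
  have dh: "d holomorphic_on ball 0 1" unfolding d_def by (intro holomorphic_intros e_holomorphic)
  have "(d has_field_derivative 1728) (at 0)"
    unfolding d_def by (auto intro!: derivative_eq_intros e4_deriv_0 e6_deriv_0)
  hence d1: "deriv d 0 = 1728" by (rule DERIV_imp_deriv)
  have "d 0 = 0" by (simp add: d_def)
  from holomorphic_factor_zero[OF dh this]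
  obtain h where h: "h holomorphic_on ball 0 1" "\<And>q. d q = q * h q" "h 0 = 1728"
    unfolding d1 by blast
  define g where "g = (\<lambda>\<tau>. (E4 \<tau> ^ 3 - E6 \<tau> ^ 2) / Delta \<tau> - 1728)"
  have gq: "g \<tau> = h (nome \<tau>) / euler_prod (nome \<tau>) ^ 24 - 1728" if "Im \<tau> > 0" for \<tau>
    using h(2)[of "nome \<tau>"] that by (simp add: g_def Delta_def E4_eq E6_eq d_def)
  have "g \<tau> = 0"
  proof (rule modular_function_zero[OF _ _ _ _ \<tau>])
    show "g holomorphic_on uhp" unfolding g_def
      by (intro holomorphic_intros E4_holomorphic E6_holomorphic Delta_holomorphic) (use Delta_nonzero in auto)
    fix \<tau> assume \<tau>: "Im \<tau> > 0"
    show "g (\<tau> + 1) = g \<tau>" using \<tau> by (simp add: g_def E4_plus_1 E6_plus_1 Delta_plus_1)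
    have "\<tau> \<noteq> 0" using \<tau> by auto
    have "(\<tau> ^ 4 * E4 \<tau>) ^ 3 - (\<tau> ^ 6 * E6 \<tau>) ^ 2 = \<tau> ^ 12 * (E4 \<tau> ^ 3 - E6 \<tau> ^ 2)"
      by (simp add: power_mult_distrib right_diff_distrib flip: power_mult)
    thus "g (- 1 / \<tau>) = g \<tau>" unfolding g_def E4_inversion[OF \<tau>] E6_inversion[OF \<tau>] Delta_inversion[OF \<tau>]
      using \<open>\<tau> \<noteq> 0\<close> by simp
  next
    have "(\<lambda>q. h q / euler_prod q ^ 24 - 1728) holomorphic_on ball 0 1"
      by (intro holomorphic_intros h euler_prod_holomorphic) (auto simp: euler_prod_nonzero)
    from tendsto_hol_nome[OF this]
    have "((\<lambda>\<tau>. h (nome \<tau>) / euler_prod (nome \<tau>) ^ 24 - 1728) \<longlongrightarrow> 0) cusp" by (simp add: h(3))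
    thus "(g \<longlongrightarrow> 0) cusp"
      by (rule Lim_transform_eventually) (use gq in \<open>auto intro!: eventually_mono[OF eventually_cusp_uhp[of 0]]\<close>)
  qed
  thus ?thesis using Delta_nonzero[OF \<tau>] by (simp add: g_def field_simps)
qed

lemma modular_j_eq: "Im \<tau> > 0 \<Longrightarrow> modular_j \<tau> = E4 \<tau> ^ 3 / Delta \<tau>"
  by (simp add: modular_j_E discriminant_eq)

lemma modular_j_1728: "Im \<tau> > 0 \<Longrightarrow> modular_j \<tau> - 1728 = E6 \<tau> ^ 2 / Delta \<tau>"
  using discriminant_eq[of \<tau>] Delta_nonzero[of \<tau>] by (simp add: modular_j_eq field_simps)

lemma modular_j_plus_1: "Im \<tau> > 0 \<Longrightarrow> modular_j (\<tau> + 1) = modular_j \<tau>"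
  by (simp add: modular_j_eq E4_plus_1 Delta_plus_1)

lemma modular_j_inversion: "Im \<tau> > 0 \<Longrightarrow> modular_j (- 1 / \<tau>) = modular_j \<tau>"
proof -
  assume \<tau>: "Im \<tau> > 0"
  hence "\<tau> \<noteq> 0" by auto
  have "(\<tau> ^ 4 * E4 \<tau>) ^ 3 = \<tau> ^ 12 * E4 \<tau> ^ 3" by (simp add: power_mult_distrib flip: power_mult)
  thus ?thesis using \<tau> \<open>\<tau> \<noteq> 0\<close>
    unfolding modular_j_eq[OF \<tau>] modular_j_eq[OF Im_inversion[OF \<tau>]] E4_inversion[OF \<tau>] Delta_inversion[OF \<tau>] by simp
qed

lemma modular_j_holomorphic: "modular_j holomorphic_on uhp"
proof -
  have "(\<lambda>\<tau>. E4 \<tau> ^ 3 / Delta \<tau>) holomorphic_on uhp"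
    by (intro holomorphic_intros E4_holomorphic Delta_holomorphic) (use Delta_nonzero in auto)
  thus ?thesis by (rule holomorphic_transform) (simp add: modular_j_eq)
qed

lemma E4_deriv:
  "Im \<tau> > 0 \<Longrightarrow> (E4 has_field_derivative 2 * of_real pi * \<i> * ((E2 \<tau> * E4 \<tau> - E6 \<tau>) / 3)) (at \<tau>)"
  using E4_deriv_q by (simp only: E4_Ramanujan)

lemma E6_deriv:
  "Im \<tau> > 0 \<Longrightarrow> (E6 has_field_derivative 2 * of_real pi * \<i> * ((E2 \<tau> * E6 \<tau> - E4 \<tau> ^ 2) / 2)) (at \<tau>)"
  using E6_deriv_q by (simp only: E6_Ramanujan)

lemma E2_deriv:
  assumes "Im \<tau> > 0"
  shows "(E2 has_field_derivative 2 * of_real pi * \<i> * ((E2 \<tau> ^ 2 - E4 \<tau>) / 12)) (at \<tau>)"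
  using nome_compose_deriv[OF e_holomorphic(1) assms] unfolding E2_Ramanujan[OF assms] E2_eq[abs_def, symmetric] .

lemma modular_j_deriv:
  assumes \<tau>: "Im \<tau> > 0"
  shows "(modular_j has_field_derivative - 2 * of_real pi * \<i> * (E4 \<tau> ^ 2 * E6 \<tau> / Delta \<tau>)) (at \<tau>)"
proof -
  let ?c = "2 * of_real pi * \<i>"
  note nz = Delta_nonzero[OF \<tau>]
  have 1: "((\<lambda>\<tau>. E4 \<tau> ^ 3) has_field_derivative ?c * (E4 \<tau> ^ 2 * (E2 \<tau> * E4 \<tau> - E6 \<tau>))) (at \<tau>)"
    by (auto intro!: derivative_eq_intros E4_deriv[OF \<tau>])
  have "((\<lambda>\<tau>. E4 \<tau> ^ 3 / Delta \<tau>) has_field_derivative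
     (?c * (E4 \<tau> ^ 2 * (E2 \<tau> * E4 \<tau> - E6 \<tau>)) * Delta \<tau> - E4 \<tau> ^ 3 * (?c * (E2 \<tau> * Delta \<tau>))) / (Delta \<tau> * Delta \<tau>)) (at \<tau>)"
    by (rule DERIV_divide[OF 1 Delta_deriv[OF \<tau>] nz])
  also have "?c * (E4 \<tau> ^ 2 * (E2 \<tau> * E4 \<tau> - E6 \<tau>)) * Delta \<tau> - E4 \<tau> ^ 3 * (?c * (E2 \<tau> * Delta \<tau>)) =
     (- ?c * (E4 \<tau> ^ 2 * E6 \<tau>)) * Delta \<tau>"
    by (simp add: algebra_simps power2_eq_square power3_eq_cube)
  finally have "((\<lambda>\<tau>. E4 \<tau> ^ 3 / Delta \<tau>) has_field_derivative - ?c * (E4 \<tau> ^ 2 * E6 \<tau> / Delta \<tau>)) (at \<tau>)"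
    using nz by simp
  hence "(modular_j has_field_derivative - ?c * (E4 \<tau> ^ 2 * E6 \<tau> / Delta \<tau>)) (at \<tau>)"
    by (rule has_field_derivative_transform_within_open[OF _ open_uhp]) (use \<tau> modular_j_eq in auto)
  thus ?thesis by simp
qed

section \<open>The hypergeometric function and E4\<close>

definition hyp_fps :: "complex fps" where "hyp_fps = fps_hypergeo [1/12, 5/12] [1] 1"

lemma hyp_fps_rec:
  "of_nat (Suc n) ^ 2 * hyp_fps $ Suc n = (of_nat n + 1/12) * (of_nat n + 5/12) * hyp_fps $ n"
proof -
  have f: "(fact (Suc n) :: complex) = of_nat (Suc n) * fact n" by simp
  have h: "hyp_fps $ m = pochhammer (1/12) m * pochhammer (5/12) m / (fact m * fact m)" for m
    by (simp add: hyp_fps_def pochhammer_fact[symmetric])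
  have "of_nat (Suc n) ^ 2 * (p * a * (r * b) / (of_nat (Suc n) * f * (of_nat (Suc n) * f))) = a * b * (p * r / (f * f))"
    for p r a b f :: complex
    by (cases "f = 0") (simp_all add: divide_simps power2_eq_square del: of_nat_Suc)
  thus ?thesis unfolding h pochhammer_Suc f by (simp only: add.commute)
qed

text \<open>The ratio (n + 1/12)(n + 5/12) / (n + 1)^2 of consecutive coefficients is at most
  1.\<close>

lemma hyp_fps_bound: "norm (hyp_fps $ n) \<le> 1"
proof (induction n)
  case 0
  show ?case by (simp add: hyp_fps_def)
next
  case (Suc n)
  have a: "norm (of_nat n + 1/12 :: complex) \<le> of_nat (Suc n)" "norm (of_nat n + 5/12 :: complex) \<le> of_nat (Suc n)"
    by (rule order_trans[OF norm_triangle_ineq]; simp)+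
  have "real (Suc n) ^ 2 * norm (hyp_fps $ Suc n) = norm (of_nat (Suc n) ^ 2 * hyp_fps $ Suc n)"
    unfolding norm_mult norm_power norm_of_nat ..
  also have "\<dots> = norm (of_nat n + 1/12 :: complex) * norm (of_nat n + 5/12 :: complex) * norm (hyp_fps $ n)"
    unfolding hyp_fps_rec norm_mult ..
  also have "\<dots> \<le> real (Suc n) * real (Suc n) * 1"
    using a Suc by (intro mult_mono) auto
  finally have "real (Suc n) ^ 2 * norm (hyp_fps $ Suc n) \<le> real (Suc n) ^ 2 * 1" by (simp add: power2_eq_square)
  thus ?case by (subst (asm) mult_le_cancel_left_pos) auto
qed

lemma hyp_conv_radius: "fps_conv_radius hyp_fps \<ge> 1"
  unfolding fps_conv_radius_def
proof (rule conv_radius_geI_ex')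
  fix r :: real assume r: "0 < r" "ereal r < 1"
  show "summable (\<lambda>n. hyp_fps $ n * of_real r ^ n)"
  proof (rule summable_comparison_test')
    show "summable (\<lambda>n. r ^ n)" using r by (simp add: summable_geometric)
    show "norm (hyp_fps $ n * of_real r ^ n) \<le> r ^ n" for n
      using mult_right_mono[OF hyp_fps_bound[of n], of "r ^ n"] r by (simp add: norm_mult norm_power)
  qed
qed

definition hyp0 :: "complex \<Rightarrow> complex" where "hyp0 = eval_fps hyp_fps"
definition hyp1 :: "complex \<Rightarrow> complex" where "hyp1 = eval_fps (fps_deriv hyp_fps)"
definition hyp2 :: "complex \<Rightarrow> complex" where "hyp2 = eval_fps (fps_deriv (fps_deriv hyp_fps))"

lemma h1_hat_eq: "h1_hat = hyp0"
  by (simp add: fun_eq_iff h1_hat_def hyp2F1_def hyp0_def hyp_fps_def)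

lemma hyp_conv_radius_deriv: "fps_conv_radius (fps_deriv hyp_fps) \<ge> 1" "fps_conv_radius (fps_deriv (fps_deriv hyp_fps)) \<ge> 1"
  using hyp_conv_radius fps_conv_radius_deriv[of hyp_fps] fps_conv_radius_deriv[of "fps_deriv hyp_fps"] order_trans by blast+

lemma less_conv_radius: "norm (x::complex) < 1 \<Longrightarrow> R \<ge> 1 \<Longrightarrow> ereal (norm x) < R"
  by (metis ereal_less(3) less_le_trans one_ereal_def ereal_less_eq(3) not_le)

lemma hyp_derivs:
  assumes "norm x < 1"
  shows "(hyp0 has_field_derivative hyp1 x) (at x)" "(hyp1 has_field_derivative hyp2 x) (at x)"
  unfolding hyp0_def hyp1_def hyp2_def
  by (intro has_field_derivative_eval_fps less_conv_radius assms hyp_conv_radius hyp_conv_radius_deriv)+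

text \<open>Coefficientwise this is \<open>hyp_fps_rec\<close>; the constants are 5/144 = 1/12 *
  5/12 and 3/2 = 1 + 1/12 + 5/12.\<close>

lemma hyp_ode:
  assumes "norm x < 1"
  shows "x * (1 - x) * hyp2 x = 5/144 * hyp0 x - (1 - 3/2 * x) * hyp1 x"
proof -
  let ?F = hyp_fps and ?F1 = "fps_deriv hyp_fps" and ?F2 = "fps_deriv (fps_deriv hyp_fps)"
  let ?S = "\<lambda>f. (\<lambda>n. f $ n * x ^ n)"
  have F: "?S ?F sums hyp0 x" "?S ?F1 sums hyp1 x" "?S ?F2 sums hyp2 x"
    unfolding hyp0_def hyp1_def hyp2_def
    by (intro sums_eval_fps less_conv_radius assms hyp_conv_radius hyp_conv_radius_deriv)+
  have X: "?S (fps_X * f) sums (x * s)" if "?S f sums s" for f :: "complex fps" and s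
  proof -
    have "(\<lambda>n. (fps_X * f) $ Suc n * x ^ Suc n) sums (x * s)"
      using sums_mult[OF that, of x] by (simp add: mult_ac)
    thus ?thesis by (subst (asm) sums_Suc_iff) simp
  qed
  have "(\<lambda>n. (fps_X * ?F2) $ n * x ^ n - (fps_X * (fps_X * ?F2)) $ n * x ^ n + ?F1 $ n * x ^ n
      - 3/2 * ((fps_X * ?F1) $ n * x ^ n) - 5/144 * (?F $ n * x ^ n)) sums
      (x * hyp2 x - x * (x * hyp2 x) + hyp1 x - 3/2 * (x * hyp1 x) - 5/144 * hyp0 x)"
    by (intro sums_diff sums_add sums_mult X F)
  moreover have "(fps_X * ?F2) $ n * x ^ n - (fps_X * (fps_X * ?F2)) $ n * x ^ n + ?F1 $ n * x ^ n
      - 3/2 * ((fps_X * ?F1) $ n * x ^ n) - 5/144 * (?F $ n * x ^ n) = 0" for n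
  proof -
    have a: "(fps_X * ?F2) $ n = of_nat n * of_nat (Suc n) * ?F $ Suc n"
      by (cases n) (simp_all add: algebra_simps)
    have b: "(fps_X * (fps_X * ?F2)) $ n = of_nat n * (of_nat n - 1) * ?F $ n"
    proof (cases n)
      case (Suc m)
      thus ?thesis by (cases m) (simp_all add: algebra_simps)
    qed simp
    have c: "?F1 $ n = of_nat (Suc n) * ?F $ Suc n" by simp
    have d: "(fps_X * ?F1) $ n = of_nat n * ?F $ n" by (cases n) simp_all
    have "of_nat n * of_nat (Suc n) * ?F $ Suc n + of_nat (Suc n) * ?F $ Suc n = of_nat (Suc n) ^ 2 * ?F $ Suc n"
      by (simp add: algebra_simps power2_eq_square)
    hence e: "of_nat n * of_nat (Suc n) * ?F $ Suc n + of_nat (Suc n) * ?F $ Suc n = (of_nat n + 1/12) * (of_nat n + 5/12) * ?F $ n"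
      unfolding hyp_fps_rec .
    have "(of_nat n * of_nat (Suc n) * ?F $ Suc n - of_nat n * (of_nat n - 1) * ?F $ n + of_nat (Suc n) * ?F $ Suc n
      - 3/2 * (of_nat n * ?F $ n) - 5/144 * ?F $ n) =
      (of_nat n * of_nat (Suc n) * ?F $ Suc n + of_nat (Suc n) * ?F $ Suc n) - (of_nat n * (of_nat n - 1) + 3/2 * of_nat n + 5/144) * ?F $ n"
      by (simp add: algebra_simps)
    also have "\<dots> = 0" unfolding e by (simp add: field_simps)
    finally have "(of_nat n * of_nat (Suc n) * ?F $ Suc n - of_nat n * (of_nat n - 1) * ?F $ n + of_nat (Suc n) * ?F $ Suc n
      - 3/2 * (of_nat n * ?F $ n) - 5/144 * ?F $ n) * x ^ n = 0" by simp
    thus ?thesis unfolding a b c d by (simp only: left_diff_distrib distrib_right mult.assoc)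
  qed
  ultimately have "x * hyp2 x - x * (x * hyp2 x) + hyp1 x - 3/2 * (x * hyp1 x) - 5/144 * hyp0 x = 0"
    using sums_unique2 sums_zero by (simp only:)
  thus ?thesis by (simp add: algebra_simps)
qed

lemma hyp0_0: "hyp0 0 = 1"
  by (simp add: hyp0_def eval_fps_at_0 hyp_fps_def)

text \<open>Both \<open>h1_hat (1728 / j)\<close> and \<open>E4 powr (1/4)\<close> solve the hypergeometric equation in \<open>1728 / j\<close>,
  a second solution being \<open>\<tau>\<close> times the latter; hence their quotient is affine in \<open>\<tau>\<close>, and
  constant because it converges at the cusp.\<close>

theorem h1_hat_modular_j:
  "eventually (\<lambda>\<tau>. h1_hat (1728 / modular_j \<tau>) ^ 4 = E4 \<tau>) cusp"
proof -
  let ?c = "2 * of_real pi * \<i>"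
  define x where "x = (\<lambda>\<tau>. 1728 * Delta \<tau> / E4 \<tau> ^ 3)"
  have Dl: "(Delta \<longlongrightarrow> 0) cusp"
  proof -
    have "(\<lambda>q. q * euler_prod q ^ 24) holomorphic_on ball 0 1" by (intro holomorphic_intros euler_prod_holomorphic)
    from tendsto_hol_nome[OF this] show ?thesis by (simp add: Delta_def[abs_def])
  qed
  have xl: "(x \<longlongrightarrow> 0) cusp"
    unfolding x_def using tendsto_divide[OF tendsto_mult[OF tendsto_const Dl] tendsto_power[OF E4_tendsto, of 3], of 1728] by simp
  have "eventually (\<lambda>\<tau>. norm (x \<tau>) < 1 \<and> norm (E4 \<tau> - 1) < 1 \<and> Im \<tau> > 0) cusp"
    using tendstoD[OF xl, of 1] tendstoD[OF E4_tendsto, of 1] eventually_cusp_uhp[of 0]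
    by (simp add: dist_norm eventually_conj_iff)
  then obtain Y where Y: "\<And>\<tau>. Im \<tau> > Y \<Longrightarrow> norm (x \<tau>) < 1 \<and> norm (E4 \<tau> - 1) < 1 \<and> Im \<tau> > 0"
    unfolding eventually_cusp by blast
  define U where "U = {\<tau>. Im \<tau> > Y}"
  have U: "open U" "convex U" unfolding U_def by (auto simp: open_halfspace_Im_gt convex_halfspace_Im_gt)
  have Up: "norm (x \<tau>) < 1" "E4 \<tau> \<noteq> 0" "E4 \<tau> \<notin> \<real>\<^sub>\<le>\<^sub>0" "Im \<tau> > 0" if "\<tau> \<in> U" for \<tau>
  proof -
    have Y': "norm (x \<tau>) < 1" "norm (E4 \<tau> - 1) < 1" "Im \<tau> > 0" using Y that unfolding U_def by auto
    \<comment> \<open>Near the cusp E4 stays in the right half plane, where Ln and with it the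
      fourth root \<open>y\<close> are holomorphic.\<close>
    have "\<bar>Re (E4 \<tau> - 1)\<bar> < 1" using abs_Re_le_cmod[of "E4 \<tau> - 1"] Y'(2) by linarith
    hence "Re (E4 \<tau>) > 0" by simp
    thus "norm (x \<tau>) < 1" "E4 \<tau> \<noteq> 0" "E4 \<tau> \<notin> \<real>\<^sub>\<le>\<^sub>0" "Im \<tau> > 0" using Y' by (auto simp: complex_nonpos_Reals_iff)
  qed
  define y where "y = (\<lambda>\<tau>. exp (Ln (E4 \<tau>) / 4))"
  have yd: "(y has_field_derivative ?c * (y \<tau> * (E2 \<tau> * E4 \<tau> - E6 \<tau>) / (12 * E4 \<tau>))) (at \<tau>)" if "\<tau> \<in> U" for \<tau>
    unfolding y_def using Up[OF that]
    by (auto intro!: derivative_eq_intros E4_deriv simp: field_simps)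
  have xd: "(x has_field_derivative ?c * (x \<tau> * E6 \<tau> / E4 \<tau>)) (at \<tau>)" if "\<tau> \<in> U" for \<tau>
  proof -
    note nz = Up[OF that]
    have 1: "((\<lambda>\<tau>. E4 \<tau> ^ 3) has_field_derivative ?c * (E4 \<tau> ^ 2 * (E2 \<tau> * E4 \<tau> - E6 \<tau>))) (at \<tau>)"
      by (auto intro!: derivative_eq_intros E4_deriv[OF nz(4)])
    have "E4 \<tau> ^ 3 \<noteq> 0" using nz by simp
    from DERIV_divide[OF DERIV_cmult[OF Delta_deriv[OF nz(4)], of 1728] 1 this]
    have "(x has_field_derivative (1728 * (?c * (E2 \<tau> * Delta \<tau>)) * E4 \<tau> ^ 3 - 1728 * Delta \<tau> * (?c * (E4 \<tau> ^ 2 * (E2 \<tau> * E4 \<tau> - E6 \<tau>)))) / (E4 \<tau> ^ 3 * E4 \<tau> ^ 3)) (at \<tau>)"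
      unfolding x_def .
    also have "1728 * (?c * (E2 \<tau> * Delta \<tau>)) * E4 \<tau> ^ 3 - 1728 * Delta \<tau> * (?c * (E4 \<tau> ^ 2 * (E2 \<tau> * E4 \<tau> - E6 \<tau>)))
      = ?c * (1728 * Delta \<tau>) * E6 \<tau> * E4 \<tau> ^ 2"
      by (simp add: algebra_simps power2_eq_square power3_eq_cube)
    also have "?c * (1728 * Delta \<tau>) * E6 \<tau> * E4 \<tau> ^ 2 / (E4 \<tau> ^ 3 * E4 \<tau> ^ 3) = ?c * (x \<tau> * E6 \<tau> / E4 \<tau>)"
      using nz(2) by (simp add: x_def power2_eq_square power3_eq_cube)
    finally show ?thesis .
  qed
  define B where "B = (\<lambda>\<tau>. hyp0 (x \<tau>) * ((E2 \<tau> * E4 \<tau> - E6 \<tau>) / 12) - hyp1 (x \<tau>) * (x \<tau> * E6 \<tau>))"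
  \<comment> \<open>The derivative of the quotient \<open>hyp0 (x \<tau>) / y \<tau>\<close> is -2
    pi \<i> K. Thus K constant means that the quotient is affine in \<tau>, and K = 0 that it is
    constant.\<close>
  define K where "K = (\<lambda>\<tau>. B \<tau> / (E4 \<tau> * y \<tau>))"
  have ynz: "y \<tau> \<noteq> 0" for \<tau> by (simp add: y_def)
  have x1: "E4 \<tau> ^ 2 * x \<tau> * E4 \<tau> = E4 \<tau> ^ 3 - E6 \<tau> ^ 2" if "\<tau> \<in> U" for \<tau>
    using Up[OF that] discriminant_eq[of \<tau>] by (simp add: x_def power3_eq_cube power2_eq_square)
  have Bd: "(B has_field_derivative ?c * (5/12 * B \<tau> * (E2 \<tau> * E4 \<tau> - E6 \<tau>) / E4 \<tau>)) (at \<tau>)" if t: "\<tau> \<in> U" for \<tau>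
  proof -
    note nz = Up[OF t]
    let ?x = "x \<tau>" and ?P = "E2 \<tau>" and ?Q = "E4 \<tau>" and ?R = "E6 \<tau>"
    have h0: "((\<lambda>\<tau>. hyp0 (x \<tau>)) has_field_derivative hyp1 ?x * (?c * (?x * ?R / ?Q))) (at \<tau>)"
      by (rule DERIV_chain2[OF hyp_derivs(1)[OF nz(1)] xd[OF t]])
    have h1: "((\<lambda>\<tau>. hyp1 (x \<tau>)) has_field_derivative hyp2 ?x * (?c * (?x * ?R / ?Q))) (at \<tau>)"
      by (rule DERIV_chain2[OF hyp_derivs(2)[OF nz(1)] xd[OF t]])
    have pq: "((\<lambda>\<tau>. (E2 \<tau> * E4 \<tau> - E6 \<tau>) / 12) has_field_derivative ?c * (5/144 * (?P^2 * ?Q + ?Q^2 - 2 * ?P * ?R))) (at \<tau>)"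
      by (rule DERIV_cong[OF DERIV_cdivide[OF DERIV_diff[OF DERIV_mult[OF E2_deriv[OF nz(4)] E4_deriv[OF nz(4)]] E6_deriv[OF nz(4)]]]])
         (simp add: field_simps power2_eq_square)
    have xr: "((\<lambda>\<tau>. x \<tau> * E6 \<tau>) has_field_derivative ?c * (?x * ?R^2 / ?Q + ?x * (?P * ?R - ?Q^2) / 2)) (at \<tau>)"
      by (rule DERIV_cong[OF DERIV_mult[OF xd[OF t] E6_deriv[OF nz(4)]]])
         (simp add: algebra_simps power2_eq_square)
    have "(B has_field_derivative ((hyp1 ?x * (?c * (?x * ?R / ?Q))) * ((?P * ?Q - ?R) / 12) + ?c * (5/144 * (?P^2 * ?Q + ?Q^2 - 2 * ?P * ?R)) * hyp0 ?x
       - ((hyp2 ?x * (?c * (?x * ?R / ?Q))) * (?x * ?R) + ?c * (?x * ?R^2 / ?Q + ?x * (?P * ?R - ?Q^2) / 2) * hyp1 ?x))) (at \<tau>)"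
      unfolding B_def by (rule DERIV_diff[OF DERIV_mult[OF h0 pq] DERIV_mult[OF h1 xr]])
    moreover have "((hyp1 ?x * (?c * (?x * ?R / ?Q))) * ((?P * ?Q - ?R) / 12) + ?c * (5/144 * (?P^2 * ?Q + ?Q^2 - 2 * ?P * ?R)) * hyp0 ?x
       - ((hyp2 ?x * (?c * (?x * ?R / ?Q))) * (?x * ?R) + ?c * (?x * ?R^2 / ?Q + ?x * (?P * ?R - ?Q^2) / 2) * hyp1 ?x))
       = ?c * (5/12 * B \<tau> * (?P * ?Q - ?R) / ?Q)"
    proof -
      \<comment> \<open>Replacing E6^2 by E4^3 (1 - x) turns the term with \<open>hyp2\<close> into
        the left-hand side of the hypergeometric equation.\<close>
      have R2: "?R ^ 2 = ?Q ^ 3 * (1 - ?x)" using x1[OF t] by (simp add: algebra_simps power2_eq_square power3_eq_cube)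
      have h2: "hyp2 ?x * (?x * ?R / ?Q) * (?x * ?R) = ?Q ^ 2 * ?x * (5/144 * hyp0 ?x - (1 - 3/2 * ?x) * hyp1 ?x)"
      proof -
        have "hyp2 ?x * (?x * ?R / ?Q) * (?x * ?R) = hyp2 ?x * ?x ^ 2 * ?R ^ 2 / ?Q" by (simp add: power2_eq_square)
        also have "\<dots> = ?Q ^ 2 * ?x * (?x * (1 - ?x) * hyp2 ?x)"
          unfolding R2 using nz(2) by (simp add: power2_eq_square power3_eq_cube)
        finally show ?thesis unfolding hyp_ode[OF nz(1)] .
      qed
      have RQ: "?R ^ 2 / ?Q = ?Q ^ 2 * (1 - ?x)" unfolding R2 using nz(2) by (simp add: power2_eq_square power3_eq_cube)
      have s1: "(?x * ?R / ?Q) * ((?P * ?Q - ?R) / 12) = ?x * (?P * ?R - ?R ^ 2 / ?Q) / 12"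
        using nz(2) by (simp add: field_simps power2_eq_square)
      have s2: "?x * ?R ^ 2 / ?Q = ?x * (?R ^ 2 / ?Q)" by simp
      have s3: "B \<tau> * (?P * ?Q - ?R) / ?Q = hyp0 ?x * ((?P^2 * ?Q - 2 * ?P * ?R + ?R^2 / ?Q) / 12) - hyp1 ?x * ?x * (?P * ?R - ?R ^ 2 / ?Q)"
        unfolding B_def using nz(2) by (simp add: field_simps power2_eq_square)
      have "hyp1 ?x * ((?x * ?R / ?Q) * ((?P * ?Q - ?R) / 12)) + (5/144 * (?P^2 * ?Q + ?Q^2 - 2 * ?P * ?R)) * hyp0 ?x
       - (hyp2 ?x * (?x * ?R / ?Q) * (?x * ?R) + (?x * ?R^2 / ?Q + ?x * (?P * ?R - ?Q^2) / 2) * hyp1 ?x)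
       = 5/12 * (B \<tau> * (?P * ?Q - ?R) / ?Q)"
        unfolding h2 s1 s2 s3 RQ by (simp add: field_simps power2_eq_square)
      moreover have "(a * (c * X)) * S + c * Z * b - ((d * (c * X)) * W + c * V * a) =
         c * (a * (X * S) + Z * b - (d * X * W + V * a))" for a b c d X S Z W V :: complex
        by (simp add: algebra_simps)
      ultimately show ?thesis by (simp only:) simp
    qed
    ultimately show ?thesis by (simp only:)
  qed
  have Kd: "(K has_field_derivative 0) (at \<tau>)" if t: "\<tau> \<in> U" for \<tau>
  proof -
    note nz = Up[OF t]
    have Ey: "((\<lambda>\<tau>. E4 \<tau> * y \<tau>) has_field_derivative ?c * (5/12 * y \<tau> * (E2 \<tau> * E4 \<tau> - E6 \<tau>))) (at \<tau>)"
      by (rule DERIV_cong[OF DERIV_mult[OF E4_deriv[OF nz(4)] yd[OF t]]]) (use nz(2) in \<open>simp add: field_simps\<close>)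
    have n: "E4 \<tau> * y \<tau> \<noteq> 0" using nz(2) ynz by simp
    from DERIV_divide[OF Bd[OF t] Ey n] show ?thesis unfolding K_def
      by (rule DERIV_cong) (use nz(2) in \<open>simp add: field_simps\<close>)
  qed
  have "\<exists>k. \<forall>\<tau>\<in>U. K \<tau> = k"
    by (rule has_field_derivative_zero_constant[OF U(2)]) (use Kd has_field_derivative_at_within in blast)
  then obtain k where k: "\<And>\<tau>. \<tau> \<in> U \<Longrightarrow> K \<tau> = k" by blast
  have evU: "eventually (\<lambda>\<tau>. \<tau> \<in> U) cusp" unfolding U_def using eventually_cusp_uhp by simp
  have E2l: "(E2 \<longlongrightarrow> 1) cusp" using tendsto_hol_nome[OF e_holomorphic(1)] by (simp add: E2_eq[abs_def])
  have yl: "(y \<longlongrightarrow> 1) cusp"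
  proof -
    have "((\<lambda>\<tau>. exp (Ln (E4 \<tau>) / 4)) \<longlongrightarrow> exp (Ln 1 / 4)) cusp"
      by (intro tendsto_intros tendsto_Ln E4_tendsto) auto
    thus ?thesis by (simp add: y_def)
  qed
  have "isCont hyp0 0" "isCont hyp1 0" using hyp_derivs[of 0] DERIV_isCont by auto
  hence hl: "((\<lambda>\<tau>. hyp0 (x \<tau>)) \<longlongrightarrow> 1) cusp" "((\<lambda>\<tau>. hyp1 (x \<tau>)) \<longlongrightarrow> hyp1 0) cusp"
    using isCont_tendsto_compose[OF _ xl] hyp0_0 by metis+
  \<comment> \<open>Both E2 E4 - E6 and x tend to 0 at the cusp, so K does too.\<close>
  have "((\<lambda>\<tau>. B \<tau> / (E4 \<tau> * y \<tau>)) \<longlongrightarrow> (1 * ((1 * 1 - 1) / 12) - hyp1 0 * (0 * 1)) / (1 * 1)) cusp"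
    unfolding B_def by (intro tendsto_intros hl E2l E4_tendsto E6_tendsto xl yl) auto
  hence "(K \<longlongrightarrow> 0) cusp" by (simp add: K_def)
  hence "((\<lambda>_. k) \<longlongrightarrow> 0) cusp"
    by (rule Lim_transform_eventually) (use k evU in \<open>auto elim!: eventually_mono\<close>)
  hence k0: "k = 0" by (simp add: tendsto_const_iff)
  define G where "G = (\<lambda>\<tau>. hyp0 (x \<tau>) / y \<tau>)"
  have Gd: "(G has_field_derivative 0) (at \<tau>)" if t: "\<tau> \<in> U" for \<tau>
  proof -
    note nz = Up[OF t]
    have "(G has_field_derivative ((hyp1 (x \<tau>) * (?c * (x \<tau> * E6 \<tau> / E4 \<tau>))) * y \<tau> - hyp0 (x \<tau>) * (?c * (y \<tau> * (E2 \<tau> * E4 \<tau> - E6 \<tau>) / (12 * E4 \<tau>)))) / (y \<tau> * y \<tau>)) (at \<tau>)"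
      unfolding G_def by (rule DERIV_divide[OF DERIV_chain2[OF hyp_derivs(1)[OF nz(1)] xd[OF t]] yd[OF t] ynz])
    also have "(hyp1 (x \<tau>) * (?c * (x \<tau> * E6 \<tau> / E4 \<tau>))) * y \<tau> - hyp0 (x \<tau>) * (?c * (y \<tau> * (E2 \<tau> * E4 \<tau> - E6 \<tau>) / (12 * E4 \<tau>))) = - ?c * y \<tau> * (B \<tau> / E4 \<tau>)"
      using nz(2) by (simp add: B_def field_simps)
    also have "B \<tau> = 0" using k[OF t] k0 nz(2) ynz by (simp add: K_def)
    finally show ?thesis by simp
  qed
  have "\<exists>k. \<forall>\<tau>\<in>U. G \<tau> = k"
    by (rule has_field_derivative_zero_constant[OF U(2)]) (use Gd has_field_derivative_at_within in blast)
  then obtain g where g: "\<And>\<tau>. \<tau> \<in> U \<Longrightarrow> G \<tau> = g" by blast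
  have "(G \<longlongrightarrow> 1) cusp" unfolding G_def using tendsto_divide[OF hl(1) yl] by simp
  hence "((\<lambda>_. g) \<longlongrightarrow> 1) cusp"
    by (rule Lim_transform_eventually) (use g evU in \<open>auto elim!: eventually_mono\<close>)
  hence g1: "g = 1" by (simp add: tendsto_const_iff)
  show ?thesis using evU
  proof eventually_elim
    case (elim \<tau>)
    note nz = Up[OF elim]
    have "hyp0 (x \<tau>) = y \<tau>" using g[OF elim] g1 ynz[of \<tau>] by (simp add: G_def)
    moreover have "1728 / modular_j \<tau> = x \<tau>" using nz by (simp add: x_def modular_j_eq)
    moreover have "y \<tau> ^ 4 = E4 \<tau>"
      unfolding y_def using nz(2) by (simp flip: exp_of_nat_mult)
    ultimately show ?case by (simp add: h1_hat_eq)
  qed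
qed

section \<open>Rational expressions in a function on the half plane\<close>

text \<open>Holomorphic functions on the half plane form an integral domain: f vanishes on the
  nonempty open set where g does not, hence everywhere.\<close>

lemma holomorphic_mult_zero:
  assumes "f holomorphic_on uhp" "g holomorphic_on uhp" "\<And>\<tau>. Im \<tau> > 0 \<Longrightarrow> f \<tau> * g \<tau> = 0"
    and "Im \<tau>0 > 0" "g \<tau>0 \<noteq> 0" "Im \<tau> > 0"
  shows "f \<tau> = (0::complex)"
proof (rule analytic_continuation[OF assms(1) open_uhp connected_uhp])
  let ?U = "{z \<in> uhp. g z \<noteq> 0}"
  have "open ?U"
  proof -
    have "open (uhp \<inter> g -` (- {0}))"
      using holomorphic_on_imp_continuous_on[OF assms(2)] open_uhp
      by (intro continuous_open_preimage) auto
    moreover have "uhp \<inter> g -` (- {0}) = ?U" by auto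
    ultimately show ?thesis by simp
  qed
  moreover have "\<tau>0 \<in> ?U" using assms by auto
  ultimately show "\<tau>0 islimpt ?U" by (intro interior_limit_point) (simp only: interior_open)
  show "\<And>z. z \<in> ?U \<Longrightarrow> f z = 0" using assms(3) by (metis (mono_tags, lifting) mem_Collect_eq mult_eq_0_iff)
qed (use assms in auto)

text \<open>In an integral domain a finite product of nonzero elements is nonzero, so a single point
  serves all factors.\<close>

lemma finite_common_nonzero:
  assumes "finite I" "\<And>i. i \<in> I \<Longrightarrow> h i holomorphic_on uhp" "\<And>i. i \<in> I \<Longrightarrow> \<exists>\<tau>. Im \<tau> > 0 \<and> h i \<tau> \<noteq> (0::complex)"
  shows "\<exists>\<tau>. Im \<tau> > 0 \<and> (\<forall>i\<in>I. h i \<tau> \<noteq> 0)"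
proof -
  have "\<exists>\<tau>. Im \<tau> > 0 \<and> (\<Prod>i\<in>I. h i \<tau>) \<noteq> 0"
    using assms
  proof (induction I rule: finite_induct)
    case empty
    show ?case by (intro exI[of _ \<i>]) auto
  next
    case (insert i I)
    obtain \<tau>1 where 1: "Im \<tau>1 > 0" "(\<Prod>i\<in>I. h i \<tau>1) \<noteq> 0" using insert by auto
    obtain \<tau>2 where 2: "Im \<tau>2 > 0" "h i \<tau>2 \<noteq> 0" using insert.prems(2) by auto
    show ?case
    proof (rule ccontr)
      assume "\<not> ?thesis"
      hence z: "h i \<tau> * (\<Prod>i\<in>I. h i \<tau>) = 0" if "Im \<tau> > 0" for \<tau> using that insert.hyps by auto
      have "h i holomorphic_on uhp" "(\<lambda>\<tau>. \<Prod>i\<in>I. h i \<tau>) holomorphic_on uhp"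
        using insert.prems(1) by (auto intro!: holomorphic_intros)
      from holomorphic_mult_zero[OF this z 1 2(1)] 2(2) show False by simp
    qed
  qed
  thus ?thesis using assms(1) by auto
qed

text \<open>This is q j as a function of q, with the pole of j at the cusp removed.\<close>

definition j_q :: "complex \<Rightarrow> complex" where "j_q q = e4 q ^ 3 / euler_prod q ^ 24"

lemma j_q_holomorphic: "j_q holomorphic_on ball 0 1"
  unfolding j_q_def by (intro holomorphic_intros e_holomorphic euler_prod_holomorphic) (auto simp: euler_prod_nonzero)

lemma j_q_0 [simp]: "j_q 0 = 1" by (simp add: j_q_def)

lemma modular_j_q: "Im \<tau> > 0 \<Longrightarrow> modular_j \<tau> = j_q (nome \<tau>) / nome \<tau>"
  by (simp add: modular_j_eq E4_eq Delta_def j_q_def)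

lemma modular_j_at_cusp: "filterlim modular_j at_infinity cusp"
proof -
  have n: "filterlim nome (at 0) cusp"
    using tendsto_nome_cusp by (auto simp: filterlim_at)
  have "filterlim (\<lambda>\<tau>. inverse (nome \<tau>)) at_infinity cusp"
    by (rule filterlim_compose[OF filterlim_inverse_at_infinity n])
  moreover have "((\<lambda>\<tau>. j_q (nome \<tau>)) \<longlongrightarrow> 1) cusp" using tendsto_hol_nome[OF j_q_holomorphic] by simp
  ultimately have lim: "filterlim (\<lambda>\<tau>. j_q (nome \<tau>) * inverse (nome \<tau>)) at_infinity cusp"
    by (intro tendsto_mult_filterlim_at_infinity) auto
  have "eventually (\<lambda>\<tau>. j_q (nome \<tau>) * inverse (nome \<tau>) = modular_j \<tau>) cusp"
    using eventually_cusp_uhp[of 0] by eventually_elim (simp add: modular_j_q divide_inverse)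
  from iffD1[OF filterlim_cong[OF refl refl this] lim] show ?thesis .
qed

lemma modular_j_large: "\<exists>Y\<ge>1. \<forall>\<tau>. Im \<tau> > Y \<longrightarrow> norm (modular_j \<tau>) > B"
proof -
  have "eventually (\<lambda>\<tau>. norm (modular_j \<tau>) > B) cusp"
    using filterlim_at_infinity_imp_norm_at_top[OF modular_j_at_cusp] unfolding filterlim_at_top_dense by blast
  then obtain Y where Y: "\<And>\<tau>. Im \<tau> > Y \<Longrightarrow> norm (modular_j \<tau>) > B" unfolding eventually_cusp by blast
  show ?thesis by (rule exI[of _ "max Y 1"]) (use Y in auto)
qed

lemma modular_j_not_const: "\<exists>\<tau>. Im \<tau> > 0 \<and> modular_j \<tau> \<noteq> c"
proof -
  obtain Y where "Y \<ge> 1" "\<And>\<tau>. Im \<tau> > Y \<Longrightarrow> norm (modular_j \<tau>) > norm c" using modular_j_large by blast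
  from this(1) this(2)[of "Complex 0 (Y + 1)"] show ?thesis by (intro exI[of _ "Complex 0 (Y + 1)"]) auto
qed

lemma holomorphic_poly_compose: "t holomorphic_on A \<Longrightarrow> (\<lambda>\<tau>. poly P (t \<tau>)) holomorphic_on A"
  by (induction P) (auto intro!: holomorphic_intros)

text \<open>The functions \<open>t \<circ> w\<close> are roots of \<open>P - j Q\<close> in the integral domain of
  holomorphic functions on the half plane, hence finite in number.\<close>

lemma finite_conjugates:
  assumes t: "t holomorphic_on uhp" and lt: "lowest_terms modular_j t P Q"
  shows "finite ((\<lambda>w \<tau>. if Im \<tau> > 0 then t (w \<tau>) else 0) ` modular_words)" (is "finite ?O")
proof (rule ccontr)
  assume inf: "infinite ?O"
  define D where "D = max (degree P) (degree Q)"
  obtain X where X: "X \<subseteq> ?O" "finite X" "card X = Suc D"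
    using infinite_arbitrarily_large[OF inf] by blast
  have hol: "f holomorphic_on uhp" if "f \<in> X" for f
  proof -
    have "f \<in> ?O" using \<open>f \<in> X\<close> X(1) by blast
    then obtain w where w: "w \<in> modular_words" "f = (\<lambda>\<tau>. if Im \<tau> > 0 then t (w \<tau>) else 0)" by blast
    have "(t \<circ> w) holomorphic_on uhp"
      by (rule holomorphic_on_compose_gen[OF modular_words_holomorphic[OF w(1)] t])
         (use modular_words_uhp[OF w(1)] in auto)
    thus ?thesis by (rule holomorphic_transform) (simp add: w(2))
  qed
  \<comment> \<open>At a suitable point the D + 1 chosen functions take pairwise different values,
    all of which are roots of the polynomial P - j(\<tau>) Q of degree at most D.\<close>
  have "\<exists>\<tau>. Im \<tau> > 0 \<and> (\<forall>i\<in>{(f, g). f \<in> X \<and> g \<in> X \<and> f \<noteq> g}. (\<lambda>(f, g) \<tau>. f \<tau> - g \<tau>) i \<tau> \<noteq> 0)"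
  proof (rule finite_common_nonzero)
    have "{(f, g). f \<in> X \<and> g \<in> X \<and> f \<noteq> g} \<subseteq> X \<times> X" by auto
    thus "finite {(f, g). f \<in> X \<and> g \<in> X \<and> f \<noteq> g}" using X(2) finite_subset by blast
  next
    fix i assume "i \<in> {(f, g). f \<in> X \<and> g \<in> X \<and> f \<noteq> g}"
    then obtain f g where i: "i = (f, g)" "f \<in> X" "g \<in> X" "f \<noteq> g" by auto
    show "(\<lambda>(f, g) \<tau>. f \<tau> - g \<tau>) i holomorphic_on uhp" using hol i by (auto intro!: holomorphic_intros)
    obtain \<tau> where "f \<tau> \<noteq> g \<tau>" using i(4) by (auto simp: fun_eq_iff)
    \<comment> \<open>All the functions are 0 off the half plane, so a point where two of them
      differ lies in it.\<close>
    moreover have "Im \<tau> > 0"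
    proof (rule ccontr)
      assume "\<not> Im \<tau> > 0"
      hence "f \<tau> = 0" "g \<tau> = 0" using i X(1) by auto
      thus False using \<open>f \<tau> \<noteq> g \<tau>\<close> by simp
    qed
    ultimately show "\<exists>\<tau>. Im \<tau> > 0 \<and> (\<lambda>(f, g) \<tau>. f \<tau> - g \<tau>) i \<tau> \<noteq> 0" using i(1) by auto
  qed
  then obtain \<tau> where \<tau>: "Im \<tau> > 0" "\<And>f g. f \<in> X \<Longrightarrow> g \<in> X \<Longrightarrow> f \<noteq> g \<Longrightarrow> f \<tau> \<noteq> g \<tau>" by fastforce
  define p where "p = P - smult (modular_j \<tau>) Q"
  have p0: "p \<noteq> 0"
  proof
    assume "p = 0"
    hence "P = smult (modular_j \<tau>) Q" by (simp add: p_def)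
    hence "modular_j \<sigma> = modular_j \<tau>" if "Im \<sigma> > 0" for \<sigma>
      using lt that unfolding lowest_terms_def by auto
    thus False using modular_j_not_const by blast
  qed
  have "(\<lambda>f. f \<tau>) ` X \<subseteq> {x. poly p x = 0}"
  proof
    fix x assume "x \<in> (\<lambda>f. f \<tau>) ` X"
    then obtain w where w: "w \<in> modular_words" "x = t (w \<tau>)" using X(1) \<tau>(1) by auto
    have im: "Im (w \<tau>) > 0" by (rule modular_words_uhp[OF w(1) \<tau>(1)])
    have "modular_j (w \<tau>) = modular_j \<tau>"
      by (rule modular_words_invariant[OF modular_j_plus_1 modular_j_inversion w(1) \<tau>(1)])
    hence "modular_j \<tau> = poly P x / poly Q x" "poly Q x \<noteq> 0"
      using lt im unfolding lowest_terms_def w(2) by auto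
    thus "x \<in> {x. poly p x = 0}" by (simp add: p_def)
  qed
  hence "card ((\<lambda>f. f \<tau>) ` X) \<le> card {x. poly p x = 0}" by (intro card_mono poly_roots_finite p0)
  also have "\<dots> \<le> degree p" by (rule card_poly_roots_bound[OF p0])
  also have "\<dots> \<le> D" unfolding p_def D_def
    by (intro degree_diff_le) (auto intro: order_trans[OF degree_smult_le])
  finally have "card ((\<lambda>f. f \<tau>) ` X) \<le> D" .
  moreover have "inj_on (\<lambda>f. f \<tau>) X" using \<tau>(2) by (auto simp: inj_on_def)
  ultimately show False using X(3) by (simp add: card_image)
qed

lemma lowest_terms_nonconstant:
  assumes "lowest_terms modular_j t P Q"
  shows "\<not> t constant_on uhp"
proof
  assume "t constant_on uhp"
  then obtain c where "\<And>\<tau>. Im \<tau> > 0 \<Longrightarrow> t \<tau> = c" unfolding constant_on_def by auto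
  hence "modular_j \<tau> = poly P c / poly Q c" if "Im \<tau> > 0" for \<tau>
    using assms that unfolding lowest_terms_def by auto
  thus False using modular_j_not_const by metis
qed

text \<open>The image is open by the open mapping theorem. It is also closed in the connected set of
  points where Q is nonzero: near such a point P/Q is bounded, so j is bounded on the preimages;
  words move these into a compact box, and by \<open>finite_conjugates\<close> their values lie in a
  compact subset of the image.\<close>

theorem lowest_terms_image:
  assumes t: "t holomorphic_on uhp" and lt: "lowest_terms modular_j t P Q"
  shows "t ` uhp = {z. poly Q z \<noteq> 0}"
proof -
  let ?V = "{z. poly Q z \<noteq> 0}" and ?A = "t ` uhp"
  have Q: "poly Q (t \<tau>) \<noteq> 0" "modular_j \<tau> = poly P (t \<tau>) / poly Q (t \<tau>)" if "Im \<tau> > 0" for \<tau>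
    using lt that unfolding lowest_terms_def by auto
  have "Q \<noteq> 0" using Q(1)[of \<i>] by auto
  have "?V = UNIV - {z. poly Q z = 0}" by auto
  have openA: "open ?A"
    using open_mapping_thm[OF t open_uhp connected_uhp open_uhp order_refl lowest_terms_nonconstant[OF lt]] .
  have openV: "open ?V"
  proof -
    have "continuous_on UNIV (poly Q)" by (intro continuous_intros)
    hence "open (poly Q -` (- {0}))" by (intro open_vimage) auto
    thus ?thesis by (simp add: vimage_def)
  qed
  have connV: "connected ?V"
    unfolding \<open>?V = _\<close> by (intro connected_open_delete_finite poly_roots_finite \<open>Q \<noteq> 0\<close>) auto
  have AV: "?A \<subseteq> ?V" using Q by auto
  have closed: "z0 \<in> ?A" if z0: "z0 \<in> ?V" "z0 \<in> closure ?A" for z0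
  proof -
    define B where "B = norm (poly P z0 / poly Q z0) + 1"
    have "isCont (\<lambda>z. poly P z / poly Q z) z0" using z0(1) by (intro continuous_intros) auto
    hence "isCont (\<lambda>z. norm (poly P z / poly Q z)) z0" by (rule continuous_norm)
    hence "((\<lambda>z. norm (poly P z / poly Q z)) \<longlongrightarrow> norm (poly P z0 / poly Q z0)) (nhds z0)"
      unfolding continuous_at by (simp only: tendsto_at_iff_tendsto_nhds[of "\<lambda>z. norm (poly P z / poly Q z)" z0])
    hence "eventually (\<lambda>z. norm (poly P z / poly Q z) < B) (nhds z0)"
      by (rule order_tendstoD(2)) (simp add: B_def)
    then obtain N where N: "open N" "z0 \<in> N" "\<And>z. z \<in> N \<Longrightarrow> norm (poly P z / poly Q z) < B"
      unfolding eventually_nhds by blast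
    obtain Y where Y: "\<And>\<tau>. Im \<tau> > Y \<Longrightarrow> norm (modular_j \<tau>) > B" using modular_j_large by blast
    define K where "K = cbox (Complex (-1/2) (1/2)) (Complex (1/2) (max Y (1/2)))"
    have K: "compact K" "K \<subseteq> uhp" unfolding K_def by (auto simp: in_cbox_complex_iff)
    let ?c = "\<lambda>w \<tau>. if Im \<tau> > 0 then t (w \<tau>) else 0"
    define C where "C = (\<Union>f\<in>?c ` modular_words. f ` K)"
    have "compact C" unfolding C_def
    proof (intro compact_UN finite_conjugates[OF t lt])
      fix f assume "f \<in> ?c ` modular_words"
      then obtain w where w: "w \<in> modular_words" "f = ?c w" by auto
      have "(t \<circ> w) holomorphic_on uhp"
        by (rule holomorphic_on_compose_gen[OF modular_words_holomorphic[OF w(1)] t])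
           (use modular_words_uhp[OF w(1)] in auto)
      hence "f holomorphic_on uhp" by (rule holomorphic_transform) (simp add: w(2))
      thus "compact (f ` K)"
        using K holomorphic_on_imp_continuous_on continuous_on_subset by (intro compact_continuous_image) blast+
    qed
    hence Cc: "closed C" by (rule compact_imp_closed)
    have CA: "C \<subseteq> ?A"
      unfolding C_def using K(2) modular_words_uhp by fastforce
    have "N \<inter> ?A \<subseteq> C"
    proof
      fix z assume z: "z \<in> N \<inter> ?A"
      then obtain \<tau> where \<tau>: "Im \<tau> > 0" "z = t \<tau>" by auto
      obtain w \<sigma> where w: "w \<in> modular_words" "\<tau> = w \<sigma>" "\<bar>Re \<sigma>\<bar> \<le> 1/2" "Im \<sigma> \<ge> 1/2"
        using modular_words_strip[OF \<tau>(1)] by blast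
      have "modular_j \<tau> = modular_j \<sigma>" unfolding w(2)
        by (rule modular_words_invariant[OF modular_j_plus_1 modular_j_inversion w(1)]) (use w(4) in auto)
      moreover have "norm (modular_j \<tau>) < B" using Q(2)[OF \<tau>(1)] N(3)[of z] z \<tau>(2) by simp
      ultimately have "Im \<sigma> \<le> Y" using Y[of \<sigma>] by force
      hence "\<sigma> \<in> K" using w unfolding K_def in_cbox_complex_iff by auto
      moreover have "z = ?c w \<sigma>" using w \<tau> by auto
      ultimately show "z \<in> C" unfolding C_def using w(1) by blast
    qed
    moreover have "z0 \<in> closure (N \<inter> ?A)"
      using open_Int_closure_subset[OF N(1), of ?A] N(2) z0(2) by blast
    ultimately have "z0 \<in> closure C" using closure_mono by blast
    thus ?thesis using Cc CA by auto
  qed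
  have "openin (top_of_set ?V) ?A" using openA AV by (simp add: openin_open_eq openV)
  moreover have "closedin (top_of_set ?V) ?A"
  proof -
    have "?A = ?V \<inter> closure ?A"
    proof (intro equalityI subsetI)
      fix z assume "z \<in> ?A"
      thus "z \<in> ?V \<inter> closure ?A" using subsetD[OF AV] subsetD[OF closure_subset[of ?A]] by simp
    next
      fix z assume "z \<in> ?V \<inter> closure ?A"
      thus "z \<in> ?A" using closed by simp
    qed
    thus ?thesis unfolding closedin_closed using closed_closure by blast
  qed
  moreover have "?A \<noteq> {}" by (auto intro: exI[of _ \<i>])
  ultimately show ?thesis using connV connected_clopen by blast
qed

section \<open>Orders of polynomials and the derivative of j\<close>

lemma order_power: "p \<noteq> 0 \<Longrightarrow> order x (p ^ n) = n * order x (p :: complex poly)"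
  by (induction n) (simp_all add: order_mult)

lemma poly_eq_smult_if_orders_eq:
  fixes a b :: "complex poly"
  assumes "a \<noteq> 0" "b \<noteq> 0" "\<And>x. order x a = order x b"
  shows "\<exists>c. c \<noteq> 0 \<and> a = smult c b"
proof -
  have r: "poly a x = 0 \<longleftrightarrow> poly b x = 0" for x
    using assms by (simp add: order_root)
  let ?m = "\<Prod>x | poly b x = 0. [:- x, 1:] ^ order x b"
  have "a = smult (lead_coeff a) ?m"
    using complex_poly_decompose[of a] by (simp only: r assms(3))
  also have "?m = smult (1 / lead_coeff b) b"
    using arg_cong[OF complex_poly_decompose[of b], of "smult (1 / lead_coeff b)"] assms(2) by simp
  finally have "a = smult (lead_coeff a / lead_coeff b) b" by simp
  thus ?thesis using assms by (intro exI[of _ "lead_coeff a / lead_coeff b"]) auto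
qed

text \<open>At a zero of Q of order m the term P Q' has order m - 1, as P does not vanish there,
  while P' Q has order at least m or is zero.\<close>

lemma order_wronskian:
  fixes P Q :: "complex poly"
  assumes "coprime P Q" "Q \<noteq> 0" "poly Q x = 0"
  shows "Suc (order x (pderiv P * Q - P * pderiv Q)) = order x Q" "pderiv P * Q - P * pderiv Q \<noteq> 0"
proof -
  have Px: "poly P x \<noteq> 0"
    using assms coprime_poly_0[of P Q x] by auto
  hence P0: "P \<noteq> 0" by auto
  define w where "w = order x (pderiv Q)"
  have Qw: "order x Q = Suc w" unfolding w_def by (rule order_pderiv[OF assms(2,3)])
  have dQ: "pderiv Q \<noteq> 0"
  proof
    assume "pderiv Q = 0"
    hence "degree Q = 0" by (simp add: pderiv_eq_0_iff)
    then obtain c where "Q = [:c:]" by (metis degree_eq_zeroE)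
    thus False using assms by auto
  qed
  let ?l = "[:- x, 1:]"
  have ow: "order x (P * pderiv Q) = w"
    using P0 dQ Px by (simp add: order_mult order_0I w_def)
  have dv: "?l ^ Suc w dvd pderiv P * Q"
    using Qw by (metis dvd_mult order_1)
  let ?W = "pderiv P * Q - P * pderiv Q"
  have "?l ^ w dvd P * pderiv Q" using ow order_1 by metis
  moreover have "?l ^ w dvd pderiv P * Q" using dv power_le_dvd[of ?l "Suc w" "pderiv P * Q" w] by simp
  ultimately have d1: "?l ^ w dvd ?W" by (rule dvd_diff[rotated])
  have nd: "\<not> ?l ^ Suc w dvd ?W"
  proof
    assume "?l ^ Suc w dvd ?W"
    from dvd_diff[OF dv this] have "?l ^ Suc w dvd P * pderiv Q" by (simp only: minus_diff_eq diff_diff_eq2 add_diff_cancel_left')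
    hence "Suc w \<le> order x (P * pderiv Q)" using P0 dQ by (simp only: order_divides) auto
    thus False using ow by simp
  qed
  thus "?W \<noteq> 0" by auto
  have "order x ?W = w" using order_unique_lemma[OF d1 nd] by simp
  thus "Suc (order x ?W) = order x Q" using Qw by simp
qed

lemma poly_zero_on_image:
  fixes t :: "complex \<Rightarrow> complex"
  assumes "t holomorphic_on uhp" "\<not> t constant_on uhp" "\<And>\<tau>. Im \<tau> > 0 \<Longrightarrow> poly p (t \<tau>) = 0"
  shows "p = 0"
proof (rule ccontr)
  assume "p \<noteq> 0"
  have op: "open (t ` uhp)"
    using open_mapping_thm[OF assms(1) open_uhp connected_uhp open_uhp order_refl assms(2)] .
  moreover have "t ` uhp \<noteq> {}" by (auto intro: exI[of _ \<i>])
  moreover have "t ` uhp \<subseteq> {x. poly p x = 0}" using assms(3) by auto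
  hence "finite (t ` uhp)" using poly_roots_finite[OF \<open>p \<noteq> 0\<close>] finite_subset by blast
  ultimately show False using finite_imp_not_open by blast
qed

lemma lowest_terms_deriv:
  assumes t: "t holomorphic_on uhp" and lt: "lowest_terms f t P Q"
    and f: "(f has_field_derivative f') (at \<tau>)" and \<tau>: "Im \<tau> > 0"
  shows "f' * poly Q (t \<tau>) ^ 2 = poly (pderiv P * Q - P * pderiv Q) (t \<tau>) * deriv t \<tau>"
proof -
  have Q: "poly Q (t \<tau>) \<noteq> 0" using lt \<tau> unfolding lowest_terms_def by auto
  have td: "(t has_field_derivative deriv t \<tau>) (at \<tau>)"
    by (rule holomorphic_derivI[OF t open_uhp]) (use \<tau> in auto)
  have p: "((\<lambda>\<tau>. poly R (t \<tau>)) has_field_derivative poly (pderiv R) (t \<tau>) * deriv t \<tau>) (at \<tau>)" for R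
    by (rule DERIV_chain2[OF poly_DERIV td])
  have "((\<lambda>\<tau>. poly P (t \<tau>) / poly Q (t \<tau>)) has_field_derivative
     (poly (pderiv P) (t \<tau>) * deriv t \<tau> * poly Q (t \<tau>) - poly P (t \<tau>) * (poly (pderiv Q) (t \<tau>) * deriv t \<tau>)) / (poly Q (t \<tau>) * poly Q (t \<tau>))) (at \<tau>)"
    by (rule DERIV_divide[OF p p Q])
  hence "(f has_field_derivative
     (poly (pderiv P) (t \<tau>) * deriv t \<tau> * poly Q (t \<tau>) - poly P (t \<tau>) * (poly (pderiv Q) (t \<tau>) * deriv t \<tau>)) / (poly Q (t \<tau>) * poly Q (t \<tau>))) (at \<tau>)"
    by (rule has_field_derivative_transform_within_open[OF _ open_uhp]) (use lt \<tau> in \<open>auto simp: lowest_terms_def\<close>)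
  from DERIV_unique[OF f this] have "f' * poly Q (t \<tau>) ^ 2 = poly (pderiv P) (t \<tau>) * deriv t \<tau> * poly Q (t \<tau>) - poly P (t \<tau>) * (poly (pderiv Q) (t \<tau>) * deriv t \<tau>)"
    using Q by (simp add: power2_eq_square)
  thus ?thesis by (simp add: algebra_simps)
qed

text \<open>With j = P/Q this is Q^12 j^4 (j - 1728)^3, the part of (j')^6 that is rational in t.
  The exponent 12 comes from the square of Q in the quotient rule.\<close>

definition jd :: "complex poly \<Rightarrow> complex poly \<Rightarrow> complex poly" where
  "jd P Q = Q ^ 5 * P ^ 4 * (P - smult 1728 Q) ^ 3"

text \<open>Six is the least exponent for which E4^2 E6 becomes a product of integral powers of E4^3
  = j Delta and E6^2 = (j - 1728) Delta. The exponents of Delta then add up to 4 + 3 - 6 =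
  1.\<close>

lemma modular_j_deriv_6:
  assumes \<tau>: "Im \<tau> > 0"
  shows "(- 2 * of_real pi * \<i> * (E4 \<tau> ^ 2 * E6 \<tau> / Delta \<tau>)) ^ 6 =
    (2 * of_real pi * \<i>) ^ 6 * (modular_j \<tau> ^ 4 * (modular_j \<tau> - 1728) ^ 3 * Delta \<tau>)"
proof -
  note nz = Delta_nonzero[OF \<tau>]
  have "(a ^ 3 / d) ^ 4 * (b ^ 2 / d) ^ 3 * d = (a ^ 2 * b / d) ^ 6" if "d \<noteq> 0" for a b d :: complex
  proof -
    have "(a ^ 3 / d) ^ 4 * (b ^ 2 / d) ^ 3 * d = a ^ 12 * b ^ 6 * d / (d ^ 4 * d ^ 3)"
      by (simp add: power_divide flip: power_mult)
    also have "d ^ 4 * d ^ 3 = d * d ^ 6" by (simp add: eval_nat_numeral)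
    finally show ?thesis using that by (simp add: power_divide power_mult_distrib flip: power_mult)
  qed
  from this[OF nz] have "modular_j \<tau> ^ 4 * (modular_j \<tau> - 1728) ^ 3 * Delta \<tau> = (E4 \<tau> ^ 2 * E6 \<tau> / Delta \<tau>) ^ 6"
    unfolding modular_j_1728[OF \<tau>] unfolding modular_j_eq[OF \<tau>] .
  moreover have "(- x) ^ 6 = x ^ 6" for x :: complex by (rule power_minus_even) simp
  moreover have "- 2 * of_real pi * \<i> * X = - (2 * of_real pi * \<i> * X)" for X by simp
  ultimately show ?thesis by (simp only: power_mult_distrib)
qed

lemma lowest_terms_j_wronskian:
  assumes t: "t holomorphic_on uhp" and n: "n > 0"
    and lt: "lowest_terms (\<lambda>\<tau>. modular_j (of_nat n * \<tau>)) t P Q" and \<tau>: "Im \<tau> > 0"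
  shows "(poly (pderiv P * Q - P * pderiv Q) (t \<tau>) * deriv t \<tau>) ^ 6 =
    (of_nat n * (2 * of_real pi * \<i>)) ^ 6 * poly (jd P Q) (t \<tau>) * Delta (of_nat n * \<tau>)"
proof -
  let ?n = "of_nat n :: complex"
  have n\<tau>: "Im (?n * \<tau>) > 0" using n \<tau> by simp
  let ?d = "- 2 * of_real pi * \<i> * (E4 (?n * \<tau>) ^ 2 * E6 (?n * \<tau>) / Delta (?n * \<tau>))"
  have Q: "poly Q (t \<tau>) \<noteq> 0" "modular_j (?n * \<tau>) = poly P (t \<tau>) / poly Q (t \<tau>)"
    using lt \<tau> unfolding lowest_terms_def by auto
  have "((\<lambda>\<tau>. ?n * \<tau>) has_field_derivative ?n) (at \<tau>)" by (auto intro!: derivative_eq_intros)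
  from DERIV_chain2[OF modular_j_deriv[OF n\<tau>] this]
  have "((\<lambda>\<tau>. modular_j (?n * \<tau>)) has_field_derivative ?d * ?n) (at \<tau>)" .
  from lowest_terms_deriv[OF t lt this \<tau>]
  have "(poly (pderiv P * Q - P * pderiv Q) (t \<tau>) * deriv t \<tau>) ^ 6 = (?d * ?n * poly Q (t \<tau>) ^ 2) ^ 6"
    by simp
  also have "\<dots> = ?d ^ 6 * ?n ^ 6 * poly Q (t \<tau>) ^ 12"
    unfolding power_mult_distrib by (simp flip: power_mult)
  also have "\<dots> = (2 * of_real pi * \<i>) ^ 6 * ?n ^ 6 * ((poly P (t \<tau>) / poly Q (t \<tau>)) ^ 4 * (poly P (t \<tau>) / poly Q (t \<tau>) - 1728) ^ 3 * poly Q (t \<tau>) ^ 12) * Delta (?n * \<tau>)"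
    unfolding modular_j_deriv_6[OF n\<tau>] Q(2) by (simp only: mult_ac)
  also have "(poly P (t \<tau>) / poly Q (t \<tau>)) ^ 4 * (poly P (t \<tau>) / poly Q (t \<tau>) - 1728) ^ 3 * poly Q (t \<tau>) ^ 12 = poly (jd P Q) (t \<tau>)"
  proof -
    have "(p / q) ^ 4 * (p / q - 1728) ^ 3 * q ^ 12 = q ^ 5 * p ^ 4 * (p - 1728 * q) ^ 3" if "q \<noteq> 0" for p q :: complex
    proof -
      have "p / q - 1728 = (p - 1728 * q) / q" using that by (simp add: diff_divide_distrib)
      thus ?thesis using that by (simp add: power_divide eval_nat_numeral)
    qed
    from this[OF Q(1)] show ?thesis by (simp add: jd_def)
  qed
  finally show ?thesis unfolding power_mult_distrib by (simp only: mult_ac)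
qed

lemma jd_nonzero:
  assumes t: "t holomorphic_on uhp" "\<not> t constant_on uhp" and n: "n > 0"
    and lt: "lowest_terms (\<lambda>\<tau>. modular_j (of_nat n * \<tau>)) t P Q"
  shows "P \<noteq> 0" "Q \<noteq> 0" "P - smult 1728 Q \<noteq> 0"
proof -
  have L: "poly Q (t \<tau>) \<noteq> 0" "modular_j (of_nat n * \<tau>) = poly P (t \<tau>) / poly Q (t \<tau>)" if "Im \<tau> > 0" for \<tau>
    using lt that unfolding lowest_terms_def by auto
  show "Q \<noteq> 0" using L(1)[of \<i>] by auto
  have nc: "\<exists>\<tau>. Im \<tau> > 0 \<and> poly P (t \<tau>) / poly Q (t \<tau>) \<noteq> c" for c
  proof -
    obtain \<tau> where \<tau>: "Im \<tau> > 0" "modular_j \<tau> \<noteq> c" using modular_j_not_const by blast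
    thus ?thesis using L(2)[of "\<tau> / of_nat n"] n by (intro exI[of _ "\<tau> / of_nat n"]) auto
  qed
  show "P \<noteq> 0" using nc[of 0] by auto
  show "P - smult 1728 Q \<noteq> 0"
  proof
    assume "P - smult 1728 Q = 0"
    hence "P = smult 1728 Q" by simp
    thus False using nc[of 1728] L(1) by auto
  qed
qed

text \<open>With \<sigma> = n \<tau>, an expression for j(n \<tau>) in t(\<tau>) becomes one for
  j(\<sigma>) itself, so results on j apply to both kinds of expression.\<close>

lemma lowest_terms_rescale:
  fixes n :: nat
  assumes t: "t holomorphic_on uhp" and n: "n > 0"
    and lt: "lowest_terms (\<lambda>\<tau>. f (of_nat n * \<tau>)) t U V"
  shows "(\<lambda>\<sigma>. t (\<sigma> / of_nat n)) holomorphic_on uhp" "lowest_terms f (\<lambda>\<sigma>. t (\<sigma> / of_nat n)) U V"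
proof -
  let ?n = "of_nat n :: complex"
  show "(\<lambda>\<sigma>. t (\<sigma> / ?n)) holomorphic_on uhp"
    by (rule holomorphic_on_compose_gen[OF _ t, unfolded o_def]) (use n in \<open>auto intro!: holomorphic_intros\<close>)
  show "lowest_terms f (\<lambda>\<sigma>. t (\<sigma> / ?n)) U V"
    unfolding lowest_terms_def
  proof (intro conjI allI impI)
    show "coprime U V" using lt unfolding lowest_terms_def by blast
    fix \<sigma> :: complex assume "Im \<sigma> > 0"
    hence im: "Im (\<sigma> / ?n) > 0" using n by simp
    thus "poly V (t (\<sigma> / ?n)) \<noteq> 0" using lt unfolding lowest_terms_def by blast
    have "f (?n * (\<sigma> / ?n)) = poly U (t (\<sigma> / ?n)) / poly V (t (\<sigma> / ?n))"
      using lt im unfolding lowest_terms_def by blast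
    thus "f \<sigma> = poly U (t (\<sigma> / ?n)) / poly V (t (\<sigma> / ?n))" using n by simp
  qed
qed

text \<open>\<open>Delta (n\<tau>) Q(t) / (Delta \<tau> V(t))\<close> is a rational function of \<open>t\<close>, since up to a constant
  \<open>(j')\<^sup>6 = j\<^sup>4 (j - 1728)\<^sup>3 Delta\<close>. It has neither zeros nor poles: this is clear at the values of
  \<open>t\<close>, and at the omitted values, which are the zeros of \<open>Q\<close> and also those of \<open>V\<close>, the orders cancel.\<close>

theorem Delta_quotient:
  assumes t: "t holomorphic_on uhp" and n: "n > 0"
    and lt: "lowest_terms modular_j t P Q"
    and lt': "lowest_terms (\<lambda>\<tau>. modular_j (of_nat n * \<tau>)) t U V"
  obtains c where "c \<noteq> 0"
    "\<And>\<tau>. Im \<tau> > 0 \<Longrightarrow> Delta (of_nat n * \<tau>) * poly Q (t \<tau>) = c * (Delta \<tau> * poly V (t \<tau>))"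
proof -
  let ?n = "of_nat n :: complex"
  have nc: "\<not> t constant_on uhp" by (rule lowest_terms_nonconstant[OF lt])
  have lt1: "lowest_terms (\<lambda>\<tau>. modular_j (of_nat 1 * \<tau>)) t P Q" using lt by simp
  note nz = jd_nonzero[OF t nc _ lt1, simplified] and nz' = jd_nonzero[OF t nc n lt']
  have cop: "coprime P Q" "coprime U V" using lt lt' unfolding lowest_terms_def by auto
  have Qt: "poly Q (t \<tau>) \<noteq> 0" "poly V (t \<tau>) \<noteq> 0" if "Im \<tau> > 0" for \<tau>
    using lt lt' that unfolding lowest_terms_def by auto
  have im1: "t ` uhp = {z. poly Q z \<noteq> 0}" by (rule lowest_terms_image[OF t lt])
  have im2: "t ` uhp = {z. poly V z \<noteq> 0}"
  proof -
    have "(\<lambda>\<sigma>. t (\<sigma> / ?n)) ` uhp = {z. poly V z \<noteq> 0}"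
      by (rule lowest_terms_image[OF lowest_terms_rescale[OF t n lt']])
    moreover have "(\<lambda>\<sigma>. t (\<sigma> / ?n)) ` uhp = t ` uhp"
    proof safe
      fix \<sigma> :: complex assume "Im \<sigma> > 0"
      thus "t (\<sigma> / ?n) \<in> t ` uhp" using n by auto
    next
      fix \<sigma> :: complex assume "Im \<sigma> > 0"
      thus "t \<sigma> \<in> (\<lambda>\<sigma>. t (\<sigma> / ?n)) ` uhp" using n by (intro image_eqI[of _ _ "?n * \<sigma>"]) auto
    qed
    ultimately show ?thesis by simp
  qed
  define W1 where "W1 = pderiv P * Q - P * pderiv Q"
  define W2 where "W2 = pderiv U * V - U * pderiv V"
  define k where "k = (2 * of_real pi * \<i> :: complex) ^ 6"
  have k0: "k \<noteq> 0" by (simp add: k_def)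
  have w1: "(poly W1 (t \<tau>) * deriv t \<tau>) ^ 6 = k * poly (jd P Q) (t \<tau>) * Delta \<tau>" if "Im \<tau> > 0" for \<tau>
    using lowest_terms_j_wronskian[OF t _ lt1 that] by (simp add: W1_def k_def)
  have w2: "(poly W2 (t \<tau>) * deriv t \<tau>) ^ 6 = ?n ^ 6 * k * poly (jd U V) (t \<tau>) * Delta (?n * \<tau>)" if "Im \<tau> > 0" for \<tau>
    using lowest_terms_j_wronskian[OF t n lt' that] by (simp add: W2_def k_def power_mult_distrib)
  have jd0: "jd P Q \<noteq> 0" "jd U V \<noteq> 0" unfolding jd_def using nz nz' by auto
  have Dn: "Im (?n * \<tau>) > 0" if "Im \<tau> > 0" for \<tau> using n that by simp
  have W0: "W1 \<noteq> 0" "W2 \<noteq> 0"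
  proof -
    have "jd P Q = 0" if "W1 = 0"
      by (rule poly_zero_on_image[OF t nc]) (use w1 that k0 Delta_nonzero in auto)
    thus "W1 \<noteq> 0" using jd0 by auto
    have "jd U V = 0" if "W2 = 0"
    proof (rule poly_zero_on_image[OF t nc])
      fix \<tau> :: complex assume "Im \<tau> > 0"
      thus "poly (jd U V) (t \<tau>) = 0" using w2[of \<tau>] that k0 n Delta_nonzero[OF Dn[of \<tau>]] by auto
    qed
    thus "W2 \<noteq> 0" using jd0 by auto
  qed
  \<comment> \<open>Dividing the two Wronskian identities by each other eliminates t' and presents
    the quotient \<open>\<phi>\<close> as a(t)/b(t).\<close>
  define a where "a = Q * jd P Q * W2 ^ 6"
  define b where "b = smult (?n ^ 6) (V * jd U V * W1 ^ 6)"
  have ab0: "a \<noteq> 0" "b \<noteq> 0" unfolding a_def b_def using nz nz' jd0 W0 n by auto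
  define \<phi> where "\<phi> = (\<lambda>\<tau>. Delta (?n * \<tau>) * poly Q (t \<tau>) / (Delta \<tau> * poly V (t \<tau>)))"
  have Dnh: "(\<lambda>\<tau>. Delta (?n * \<tau>)) holomorphic_on uhp"
    by (rule holomorphic_on_compose_gen[OF _ Delta_holomorphic, unfolded o_def]) (use n in \<open>auto intro!: holomorphic_intros\<close>)
  note ph = holomorphic_poly_compose[OF t]
  have \<phi>h: "\<phi> holomorphic_on uhp" unfolding \<phi>_def
    by (intro holomorphic_intros Dnh ph Delta_holomorphic) (use Delta_nonzero Qt in auto)
  have \<phi>0: "\<phi> \<tau> \<noteq> 0" if "Im \<tau> > 0" for \<tau>
    unfolding \<phi>_def using Delta_nonzero[OF that] Delta_nonzero[OF Dn[OF that]] Qt[OF that] by simp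
  have key: "\<phi> \<tau> * poly b (t \<tau>) - poly a (t \<tau>) = 0" if \<tau>: "Im \<tau> > 0" for \<tau>
  proof -
    let ?F = "\<lambda>\<tau>. \<phi> \<tau> * poly b (t \<tau>) - poly a (t \<tau>)"
    have Fh: "?F holomorphic_on uhp" by (intro holomorphic_intros \<phi>h ph)
    have dh: "(\<lambda>\<tau>. deriv t \<tau> ^ 6) holomorphic_on uhp" by (intro holomorphic_intros holomorphic_deriv t open_uhp)
    have z: "?F \<tau> * deriv t \<tau> ^ 6 = 0" if \<tau>: "Im \<tau> > 0" for \<tau>
    proof -
      let ?d = "deriv t \<tau> ^ 6" and ?A = "poly (jd P Q) (t \<tau>)" and ?B = "poly (jd U V) (t \<tau>)"
      have "\<phi> \<tau> * poly b (t \<tau>) * ?d = \<phi> \<tau> * ?n ^ 6 * poly V (t \<tau>) * ?B * (poly W1 (t \<tau>) * deriv t \<tau>) ^ 6"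
        by (simp add: b_def power_mult_distrib mult_ac)
      also have "\<dots> = (\<phi> \<tau> * (Delta \<tau> * poly V (t \<tau>))) * (?n ^ 6 * k * ?A * ?B)"
        unfolding w1[OF \<tau>] by (simp only: mult_ac)
      also have "\<phi> \<tau> * (Delta \<tau> * poly V (t \<tau>)) = Delta (?n * \<tau>) * poly Q (t \<tau>)"
        unfolding \<phi>_def using Delta_nonzero[OF \<tau>] Qt[OF \<tau>] by simp
      also have "Delta (?n * \<tau>) * poly Q (t \<tau>) * (?n ^ 6 * k * ?A * ?B) = poly Q (t \<tau>) * ?A * (?n ^ 6 * k * ?B * Delta (?n * \<tau>))"
        by (simp only: mult_ac)
      also have "\<dots> = poly a (t \<tau>) * ?d"
        unfolding w2[OF \<tau>, symmetric] by (simp add: a_def power_mult_distrib mult_ac)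
      finally show ?thesis by (simp add: left_diff_distrib)
    qed
    \<comment> \<open>The derivative of t may have zeros, so it is cancelled as a factor in the
      integral domain.\<close>
    obtain \<tau>0 where \<tau>0: "Im \<tau>0 > 0" "deriv t \<tau>0 ^ 6 \<noteq> 0"
    proof -
      have "\<exists>\<tau>. Im \<tau> > 0 \<and> deriv t \<tau> \<noteq> 0"
      proof (rule ccontr)
        assume "\<not> ?thesis"
        hence "jd P Q = 0" using w1 k0 Delta_nonzero by (intro poly_zero_on_image[OF t nc]) auto
        thus False using jd0 by simp
      qed
      thus ?thesis using that by auto
    qed
    show ?thesis by (rule holomorphic_mult_zero[OF Fh dh z \<tau>0 \<tau>])
  qed
  have ord: "order x a = order x b" for x
  proof (cases "poly Q x = 0")
    case True
    hence "poly V x = 0" using im1 im2 by blast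
    have Px: "poly P x \<noteq> 0" "poly U x \<noteq> 0"
      using True \<open>poly V x = 0\<close> cop coprime_poly_0[of P Q x] coprime_poly_0[of U V x] by auto
    \<comment> \<open>By these relations both orders equal 6 ord Q + 6 ord V - 6.\<close>
    have o1: "Suc (order x W1) = order x Q" unfolding W1_def by (rule order_wronskian[OF cop(1) nz(2) True])
    have o2: "Suc (order x W2) = order x V" unfolding W2_def by (rule order_wronskian[OF cop(2) nz'(2) \<open>poly V x = 0\<close>])
    have "order x P = 0" "order x U = 0" "order x (P - smult 1728 Q) = 0" "order x (U - smult 1728 V) = 0"
      using Px True \<open>poly V x = 0\<close> by (auto intro!: order_0I)
    hence "order x (jd P Q) = 5 * order x Q" "order x (jd U V) = 5 * order x V"
      using nz nz' by (simp_all add: jd_def order_mult order_power)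
    hence "order x a = 6 * order x Q + 6 * order x W2" "order x b = 6 * order x V + 6 * order x W1"
      using ab0 W0 jd0 nz nz' n by (simp_all add: a_def b_def order_mult order_smult order_power)
    thus ?thesis using o1 o2 by linarith
  next
    case False
    then obtain \<tau>0 where \<tau>0: "Im \<tau>0 > 0" "t \<tau>0 = x" using im1 by (metis (mono_tags, lifting) imageE mem_Collect_eq)
    let ?l = "[:- x, 1:]"
    obtain a1 where a1: "a = ?l ^ order x a * a1" "poly a1 x \<noteq> 0"
      using order_decomp[OF ab0(1), of x] by (metis dvd_iff_poly_eq_0 minus_minus)
    obtain b1 where b1: "b = ?l ^ order x b * b1" "poly b1 x \<noteq> 0"
      using order_decomp[OF ab0(2), of x] by (metis dvd_iff_poly_eq_0 minus_minus)
    \<comment> \<open>Where t takes the value x, \<open>\<phi>\<close> is finite and nonzero. If the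
      orders differed, cancelling the smaller power of t - x would leave exactly one side vanishing
      at \<tau>0.\<close>
    have eq: "\<phi> \<tau> * ((t \<tau> - x) ^ order x b * poly b1 (t \<tau>)) = (t \<tau> - x) ^ order x a * poly a1 (t \<tau>)" if "Im \<tau> > 0" for \<tau>
      using key[OF that] by (subst (asm) a1, subst (asm) b1) (simp add: poly_power)
    have th: "(\<lambda>\<tau>. t \<tau> - x) holomorphic_on uhp" by (intro holomorphic_intros t)
    have "\<exists>\<tau>1\<in>uhp. t \<tau>1 \<noteq> x" using nc unfolding constant_on_def by blast
    then obtain \<tau>1 where \<tau>1: "Im \<tau>1 > 0" "t \<tau>1 - x \<noteq> 0" by auto
    show ?thesis
    proof (rule linorder_cases[of "order x a" "order x b"])
      assume lt: "order x a < order x b"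
      define m where "m = order x b - order x a"
      have m: "order x b = order x a + m" "m > 0" using lt by (auto simp: m_def)
      let ?F = "\<lambda>\<tau>. \<phi> \<tau> * ((t \<tau> - x) ^ m * poly b1 (t \<tau>)) - poly a1 (t \<tau>)"
      have "?F \<tau>0 = 0"
      proof (rule holomorphic_mult_zero[where f = ?F and ?\<tau>0.0 = \<tau>1 and g = "\<lambda>\<tau>. (t \<tau> - x) ^ order x a"])
        show "?F holomorphic_on uhp" by (intro holomorphic_intros \<phi>h th ph)
        show "(\<lambda>\<tau>. (t \<tau> - x) ^ order x a) holomorphic_on uhp" by (intro holomorphic_intros th)
        show "?F \<tau> * (t \<tau> - x) ^ order x a = 0" if "Im \<tau> > 0" for \<tau>
          using eq[OF that] unfolding m(1) power_add by (simp add: algebra_simps)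
      qed (use \<tau>0 \<tau>1 in auto)
      thus ?thesis using \<tau>0 a1(2) zero_power[OF m(2), where ?'a = complex] by simp
    next
      assume gt: "order x b < order x a"
      define m where "m = order x a - order x b"
      have m: "order x a = order x b + m" "m > 0" using gt by (auto simp: m_def)
      let ?F = "\<lambda>\<tau>. \<phi> \<tau> * poly b1 (t \<tau>) - (t \<tau> - x) ^ m * poly a1 (t \<tau>)"
      have "?F \<tau>0 = 0"
      proof (rule holomorphic_mult_zero[where f = ?F and ?\<tau>0.0 = \<tau>1 and g = "\<lambda>\<tau>. (t \<tau> - x) ^ order x b"])
        show "?F holomorphic_on uhp" by (intro holomorphic_intros \<phi>h th ph)
        show "(\<lambda>\<tau>. (t \<tau> - x) ^ order x b) holomorphic_on uhp" by (intro holomorphic_intros th)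
        show "?F \<tau> * (t \<tau> - x) ^ order x b = 0" if "Im \<tau> > 0" for \<tau>
          using eq[OF that] unfolding m(1) power_add by (simp add: algebra_simps)
      qed (use \<tau>0 \<tau>1 in auto)
      thus ?thesis using \<tau>0 b1(2) \<phi>0[OF \<tau>0(1)] zero_power[OF m(2), where ?'a = complex] by simp
    qed simp
  qed
  obtain c where c: "c \<noteq> 0" "a = smult c b" using poly_eq_smult_if_orders_eq[OF ab0 ord] by blast
  obtain \<tau>2 where \<tau>2: "Im \<tau>2 > 0" "poly b (t \<tau>2) \<noteq> 0"
    using poly_zero_on_image[OF t nc, of b] ab0 by blast
  have "\<phi> \<tau> - c = 0" if "Im \<tau> > 0" for \<tau>
  proof (rule holomorphic_mult_zero[where g = "\<lambda>\<tau>. poly b (t \<tau>)" and f = "\<lambda>\<tau>. \<phi> \<tau> - c"])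
    show "(\<phi> \<tau> - c) * poly b (t \<tau>) = 0" if "Im \<tau> > 0" for \<tau>
      using key[OF that] unfolding c(2) by (simp add: algebra_simps)
  qed (use \<tau>2 that in \<open>auto intro!: holomorphic_intros \<phi>h ph\<close>)
  thus ?thesis using that[of c] c(1) Delta_nonzero Qt unfolding \<phi>_def by (simp add: field_simps)
qed

section \<open>Local identities near the cusp\<close>

text \<open>The quotient is a twelfth root of unity and tends to 1, while the eleven other roots
  form a closed set that avoids 1.\<close>

lemma eventually_eq_if_power_eq:
  fixes f g :: "'a \<Rightarrow> complex"
  assumes "(f \<longlongrightarrow> 1) F" "(g \<longlongrightarrow> 1) F" "eventually (\<lambda>x. f x ^ 12 = g x ^ 12) F"
  shows "eventually (\<lambda>x. f x = g x) F"
proof -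
  have "((\<lambda>x. f x / g x) \<longlongrightarrow> 1) F" using tendsto_divide[OF assms(1,2)] by simp
  moreover define R where "R = {z::complex. z ^ 12 = 1} - {1}"
  have "finite R" unfolding R_def by (intro finite_Diff finite_roots_unity) simp
  hence "open (- R)" by (intro open_Compl finite_imp_closed)
  moreover have "1 \<in> - R" by (simp add: R_def)
  ultimately have 1: "eventually (\<lambda>x. f x / g x \<in> - R) F" by (rule topological_tendstoD)
  have 2: "eventually (\<lambda>x. g x \<in> - {0}) F" by (rule topological_tendstoD[OF assms(2)]) auto
  show ?thesis using 1 2 assms(3)
  proof eventually_elim
    case (elim x)
    have "(f x / g x) ^ 12 = 1" using elim by (simp add: power_divide)
    hence "f x / g x = 1" using elim by (auto simp: R_def)
    thus ?case using elim by simp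
  qed
qed

definition q_holomorphic :: "(complex \<Rightarrow> complex) \<Rightarrow> bool" where
  "q_holomorphic t \<longleftrightarrow> (\<exists>T. T holomorphic_on ball 0 1 \<and> T 0 = 0 \<and> (\<forall>\<tau>. Im \<tau> > 0 \<longrightarrow> t \<tau> = T (nome \<tau>)))"

lemma q_holomorphicD:
  assumes "q_holomorphic t"
  shows "t holomorphic_on uhp" "(t \<longlongrightarrow> 0) cusp"
proof -
  obtain T where T: "T holomorphic_on ball 0 1" "T 0 = 0" "\<And>\<tau>. Im \<tau> > 0 \<Longrightarrow> t \<tau> = T (nome \<tau>)"
    using assms unfolding q_holomorphic_def by blast
  show "t holomorphic_on uhp"
    by (rule holomorphic_transform[OF holomorphic_nome_compose[OF T(1)]]) (use T(3) in auto)
  have "((\<lambda>\<tau>. T (nome \<tau>)) \<longlongrightarrow> 0) cusp" using tendsto_hol_nome[OF T(1)] T(2) by simp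
  thus "(t \<longlongrightarrow> 0) cusp"
    by (rule Lim_transform_eventually) (use T(3) in \<open>auto intro!: eventually_mono[OF eventually_cusp_uhp[of 0]]\<close>)
qed

text \<open>By the open mapping theorem every small u other than 0 is a value of t at a point as
  high as desired. This turns identities near the cusp into identities in u near 0.\<close>

lemma q_holomorphic_near_0:
  assumes "q_holomorphic t" "\<not> t constant_on uhp"
  shows "eventually (\<lambda>u. \<exists>\<tau>. Im \<tau> > Y \<and> Im \<tau> > 0 \<and> t \<tau> = u) (at 0)"
proof -
  obtain T where T: "T holomorphic_on ball 0 1" "T 0 = 0" "\<And>\<tau>. Im \<tau> > 0 \<Longrightarrow> t \<tau> = T (nome \<tau>)"
    using assms unfolding q_holomorphic_def by blast
  have nc: "\<not> T constant_on ball 0 1"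
  proof
    assume "T constant_on ball 0 1"
    then obtain c where "\<And>q. norm q < 1 \<Longrightarrow> T q = c" unfolding constant_on_def by auto
    hence "t constant_on uhp" unfolding constant_on_def using T(3) norm_nome_less_1 by (metis mem_Collect_eq)
    thus False using assms by simp
  qed
  define r where "r = exp (- 2 * pi * max Y 0)"
  have r: "0 < r" "r \<le> 1" by (auto simp: r_def)
  have "open (T ` ball 0 r)"
    by (rule open_mapping_thm[OF T(1) open_ball connected_ball _ _ nc]) (use r in auto)
  moreover have "0 \<in> T ` ball 0 r" using T(2) r(1) by (metis centre_in_ball imageI)
  ultimately have "eventually (\<lambda>u. u \<in> T ` ball 0 r) (nhds 0)" by (rule eventually_nhds_in_open)
  hence "eventually (\<lambda>u. u \<in> T ` ball 0 r) (at 0)" using eventually_nhds_conv_at by blast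
  moreover have "eventually (\<lambda>u::complex. u \<noteq> 0) (at 0)" by (rule eventually_neq_at_within)
  ultimately show ?thesis
  proof eventually_elim
    case (elim u)
    then obtain q where q: "norm q < r" "u = T q" by auto
    have q0: "q \<noteq> 0" using elim q T(2) by auto
    define \<tau> where "\<tau> = Ln q / (2 * of_real pi * \<i>)"
    have e: "nome \<tau> = q" using q0 by (simp add: \<tau>_def)
    have "exp (- 2 * pi * Im \<tau>) < exp (- 2 * pi * max Y 0)" using q(1) e norm_nome[of \<tau>] by (simp add: r_def)
    hence "Im \<tau> > max Y 0" by simp
    thus ?case using T(3)[of \<tau>] e q by (intro exI[of _ \<tau>]) auto
  qed
qed

lemma lowest_terms_at_0:
  assumes "(t \<longlongrightarrow> 0) cusp" and lt: "lowest_terms modular_j t P Q"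
  shows "poly P 0 \<noteq> 0" "poly Q 0 = 0"
proof -
  have c: "((\<lambda>\<tau>. poly R (t \<tau>)) \<longlongrightarrow> poly R 0) cusp" for R
    using assms(1) by (intro tendsto_poly)
  have "((\<lambda>\<tau>. inverse (modular_j \<tau>)) \<longlongrightarrow> 0) cusp"
    using filterlim_compose[OF tendsto_inverse_0 modular_j_at_cusp] .
  from tendsto_mult[OF c[of P] this]
  have "((\<lambda>\<tau>. poly P (t \<tau>) * inverse (modular_j \<tau>)) \<longlongrightarrow> 0) cusp" by simp
  moreover have "eventually (\<lambda>\<tau>. poly P (t \<tau>) * inverse (modular_j \<tau>) = poly Q (t \<tau>)) cusp"
  proof -
    obtain Y where Y: "Y \<ge> 1" "\<And>\<tau>. Im \<tau> > Y \<Longrightarrow> norm (modular_j \<tau>) > 0" using modular_j_large by blast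
    show ?thesis using eventually_cusp_uhp[of Y]
    proof eventually_elim
      case (elim \<tau>)
      have "modular_j \<tau> \<noteq> 0" "modular_j \<tau> = poly P (t \<tau>) / poly Q (t \<tau>)"
        using lt Y elim unfolding lowest_terms_def by auto
      moreover have "poly Q (t \<tau>) \<noteq> 0" using lt Y elim unfolding lowest_terms_def by auto
      ultimately have "poly P (t \<tau>) = modular_j \<tau> * poly Q (t \<tau>)" by simp
      thus ?case using \<open>modular_j \<tau> \<noteq> 0\<close> by simp
    qed
  qed
  ultimately have "((\<lambda>\<tau>. poly Q (t \<tau>)) \<longlongrightarrow> 0) cusp" by (rule Lim_transform_eventually)
  from tendsto_unique[OF _ c this] show Q: "poly Q 0 = 0" by simp
  have "coprime P Q" using lt unfolding lowest_terms_def by blast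
  thus "poly P 0 \<noteq> 0" using Q coprime_poly_0 by blast
qed

lemma tendsto_cusp_rescale:
  fixes n :: nat
  assumes "(t \<longlongrightarrow> c) cusp" "n > 0"
  shows "((\<lambda>\<sigma>. t (\<sigma> / of_nat n)) \<longlongrightarrow> c) cusp" "((\<lambda>\<sigma>. t (of_nat n * \<sigma>)) \<longlongrightarrow> c) cusp"
proof -
  have 1: "filterlim (\<lambda>\<sigma>::complex. \<sigma> / of_nat n) cusp cusp"
    unfolding filterlim_iff eventually_cusp
  proof (intro allI impI; elim exE)
    fix P Y assume Y: "\<forall>\<tau>. Im \<tau> > Y \<longrightarrow> P \<tau>"
    show "\<exists>Z. \<forall>\<tau>. Im \<tau> > Z \<longrightarrow> P (\<tau> / of_nat n)"
      by (rule exI[of _ "of_nat n * Y"]) (use Y assms(2) in \<open>auto simp: field_simps\<close>)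
  qed
  have 2: "filterlim (\<lambda>\<sigma>::complex. of_nat n * \<sigma>) cusp cusp"
    unfolding filterlim_iff eventually_cusp
  proof (intro allI impI; elim exE)
    fix P Y assume Y: "\<forall>\<tau>. Im \<tau> > Y \<longrightarrow> P \<tau>"
    show "\<exists>Z. \<forall>\<tau>. Im \<tau> > Z \<longrightarrow> P (of_nat n * \<tau>)"
      by (rule exI[of _ "Y / of_nat n"]) (use Y assms(2) in \<open>auto simp: field_simps\<close>)
  qed
  show "((\<lambda>\<sigma>. t (\<sigma> / of_nat n)) \<longlongrightarrow> c) cusp" "((\<lambda>\<sigma>. t (of_nat n * \<sigma>)) \<longlongrightarrow> c) cusp"
    by (rule filterlim_compose[OF assms(1) 1], rule filterlim_compose[OF assms(1) 2])
qed

text \<open>The formula of \<open>h_fun\<close> for a given pair in place of the chosen one; it is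
  also applied to expressions for j(n \<tau>).\<close>

definition h_form :: "complex poly \<Rightarrow> complex poly \<Rightarrow> complex \<Rightarrow> complex" where
  "h_form P Q t = (poly P t / poly P 0) powr (-1/12) * h1_hat (12^3 * poly Q t / poly P t)"

lemma tendsto_powr_1:
  assumes "(f \<longlongrightarrow> (1::complex)) F"
  shows "((\<lambda>x. f x powr c) \<longlongrightarrow> 1) F"
proof -
  have "((\<lambda>x. f x powr c) \<longlongrightarrow> 1 powr c) F"
    by (rule tendsto_powr_complex[OF _ assms tendsto_const]) auto
  thus ?thesis by simp
qed

lemma h1_hat_tendsto: "(f \<longlongrightarrow> 0) F \<Longrightarrow> ((\<lambda>x. h1_hat (f x)) \<longlongrightarrow> 1) F"
  using isCont_tendsto_compose[OF DERIV_isCont[OF hyp_derivs(1)[of 0]]] hyp0_0 by (simp add: h1_hat_eq)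

lemma poly_tendsto_nhds_0: "(poly R \<longlongrightarrow> poly R 0) (nhds (0::complex))"
  using poly_isCont[of 0 R] by (simp only: isCont_def tendsto_at_iff_tendsto_nhds[of "poly R" 0])

lemma h_form_tendsto:
  assumes "poly P 0 \<noteq> 0" "poly Q 0 = 0"
  shows "(h_form P Q \<longlongrightarrow> 1) (nhds 0)"
proof -
  note p = poly_tendsto_nhds_0
  have "((\<lambda>u. (poly P u / poly P 0) powr (-1/12)) \<longlongrightarrow> 1) (nhds 0)"
    by (rule tendsto_powr_1) (use tendsto_divide[OF p[of P] tendsto_const assms(1)] assms(1) in simp)
  moreover have "((\<lambda>u. h1_hat (12^3 * poly Q u / poly P u)) \<longlongrightarrow> 1) (nhds 0)"
    by (rule h1_hat_tendsto)
       (use tendsto_divide[OF tendsto_mult[OF tendsto_const p[of Q]] p[of P] assms(1), of "12^3"] assms(2) in simp)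
  ultimately show ?thesis using tendsto_mult unfolding h_form_def by fastforce
qed

lemma powr_12:
  assumes "(z::complex) \<noteq> 0"
  shows "(z powr (- of_nat d / 12)) ^ 12 = 1 / z ^ d"
proof -
  have "(z powr (- of_nat d / 12)) ^ 12 = exp (of_nat 12 * (- of_nat d / 12 * ln z))"
    using assms by (simp only: powr_def if_False exp_of_nat_mult)
  also have "of_nat 12 * (- of_nat d / 12 * ln z) = - (of_nat d * ln z)" by simp
  also have "exp (- (of_nat d * ln z)) = 1 / z ^ d" using assms by (simp add: exp_minus exp_of_nat_mult divide_inverse)
  finally show ?thesis .
qed

lemma h_form_12:
  assumes "poly P u \<noteq> 0" "poly P 0 \<noteq> 0"
  shows "h_form P Q u ^ 12 = poly P 0 / poly P u * h1_hat (1728 * poly Q u / poly P u) ^ 12"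
  using powr_12[of "poly P u / poly P 0" 1] assms by (simp add: h_form_def power_mult_distrib)

lemma eventually_poly_nonzero: "poly P 0 \<noteq> (0::complex) \<Longrightarrow> eventually (\<lambda>u. poly P u \<noteq> 0) (nhds 0)"
  by (rule tendsto_imp_eventually_ne[OF poly_tendsto_nhds_0])

text \<open>The twelfth power of either side is a constant times Delta over the denominator, and
  \<open>Delta_quotient\<close> makes the two proportional. Since both sides tend to 1 at u = 0, the
  factor is 1 and the twelfth root is the trivial one. The case n = 1 shows independence of the
  pair.\<close>

theorem h_form_eq:
  fixes n :: nat
  assumes t: "q_holomorphic t" and n: "n > 0"
    and lt: "lowest_terms modular_j t P Q"
    and lt': "lowest_terms (\<lambda>\<tau>. modular_j (of_nat n * \<tau>)) t U V"
  shows "eventually (\<lambda>u. h_form P Q u = h_form U V u) (nhds 0)"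
proof -
  let ?n = "of_nat n :: complex"
  note th = q_holomorphicD[OF t]
  note PQ = lowest_terms_at_0[OF th(2) lt]
  note UV = lowest_terms_at_0[OF tendsto_cusp_rescale(1)[OF th(2) n] lowest_terms_rescale(2)[OF th(1) n lt']]
  obtain c where c: "c \<noteq> 0"
    "\<And>\<tau>. Im \<tau> > 0 \<Longrightarrow> Delta (?n * \<tau>) * poly Q (t \<tau>) = c * (Delta \<tau> * poly V (t \<tau>))"
    using Delta_quotient[OF th(1) n lt lt'] by blast
  obtain Y where Y: "\<And>\<tau>. Im \<tau> > Y \<Longrightarrow> h1_hat (1728 / modular_j \<tau>) ^ 4 = E4 \<tau>"
    using h1_hat_modular_j unfolding eventually_cusp by blast
  define \<kappa> where "\<kappa> = poly U 0 * c / poly P 0"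
  have "eventually (\<lambda>u. poly P u \<noteq> 0 \<and> poly U u \<noteq> 0) (at 0)"
    using eventually_poly_nonzero[OF PQ(1)] eventually_poly_nonzero[OF UV(1)]
    by (simp add: eventually_conj_iff eventually_nhds_conv_at)
  hence ev: "eventually (\<lambda>u. h_form U V u ^ 12 = \<kappa> * h_form P Q u ^ 12) (at 0)"
    using q_holomorphic_near_0[OF t lowest_terms_nonconstant[OF lt], of Y]
  proof eventually_elim
    case (elim u)
    then obtain \<tau> where \<tau>: "Im \<tau> > Y" "Im \<tau> > 0" "t \<tau> = u" by blast
    have n\<tau>: "Im (?n * \<tau>) > Y" "Im (?n * \<tau>) > 0"
    proof -
      have "Im (?n * \<tau>) = real n * Im \<tau>" by simp
      moreover have "real n * Im \<tau> \<ge> 1 * Im \<tau>" using n \<tau>(2) by (intro mult_right_mono) auto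
      ultimately show "Im (?n * \<tau>) > Y" "Im (?n * \<tau>) > 0" using \<tau> by linarith+
    qed
    have j: "poly Q u \<noteq> 0" "modular_j \<tau> = poly P u / poly Q u" "poly V u \<noteq> 0" "modular_j (?n * \<tau>) = poly U u / poly V u"
      using lt lt' \<tau> unfolding lowest_terms_def by auto
    have E: "x ^ 12 = (x ^ 4) ^ 3" for x :: complex by (simp flip: power_mult)
    have "h1_hat (1728 * poly Q u / poly P u) ^ 12 = E4 \<tau> ^ 3"
      using Y[OF \<tau>(1)] by (simp add: E j(2))
    also have "\<dots> = poly P u / poly Q u * Delta \<tau>"
      using modular_j_eq[OF \<tau>(2)] Delta_nonzero[OF \<tau>(2)] by (simp add: j(2) field_simps)
    finally have 1: "h_form P Q u ^ 12 = poly P 0 * Delta \<tau> / poly Q u"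
      using elim PQ(1) by (simp add: h_form_12)
    have "h1_hat (1728 * poly V u / poly U u) ^ 12 = E4 (?n * \<tau>) ^ 3"
      using Y[OF n\<tau>(1)] by (simp add: E j(4))
    also have "\<dots> = poly U u / poly V u * Delta (?n * \<tau>)"
      using modular_j_eq[OF n\<tau>(2)] Delta_nonzero[OF n\<tau>(2)] unfolding j(4) by (simp add: field_simps)
    finally have 2: "h_form U V u ^ 12 = poly U 0 * Delta (?n * \<tau>) / poly V u"
      using elim UV(1) by (simp add: h_form_12)
    have "Delta (?n * \<tau>) = c * (Delta \<tau> * poly V u) / poly Q u"
      using c(2)[OF \<tau>(2)] j(1) \<tau>(3) by (simp add: field_simps)
    thus ?case unfolding 1 2 \<kappa>_def using j PQ(1) by simp
  qed
  have l1: "(h_form P Q \<longlongrightarrow> 1) (nhds 0)" and l2: "(h_form U V \<longlongrightarrow> 1) (nhds 0)"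
    by (intro h_form_tendsto PQ UV)+
  have atle: "at (0::complex) \<le> nhds 0" by (simp add: at_within_def)
  have "((\<lambda>u. \<kappa> * h_form P Q u ^ 12) \<longlongrightarrow> \<kappa> * 1 ^ 12) (at 0)"
    by (intro tendsto_intros tendsto_mono[OF atle l1])
  moreover have "((\<lambda>u. \<kappa> * h_form P Q u ^ 12) \<longlongrightarrow> 1 ^ 12) (at 0)"
    by (rule Lim_transform_eventually[OF tendsto_power[OF tendsto_mono[OF atle l2]] ev])
  ultimately have "\<kappa> * 1 ^ 12 = 1 ^ 12" by (rule tendsto_unique[rotated]) simp
  hence "\<kappa> = 1" by simp
  have "eventually (\<lambda>u. h_form P Q u = h_form U V u) (at 0)"
  proof (rule eventually_eq_if_power_eq[OF tendsto_mono[OF atle l1] tendsto_mono[OF atle l2]])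
    show "eventually (\<lambda>u. h_form P Q u ^ 12 = h_form U V u ^ 12) (at 0)"
      using ev by eventually_elim (simp add: \<open>\<kappa> = 1\<close>)
  qed
  \<comment> \<open>The comparison through values of t covers a punctured neighbourhood; the centre
    is checked directly.\<close>
  moreover have "h_form P Q 0 = h_form U V 0"
    using PQ UV by (simp add: h_form_def)
  ultimately show ?thesis by (simp add: eventually_nhds_conv_at)
qed

section \<open>Substitution of one Hauptmodul into the expression for j in another\<close>

text \<open>\<open>B\<^sup>d p(A/B)\<close>\<close>

definition homogenize :: "nat \<Rightarrow> complex poly \<Rightarrow> complex poly \<Rightarrow> complex poly \<Rightarrow> complex poly" where
  "homogenize d p A B = (\<Sum>i\<le>d. smult (coeff p i) (A ^ i * B ^ (d - i)))"

lemma poly_homogenize: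
  assumes "degree p \<le> d" "poly B x \<noteq> 0"
  shows "poly (homogenize d p A B) x = poly B x ^ d * poly p (poly A x / poly B x)"
proof -
  have "poly p (poly A x / poly B x) = (\<Sum>i\<le>d. coeff p i * (poly A x / poly B x) ^ i)"
    unfolding poly_altdef using assms(1)
    by (intro sum.mono_neutral_left) (auto simp: coeff_eq_0)
  also have "poly B x ^ d * \<dots> = (\<Sum>i\<le>d. coeff p i * (poly A x ^ i * poly B x ^ (d - i)))"
    unfolding sum_distrib_left
  proof (intro sum.cong refl)
    fix i assume "i \<in> {..d}"
    hence "poly B x ^ d = poly B x ^ i * poly B x ^ (d - i)" by (simp flip: power_add)
    thus "poly B x ^ d * (coeff p i * (poly A x / poly B x) ^ i) = coeff p i * (poly A x ^ i * poly B x ^ (d - i))"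
      using assms(2) by (simp add: power_divide)
  qed
  finally show ?thesis by (simp add: homogenize_def poly_sum poly_power)
qed

text \<open>Only the summand i = d survives. If d is the degree of p, the value is nonzero wherever
  A is, which keeps fractions in lowest terms under substitution.\<close>

lemma poly_homogenize_0:
  assumes "poly B x = 0"
  shows "poly (homogenize d p A B) x = coeff p d * poly A x ^ d"
proof -
  have "poly (homogenize d p A B) x = (\<Sum>i\<le>d. if i = d then coeff p d * poly A x ^ d else 0)"
    unfolding homogenize_def poly_sum using assms
    by (intro sum.cong) (auto simp: poly_power power_0_left)
  thus ?thesis by simp
qed

lemma coprime_iff_no_common_root:
  fixes P Q :: "complex poly"
  shows "coprime P Q \<longleftrightarrow> (\<forall>x. \<not> (poly P x = 0 \<and> poly Q x = 0))"
proof
  assume "\<forall>x. \<not> (poly P x = 0 \<and> poly Q x = 0)"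
  show "coprime P Q"
  proof (rule coprimeI)
    fix D assume D: "D dvd P" "D dvd Q"
    have "\<not> (\<exists>x. poly D x = 0)"
      using D \<open>\<forall>x. _\<close> by (metis dvd_trans poly_eq_0_iff_dvd)
    hence "degree D = 0" using Fundamental_Theorem_Algebra.fundamental_theorem_of_algebra[of D] constant_degree[of D] by blast
    moreover have "D \<noteq> 0" using \<open>\<not> (\<exists>x. poly D x = 0)\<close> by auto
    ultimately show "is_unit D" by (simp add: is_unit_iff_degree)
  qed
qed (use coprime_poly_0 in blast)

text \<open>A common root x is excluded in two ways: if Q vanishes at x, by the leading coefficient
  of A; otherwise P(x)/Q(x) would be a common root of A and B.\<close>

lemma lowest_terms_compose:
  fixes n :: nat
  assumes lt: "lowest_terms f s A B" and d: "degree A = d" "degree B < d" and n: "n > 0"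
    and lt': "lowest_terms (\<lambda>\<tau>. s (of_nat n * \<tau>)) t P Q"
  shows "lowest_terms (\<lambda>\<tau>. f (of_nat n * \<tau>)) t (homogenize d A P Q) (homogenize d B P Q)"
  unfolding lowest_terms_def
proof (intro conjI allI impI)
  have cop: "coprime A B" "coprime P Q" using lt lt' unfolding lowest_terms_def by auto
  have A: "coeff A d \<noteq> 0" using d by (metis leading_coeff_0_iff degree_0 less_nat_zero_code)
  show "coprime (homogenize d A P Q) (homogenize d B P Q)"
    unfolding coprime_iff_no_common_root
  proof (intro allI notI; elim conjE)
    fix x assume z: "poly (homogenize d A P Q) x = 0" "poly (homogenize d B P Q) x = 0"
    show False
    proof (cases "poly Q x = 0")
      case True
      hence "poly P x \<noteq> 0" using cop(2) unfolding coprime_iff_no_common_root by auto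
      thus False using z(1) True A by (simp add: poly_homogenize_0)
    next
      case False
      thus False using z d cop(1) unfolding coprime_iff_no_common_root by (simp add: poly_homogenize)
    qed
  qed
  fix \<tau> :: complex assume \<tau>: "Im \<tau> > 0"
  hence n\<tau>: "Im (of_nat n * \<tau>) > 0" using n by simp
  have 1: "poly Q (t \<tau>) \<noteq> 0" "s (of_nat n * \<tau>) = poly P (t \<tau>) / poly Q (t \<tau>)"
    using lt' \<tau> unfolding lowest_terms_def by auto
  have 2: "poly B (s (of_nat n * \<tau>)) \<noteq> 0" "f (of_nat n * \<tau>) = poly A (s (of_nat n * \<tau>)) / poly B (s (of_nat n * \<tau>))"
    using lt n\<tau> unfolding lowest_terms_def by auto
  show "poly (homogenize d B P Q) (t \<tau>) \<noteq> 0" using 1 2 d by (simp add: poly_homogenize)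
  show "f (of_nat n * \<tau>) = poly (homogenize d A P Q) (t \<tau>) / poly (homogenize d B P Q) (t \<tau>)"
    using 1 2 d by (simp add: poly_homogenize)
qed

lemma lowest_terms_zero_at_0:
  assumes t: "(t \<longlongrightarrow> 0) cusp" and s: "(s \<longlongrightarrow> 0) cusp" and lt: "lowest_terms s t P Q"
  shows "poly P 0 = 0" "poly Q 0 \<noteq> 0"
proof -
  have c: "((\<lambda>\<tau>. poly R (t \<tau>)) \<longlongrightarrow> poly R 0) cusp" for R
    using t by (intro tendsto_poly)
  have "((\<lambda>\<tau>. s \<tau> * poly Q (t \<tau>)) \<longlongrightarrow> 0) cusp" using tendsto_mult[OF s c[of Q]] by simp
  moreover have "eventually (\<lambda>\<tau>. s \<tau> * poly Q (t \<tau>) = poly P (t \<tau>)) cusp"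
    using eventually_cusp_uhp[of 0] by eventually_elim (use lt in \<open>auto simp: lowest_terms_def\<close>)
  ultimately have "((\<lambda>\<tau>. poly P (t \<tau>)) \<longlongrightarrow> 0) cusp" by (rule Lim_transform_eventually)
  from tendsto_unique[OF _ c this] show P: "poly P 0 = 0" by simp
  have "coprime P Q" using lt unfolding lowest_terms_def by blast
  thus "poly Q 0 \<noteq> 0" using P coprime_poly_0 by blast
qed

text \<open>The homogenized A is Q^d A(P/Q), so the twelfth powers differ by (Q(0)/Q)^d, the source
  of the exponent -d/12. Both sides tend to 1 at 0.\<close>

lemma h_form_homogenize:
  assumes AB: "poly A 0 \<noteq> 0" "poly B 0 = 0" and d: "degree A \<le> d" "degree B \<le> d"
    and PQ: "poly P 0 = 0" "poly Q 0 \<noteq> 0"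
  shows "eventually (\<lambda>u. h_form (homogenize d A P Q) (homogenize d B P Q) u =
     (poly Q u / poly Q 0) powr (- of_nat d / 12) * h_form A B (poly P u / poly Q u)) (nhds 0)"
proof (rule eventually_eq_if_power_eq)
  have A0: "poly (homogenize d A P Q) 0 = poly Q 0 ^ d * poly A 0"
    and B0: "poly (homogenize d B P Q) 0 = 0"
    using poly_homogenize[OF d(1) PQ(2)] poly_homogenize[OF d(2) PQ(2)] PQ AB by simp_all
  show "(h_form (homogenize d A P Q) (homogenize d B P Q) \<longlongrightarrow> 1) (nhds 0)"
    by (rule h_form_tendsto) (use A0 B0 PQ AB in auto)
  note p = poly_tendsto_nhds_0
  have l: "((\<lambda>u. poly P u / poly Q u) \<longlongrightarrow> 0) (nhds 0)"
    using tendsto_divide[OF p[of P] p[of Q] PQ(2)] PQ(1) by simp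
  have "((\<lambda>u. (poly Q u / poly Q 0) powr (- of_nat d / 12)) \<longlongrightarrow> 1) (nhds 0)"
    by (rule tendsto_powr_1) (use tendsto_divide[OF p[of Q] tendsto_const PQ(2)] PQ(2) in simp)
  moreover have "((\<lambda>u. h_form A B (poly P u / poly Q u)) \<longlongrightarrow> 1) (nhds 0)"
    using filterlim_compose[OF h_form_tendsto[OF AB] l] .
  ultimately show "((\<lambda>u. (poly Q u / poly Q 0) powr (- of_nat d / 12) * h_form A B (poly P u / poly Q u)) \<longlongrightarrow> 1) (nhds 0)"
    using tendsto_mult by fastforce
  have "eventually (\<lambda>u. poly A (poly P u / poly Q u) \<noteq> 0) (nhds 0)"
    using eventually_compose_filterlim[OF eventually_poly_nonzero[OF AB(1)] l] .
  thus "eventually (\<lambda>u. h_form (homogenize d A P Q) (homogenize d B P Q) u ^ 12 =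
     ((poly Q u / poly Q 0) powr (- of_nat d / 12) * h_form A B (poly P u / poly Q u)) ^ 12) (nhds 0)"
    using eventually_poly_nonzero[OF PQ(2)]
  proof eventually_elim
    case (elim u)
    let ?x = "poly P u / poly Q u"
    note hA = poly_homogenize[OF d(1) elim(2), of P] and hB = poly_homogenize[OF d(2) elim(2), of P]
    have "h_form (homogenize d A P Q) (homogenize d B P Q) u ^ 12 =
       poly (homogenize d A P Q) 0 / poly (homogenize d A P Q) u * h1_hat (1728 * poly (homogenize d B P Q) u / poly (homogenize d A P Q) u) ^ 12"
      by (rule h_form_12) (use hA elim A0 PQ AB in auto)
    also have "\<dots> = (poly Q 0 / poly Q u) ^ d * (poly A 0 / poly A ?x * h1_hat (1728 * poly B ?x / poly A ?x) ^ 12)"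
      unfolding A0 hA hB using elim by (simp add: power_divide mult_ac)
    also have "(poly Q 0 / poly Q u) ^ d = ((poly Q u / poly Q 0) powr (- of_nat d / 12)) ^ 12"
      using elim PQ(2) by (subst powr_12) (auto simp: power_divide)
    also have "poly A 0 / poly A ?x * h1_hat (1728 * poly B ?x / poly A ?x) ^ 12 = h_form A B ?x ^ 12"
      by (rule h_form_12[symmetric]) (use elim AB in auto)
    finally show ?case by (simp only: power_mult_distrib)
  qed
qed

lemma h_fun_eq: "h_fun N t = h_form (fst (j_frac N)) (snd (j_frac N)) t"
  by (simp add: h_fun_def h_form_def case_prod_unfold Let_def)

text \<open>The hypothesis \<open>ex\<close> guarantees that the choice in \<open>j_frac\<close> has
  the intended property, and \<open>h_form_eq\<close> makes its outcome immaterial.\<close>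

lemma h_fun_eventually:
  fixes n :: nat
  assumes t: "q_holomorphic (hauptmodul N)" and ex: "lowest_terms modular_j (hauptmodul N) P Q" and n: "n > 0"
    and lt: "lowest_terms (\<lambda>\<tau>. modular_j (of_nat n * \<tau>)) (hauptmodul N) U V"
  shows "eventually (\<lambda>u. h_fun N u = h_form U V u) (nhds 0)"
proof -
  have "(case j_frac N of (P, Q) \<Rightarrow> lowest_terms modular_j (hauptmodul N) P Q)"
    unfolding j_frac_def by (rule someI[of _ "(P, Q)"]) (use ex in simp)
  hence "lowest_terms modular_j (hauptmodul N) (fst (j_frac N)) (snd (j_frac N))" by (simp add: case_prod_unfold)
  from h_form_eq[OF t n this lt] show ?thesis by (simp add: h_fun_eq)
qed

text \<open>Substituting t_M(n \<tau>), expressed in t_L, into the expression for j in t_M gives one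
  for j(n \<tau>) in t_L; this reduces the claim to the transformation of \<open>h_form\<close>
  under substitution.\<close>

theorem h_fun_compose:
  fixes n L M d :: nat
  assumes L: "q_holomorphic (hauptmodul L)" and M: "q_holomorphic (hauptmodul M)" and n: "n > 0"
    and AB: "lowest_terms modular_j (hauptmodul M) A B" "degree A = d" "degree B < d"
    and ex: "lowest_terms modular_j (hauptmodul L) P0 Q0"
    and lt: "lowest_terms (\<lambda>\<tau>. hauptmodul M (of_nat n * \<tau>)) (hauptmodul L) P Q"
  shows "eventually (\<lambda>u. h_fun L u = (poly Q u / poly Q 0) powr (- of_nat d / 12) * h_fun M (poly P u / poly Q u)) (nhds 0)"
proof -
  note A0 = lowest_terms_at_0[OF q_holomorphicD(2)[OF M] AB(1)]
  note P0 = lowest_terms_zero_at_0[OF q_holomorphicD(2)[OF L] tendsto_cusp_rescale(2)[OF q_holomorphicD(2)[OF M] n] lt]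
  have "eventually (\<lambda>u. h_fun L u = h_form (homogenize d A P Q) (homogenize d B P Q) u) (nhds 0)"
    by (rule h_fun_eventually[OF L ex n lowest_terms_compose[OF AB n lt]])
  moreover have "eventually (\<lambda>u. h_form (homogenize d A P Q) (homogenize d B P Q) u =
     (poly Q u / poly Q 0) powr (- of_nat d / 12) * h_form A B (poly P u / poly Q u)) (nhds 0)"
    by (rule h_form_homogenize[OF A0 _ _ P0]) (use AB in auto)
  moreover have "eventually (\<lambda>u. h_fun M (poly P u / poly Q u) = h_form A B (poly P u / poly Q u)) (nhds 0)"
  proof -
    note p = poly_tendsto_nhds_0
    have l: "((\<lambda>u. poly P u / poly Q u) \<longlongrightarrow> 0) (nhds 0)"
      using tendsto_divide[OF p[of P] p[of Q] P0(2)] P0(1) by simp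
    have "lowest_terms (\<lambda>\<tau>. modular_j (of_nat 1 * \<tau>)) (hauptmodul M) A B" using AB(1) by simp
    from eventually_compose_filterlim[OF h_fun_eventually[OF M AB(1) _ this] l] show ?thesis by simp
  qed
  ultimately show ?thesis by eventually_elim simp
qed

section \<open>Eta quotients\<close>

text \<open>The formula of \<open>hauptmodul\<close> with the eta values left open, so that the
  powers of q can be separated from the Euler products.\<close>

definition eta_quot :: "nat \<Rightarrow> (nat \<Rightarrow> complex) \<Rightarrow> complex" where
  "eta_quot N e = (
     if N = 2 then 2^12 * e 2 ^ 24 / e 1 ^ 24
     else if N = 3 then 3^6 * e 3 ^ 12 / e 1 ^ 12
     else if N = 4 then 2^8 * e 4 ^ 8 / e 1 ^ 8
     else if N = 5 then 5^3 * e 5 ^ 6 / e 1 ^ 6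
     else if N = 6 then 2^3 * 3^2 * (e 2 * e 6 ^ 5) / (e 1 ^ 5 * e 3)
     else if N = 7 then 7^2 * e 7 ^ 4 / e 1 ^ 4
     else if N = 8 then 2^5 * (e 2 ^ 2 * e 8 ^ 4) / (e 1 ^ 4 * e 4 ^ 2)
     else if N = 9 then 3^3 * e 9 ^ 3 / e 1 ^ 3
     else if N = 10 then 2^2 * 5 * (e 2 * e 10 ^ 3) / (e 1 ^ 3 * e 5)
     else if N = 12 then 2^2 * 3 * (e 2 ^ 2 * e 3 * e 12 ^ 3) / (e 1 ^ 3 * e 4 * e 6 ^ 2)
     else if N = 13 then 13 * e 13 ^ 2 / e 1 ^ 2
     else if N = 16 then 2^3 * (e 2 * e 16 ^ 2) / (e 1 ^ 2 * e 8)
     else if N = 18 then 2 * 3 * (e 2 * e 3 * e 18 ^ 2) / (e 1 ^ 2 * e 6 * e 9)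
     else if N = 25 then 5 * e 25 / e 1
     else 0)"

lemma hauptmodul_eta_quot: "hauptmodul N \<tau> = eta_quot N (\<lambda>m. dedekind_eta (of_nat m * \<tau>))"
  by (simp add: hauptmodul_def eta_quot_def Let_def)

text \<open>At every level the exponents, weighted by m, sum to 24; hence the factors q^(m/24) of
  the eta functions combine to a single q.\<close>

lemma eta_quot_homogeneous:
  assumes "N \<in> genus0_levels" "w \<noteq> 0" "\<And>m. e m \<noteq> 0"
  shows "eta_quot N (\<lambda>m. w ^ m * e m) = w ^ 24 * eta_quot N e"
proof -
  show ?thesis using assms(1) unfolding genus0_levels_def
    by (elim insertE emptyE)
       (simp_all add: eta_quot_def power_mult_distrib power_mult[symmetric] power_add[symmetric] assms field_simps,
        simp flip: power_Suc)
qed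

lemma eta_mult: "dedekind_eta (of_nat m * \<tau>) = nome (\<tau> / 24) ^ m * euler_prod (nome \<tau> ^ m)"
proof -
  have "of_nat m * \<tau> / 24 = of_nat m * (\<tau> / 24)" by simp
  thus ?thesis unfolding dedekind_eta_eq by (simp only: nome_mult_nat)
qed

lemma power_m_less_1: "norm (q::complex) < 1 \<Longrightarrow> m > 0 \<Longrightarrow> norm (q ^ m) < 1"
  using norm_power_less_1[of q "m - 1"] by simp

text \<open>This is t_N / q as a function of q. For m = 0 the argument q^0 lies outside the disc;
  the value 1 keeps all entries nonzero, as \<open>eta_quot_homogeneous\<close> asks.\<close>

definition haupt_u :: "nat \<Rightarrow> complex \<Rightarrow> complex" where
  "haupt_u N q = eta_quot N (\<lambda>m. if m = 0 then 1 else euler_prod (q ^ m))"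

lemma hauptmodul_q:
  assumes "N \<in> genus0_levels" "Im \<tau> > 0"
  shows "hauptmodul N \<tau> = nome \<tau> * haupt_u N (nome \<tau>)"
proof -
  let ?e = "\<lambda>m::nat. if m = 0 then 1 else euler_prod (nome \<tau> ^ m)"
  have nz: "?e m \<noteq> 0" for m
    using power_m_less_1[OF norm_nome_less_1[OF assms(2)], of m] euler_prod_nonzero by auto
  have "eta_quot N (\<lambda>m. nome (\<tau> / 24) ^ m * ?e m) = nome (\<tau> / 24) ^ 24 * eta_quot N ?e"
    by (rule eta_quot_homogeneous[OF assms(1) _ nz]) simp
  moreover have "eta_quot N (\<lambda>m. nome (\<tau> / 24) ^ m * ?e m) = hauptmodul N \<tau>"
    unfolding hauptmodul_eta_quot eta_mult unfolding eta_quot_def by simp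
  ultimately show ?thesis unfolding nome_24 haupt_u_def by simp
qed

lemma euler_prod_power_holomorphic: "m > 0 \<Longrightarrow> (\<lambda>q. euler_prod (q ^ m)) holomorphic_on ball 0 1"
  by (rule holomorphic_on_compose_gen[OF _ euler_prod_holomorphic, unfolded o_def])
     (use power_m_less_1 in \<open>auto intro!: holomorphic_intros\<close>)

lemma haupt_u_props:
  assumes "N \<in> genus0_levels"
  shows "haupt_u N holomorphic_on ball 0 1" "norm q < 1 \<Longrightarrow> haupt_u N q \<noteq> 0"
proof -
  have nz: "euler_prod (q ^ m) \<noteq> 0" if "norm q < 1" "m > 0" for q m
    using power_m_less_1[OF that] euler_prod_nonzero by blast
  show "haupt_u N holomorphic_on ball 0 1" using assms unfolding genus0_levels_def haupt_u_def
    by (elim insertE emptyE) (simp_all add: eta_quot_def, (intro holomorphic_intros euler_prod_holomorphic euler_prod_power_holomorphic; simp add: nz euler_prod_nonzero)+)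
  show "norm q < 1 \<Longrightarrow> haupt_u N q \<noteq> 0" using assms unfolding genus0_levels_def haupt_u_def
    by (elim insertE emptyE) (simp_all add: eta_quot_def nz euler_prod_nonzero)
qed

lemma hauptmodul_q_holomorphic:
  assumes "N \<in> genus0_levels"
  shows "q_holomorphic (hauptmodul N)"
  unfolding q_holomorphic_def
  by (rule exI[of _ "\<lambda>q. q * haupt_u N q"]) (use hauptmodul_q[OF assms] in \<open>auto intro!: holomorphic_intros haupt_u_props(1)[OF assms]\<close>)

lemma hauptmodul_nonzero: "N \<in> genus0_levels \<Longrightarrow> Im \<tau> > 0 \<Longrightarrow> hauptmodul N \<tau> \<noteq> 0"
  using hauptmodul_q haupt_u_props(2) norm_nome_less_1 by simp

lemma hauptmodul_plus_int:
  "N \<in> genus0_levels \<Longrightarrow> Im \<tau> > 0 \<Longrightarrow> hauptmodul N (\<tau> + of_int n) = hauptmodul N \<tau>"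
  using hauptmodul_q[of N \<tau>] hauptmodul_q[of N "\<tau> + of_int n"] by (simp only: nome_plus_int) simp

section \<open>Transformation laws of Delta, eta and the Hauptmodul\<close>

text \<open>The lattice sums transform under a whole matrix at once, and 1728 Delta is a polynomial
  in E4 and E6.\<close>

lemma Delta_moebius:
  fixes a b c d :: int
  assumes det: "a * d - b * c = 1" and \<tau>: "Im \<tau> > 0"
  shows "Delta ((of_int a * \<tau> + of_int b) / (of_int c * \<tau> + of_int d)) = (of_int c * \<tau> + of_int d) ^ 12 * Delta \<tau>"
proof -
  let ?m = "(of_int a * \<tau> + of_int b) / (of_int c * \<tau> + of_int d)" and ?w = "of_int c * \<tau> + of_int d"
  have 4: "E4 ?m ^ 3 = ?w ^ 12 * E4 \<tau> ^ 3" and 6: "E6 ?m ^ 2 = ?w ^ 12 * E6 \<tau> ^ 2"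
    by (simp_all add: E4_def E6_def eisenstein_G_moebius[OF det \<tau>] power_mult_distrib power_divide power_mult[symmetric])
  have "1728 * Delta ?m = ?w ^ 12 * (1728 * Delta \<tau>)"
    unfolding discriminant_eq[OF \<tau>, symmetric] discriminant_eq[OF Im_moebius(2)[OF det \<tau>], symmetric] 4 6
    by (simp add: right_diff_distrib)
  thus ?thesis by simp
qed

lemma eta_holomorphic: "dedekind_eta holomorphic_on uhp"
  unfolding dedekind_eta_eq[abs_def]
  by (intro holomorphic_intros holomorphic_nome_compose euler_prod_holomorphic) auto

lemma eta_nonzero: "Im \<tau> > 0 \<Longrightarrow> dedekind_eta \<tau> \<noteq> 0"
  by (simp add: dedekind_eta_eq euler_prod_nonzero norm_nome_less_1)

text \<open>A continuous function with finitely many values on a connected set is constant.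
  Multipliers can therefore be evaluated at one convenient point.\<close>

lemma root_of_unity_valued_constant:
  assumes "g holomorphic_on uhp" "k > 0" "\<And>\<tau>. Im \<tau> > 0 \<Longrightarrow> g \<tau> ^ k = (1::complex)"
  obtains c where "\<And>\<tau>. Im \<tau> > 0 \<Longrightarrow> g \<tau> = c"
proof -
  have "g ` uhp \<subseteq> {z. z ^ k = 1}" using assms(3) by auto
  hence "finite (g ` uhp)" using finite_roots_unity[of k, where 'a = complex] assms(2) finite_subset by (metis One_nat_def Suc_leI)
  hence "g constant_on uhp"
    by (rule continuous_finite_range_constant[OF connected_uhp holomorphic_on_imp_continuous_on[OF assms(1)]])
  thus ?thesis using that unfolding constant_on_def by auto
qed

text \<open>Squaring avoids the square root of \<tau>/\<i>. By \<open>Delta_inversion\<close> the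
  quotient of the sides has twelfth power 1, and its value is found at \<i>.\<close>

lemma eta_inversion_square:
  assumes \<tau>: "Im \<tau> > 0"
  shows "dedekind_eta (- 1 / \<tau>) ^ 2 = (\<tau> / \<i>) * dedekind_eta \<tau> ^ 2"
proof -
  define g where "g = (\<lambda>\<tau>. dedekind_eta (- 1 / \<tau>) ^ 2 / ((\<tau> / \<i>) * dedekind_eta \<tau> ^ 2))"
  have nz: "\<tau> \<noteq> 0" if "Im \<tau> > 0" for \<tau> using that by auto
  have ih: "(\<lambda>\<tau>. dedekind_eta (- 1 / \<tau>)) holomorphic_on uhp"
    by (rule holomorphic_on_compose_gen[OF _ eta_holomorphic, unfolded o_def])
       (use Im_inversion nz in \<open>auto intro!: holomorphic_intros\<close>)
  have gh: "g holomorphic_on uhp" unfolding g_def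
    by (intro holomorphic_intros ih eta_holomorphic) (use nz eta_nonzero in auto)
  have "g \<tau> ^ 12 = 1" if \<tau>: "Im \<tau> > 0" for \<tau>
  proof -
    have a: "(dedekind_eta x ^ 2) ^ 12 = Delta x" for x by (simp add: eta_24 flip: power_mult)
    have "\<i> ^ 12 = (\<i> ^ 2) ^ 6" by (simp only: power_mult[symmetric]) simp
    hence "(\<tau> / \<i>) ^ 12 = \<tau> ^ 12" by (simp add: power_divide power_mult_distrib)
    hence "g \<tau> ^ 12 = Delta (- 1 / \<tau>) / (\<tau> ^ 12 * Delta \<tau>)"
      unfolding g_def power_divide[of _ _ 12] power_mult_distrib a by simp
    thus ?thesis using Delta_inversion[OF \<tau>] Delta_nonzero[OF \<tau>] nz[OF \<tau>] by simp
  qed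
  then obtain c where c: "\<And>\<tau>. Im \<tau> > 0 \<Longrightarrow> g \<tau> = c" using root_of_unity_valued_constant[OF gh, of 12] by auto
  have "g \<i> = 1" using eta_nonzero[of \<i>] by (simp add: g_def)
  hence "g \<tau> = 1" using c[of \<i>] c[OF \<tau>] by simp
  thus ?thesis unfolding g_def divide_eq_1_iff by blast
qed

text \<open>For these p the exponent 24/(p - 1) of eta is even, so
  \<open>eta_inversion_square\<close> applies. The factors \<tau>/\<i> cancel between numerator and
  denominator.\<close>

lemma Fricke_inversion:
  assumes p: "p \<in> {2, 3, 5}" and \<tau>: "Im \<tau> > 0"
  shows "hauptmodul p (- 1 / (of_nat p * \<tau>)) * hauptmodul p \<tau> = of_nat p ^ (12 div (p - 1))"
proof -
  define k where "k = 12 div (p - 1)"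
  let ?e = dedekind_eta
  have p0: "p > 0" using p by auto
  have h: "hauptmodul p \<sigma> = of_nat p ^ k * (?e (of_nat p * \<sigma>) ^ 2) ^ k / (?e \<sigma> ^ 2) ^ k" for \<sigma>
    using p by (auto simp: hauptmodul_def Let_def k_def power_mult[symmetric])
  have p\<tau>: "Im (of_nat p * \<tau>) > 0" using \<tau> p0 by simp
  have "of_nat p * (- 1 / (of_nat p * \<tau>)) = - 1 / \<tau>" using p0 by simp
  hence "hauptmodul p (- 1 / (of_nat p * \<tau>)) = of_nat p ^ k * ((\<tau> / \<i>) * ?e \<tau> ^ 2) ^ k / ((of_nat p * \<tau> / \<i>) * ?e (of_nat p * \<tau>) ^ 2) ^ k"
    unfolding h by (simp only: eta_inversion_square[OF \<tau>] eta_inversion_square[OF p\<tau>])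
  also have "\<dots> = (?e \<tau> ^ 2) ^ k / (?e (of_nat p * \<tau>) ^ 2) ^ k"
  proof -
    have "\<tau> / \<i> \<noteq> 0" using \<tau> by auto
    moreover have "a ^ k * (b * x) ^ k / (a * b * y) ^ k = x ^ k / y ^ k" if "a \<noteq> 0" "b \<noteq> 0" for a b x y :: complex
      using that by (simp add: power_mult_distrib)
    moreover have "of_nat p * \<tau> / \<i> = of_nat p * (\<tau> / \<i>)" by simp
    moreover have "(of_nat p :: complex) \<noteq> 0" using p0 by simp
    ultimately show ?thesis by metis
  qed
  finally show ?thesis unfolding h[of \<tau>] k_def[symmetric]
    using eta_nonzero[OF \<tau>] eta_nonzero[OF p\<tau>] by simp
qed

section \<open>The relation between j and the Hauptmodul: levels 2, 3 and 5\<close>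

text \<open>Congruence of power series modulo \<open>q\<^sup>k\<close>, stated for holomorphic functions.\<close>

definition qcong :: "nat \<Rightarrow> (complex \<Rightarrow> complex) \<Rightarrow> (complex \<Rightarrow> complex) \<Rightarrow> bool" where
  "qcong k f g \<longleftrightarrow> (\<exists>h. h holomorphic_on ball 0 1 \<and> (\<forall>q. norm q < 1 \<longrightarrow> f q = g q + q ^ k * h q))"

lemma qcongI: "h holomorphic_on ball 0 1 \<Longrightarrow> (\<And>q. norm q < 1 \<Longrightarrow> f q = g q + q ^ k * h q) \<Longrightarrow> qcong k f g"
  unfolding qcong_def by blast

lemma qcongE:
  assumes "qcong k f g"
  obtains h where "h holomorphic_on ball 0 1" "\<And>q. norm q < 1 \<Longrightarrow> f q = g q + q ^ k * h q"
  using assms unfolding qcong_def by blast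

lemma qcong_refl: "qcong k f f"
  by (rule qcongI[of "\<lambda>_. 0"]) auto

lemma qcong_sym: "qcong k f g \<Longrightarrow> qcong k g f"
  by (elim qcongE, rule_tac h = "\<lambda>q. - h q" in qcongI) (auto intro!: holomorphic_intros)

lemma qcong_trans [trans]:
  assumes "qcong k f g" "qcong k g h"
  shows "qcong k f h"
proof -
  obtain u where u: "u holomorphic_on ball 0 1" "\<And>q. norm q < 1 \<Longrightarrow> f q = g q + q ^ k * u q" using assms(1) qcongE by blast
  obtain v where v: "v holomorphic_on ball 0 1" "\<And>q. norm q < 1 \<Longrightarrow> g q = h q + q ^ k * v q" using assms(2) qcongE by blast
  show ?thesis
    by (rule qcongI[of "\<lambda>q. u q + v q"]) (auto intro!: holomorphic_intros u(1) v(1) simp: u(2) v(2) algebra_simps)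
qed

lemma qcong_add:
  assumes "qcong k f g" "qcong k f' g'"
  shows "qcong k (\<lambda>q. f q + f' q) (\<lambda>q. g q + g' q)"
proof -
  obtain u where u: "u holomorphic_on ball 0 1" "\<And>q. norm q < 1 \<Longrightarrow> f q = g q + q ^ k * u q" using assms(1) qcongE by blast
  obtain v where v: "v holomorphic_on ball 0 1" "\<And>q. norm q < 1 \<Longrightarrow> f' q = g' q + q ^ k * v q" using assms(2) qcongE by blast
  show ?thesis
    by (rule qcongI[of "\<lambda>q. u q + v q"]) (auto intro!: holomorphic_intros u(1) v(1) simp: u(2) v(2) algebra_simps)
qed

lemma qcong_mult:
  assumes "qcong k f g" "qcong k f' g'" "g holomorphic_on ball 0 1" "f' holomorphic_on ball 0 1"
  shows "qcong k (\<lambda>q. f q * f' q) (\<lambda>q. g q * g' q)"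
proof -
  obtain h where h: "h holomorphic_on ball 0 1" "\<And>q. norm q < 1 \<Longrightarrow> f q = g q + q ^ k * h q" using assms(1) qcongE by blast
  obtain h' where h': "h' holomorphic_on ball 0 1" "\<And>q. norm q < 1 \<Longrightarrow> f' q = g' q + q ^ k * h' q" using assms(2) qcongE by blast
  show ?thesis
  proof (rule qcongI[of "\<lambda>q. h q * f' q + g q * h' q"])
    show "(\<lambda>q. h q * f' q + g q * h' q) holomorphic_on ball 0 1" by (intro holomorphic_intros h h' assms)
    fix q :: complex assume q: "norm q < 1"
    have "f q * f' q = g q * f' q + q ^ k * h q * f' q" using h(2)[OF q] by (simp add: algebra_simps)
    also have "g q * f' q = g q * g' q + q ^ k * (g q * h' q)" using h'(2)[OF q] by (simp add: algebra_simps)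
    finally show "f q * f' q = g q * g' q + q ^ k * (h q * f' q + g q * h' q)" by (simp add: algebra_simps)
  qed
qed

lemma qcong_power:
  assumes "qcong k f g" "g holomorphic_on ball 0 1" "f holomorphic_on ball 0 1"
  shows "qcong k (\<lambda>q. f q ^ n) (\<lambda>q. g q ^ n)"
proof (induction n)
  case (Suc n)
  show ?case unfolding power_Suc by (intro qcong_mult assms Suc holomorphic_intros)
qed (simp add: qcong_refl)

lemma qcong_mono: "qcong k f g \<Longrightarrow> l \<le> k \<Longrightarrow> qcong l f g"
  by (elim qcongE, rule_tac h = "\<lambda>q. q ^ (k - l) * h q" in qcongI)
     (auto intro!: holomorphic_intros simp flip: power_add mult.assoc)

text \<open>A holomorphic function that is O(q^k) at 0 can be divided by q, one factor at a time, k
  times.\<close>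

lemma qcong_of_bound:
  assumes "f holomorphic_on ball 0 1" "g holomorphic_on ball 0 1"
    and "eventually (\<lambda>q. norm (f q - g q) \<le> C * norm q ^ k) (at 0)"
  shows "qcong k f g"
proof -
  have "\<exists>h. h holomorphic_on ball 0 1 \<and> (\<forall>q. norm q < 1 \<longrightarrow> F q = q ^ k * h q)"
    if "F holomorphic_on ball 0 1" "eventually (\<lambda>q. norm (F q) \<le> C * norm q ^ k) (at 0)" for F
    using that
  proof (induction k arbitrary: F)
    case 0
    thus ?case by (intro exI[of _ F]) auto
  next
    case (Suc k)
    have "((\<lambda>q::complex. C * norm q ^ Suc k) \<longlongrightarrow> C * norm (0::complex) ^ Suc k) (at 0)"
      by (intro tendsto_intros)
    hence "(F \<longlongrightarrow> 0) (at 0)" using Suc.prems(2) by (intro Lim_null_comparison[OF Suc.prems(2)]) simp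
    moreover have "isCont F 0"
      using Suc.prems(1) holomorphic_on_imp_continuous_on continuous_on_interior by fastforce
    hence "(F \<longlongrightarrow> F 0) (at 0)" by (simp add: isCont_def)
    ultimately have "F 0 = 0" by (metis tendsto_unique at_neq_bot)
    then obtain H where H: "H holomorphic_on ball 0 1" "\<And>q. F q = q * H q"
      using holomorphic_factor_zero[OF Suc.prems(1)] by blast
    have "eventually (\<lambda>q. norm (H q) \<le> C * norm q ^ k) (at 0)"
      using Suc.prems(2) eventually_neq_at_within[of 0 0 UNIV]
    proof eventually_elim
      case (elim q)
      hence "norm q * norm (H q) \<le> norm q * (C * norm q ^ k)" by (simp add: H(2) norm_mult mult_ac)
      thus ?case using elim by simp
    qed
    then obtain h where h: "h holomorphic_on ball 0 1" "\<forall>q. norm q < 1 \<longrightarrow> H q = q ^ k * h q"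
      using Suc.IH[OF H(1)] by blast
    thus ?case using H(2) by (intro exI[of _ h]) auto
  qed
  from this[of "\<lambda>q. f q - g q"] obtain h where h: "h holomorphic_on ball 0 1" "\<forall>q. norm q < 1 \<longrightarrow> f q - g q = q ^ k * h q"
    using assms by (auto intro!: holomorphic_intros)
  show ?thesis by (rule qcongI[OF h(1)]) (use h(2) in \<open>simp add: algebra_simps\<close>)
qed

section \<open>The Euler product and its powers modulo q^p\<close>

lemma euler_prod_LIMSEQ:
  assumes "norm q < 1"
  shows "(\<lambda>n. \<Prod>i\<le>n. 1 - q ^ Suc i) \<longlonglongrightarrow> euler_prod q"
proof -
  have "summable (\<lambda>i. norm q ^ Suc i)" using assms by (simp add: summable_mult summable_geometric)
  hence "summable (\<lambda>i. norm (1 - q ^ Suc i - 1))" by (simp add: norm_power norm_mult)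
  hence "convergent_prod (\<lambda>i. 1 - q ^ Suc i)"
    using abs_convergent_prod_conv_summable abs_convergent_prod_imp_convergent_prod by blast
  from convergent_prod_LIMSEQ[OF this] show ?thesis unfolding euler_prod_def .
qed

text \<open>The first four factors determine the product modulo q^5, the precision used at level 5.
  The tail is estimated through 1 + |x| <= exp |x|.\<close>

lemma euler_prod_qcong: "qcong 5 euler_prod (\<lambda>q. 1 - q - q ^ 2)"
proof -
  let ?P = "\<lambda>q::complex. \<Prod>i\<in>{..<4}. 1 - q ^ Suc i"
  have Ph: "?P holomorphic_on ball 0 1" by (intro holomorphic_intros)
  have P: "?P q = (1 - q) * (1 - q ^ 2) * (1 - q ^ 3) * (1 - q ^ 4)" for q
    by (simp add: eval_nat_numeral lessThan_Suc mult_ac)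
  have "qcong 5 euler_prod ?P"
  proof (rule qcong_of_bound[OF euler_prod_holomorphic Ph, of 64])
    have "eventually (\<lambda>q::complex. norm q < 1/2) (at 0)"
      unfolding eventually_at by (rule exI[of _ "1/2"]) auto
    thus "eventually (\<lambda>q. norm (euler_prod q - ?P q) \<le> 64 * norm q ^ 5) (at 0)"
    proof eventually_elim
      case (elim q)
      define r where "r = norm q"
      have r: "0 \<le> r" "r < 1/2" using elim by (auto simp: r_def)
      have x1: "2 * r ^ 5 \<le> 1"
      proof -
        have "r ^ 5 \<le> (1/2) ^ 5" using r by (intro power_mono) auto
        thus ?thesis by (simp add: power_divide)
      qed
      \<comment> \<open>The constant is 16 * 4: each of the four factors has norm at most 2, and the
        remaining product differs from 1 by at most 4 r^5.\<close>
      have part: "norm ((\<Prod>i\<le>n. 1 - q ^ Suc i) - ?P q) \<le> 64 * r ^ 5" if n: "n \<ge> 4" for n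
      proof -
        let ?R = "\<Prod>i\<in>{4..n}. 1 + (- (q ^ Suc i))"
        have "{..n} = {..<4} \<union> {4..n}" using n by auto
        hence "(\<Prod>i\<le>n. 1 - q ^ Suc i) = ?P q * ?R"
          by (simp only:) (subst prod.union_disjoint, auto)
        hence "(\<Prod>i\<le>n. 1 - q ^ Suc i) - ?P q = ?P q * (?R - 1)" by (simp add: algebra_simps)
        moreover have B: "norm (?R - 1) \<le> 4 * r ^ 5"
        proof -
          have "norm (?R - 1) \<le> (\<Prod>i\<in>{4..n}. 1 + norm (- (q ^ Suc i))) - 1"
            by (rule norm_prod_minus1_le_prod_minus1)
          also have "(\<Prod>i\<in>{4..n}. 1 + norm (- (q ^ Suc i))) \<le> exp (\<Sum>i\<in>{4..n}. norm (- (q ^ Suc i)))"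
            by (rule prod_le_exp_sum) auto
          also have "(\<Sum>i\<in>{4..n}. norm (- (q ^ Suc i))) = (\<Sum>i\<in>{4..n}. r ^ Suc i)"
            by (simp only: norm_minus_cancel norm_power r_def)
          also have "(\<Sum>i\<in>{4..n}. r ^ Suc i) = r ^ 5 * (\<Sum>i\<in>{..n-4}. r ^ i)"
          proof -
            have "(\<Sum>i\<in>{4..n}. r ^ Suc i) = (\<Sum>i\<in>{..n-4}. r ^ (5 + i))"
              by (rule sum.reindex_bij_witness[of _ "\<lambda>i. i + 4" "\<lambda>i. i - 4"]) (use n in auto)
            thus ?thesis by (simp add: power_add sum_distrib_left)
          qed
          also have "(\<Sum>i\<in>{..n-4}. r ^ i) \<le> 2"
          proof -
            have "(\<Sum>i\<in>{..n-4}. r ^ i) = (1 - r ^ Suc (n - 4)) / (1 - r)"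
              using r sum_gp0[of r "n - 4"] by simp
            also have "\<dots> \<le> 1 / (1/2)" using r by (intro frac_le) auto
            finally show ?thesis by simp
          qed
          finally have "norm (?R - 1) \<le> exp (r ^ 5 * 2) - 1" using r by (simp add: mult_left_mono)
          also have "exp (r ^ 5 * 2) \<le> 1 + r ^ 5 * 2 + (r ^ 5 * 2)\<^sup>2" using x1 r by (intro exp_bound) auto
          also have "(r ^ 5 * 2)\<^sup>2 \<le> r ^ 5 * 2" unfolding power2_eq_square by (rule mult_left_le) (use x1 r in auto)
          finally show ?thesis by simp
        qed
        moreover have C: "norm (?P q) \<le> 16"
        proof -
          have "norm (1 - q ^ Suc i) \<le> 2" for i
          proof -
            have "norm (q ^ Suc i) \<le> 1" unfolding norm_power using elim by (intro power_le_one) auto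
            thus ?thesis using norm_triangle_ineq4[of 1 "q ^ Suc i"] by simp
          qed
          hence "(\<Prod>i\<in>{..<4::nat}. norm (1 - q ^ Suc i)) \<le> (\<Prod>i\<in>{..<4::nat}. 2)"
            by (intro prod_mono) auto
          thus ?thesis unfolding prod_norm by simp
        qed
        moreover have "norm (?P q * (?R - 1)) \<le> 16 * (4 * r ^ 5)"
          unfolding norm_mult by (rule mult_mono[OF C B]) auto
        ultimately show ?thesis by simp
      qed
      have "(\<lambda>n. norm ((\<Prod>i\<le>n. 1 - q ^ Suc i) - ?P q)) \<longlonglongrightarrow> norm (euler_prod q - ?P q)"
        using elim by (intro tendsto_intros euler_prod_LIMSEQ) auto
      thus ?case unfolding r_def[symmetric]
        by (rule LIMSEQ_le_const2) (use part in auto)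
    qed
  qed
  also have "qcong 5 ?P (\<lambda>q. 1 - q - q ^ 2)"
    by (rule qcongI[of "\<lambda>q. 2 - q ^ 3 - q ^ 4 + q ^ 5"])
       (auto intro!: holomorphic_intros simp: P algebra_simps eval_nat_numeral)
  finally show ?thesis .
qed

text \<open>The terms below q^p of \<open>euler_prod\<close> to the power 24/(p - 1). Up to a
  constant this is the reciprocal of t_p / q modulo q^p. The last branch belongs to p = 5.\<close>

definition trunc_v :: "nat \<Rightarrow> complex \<Rightarrow> complex" where
  "trunc_v p q = (if p = 2 then 1 - 24 * q else if p = 3 then 1 - 12 * q + 54 * q ^ 2
     else 1 - 6 * q + 9 * q ^ 2 + 10 * q ^ 3 - 30 * q ^ 4)"

lemma trunc_v_holomorphic: "trunc_v p holomorphic_on A"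
  unfolding trunc_v_def by (cases "p = 2"; cases "p = 3") (auto intro!: holomorphic_intros)

text \<open>A power followed by truncation: r collects what g^n contributes from q^k
  onwards.\<close>

lemma qcong_power_step:
  assumes "qcong k (\<lambda>q. f q ^ m) g" "f holomorphic_on ball 0 1" "g holomorphic_on ball 0 1" "r holomorphic_on ball 0 1"
    "\<And>q. g q ^ n = h q + q ^ k * r q"
  shows "qcong k (\<lambda>q. f q ^ (m * n)) h"
proof -
  have "qcong k (\<lambda>q. f q ^ (m * n)) (\<lambda>q. g q ^ n)"
    unfolding power_mult by (intro qcong_power assms holomorphic_intros)
  also have "qcong k (\<lambda>q. g q ^ n) h" by (rule qcongI[OF assms(4)]) (rule assms(5))
  finally show ?thesis .
qed

lemma euler_prod_power_qcong:
  assumes "p \<in> {2, 3, 5}"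
  shows "qcong p (\<lambda>q. euler_prod q ^ (2 * (12 div (p - 1)))) (trunc_v p)"
proof -
  have E: "qcong p (\<lambda>q. euler_prod q ^ 1) (\<lambda>q. 1 - q - q ^ 2)"
    using qcong_mono[OF euler_prod_qcong, of p] assms by auto
  note step = qcong_power_step[OF _ euler_prod_holomorphic]
  consider "p = 2" | "p = 3" | "p = 5" using assms by auto
  thus ?thesis
  proof cases
    case 1
    \<comment> \<open>The exponent 24 is reached as 2 * 2 * 2 * 3, with truncation after each factor
      to keep the expansions short.\<close>
    have a: "qcong 2 (\<lambda>q. euler_prod q ^ (1 * 2)) (\<lambda>q. (1) + (-2) * q ^ 1)"
      by (rule step[OF E[unfolded 1], where r = "\<lambda>q. (-1) + (2) * q ^ 1 + (1) * q ^ 2"]) (auto intro!: holomorphic_intros simp: algebra_simps eval_nat_numeral)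
    have aa: "qcong 2 (\<lambda>q. euler_prod q ^ (1 * 2 * 2)) (\<lambda>q. (1) + (-4) * q ^ 1)"
      by (rule step[OF a, where r = "\<lambda>q. (4)"]) (auto intro!: holomorphic_intros simp: algebra_simps eval_nat_numeral)
    have aaa: "qcong 2 (\<lambda>q. euler_prod q ^ (1 * 2 * 2 * 2)) (\<lambda>q. (1) + (-8) * q ^ 1)"
      by (rule step[OF aa, where r = "\<lambda>q. (16)"]) (auto intro!: holomorphic_intros simp: algebra_simps eval_nat_numeral)
    have aaaa: "qcong 2 (\<lambda>q. euler_prod q ^ (1 * 2 * 2 * 2 * 3)) (\<lambda>q. (1) + (-24) * q ^ 1)"
      by (rule step[OF aaa, where r = "\<lambda>q. (192) + (-512) * q ^ 1"]) (auto intro!: holomorphic_intros simp: algebra_simps eval_nat_numeral)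
    show ?thesis using aaaa by (simp add: trunc_v_def[abs_def] 1)
  next
    case 2
    have a: "qcong 3 (\<lambda>q. euler_prod q ^ (1 * 2)) (\<lambda>q. (1) + (-2) * q ^ 1 + (-1) * q ^ 2)"
      by (rule step[OF E[unfolded 2], where r = "\<lambda>q. (2) + (1) * q ^ 1"]) (auto intro!: holomorphic_intros simp: algebra_simps eval_nat_numeral)
    have aa: "qcong 3 (\<lambda>q. euler_prod q ^ (1 * 2 * 2)) (\<lambda>q. (1) + (-4) * q ^ 1 + (2) * q ^ 2)"
      by (rule step[OF a, where r = "\<lambda>q. (4) + (1) * q ^ 1"]) (auto intro!: holomorphic_intros simp: algebra_simps eval_nat_numeral)
    have aaa: "qcong 3 (\<lambda>q. euler_prod q ^ (1 * 2 * 2 * 3)) (\<lambda>q. (1) + (-12) * q ^ 1 + (54) * q ^ 2)"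
      by (rule step[OF aa, where r = "\<lambda>q. (-112) + (108) * q ^ 1 + (-48) * q ^ 2 + (8) * q ^ 3"]) (auto intro!: holomorphic_intros simp: algebra_simps eval_nat_numeral)
    show ?thesis using aaa by (simp add: trunc_v_def[abs_def] 2)
  next
    case 3
    have a: "qcong 5 (\<lambda>q. euler_prod q ^ (1 * 2)) (\<lambda>q. (1) + (-2) * q ^ 1 + (-1) * q ^ 2 + (2) * q ^ 3 + (1) * q ^ 4)"
      by (rule step[OF E[unfolded 3], where r = "\<lambda>q. 0"]) (auto intro!: holomorphic_intros simp: algebra_simps eval_nat_numeral)
    have aa: "qcong 5 (\<lambda>q. euler_prod q ^ (1 * 2 * 3)) (\<lambda>q. (1) + (-6) * q ^ 1 + (9) * q ^ 2 + (10) * q ^ 3 + (-30) * q ^ 4)"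
      by (rule step[OF a, where r = "\<lambda>q. (-6) + (41) * q ^ 1 + (6) * q ^ 2 + (-30) * q ^ 3 + (-10) * q ^ 4 + (9) * q ^ 5 + (6) * q ^ 6 + (1) * q ^ 7"]) (auto intro!: holomorphic_intros simp: algebra_simps eval_nat_numeral)
    show ?thesis using aa by (simp add: trunc_v_def[abs_def] 3)
  qed
qed

section \<open>The relation between j and t_p at the two cusps of level p\<close>

lemma euler_prod_deriv_0: "(euler_prod has_field_derivative -1) (at 0)"
  using euler_prod_deriv[of 0] by (simp add: deriv_log_euler_prod_0)

lemma j_q_deriv_0: "(j_q has_field_derivative 744) (at 0)"
  unfolding j_q_def[abs_def]
  by (rule DERIV_cong[OF DERIV_divide[OF DERIV_power[OF e4_deriv_0, of 3] DERIV_power[OF euler_prod_deriv_0, of 24]]]) simp_all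

text \<open>The numerator of j = \<open>j_num p t 1\<close> / t, made homogeneous of degree p + 1 in
  v and r. Near the other cusp, where t has a pole, t is written as v/r.\<close>

definition j_num :: "nat \<Rightarrow> complex \<Rightarrow> complex \<Rightarrow> complex" where
  "j_num p v r = (if p = 2 then (v + 16 * r) ^ 3 else if p = 3 then (v + 27 * r) * (v + 3 * r) ^ 3
     else (v ^ 2 + 10 * (v * r) + 5 * r ^ 2) ^ 3)"

lemma j_num_scale:
  assumes "p \<in> {2, 3, 5}" "r \<noteq> 0"
  shows "j_num p (v / r) 1 = j_num p v r / r ^ (p + 1)"
proof -
  have a: "v / r + c = (v + c * r) / r" "(v / r) ^ 2 + 10 * v / r + 5 = (v ^ 2 + 10 * (v * r) + 5 * r ^ 2) / r ^ 2" for c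
    using assms(2) by (simp_all add: field_simps power2_eq_square)
  have "r * r ^ 3 = r ^ 4" "r ^ 3 * r = r ^ 4" "(r ^ 2) ^ 3 = r ^ 6" by (simp_all add: eval_nat_numeral)
  thus ?thesis using assms(1)
    by (elim insertE emptyE) (simp_all add: j_num_def a, simp_all add: power_divide)
qed

lemma haupt_u_prime:
  assumes "p \<in> {2, 3, 5}" "norm q < 1"
  shows "haupt_u p q = of_nat p ^ (12 div (p - 1)) * (euler_prod (q ^ p) ^ (2 * (12 div (p - 1))) / euler_prod q ^ (2 * (12 div (p - 1))))"
  using assms(1) by (elim insertE emptyE) (simp_all add: haupt_u_def eta_quot_def)

lemma prime_in_levels: "p \<in> {2, 3, 5} \<Longrightarrow> p \<in> genus0_levels"
  by (auto simp: genus0_levels_def)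

lemma haupt_u_deriv_0:
  assumes p: "p \<in> {2, 3, 5}"
  shows "haupt_u p 0 = of_nat p ^ (12 div (p - 1))"
    "(haupt_u p has_field_derivative of_nat p ^ (12 div (p - 1)) * of_nat (2 * (12 div (p - 1)))) (at 0)"
proof -
  let ?m = "2 * (12 div (p - 1))"
  have p0: "p > 1" using p by auto
  show u0: "haupt_u p 0 = of_nat p ^ (12 div (p - 1))" using haupt_u_prime[OF p, of 0] p0 by (simp add: power_0_left)
  have "((\<lambda>q. q ^ p) has_field_derivative 0) (at (0::complex))"
    using p0 by (auto intro!: derivative_eq_intros simp: power_0_left)
  moreover have "(euler_prod has_field_derivative -1) (at (0 ^ p))" using euler_prod_deriv_0 p0 by (simp add: power_0_left)
  ultimately have "((\<lambda>q. euler_prod (q ^ p)) has_field_derivative 0) (at 0)"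
    using DERIV_chain2[of euler_prod "-1" "\<lambda>q. q ^ p" 0 0 UNIV] by simp
  note d = DERIV_divide[OF DERIV_power[OF this, of ?m] DERIV_power[OF euler_prod_deriv_0, of ?m]]
  have "((\<lambda>q. of_nat p ^ (12 div (p - 1)) * (euler_prod (q ^ p) ^ ?m / euler_prod q ^ ?m)) has_field_derivative
     of_nat p ^ (12 div (p - 1)) * of_nat ?m) (at 0)"
    by (rule DERIV_cong[OF DERIV_cmult[OF d]]) (use p0 in \<open>simp_all add: power_0_left\<close>)
  thus "(haupt_u p has_field_derivative of_nat p ^ (12 div (p - 1)) * of_nat ?m) (at 0)"
    by (rule has_field_derivative_transform_within_open[of _ _ _ "ball 0 1"]) (use haupt_u_prime[OF p] in auto)
qed

lemma j_num_holomorphic: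
  "f holomorphic_on A \<Longrightarrow> g holomorphic_on A \<Longrightarrow> (\<lambda>q. j_num p (f q) (g q)) holomorphic_on A"
  unfolding j_num_def by (cases "p = 2"; cases "p = 3") (auto intro!: holomorphic_intros)

text \<open>Both terms of the difference have the expansion 1/q + 744 + ..., so the pole and the
  constant term cancel.\<close>

lemma level_relation_at_infinity:
  assumes p: "p \<in> {2, 3, 5}"
  shows "((\<lambda>\<tau>. j_num p (hauptmodul p \<tau>) 1 / hauptmodul p \<tau> - modular_j \<tau>) \<longlongrightarrow> 0) cusp"
proof -
  note lv = prime_in_levels[OF p]
  let ?u = "haupt_u p"
  note u0 = haupt_u_deriv_0[OF p]
  define N where "N = (\<lambda>q. j_num p (q * ?u q) 1 / ?u q - j_q q)"
  have Nh: "N holomorphic_on ball 0 1" unfolding N_def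
    by (intro holomorphic_intros j_num_holomorphic haupt_u_props(1)[OF lv] j_q_holomorphic) (use haupt_u_props(2)[OF lv] in auto)
  have "j_num p 0 1 = of_nat p ^ (12 div (p - 1))" using p by (elim insertE emptyE) (simp_all add: j_num_def)
  hence N0: "N 0 = 0" using p by (auto simp: N_def u0(1))
  have qu: "((\<lambda>q. q * ?u q) has_field_derivative ?u 0) (at 0)"
    using DERIV_mult[OF DERIV_ident u0(2)] by simp
  \<comment> \<open>The linear coefficient of \<open>j_num p z 1\<close>: 768, 756 and 750 for p =
    2, 3 and 5. The excess over 744 compensates the linear term of \<open>haupt_u\<close>.\<close>
  define D :: complex where "D = 744 + of_nat (2 * (12 div (p - 1)))"
  have "((\<lambda>z. j_num p z 1) has_field_derivative D) (at 0)"
    unfolding j_num_def D_def using p by (elim insertE emptyE) (auto intro!: derivative_eq_intros)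
  hence D: "((\<lambda>q. j_num p (q * ?u q) 1) has_field_derivative D * ?u 0) (at 0)"
    using DERIV_chain2[of "\<lambda>z. j_num p z 1" D "\<lambda>q. q * ?u q" 0, OF _ qu] by simp
  have unz: "?u 0 \<noteq> 0" using haupt_u_props(2)[OF lv, of 0] by simp
  have j0: "j_num p (0 * ?u 0) 1 = ?u 0" using N0 unz unfolding N_def by simp
  have "(N has_field_derivative 0) (at 0)" unfolding N_def
    by (rule DERIV_cong[OF DERIV_diff[OF DERIV_divide[OF D u0(2) unz] j_q_deriv_0]])
       (use unz j0 D_def u0(1) in \<open>simp add: field_simps\<close>)
  hence dN: "deriv N 0 = 0" by (rule DERIV_imp_deriv)
  obtain H where H: "H holomorphic_on ball 0 1" "\<And>q. N q = q * H q" "H 0 = 0"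
    using holomorphic_factor_zero[OF Nh N0] unfolding dN by blast
  have "((\<lambda>\<tau>. H (nome \<tau>)) \<longlongrightarrow> 0) cusp" using tendsto_hol_nome[OF H(1)] H(3) by simp
  moreover have "eventually (\<lambda>\<tau>. H (nome \<tau>) = j_num p (hauptmodul p \<tau>) 1 / hauptmodul p \<tau> - modular_j \<tau>) cusp"
    using eventually_cusp_uhp[of 0]
  proof eventually_elim
    case (elim \<tau>)
    have "H (nome \<tau>) = N (nome \<tau>) / nome \<tau>" using H(2)[of "nome \<tau>"] by simp
    thus ?case unfolding hauptmodul_q[OF lv elim] modular_j_q[OF elim] N_def by (simp add: diff_divide_distrib)
  qed
  ultimately show ?thesis by (rule Lim_transform_eventually)
qed

lemma qcong_j_num:
  assumes "p \<in> {2, 3, 5}" "qcong k f g" "f holomorphic_on ball 0 1" "g holomorphic_on ball 0 1"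
  shows "qcong k (\<lambda>q. j_num p (f q) q) (\<lambda>q. j_num p (g q) q)"
proof -
  have c: "qcong k (\<lambda>q. f q + c * q) (\<lambda>q. g q + c * q)" for c
    by (intro qcong_add qcong_refl assms)
  have s: "qcong k (\<lambda>q. f q ^ 2 + 10 * (f q * q) + 5 * q ^ 2) (\<lambda>q. g q ^ 2 + 10 * (g q * q) + 5 * q ^ 2)"
    by (intro qcong_add qcong_refl qcong_power qcong_mult assms holomorphic_intros)
  show ?thesis using assms(1) unfolding j_num_def
    by (elim insertE emptyE) (simp_all, (intro qcong_power qcong_mult c s holomorphic_intros assms)+)
qed

text \<open>A finite computation; the witness is the difference divided by q^p. It expresses that
  all polar terms of the relation cancel at the cusp 0.\<close>

lemma j_num_trunc_v:
  assumes "p \<in> {2, 3, 5}"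
  shows "qcong p (\<lambda>q. j_num p (trunc_v p q) q) (trunc_v p)"
  using assms
proof (elim insertE emptyE)
  assume [simp]: "p = 2"
  show ?thesis
    by (rule qcongI[of "\<lambda>q. (192) + (-512) * q ^ 1"])
       (auto intro!: holomorphic_intros simp: j_num_def trunc_v_def algebra_simps eval_nat_numeral)
next
  assume [simp]: "p = 3"
  show ?thesis
    by (rule qcongI[of "\<lambda>q. (972) + (-10935) * q ^ 1 + (52488) * q ^ 2 + (157464) * q ^ 3 + (-1889568) * q ^ 4 + (8503056) * q ^ 5"])
       (auto intro!: holomorphic_intros simp: j_num_def trunc_v_def algebra_simps eval_nat_numeral)
next
  assume [simp]: "p = 5"
  show ?thesis
    by (rule qcongI[of "\<lambda>q. (714) + (-4159) * q ^ 1 + (4926) * q ^ 2 + (12990) * q ^ 3 + (-28570) * q ^ 4 + (164649) * q ^ 5 + (-936594) * q ^ 6 + (812341) * q ^ 7 + (4395840) * q ^ 8 + (-7870320) * q ^ 9 + (9105000) * q ^ 10 + (-60346500) * q ^ 11 + (34380000) * q ^ 12 + (440290000) * q ^ 13 + (-657900000) * q ^ 14 + (-727650000) * q ^ 15 + (1792800000) * q ^ 16 + (-97200000) * q ^ 17 + (-1458000000) * q ^ 18 + (729000000) * q ^ 19"])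
       (auto intro!: holomorphic_intros simp: j_num_def trunc_v_def algebra_simps eval_nat_numeral)
qed

text \<open>At the cusp 0 the parameter is r = q^(1/p), and j has a pole of order p in r. There t
  becomes V/r with V congruent to \<open>trunc_v\<close> modulo r^p, so \<open>j_num_trunc_v\<close>
  removes the whole polar part. A finite limit L is enough: in the product over the cosets it meets
  a factor tending to 0.\<close>

lemma level_relation_at_zero:
  assumes p: "p \<in> {2, 3, 5}"
  shows "\<exists>L. ((\<lambda>\<tau>. j_num p (of_nat p ^ (12 div (p - 1)) / hauptmodul p (\<tau> / of_nat p)) 1 /
       (of_nat p ^ (12 div (p - 1)) / hauptmodul p (\<tau> / of_nat p)) - modular_j \<tau>) \<longlongrightarrow> L) cusp"
proof -
  note lv = prime_in_levels[OF p]
  let ?m = "2 * (12 div (p - 1))" and ?c = "of_nat p ^ (12 div (p - 1)) :: complex"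
  have p0: "p > 0" using p by auto
  define V where "V = (\<lambda>q. euler_prod q ^ ?m * inverse (euler_prod (q ^ p) ^ ?m))"
  have nz: "euler_prod (q ^ p) \<noteq> 0" if "norm q < 1" for q
    using power_m_less_1[OF that p0] euler_prod_nonzero by blast
  have ih: "(\<lambda>q. inverse (euler_prod (q ^ p) ^ ?m)) holomorphic_on ball 0 1"
    by (intro holomorphic_intros euler_prod_power_holomorphic p0) (use nz in auto)
  have Vh: "V holomorphic_on ball 0 1" unfolding V_def
    by (intro holomorphic_intros ih euler_prod_holomorphic)
  have Vnz: "V q \<noteq> 0" if "norm q < 1" for q
    unfolding V_def using nz[OF that] euler_prod_nonzero[OF that] by simp
  have subst_p: "qcong p (\<lambda>q. f (q ^ p)) (\<lambda>_. 1)" if f: "f holomorphic_on ball 0 1" "f 0 = 1" for f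
  proof -
    have "(\<lambda>q. f q - 1) holomorphic_on ball 0 1" "f 0 - 1 = 0" using f by (auto intro!: holomorphic_intros)
    then obtain H where H: "H holomorphic_on ball 0 1" "\<And>q. f q - 1 = q * H q" using holomorphic_factor_zero by blast
    show ?thesis
    proof (rule qcongI[of "\<lambda>q. H (q ^ p)"])
      show "(\<lambda>q. H (q ^ p)) holomorphic_on ball 0 1"
        by (rule holomorphic_on_compose_gen[OF _ H(1), unfolded o_def])
           (use power_m_less_1 p0 in \<open>auto intro!: holomorphic_intros\<close>)
      show "f (q ^ p) = 1 + q ^ p * H (q ^ p)" for q using H(2)[of "q ^ p"] by (simp add: algebra_simps)
    qed
  qed
  have "qcong p (\<lambda>q. euler_prod (q ^ p) ^ ?m) (\<lambda>_. 1 ^ ?m)"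
    by (intro qcong_power subst_p euler_prod_holomorphic euler_prod_power_holomorphic p0 holomorphic_intros) simp
  hence "qcong p (\<lambda>q. inverse (euler_prod (q ^ p) ^ ?m) * euler_prod (q ^ p) ^ ?m) (\<lambda>q. inverse (euler_prod (q ^ p) ^ ?m) * 1 ^ ?m)"
    by (rule qcong_mult[OF qcong_refl _ ih]) (intro holomorphic_intros euler_prod_power_holomorphic p0)
  then obtain h where h: "h holomorphic_on ball 0 1" "\<And>q. norm q < 1 \<Longrightarrow> inverse (euler_prod (q ^ p) ^ ?m) * euler_prod (q ^ p) ^ ?m = inverse (euler_prod (q ^ p) ^ ?m) * 1 ^ ?m + q ^ p * h q"
    using qcongE by blast
  have inv1: "qcong p (\<lambda>q. inverse (euler_prod (q ^ p) ^ ?m)) (\<lambda>_. 1)"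
  proof (rule qcong_sym, rule qcongI[OF h(1)])
    fix q :: complex assume q: "norm q < 1"
    have "inverse (euler_prod (q ^ p) ^ ?m) * euler_prod (q ^ p) ^ ?m = 1" using nz[OF q] by simp
    with h(2)[OF q] show "1 = inverse (euler_prod (q ^ p) ^ ?m) + q ^ p * h q" by (simp only: power_one mult_1_right)
  qed
  have "qcong p V (\<lambda>q. trunc_v p q * 1)" unfolding V_def
    by (intro qcong_mult euler_prod_power_qcong p inv1 trunc_v_holomorphic ih)
  hence Vq: "qcong p V (trunc_v p)" by simp
  have "qcong p (\<lambda>q. j_num p (V q) q) (\<lambda>q. j_num p (trunc_v p q) q)"
    by (intro qcong_j_num p Vq Vh trunc_v_holomorphic)
  also have "qcong p \<dots> (trunc_v p)" by (rule j_num_trunc_v[OF p])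
  also have "qcong p \<dots> V" by (rule qcong_sym[OF Vq])
  finally obtain h1 where h1: "h1 holomorphic_on ball 0 1" "\<And>q. norm q < 1 \<Longrightarrow> j_num p (V q) q = V q + q ^ p * h1 q"
    using qcongE by blast
  obtain h2 where h2: "h2 holomorphic_on ball 0 1" "\<And>q. norm q < 1 \<Longrightarrow> j_q (q ^ p) = 1 + q ^ p * h2 q"
    using qcongE[OF subst_p[OF j_q_holomorphic j_q_0]] by blast
  let ?h = "\<lambda>q. h1 q / V q - h2 q"
  have hh: "?h holomorphic_on ball 0 1" by (intro holomorphic_intros h1 h2 Vh) (use Vnz in auto)
  have "((\<lambda>\<tau>. ?h (nome (\<tau> / of_nat p))) \<longlongrightarrow> ?h 0) cusp"
    by (rule tendsto_cusp_rescale(1)[OF tendsto_hol_nome[OF hh] p0])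
  moreover have "eventually (\<lambda>\<tau>. ?h (nome (\<tau> / of_nat p)) = j_num p (?c / hauptmodul p (\<tau> / of_nat p)) 1 /
       (?c / hauptmodul p (\<tau> / of_nat p)) - modular_j \<tau>) cusp"
    using eventually_cusp_uhp[of 0]
  proof eventually_elim
    case (elim \<tau>)
    define r where "r = nome (\<tau> / of_nat p)"
    have im: "Im (\<tau> / of_nat p) > 0" using elim p0 by simp
    have r: "norm r < 1" "r \<noteq> 0" unfolding r_def using norm_nome_less_1[OF im] by auto
    have "nome (of_nat p * (\<tau> / of_nat p)) = r ^ p" unfolding r_def by (rule nome_mult_nat)
    hence n: "nome \<tau> = r ^ p" using p0 by simp
    have F: "?c / hauptmodul p (\<tau> / of_nat p) = V r / r"
      unfolding hauptmodul_q[OF lv im] r_def[symmetric] haupt_u_prime[OF p r(1)] V_def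
      using p0 nz[OF r(1)] euler_prod_nonzero[OF r(1)] by (simp add: divide_simps)
    have "j_num p (V r / r) 1 / (V r / r) - modular_j \<tau> = (j_num p (V r) r / V r - j_q (r ^ p)) / r ^ p"
      unfolding j_num_scale[OF p r(2)] modular_j_q[OF elim] n using r(2) Vnz[OF r(1)]
      by (simp add: diff_divide_distrib)
    also have "j_num p (V r) r / V r - j_q (r ^ p) = r ^ p * ?h r"
      unfolding h1(2)[OF r(1)] h2(2)[OF r(1)] using Vnz[OF r(1)] by (simp add: add_divide_distrib algebra_simps)
    finally show ?case unfolding F using r(2) by (simp add: r_def)
  qed
  ultimately have "((\<lambda>\<tau>. j_num p (?c / hauptmodul p (\<tau> / of_nat p)) 1 /
       (?c / hauptmodul p (\<tau> / of_nat p)) - modular_j \<tau>) \<longlongrightarrow> ?h 0) cusp" by (rule Lim_transform_eventually)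
  thus ?thesis by blast
qed

section \<open>The conjugates of t_p over the cosets of Gamma_0(p)\<close>

text \<open>The index runs over the projective line over F_p, with p for infinity. For x < p the
  value is t_p(-1/(\<tau> + x)), rewritten by \<open>Fricke_inversion\<close>.\<close>

definition haupt_conj :: "nat \<Rightarrow> nat \<Rightarrow> complex \<Rightarrow> complex" where
  "haupt_conj p x \<tau> = (if x = p then hauptmodul p \<tau>
     else of_nat p ^ (12 div (p - 1)) / hauptmodul p ((\<tau> + of_nat x) / of_nat p))"

context
  fixes p :: nat
  assumes p: "p \<in> {2, 3, 5}"
begin

lemma p_pos: "p > 0" using p by auto

lemma Im_shift_div: "Im \<tau> > 0 \<Longrightarrow> Im ((\<tau> + of_nat x) / of_nat p) > 0"
  using p_pos by simp

lemma haupt_conj_nonzero: "Im \<tau> > 0 \<Longrightarrow> haupt_conj p x \<tau> \<noteq> 0"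
  unfolding haupt_conj_def using hauptmodul_nonzero[OF prime_in_levels[OF p]] Im_shift_div p_pos by simp

lemma haupt_conj_holomorphic: "haupt_conj p x holomorphic_on uhp"
proof (cases "x = p")
  case True
  hence "haupt_conj p x = hauptmodul p" by (simp add: haupt_conj_def fun_eq_iff)
  thus ?thesis using q_holomorphicD(1)[OF hauptmodul_q_holomorphic[OF prime_in_levels[OF p]]] by simp
next
  case False
  have "(\<lambda>\<tau>. hauptmodul p ((\<tau> + of_nat x) / of_nat p)) holomorphic_on uhp"
    by (rule holomorphic_on_compose_gen[OF _ q_holomorphicD(1)[OF hauptmodul_q_holomorphic[OF prime_in_levels[OF p]]], unfolded o_def])
       (use Im_shift_div p_pos in \<open>auto intro!: holomorphic_intros\<close>)
  thus ?thesis unfolding haupt_conj_def[abs_def] using False hauptmodul_nonzero[OF prime_in_levels[OF p] Im_shift_div]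
    by (auto intro!: holomorphic_intros)
qed

lemma haupt_conj_shift:
  assumes "Im \<tau> > 0" "x < p"
  shows "haupt_conj p x (\<tau> + 1) = haupt_conj p (if Suc x = p then 0 else Suc x) \<tau>"
proof (cases "Suc x = p")
  case True
  have p1: "(of_nat p :: complex) = of_nat x + 1" using True by (metis of_nat_Suc add.commute)
  have "\<tau> + 1 + of_nat x = \<tau> + of_nat p" using p1 by simp
  hence "(\<tau> + 1 + of_nat x) / of_nat p = (\<tau> + of_nat 0) / of_nat p + of_int 1"
    using p_pos by (simp only:) (simp add: add_divide_distrib)
  hence "hauptmodul p ((\<tau> + 1 + of_nat x) / of_nat p) = hauptmodul p ((\<tau> + of_nat 0) / of_nat p)"
    using hauptmodul_plus_int[OF prime_in_levels[OF p] Im_shift_div[OF assms(1)], of 0 1] by simp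
  thus ?thesis using True assms(2) p_pos by (simp add: haupt_conj_def)
next
  case False
  thus ?thesis using assms(2) by (simp add: haupt_conj_def add_ac)
qed

lemma haupt_conj_inversion_cusps:
  assumes "Im \<tau> > 0"
  shows "haupt_conj p p (- 1 / \<tau>) = haupt_conj p 0 \<tau>" "haupt_conj p 0 (- 1 / \<tau>) = haupt_conj p p \<tau>"
proof -
  have im: "Im (\<tau> / of_nat p) > 0" using Im_shift_div[OF assms, of 0] by simp
  have "of_nat p * (\<tau> / of_nat p) = \<tau>" using p_pos by simp
  hence "hauptmodul p (- 1 / \<tau>) * hauptmodul p (\<tau> / of_nat p) = of_nat p ^ (12 div (p - 1))"
    using Fricke_inversion[OF p im] by simp
  thus 1: "haupt_conj p p (- 1 / \<tau>) = haupt_conj p 0 \<tau>"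
    using hauptmodul_nonzero[OF prime_in_levels[OF p] im] p_pos by (simp add: haupt_conj_def field_simps)
  have "(- 1 / \<tau> + of_nat 0) / of_nat p = - 1 / (of_nat p * \<tau>)" by simp
  moreover have "hauptmodul p (- 1 / (of_nat p * \<tau>)) \<noteq> 0"
    using hauptmodul_nonzero[OF prime_in_levels[OF p] Im_inversion, of "of_nat p * \<tau>"] assms p_pos by simp
  ultimately show "haupt_conj p 0 (- 1 / \<tau>) = haupt_conj p p \<tau>"
    using Fricke_inversion[OF p assms] p_pos unfolding haupt_conj_def by (simp add: field_simps)
qed

text \<open>The exponent p - 1 raises the eta powers to 24, so that \<open>Delta_moebius\<close>
  becomes applicable.\<close>

lemma haupt_conj_power:
  assumes "Im \<sigma> > 0"
  shows "(of_nat p ^ (12 div (p - 1)) / hauptmodul p \<sigma>) ^ (p - 1) = Delta \<sigma> / Delta (of_nat p * \<sigma>)"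
proof -
  have "Im (of_nat p * \<sigma>) > 0" using assms p_pos by simp
  note nz = eta_nonzero[OF assms] eta_nonzero[OF this]
  show ?thesis using p nz
    by (elim insertE emptyE)
       (simp_all add: hauptmodul_def Let_def eta_24[symmetric] power_divide power_mult_distrib flip: power_mult)
qed

text \<open>As x y = -1 modulo p, a matrix in SL_2(Z) carries (\<tau> + y)/p to (-1/\<tau> + x)/p,
  and another one their multiples by p. By \<open>haupt_conj_power\<close> the quotient of the two
  conjugates then has (p - 1)-th power 1.\<close>

lemma haupt_conj_inversion_const:
  fixes x y :: nat
  assumes xy: "0 < x" "x < p" "0 < y" "y < p" "p dvd x * y + 1"
  shows "\<exists>\<kappa>. \<forall>\<tau>. Im \<tau> > 0 \<longrightarrow> haupt_conj p x (- 1 / \<tau>) = \<kappa> * haupt_conj p y \<tau>"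
proof -
  define g where "g = (\<lambda>\<tau>. haupt_conj p x (- 1 / \<tau>) / haupt_conj p y \<tau>)"
  obtain b where b: "x * y + 1 = p * b" using xy(5) by (auto elim: dvdE)
  have ih: "(\<lambda>\<tau>. haupt_conj p x (- 1 / \<tau>)) holomorphic_on uhp"
    by (rule holomorphic_on_compose_gen[OF _ haupt_conj_holomorphic, unfolded o_def])
       (use Im_inversion in \<open>auto intro!: holomorphic_intros\<close>)
  have gh: "g holomorphic_on uhp" unfolding g_def
    by (intro holomorphic_intros ih haupt_conj_holomorphic) (use haupt_conj_nonzero in auto)
  have "g \<tau> ^ (p - 1) = 1" if \<tau>: "Im \<tau> > 0" for \<tau>
  proof -
    have t0: "\<tau> \<noteq> 0" using \<tau> by auto
    let ?s = "(\<tau> + of_nat y) / of_nat p" and ?s' = "(- 1 / \<tau> + of_nat x) / of_nat p"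
    have s: "Im ?s > 0" "Im ?s' > 0" using Im_shift_div \<tau> Im_inversion by blast+
    have pz: "(of_nat p :: complex) \<noteq> 0" using p_pos by simp
    have pse: "of_nat p * ?s = \<tau> + of_nat y" using pz by simp
    hence ps: "Im (of_nat p * ?s) > 0" using \<tau> by (simp only:) simp
    have w: "of_int (int p) * ?s + of_int (- int y) = \<tau>" using pz by simp
    have bc: "(of_nat p * of_nat b :: complex) = of_nat x * of_nat y + 1"
      using arg_cong[OF b, of "of_nat :: nat \<Rightarrow> complex"] by (simp add: add.commute)
    \<comment> \<open>The matrix with rows (x, -b) and (p, -y); its denominator at \<open>?s\<close>
      is \<tau>.\<close>
    have det1: "int x * (- int y) - (- int b) * int p = 1"
      using arg_cong[OF b, of int] by (simp add: algebra_simps)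
    have e1: "(of_int (int x) * ?s + of_int (- int b)) / (of_int (int p) * ?s + of_int (- int y)) = ?s'"
    proof -
      have "of_int (int x) * ?s + of_int (- int b) = (of_nat x * \<tau> + of_nat x * of_nat y - of_nat p * of_nat b) / of_nat p"
        using pz by (simp add: field_simps)
      also have "\<dots> = (of_nat x * \<tau> - 1) / of_nat p" unfolding bc by simp
      finally show ?thesis unfolding w using t0 pz by (simp add: field_simps)
    qed
    have 1: "Delta ?s' = \<tau> ^ 12 * Delta ?s"
      using trans[OF arg_cong[OF e1, of Delta, symmetric] Delta_moebius[OF det1 s(1)]] unfolding w .
    \<comment> \<open>Conjugation by multiplication with p gives the rows (x, -p b) and (1, -y),
      again with denominator \<tau>.\<close>
    have det2: "int x * (- int y) - (- int (p * b)) * 1 = 1"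
      using arg_cong[OF b, of int] by (simp add: algebra_simps)
    have w2: "of_int 1 * (of_nat p * ?s) + of_int (- int y) = \<tau>" using pz by simp
    have e2: "(of_int (int x) * (of_nat p * ?s) + of_int (- int (p * b))) / (of_int 1 * (of_nat p * ?s) + of_int (- int y)) = of_nat p * ?s'"
    proof -
      have "of_int (int x) * (of_nat p * ?s) + of_int (- int (p * b)) = of_nat x * \<tau> + of_nat x * of_nat y - of_nat p * of_nat b"
        unfolding pse by (simp add: algebra_simps)
      also have "\<dots> = of_nat x * \<tau> - 1" unfolding bc by simp
      finally show ?thesis unfolding w2 using t0 pz by (simp add: field_simps)
    qed
    have 2: "Delta (of_nat p * ?s') = \<tau> ^ 12 * Delta (of_nat p * ?s)"
      using trans[OF arg_cong[OF e2, of Delta, symmetric] Delta_moebius[OF det2 ps]] unfolding w2 .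
    have "g \<tau> ^ (p - 1) = (Delta ?s' / Delta (of_nat p * ?s')) / (Delta ?s / Delta (of_nat p * ?s))"
      unfolding g_def power_divide haupt_conj_power[OF s(1), symmetric] haupt_conj_power[OF s(2), symmetric]
      using xy by (simp add: haupt_conj_def power_divide)
    thus ?thesis unfolding 1 2 using t0 Delta_nonzero[OF s(1)] Delta_nonzero[OF ps] by simp
  qed
  moreover have "p - 1 > 0" using p by auto
  ultimately obtain \<kappa> where "\<And>\<tau>. Im \<tau> > 0 \<Longrightarrow> g \<tau> = \<kappa>" using root_of_unity_valued_constant[OF gh, of "p - 1"] by blast
  thus ?thesis unfolding g_def using haupt_conj_nonzero by (intro exI[of _ \<kappa>]) (auto simp: field_simps)
qed

text \<open>The constant is evaluated at the fixed points \<open>\<rho>\<close> of \<open>\<tau> \<mapsto> -1/(\<tau>+1)\<close> and \<open>\<i>\<close> of \<open>\<tau> \<mapsto> -1/\<tau>\<close>.\<close>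

lemma haupt_conj_inversion_1:
  assumes "Im \<tau> > 0"
  shows "haupt_conj p 1 (- 1 / \<tau>) = haupt_conj p (p - 1) \<tau>"
proof -
  have p2: "p \<ge> 2" using p by auto
  have "1 * (p - 1) + 1 = p" using p2 by simp
  then obtain \<kappa> where \<kappa>: "\<And>\<tau>. Im \<tau> > 0 \<Longrightarrow> haupt_conj p 1 (- 1 / \<tau>) = \<kappa> * haupt_conj p (p - 1) \<tau>"
    using haupt_conj_inversion_const[of 1 "p - 1"] p2 by auto
  define \<rho> where "\<rho> = Complex (-1/2) (sqrt 3 / 2)"
  have im: "Im \<rho> > 0" by (simp add: \<rho>_def)
  have im1: "Im (\<rho> + 1) > 0" using im by simp
  have "\<rho> * (\<rho> + 1) = -1" by (simp add: \<rho>_def complex_eq_iff field_simps)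
  moreover have "\<rho> + 1 \<noteq> 0" using im1 by (metis less_irrefl zero_complex.simps(2))
  ultimately have r: "- 1 / (\<rho> + 1) = \<rho>" by (simp add: field_simps)
  \<comment> \<open>Following the index through 1, p - 1, 0, p, p, 0, 1 by alternating inversions
    and shifts leads back to the start, and the unknown factor enters once.\<close>
  have "haupt_conj p 1 \<rho> = \<kappa> * haupt_conj p (p - 1) (\<rho> + 1)" using \<kappa>[OF im1] r by simp
  also have "haupt_conj p (p - 1) (\<rho> + 1) = haupt_conj p 0 \<rho>"
    using haupt_conj_shift[OF im, of "p - 1"] p2 by simp
  also have "haupt_conj p 0 \<rho> = haupt_conj p p (\<rho> + 1)"
    using haupt_conj_inversion_cusps(2)[OF im1] r by simp
  also have "haupt_conj p p (\<rho> + 1) = haupt_conj p p \<rho>"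
    using hauptmodul_plus_int[OF prime_in_levels[OF p] im, of 1] by (simp add: haupt_conj_def)
  also have "haupt_conj p p \<rho> = haupt_conj p 0 (\<rho> + 1)"
    using haupt_conj_inversion_cusps(1)[OF im1] r by simp
  also have "haupt_conj p 0 (\<rho> + 1) = haupt_conj p 1 \<rho>"
    using haupt_conj_shift[OF im, of 0] p2 by simp
  finally have "\<kappa> = 1" using haupt_conj_nonzero[OF im, of 1] by simp
  thus ?thesis using \<kappa>[OF assms] by simp
qed

text \<open>It serves p = 5 with x = 2 and x = 3, the square roots of -1 modulo 5: both the index
  and the point \<i> are fixed by the inversion.\<close>

lemma haupt_conj_inversion_i:
  assumes "Im \<tau> > 0" "0 < x" "x < p" "p dvd x * x + 1"
  shows "haupt_conj p x (- 1 / \<tau>) = haupt_conj p x \<tau>"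
proof -
  obtain \<kappa> where \<kappa>: "\<And>\<tau>. Im \<tau> > 0 \<Longrightarrow> haupt_conj p x (- 1 / \<tau>) = \<kappa> * haupt_conj p x \<tau>"
    using haupt_conj_inversion_const[of x x] assms by auto
  have "- 1 / \<i> = \<i>" by (simp add: divide_simps)
  hence "\<kappa> = 1" using \<kappa>[of \<i>] haupt_conj_nonzero[of \<i> x] by simp
  thus ?thesis using \<kappa>[OF assms(1)] by simp
qed

text \<open>This is x -> -1/x on the projective line over F_p, with p as infinity. For x = 1 and x =
  p - 1 it is p - x; the residues 2 and 3 modulo 5 are fixed.\<close>

definition inv_perm :: "nat \<Rightarrow> nat" where
  "inv_perm x = (if x = 0 then p else if x = p then 0 else if p = 5 \<and> (x = 2 \<or> x = 3) then x else p - x)"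

definition shift_perm :: "nat \<Rightarrow> nat" where
  "shift_perm x = (if x = p then p else if Suc x = p then 0 else Suc x)"

lemma haupt_conj_inversion:
  assumes "Im \<tau> > 0" "x \<le> p"
  shows "haupt_conj p x (- 1 / \<tau>) = haupt_conj p (inv_perm x) \<tau>"
proof -
  have a: "haupt_conj p (p - 1) (- 1 / \<tau>) = haupt_conj p 1 \<tau>"
    using haupt_conj_inversion_1[OF Im_inversion[OF assms(1)]] by simp
  consider "x = 0" | "x = p" | "x = 1" | "x = p - 1" | "p = 5" "x = 2 \<or> x = 3"
    using p assms(2) by (auto simp: le_Suc_eq eval_nat_numeral)
  thus ?thesis
  proof cases
    case 3
    thus ?thesis using haupt_conj_inversion_1[OF assms(1)] p by (auto simp: inv_perm_def)
  next
    case 4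
    thus ?thesis using a p by (auto simp: inv_perm_def)
  next
    case 5
    thus ?thesis unfolding inv_perm_def using haupt_conj_inversion_i[OF assms(1), of x] by auto
  qed (use haupt_conj_inversion_cusps[OF assms(1)] p_pos in \<open>auto simp: inv_perm_def\<close>)
qed

lemma haupt_conj_shift_perm:
  assumes "Im \<tau> > 0" "x \<le> p"
  shows "haupt_conj p x (\<tau> + 1) = haupt_conj p (shift_perm x) \<tau>"
proof (cases "x = p")
  case True
  thus ?thesis using hauptmodul_plus_int[OF prime_in_levels[OF p] assms(1), of 1] by (simp add: haupt_conj_def shift_perm_def)
next
  case False
  thus ?thesis using haupt_conj_shift[OF assms(1), of x] assms(2) by (simp add: shift_perm_def)
qed

text \<open>The vanishing of the product over the cosets yields one factor that is identically zero,
  for an unknown coset. Shifts lead from it to the index 0 and the inversion leads from there to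
  p.\<close>

theorem modular_j_level_prime:
  assumes \<tau>: "Im \<tau> > 0"
  shows "modular_j \<tau> = j_num p (hauptmodul p \<tau>) 1 / hauptmodul p \<tau>"
proof -
  define h where "h = (\<lambda>x \<tau>. j_num p (haupt_conj p x \<tau>) 1 / haupt_conj p x \<tau> - modular_j \<tau>)"
  have hol: "h x holomorphic_on uhp" for x unfolding h_def
    by (intro holomorphic_intros j_num_holomorphic haupt_conj_holomorphic modular_j_holomorphic)
       (use haupt_conj_nonzero in auto)
  have hS: "h x (- 1 / \<tau>) = h (inv_perm x) \<tau>" if "Im \<tau> > 0" "x \<le> p" for x \<tau>
    unfolding h_def by (simp only: haupt_conj_inversion[OF that] modular_j_inversion[OF that(1)])
  have hT: "h x (\<tau> + 1) = h (shift_perm x) \<tau>" if "Im \<tau> > 0" "x \<le> p" for x \<tau>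
    using that by (simp add: h_def haupt_conj_shift_perm modular_j_plus_1)
  have h_add: "h x \<tau> = h 0 (\<tau> + of_nat x)" if "Im \<tau> > 0" "x < p" for x \<tau>
    using that
  proof (induction x arbitrary: \<tau>)
    case (Suc x)
    have "h (Suc x) \<tau> = h x (\<tau> + 1)" using hT[of \<tau> x] Suc.prems by (simp add: shift_perm_def)
    also have "\<dots> = h 0 (\<tau> + 1 + of_nat x)" using Suc by simp
    finally show ?case by (simp add: add_ac)
  qed simp
  have limp: "(h p \<longlongrightarrow> 0) cusp"
    using level_relation_at_infinity[OF p] by (simp add: h_def haupt_conj_def)
  obtain L where lim0: "(h 0 \<longlongrightarrow> L) cusp"
    using level_relation_at_zero[OF p] p_pos by (auto simp: h_def haupt_conj_def)
  have limx: "(h x \<longlongrightarrow> L) cusp" if "x < p" for x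
  proof -
    have "filterlim (\<lambda>\<tau>::complex. \<tau> + of_nat x) cusp cusp"
      unfolding filterlim_iff eventually_cusp
    proof (intro allI impI; elim exE)
      fix P Y assume "\<forall>\<tau>. Im \<tau> > Y \<longrightarrow> P \<tau>"
      thus "\<exists>Z. \<forall>\<tau>. Im \<tau> > Z \<longrightarrow> P (\<tau> + of_nat x)" by (intro exI[of _ Y]) auto
    qed
    from filterlim_compose[OF lim0 this]
    show ?thesis by (rule Lim_transform_eventually)
      (use h_add[OF _ that] in \<open>auto intro!: eventually_mono[OF eventually_cusp_uhp[of 0]]\<close>)
  qed
  define g where "g = (\<lambda>\<tau>. \<Prod>x\<le>p. h x \<tau>)"
  have g0: "g \<tau> = 0" if \<tau>: "Im \<tau> > 0" for \<tau>
  proof (rule modular_function_zero[OF _ _ _ _ \<tau>])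
    show "g holomorphic_on uhp" unfolding g_def by (intro holomorphic_intros hol)
    fix \<tau> assume \<tau>: "Im \<tau> > 0"
    have "g (\<tau> + 1) = (\<Prod>x\<le>p. h (shift_perm x) \<tau>)" unfolding g_def using hT[OF \<tau>] by (intro prod.cong) auto
    also have "\<dots> = g \<tau>" unfolding g_def
      by (rule prod.reindex_bij_witness[where j = shift_perm and i = "\<lambda>x. if x = p then p else if x = 0 then p - 1 else x - 1"])
         (use p in \<open>auto simp: shift_perm_def split: if_splits\<close>)
    finally show "g (\<tau> + 1) = g \<tau>" .
    have "g (- 1 / \<tau>) = (\<Prod>x\<le>p. h (inv_perm x) \<tau>)" unfolding g_def using hS[OF \<tau>] by (intro prod.cong) auto
    also have "\<dots> = g \<tau>" unfolding g_def
      by (rule prod.reindex_bij_witness[where j = inv_perm and i = inv_perm])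
         (use p in \<open>auto simp: inv_perm_def split: if_splits\<close>)
    finally show "g (- 1 / \<tau>) = g \<tau>" .
  next
    \<comment> \<open>The factor at infinity tends to 0, and the p others share the finite limit
      L.\<close>
    have "((\<lambda>\<tau>. h p \<tau> * (\<Prod>x<p. h x \<tau>)) \<longlongrightarrow> 0 * (\<Prod>x<p. L)) cusp"
      by (intro tendsto_mult limp tendsto_prod limx) auto
    moreover have "g = (\<lambda>\<tau>. h p \<tau> * (\<Prod>x<p. h x \<tau>))"
    proof -
      have "{..p} = insert p {..<p}" by auto
      thus ?thesis by (simp add: g_def)
    qed
    ultimately show "(g \<longlongrightarrow> 0) cusp" by simp
  qed
  have "\<exists>x\<le>p. \<forall>\<tau>. Im \<tau> > 0 \<longrightarrow> h x \<tau> = 0"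
  proof (rule ccontr)
    assume "\<not> ?thesis"
    hence "\<exists>\<tau>. Im \<tau> > 0 \<and> (\<forall>x\<in>{..p}. h x \<tau> \<noteq> 0)"
      by (intro finite_common_nonzero hol) auto
    thus False using g0 unfolding g_def by fastforce
  qed
  then obtain x where x: "x \<le> p" "\<And>\<tau>. Im \<tau> > 0 \<Longrightarrow> h x \<tau> = 0" by blast
  have "h p \<tau> = 0"
  proof (cases "x = p")
    case False
    hence "x < p" using x by simp
    have "h 0 \<sigma> = 0" if "Im \<sigma> > 0" for \<sigma>
      using h_add[of "\<sigma> - of_nat x" x] x(2)[of "\<sigma> - of_nat x"] that \<open>x < p\<close> by simp
    hence "h 0 (- 1 / \<tau>) = 0" using Im_inversion[OF \<tau>] by blast
    thus ?thesis using hS[OF \<tau>, of 0] by (simp add: inv_perm_def)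
  qed (use x \<tau> in auto)
  thus ?thesis by (simp add: h_def haupt_conj_def)
qed

end

section \<open>Levels 4, 6, 8 and 9\<close>

text \<open>The local inverse of R, composed with a. An unknown y defined by the expected relation
  can be compared with t_N afterwards.\<close>

lemma local_solution:
  assumes hol: "R holomorphic_on ball 0 1" and R0: "R (0::complex) = 0" and d: "(R has_field_derivative d) (at 0)" "d \<noteq> 0"
    and a: "(a \<longlongrightarrow> 0) F"
  obtains y where "(y \<longlongrightarrow> 0) F" "eventually (\<lambda>x. R (y x) = a x) F"
proof -
  have "deriv R 0 \<noteq> 0" using DERIV_imp_deriv[OF d(1)] d(2) by simp
  then obtain r where r: "r > 0" "ball (0::complex) r \<subseteq> ball 0 1" "inj_on R (ball 0 r)"
    by (rule has_complex_derivative_locally_injective[OF hol _ open_ball, rotated]) auto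
  have holr: "R holomorphic_on ball 0 r" using hol r(2) holomorphic_on_subset by blast
  obtain g where g: "g holomorphic_on R ` ball 0 r" "\<And>z. z \<in> ball 0 r \<Longrightarrow> g (R z) = z"
    using holomorphic_has_inverse[OF holr open_ball r(3)] by metis
  have op: "open (R ` ball 0 r)" by (rule open_mapping_thm3[OF holr open_ball r(3)])
  have 0: "0 \<in> R ` ball 0 r" using R0 r(1) by (metis centre_in_ball imageI)
  have "isCont g 0"
    using holomorphic_on_imp_continuous_on[OF g(1)] op 0 continuous_on_eq_continuous_at by blast
  moreover have "g 0 = 0" using g(2)[of 0] R0 r(1) by simp
  ultimately have 1: "((\<lambda>x. g (a x)) \<longlongrightarrow> 0) F" using isCont_tendsto_compose[OF _ a, of g] by simp
  have "eventually (\<lambda>x. a x \<in> R ` ball 0 r) F" by (rule topological_tendstoD[OF a op 0])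
  hence 2: "eventually (\<lambda>x. R (g (a x)) = a x) F" by eventually_elim (use g(2) in auto)
  show ?thesis by (rule that[OF 1 2])
qed

lemma local_injective:
  assumes hol: "R holomorphic_on ball 0 1" and d: "(R has_field_derivative d) (at (0::complex))" "d \<noteq> 0"
    and b: "(b \<longlongrightarrow> 0) F" "(b' \<longlongrightarrow> 0) F" and eq: "eventually (\<lambda>x. R (b x) = R (b' x)) F"
  shows "eventually (\<lambda>x. b x = b' x) F"
proof -
  have "deriv R 0 \<noteq> 0" using DERIV_imp_deriv[OF d(1)] d(2) by simp
  then obtain r where r: "r > 0" "inj_on R (ball 0 r)"
    by (rule has_complex_derivative_locally_injective[OF hol _ open_ball, rotated]) auto
  have "eventually (\<lambda>x. b x \<in> ball 0 r) F" "eventually (\<lambda>x. b' x \<in> ball 0 r) F"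
    by (rule topological_tendstoD[OF b(1)]; use r in simp) (rule topological_tendstoD[OF b(2)]; use r in simp)
  with eq show ?thesis by eventually_elim (use r(2) in \<open>auto dest: inj_onD\<close>)
qed

lemma uhp_zero_if_eventually_zero:
  assumes "f holomorphic_on uhp" "eventually (\<lambda>\<tau>. f \<tau> = (0::complex)) cusp" "Im \<tau> > 0"
  shows "f \<tau> = 0"
proof -
  obtain Y where Y: "\<And>\<tau>. Im \<tau> > Y \<Longrightarrow> f \<tau> = 0" using assms(2) unfolding eventually_cusp by blast
  let ?U = "{z. Im z > max Y 0}"
  have o: "open ?U" by (rule open_halfspace_Im_gt)
  let ?z = "Complex 0 (max Y 0 + 1)"
  show ?thesis
    by (rule analytic_continuation_open[OF o open_uhp _ connected_uhp, of f "\<lambda>_. 0"])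
       (use assms Y in \<open>auto intro!: exI[of _ ?z]\<close>)
qed

text \<open>Equality of the powers leaves a root of unity, which the leading coefficient in q fixes.
  The exponent 24 is a common multiple of the powers of t_N that the eta identities produce.\<close>

lemma eventually_eq_hauptmodul:
  assumes N: "N \<in> genus0_levels" and y: "((\<lambda>\<tau>. y \<tau> / nome \<tau>) \<longlongrightarrow> haupt_u N 0) cusp"
    and eq: "eventually (\<lambda>\<tau>. y \<tau> ^ 24 = hauptmodul N \<tau> ^ 24) cusp"
  shows "eventually (\<lambda>\<tau>. y \<tau> = hauptmodul N \<tau>) cusp"
proof -
  let ?c = "haupt_u N 0"
  have c: "?c \<noteq> 0" using haupt_u_props(2)[OF N, of 0] by simp
  have "((\<lambda>\<tau>. y \<tau> / nome \<tau> / ?c) \<longlongrightarrow> ?c / ?c) cusp" by (intro tendsto_intros y c)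
  hence 1: "((\<lambda>\<tau>. y \<tau> / nome \<tau> / ?c) \<longlongrightarrow> 1) cusp" using c by simp
  have "((\<lambda>\<tau>. haupt_u N (nome \<tau>) / ?c) \<longlongrightarrow> ?c / ?c) cusp"
    by (intro tendsto_intros tendsto_hol_nome haupt_u_props(1) N c)
  hence 2: "((\<lambda>\<tau>. haupt_u N (nome \<tau>) / ?c) \<longlongrightarrow> 1) cusp" using c by simp
  \<comment> \<open>\<open>eventually_eq_if_power_eq\<close> removes twelfth powers only, so the
    squares are equated first and then raised to the sixth power.\<close>
  have "((\<lambda>\<tau>. (y \<tau> / nome \<tau> / ?c) ^ 2) \<longlongrightarrow> 1) cusp" "((\<lambda>\<tau>. (haupt_u N (nome \<tau>) / ?c) ^ 2) \<longlongrightarrow> 1) cusp"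
    using tendsto_power[OF 1, of 2] tendsto_power[OF 2, of 2] by simp_all
  moreover have "eventually (\<lambda>\<tau>. ((y \<tau> / nome \<tau> / ?c) ^ 2) ^ 12 = ((haupt_u N (nome \<tau>) / ?c) ^ 2) ^ 12) cusp"
    using eq eventually_cusp_uhp[of 0]
    by eventually_elim (simp add: hauptmodul_q[OF N] power_divide power_mult_distrib flip: power_mult)
  ultimately have "eventually (\<lambda>\<tau>. (y \<tau> / nome \<tau> / ?c) ^ 2 = (haupt_u N (nome \<tau>) / ?c) ^ 2) cusp"
    by (rule eventually_eq_if_power_eq)
  hence "eventually (\<lambda>\<tau>. (y \<tau> / nome \<tau> / ?c) ^ 12 = (haupt_u N (nome \<tau>) / ?c) ^ 12) cusp"
  proof eventually_elim
    case (elim \<tau>)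
    from arg_cong[OF elim, of "\<lambda>z. z ^ 6"] show ?case unfolding power_mult[symmetric] by simp
  qed
  from eventually_eq_if_power_eq[OF 1 2 this] eventually_cusp_uhp[of 0]
  show ?thesis by eventually_elim (use c in \<open>simp add: hauptmodul_q[OF N] field_simps\<close>)
qed

lemma hauptmodul_tendsto_0: "N \<in> genus0_levels \<Longrightarrow> (hauptmodul N \<longlongrightarrow> 0) cusp"
  using q_holomorphicD(2)[OF hauptmodul_q_holomorphic] .

lemma hauptmodul_holomorphic: "N \<in> genus0_levels \<Longrightarrow> hauptmodul N holomorphic_on uhp"
  using q_holomorphicD(1)[OF hauptmodul_q_holomorphic] .

lemma hauptmodul_mult_holomorphic:
  assumes "N \<in> genus0_levels" "n > 0"
  shows "(\<lambda>\<tau>. hauptmodul N (of_nat n * \<tau>)) holomorphic_on uhp"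
  by (rule holomorphic_on_compose_gen[OF _ hauptmodul_holomorphic[OF assms(1)], unfolded o_def])
     (use assms(2) in \<open>auto intro!: holomorphic_intros\<close>)

lemma hauptmodul_over_nome:
  assumes "N \<in> genus0_levels"
  shows "((\<lambda>\<tau>. hauptmodul N \<tau> / nome \<tau>) \<longlongrightarrow> haupt_u N 0) cusp"
  by (rule Lim_transform_eventually[OF tendsto_hol_nome[OF haupt_u_props(1)[OF assms]]])
     (use hauptmodul_q[OF assms] in \<open>auto intro!: eventually_mono[OF eventually_cusp_uhp[of 0]]\<close>)

text \<open>This is 1/j as a function of t_p. Unlike j it is holomorphic at t = 0 and injective near
  it.\<close>

definition inv_j :: "nat \<Rightarrow> complex \<Rightarrow> complex" where
  "inv_j p z = z / j_num p z 1"

lemma inv_j_hauptmodul: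
  assumes "p \<in> {2, 3, 5}" "Im \<tau> > 0"
  shows "inv_j p (hauptmodul p \<tau>) = 1 / modular_j \<tau>"
  unfolding inv_j_def modular_j_level_prime[OF assms] by simp

text \<open>The Fricke involution replaces \<tau> by -1/(p \<tau>), where j takes the value j(p
  \<tau>).\<close>

lemma inv_j_Fricke:
  assumes p: "p \<in> {2, 3, 5}" and \<tau>: "Im \<tau> > 0"
  shows "inv_j p (of_nat p ^ (12 div (p - 1)) / hauptmodul p \<tau>) = 1 / modular_j (of_nat p * \<tau>)"
proof -
  have p\<tau>: "Im (of_nat p * \<tau>) > 0" using p \<tau> by auto
  note im = Im_inversion[OF p\<tau>]
  have "hauptmodul p (- 1 / (of_nat p * \<tau>)) = of_nat p ^ (12 div (p - 1)) / hauptmodul p \<tau>"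
    using Fricke_inversion[OF p \<tau>] hauptmodul_nonzero[OF prime_in_levels[OF p] \<tau>] by (simp add: field_simps)
  thus ?thesis using inv_j_hauptmodul[OF p im] by (simp only: modular_j_inversion[OF p\<tau>])
qed

lemma add_numeral_nonzero: "norm (z::complex) < 1 \<Longrightarrow> z + numeral k \<noteq> 0"
proof
  assume z: "norm z < 1" "z + numeral k = 0"
  hence "z = - numeral k" by (simp add: add_eq_0_iff2)
  hence "norm z = numeral k" by simp
  moreover have "(1::real) \<le> numeral k" by simp
  ultimately show False using z(1) by linarith
qed

text \<open>For p = 2 and p = 3 the numerator has no zero in the unit disc. For p = 5 the factor t^2
  + 10 t + 5 has the zero -5 + 2 sqrt 5 there.\<close>

lemma inv_j_near_0:
  assumes p: "p \<in> {2, 3}"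
  shows "inv_j p holomorphic_on ball 0 1" "(inv_j p has_field_derivative inverse (j_num p 0 1)) (at 0)" "j_num p 0 1 \<noteq> 0"
proof -
  have nz: "j_num p z 1 \<noteq> 0" if "norm z < 1" for z
    using p that add_numeral_nonzero by (auto simp: j_num_def)
  show hol: "inv_j p holomorphic_on ball 0 1" unfolding inv_j_def
    by (intro holomorphic_intros j_num_holomorphic) (use nz in auto)
  show n0: "j_num p 0 1 \<noteq> 0" using nz by simp
  have "(\<lambda>z. j_num p z 1) holomorphic_on UNIV" by (intro holomorphic_intros j_num_holomorphic)
  then obtain D where "((\<lambda>z. j_num p z 1) has_field_derivative D) (at 0)"
    using holomorphic_on_imp_differentiable_at[of _ UNIV 0] unfolding field_differentiable_def by auto
  from DERIV_divide[OF DERIV_ident this n0]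
  show "(inv_j p has_field_derivative inverse (j_num p 0 1)) (at 0)"
    unfolding inv_j_def[abs_def] using n0 by (simp add: divide_simps)
qed

text \<open>As \<open>inv_j p\<close> is injective near 0, a function tending to 0 with the right
  value of 1/j(n \<tau>) must be t_p(n \<tau>).\<close>

lemma eventually_eq_hauptmodul_prime:
  assumes p: "p \<in> {2, 3}" and n: "n > 0" and b: "(b \<longlongrightarrow> 0) cusp"
    and eq: "eventually (\<lambda>\<tau>. inv_j p (b \<tau>) = 1 / modular_j (of_nat n * \<tau>)) cusp"
  shows "eventually (\<lambda>\<tau>. b \<tau> = hauptmodul p (of_nat n * \<tau>)) cusp"
proof (rule local_injective[OF inv_j_near_0(1,2)[OF p] _ b])
  have p': "p \<in> {2, 3, 5}" using p by auto
  show "inverse (j_num p 0 1) \<noteq> 0" using inv_j_near_0(3)[OF p] by simp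
  show "((\<lambda>\<tau>. hauptmodul p (of_nat n * \<tau>)) \<longlongrightarrow> 0) cusp"
    by (rule tendsto_cusp_rescale(2)[OF hauptmodul_tendsto_0[OF prime_in_levels[OF p']] n])
  show "eventually (\<lambda>\<tau>. inv_j p (b \<tau>) = inv_j p (hauptmodul p (of_nat n * \<tau>))) cusp"
    using eq eventually_cusp_uhp[of 0]
  proof eventually_elim
    case (elim \<tau>)
    hence "Im (of_nat n * \<tau>) > 0" using n by simp
    from inv_j_hauptmodul[OF p' this] elim show ?case by simp
  qed
qed

lemma eventually_small:
  assumes "(y \<longlongrightarrow> (0::complex)) F"
  shows "eventually (\<lambda>x. norm (y x) < 1) F"
  using tendstoD[OF assms, of 1] by (simp add: dist_norm)

section \<open>The relations at the composite levels\<close>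

text \<open>For y = t_4 the arguments are t_2(2 \<tau>) and the Fricke image of t_2(\<tau>). Both
  have to give 1/j(2 \<tau>), and the identity holds with y free.\<close>

lemma level_4_aux:
  assumes "norm (y::complex) < 1"
  shows "inv_j 2 (y ^ 2 / (y + 16)) = inv_j 2 (4096 / (y * (y + 16)))"
proof (cases "y = 0")
  case False
  have nz: "y + 16 \<noteq> 0" using add_numeral_nonzero[OF assms] by blast
  define w where "w = y ^ 2 + 16 * y + 256"
  have 1: "y ^ 2 / (y + 16) + 16 = w / (y + 16)" using nz by (simp add: w_def field_simps)
  have 2: "4096 / (y * (y + 16)) + 16 = 16 * w / (y * (y + 16))"
  proof -
    have "16 * w = 4096 + 16 * (y * (y + 16))" by (simp add: w_def algebra_simps power2_eq_square)
    thus ?thesis using nz False by (simp add: add_divide_distrib)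
  qed
  show ?thesis
  \<comment> \<open>w divides both values of \<open>j_num\<close>; at its zeros each side is a
    quotient by 0 and therefore 0.\<close>
  proof (cases "w = 0")
    case False
    thus ?thesis unfolding inv_j_def j_num_def mult_1_right using nz \<open>y \<noteq> 0\<close>
      by (simp add: 1 2 power_divide power_mult_distrib) (simp add: divide_simps, simp add: eval_nat_numeral)
  qed (simp add: inv_j_def j_num_def 1 2)
qed (simp add: inv_j_def)

text \<open>For the local solution y of the first relation, \<open>level_4_aux\<close> yields the
  second. The product of t_2(\<tau>) and t_2(2 \<tau>) is y^3 by these relations and t_4^3 by the
  eta quotients. The second relation is used again at level 8.\<close>

theorem level_4:
  assumes \<tau>: "Im \<tau> > 0"
  shows "hauptmodul 2 \<tau> = hauptmodul 4 \<tau> * (hauptmodul 4 \<tau> + 16)"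
    "hauptmodul 2 (2 * \<tau>) * (hauptmodul 4 \<tau> + 16) = hauptmodul 4 \<tau> ^ 2"
proof -
  have lv: "2 \<in> genus0_levels" "4 \<in> genus0_levels" by (auto simp: genus0_levels_def)
  obtain y where y: "(y \<longlongrightarrow> 0) cusp" "eventually (\<lambda>\<tau>. y \<tau> * (y \<tau> + 16) = hauptmodul 2 \<tau>) cusp"
  proof (rule local_solution[of "\<lambda>z. z * (z + 16)" 16 "hauptmodul 2" cusp])
    show "((\<lambda>z. z * (z + 16)) has_field_derivative 16) (at (0::complex))"
      by (auto intro!: derivative_eq_intros)
  qed (auto intro!: holomorphic_intros hauptmodul_tendsto_0 lv)
  have b: "eventually (\<lambda>\<tau>. y \<tau> ^ 2 / (y \<tau> + 16) = hauptmodul 2 (of_nat 2 * \<tau>)) cusp"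
  proof (rule eventually_eq_hauptmodul_prime)
    have "((\<lambda>\<tau>. y \<tau> ^ 2 / (y \<tau> + 16)) \<longlongrightarrow> 0 ^ 2 / (0 + 16)) cusp" by (intro tendsto_intros y(1)) auto
    thus "((\<lambda>\<tau>. y \<tau> ^ 2 / (y \<tau> + 16)) \<longlongrightarrow> 0) cusp" by simp
    show "eventually (\<lambda>\<tau>. inv_j 2 (y \<tau> ^ 2 / (y \<tau> + 16)) = 1 / modular_j (of_nat 2 * \<tau>)) cusp"
      using y(2) eventually_small[OF y(1)] eventually_cusp_uhp[of 0]
      by eventually_elim (use inv_j_Fricke[of 2] in \<open>simp add: level_4_aux\<close>)
  qed auto
  have yn: "eventually (\<lambda>\<tau>. y \<tau> + 16 \<noteq> 0) cusp"
    using eventually_small[OF y(1)] by eventually_elim (rule add_numeral_nonzero)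
  have "eventually (\<lambda>\<tau>. y \<tau> = hauptmodul 4 \<tau>) cusp"
  proof (rule eventually_eq_hauptmodul[OF lv(2)])
    have "((\<lambda>\<tau>. hauptmodul 2 \<tau> / nome \<tau> / (y \<tau> + 16)) \<longlongrightarrow> haupt_u 2 0 / (0 + 16)) cusp"
      by (intro tendsto_intros hauptmodul_over_nome lv y(1)) auto
    moreover have "eventually (\<lambda>\<tau>. hauptmodul 2 \<tau> / nome \<tau> / (y \<tau> + 16) = y \<tau> / nome \<tau>) cusp"
      using y(2) yn
    proof eventually_elim
      case (elim \<tau>)
      show ?case unfolding elim(1)[symmetric] using elim(2) by simp
    qed
    ultimately show "((\<lambda>\<tau>. y \<tau> / nome \<tau>) \<longlongrightarrow> haupt_u 4 0) cusp"
      using Lim_transform_eventually by (fastforce simp: haupt_u_def eta_quot_def)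
    show "eventually (\<lambda>\<tau>. y \<tau> ^ 24 = hauptmodul 4 \<tau> ^ 24) cusp"
      using y(2) yn b eventually_cusp_uhp[of 0]
    proof eventually_elim
      case (elim \<tau>)
      have "y \<tau> ^ 3 = hauptmodul 2 \<tau> * hauptmodul 2 (of_nat 2 * \<tau>)"
        unfolding elim(1)[symmetric] elim(3)[symmetric] using elim(2) by (simp add: field_simps eval_nat_numeral)
      also have "\<dots> = hauptmodul 4 \<tau> ^ 3"
        using eta_nonzero[of \<tau>] eta_nonzero[of "2 * \<tau>"] elim(4)
        by (simp add: hauptmodul_def Let_def power_divide power_mult_distrib mult.assoc[symmetric] flip: power_mult)
      finally have "(y \<tau> ^ 3) ^ 8 = (hauptmodul 4 \<tau> ^ 3) ^ 8" by simp
      thus ?case by (simp flip: power_mult)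
    qed
  qed
  note y4 = this
  have ev: "eventually (\<lambda>\<tau>. hauptmodul 2 \<tau> - hauptmodul 4 \<tau> * (hauptmodul 4 \<tau> + 16) = 0) cusp"
    "eventually (\<lambda>\<tau>. hauptmodul 2 (of_nat 2 * \<tau>) * (hauptmodul 4 \<tau> + 16) - hauptmodul 4 \<tau> ^ 2 = 0) cusp"
    by (use y4 y(2) in \<open>eventually_elim, simp\<close>) (use y4 b yn in \<open>eventually_elim, simp add: nonzero_divide_eq_eq\<close>)
  show "hauptmodul 2 \<tau> = hauptmodul 4 \<tau> * (hauptmodul 4 \<tau> + 16)"
    using uhp_zero_if_eventually_zero[OF _ ev(1) \<tau>] by (simp add: holomorphic_intros hauptmodul_holomorphic lv)
  show "hauptmodul 2 (2 * \<tau>) * (hauptmodul 4 \<tau> + 16) = hauptmodul 4 \<tau> ^ 2"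
    using uhp_zero_if_eventually_zero[OF _ ev(2) \<tau>] hauptmodul_mult_holomorphic[OF lv(1), of 2]
    by (simp add: holomorphic_intros hauptmodul_holomorphic lv)
qed

text \<open>As at level 4, for t_3(3 \<tau>) and the Fricke image of t_3(\<tau>), both expressed in
  y = t_9.\<close>

lemma level_9_aux:
  assumes "norm (y::complex) < 1" "y ^ 2 + 9 * y + 27 \<noteq> 0"
  shows "inv_j 3 (y ^ 3 / (y ^ 2 + 9 * y + 27)) = inv_j 3 (729 / (y * (y ^ 2 + 9 * y + 27)))"
proof (cases "y = 0")
  case False
  define w where "w = y ^ 2 + 9 * y + 27"
  have nz: "w \<noteq> 0" using assms(2) by (simp add: w_def)
  \<comment> \<open>Up to constants and powers of y and w, both values of \<open>j_num\<close> are
    f^3 g^3 h^3.\<close>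
  define f g h where "f = y + 9" and "g = y + 3" and "h = y ^ 2 + 27"
  have "y ^ 3 + 27 * w = f ^ 3" "y ^ 3 + 3 * w = g * h"
    by (simp_all add: w_def f_def g_def h_def algebra_simps eval_nat_numeral)
  hence 1: "y ^ 3 / w + 27 = f ^ 3 / w" "y ^ 3 / w + 3 = g * h / w" using nz by (simp_all add: field_simps)
  have "729 + 27 * (y * w) = 27 * g ^ 3" "729 + 3 * (y * w) = 3 * (f * h)"
    by (simp_all add: w_def f_def g_def h_def algebra_simps eval_nat_numeral)
  hence 2: "729 / (y * w) + 27 = 27 * g ^ 3 / (y * w)" "729 / (y * w) + 3 = 3 * (f * h) / (y * w)"
    using nz False by (simp_all add: add_divide_distrib flip: \<open>729 + 27 * (y * w) = 27 * g ^ 3\<close> \<open>729 + 3 * (y * w) = 3 * (f * h)\<close>)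
  have fg: "f \<noteq> 0" "g \<noteq> 0" using add_numeral_nonzero[OF assms(1)] by (auto simp: f_def g_def)
  show ?thesis
  proof (cases "h = 0")
    case False
    thus ?thesis unfolding inv_j_def j_num_def mult_1_right w_def[symmetric] using nz fg \<open>y \<noteq> 0\<close>
      by (simp add: 1 2 power_divide power_mult_distrib)
  qed (simp add: inv_j_def j_num_def 1 2 flip: w_def)
qed (simp add: inv_j_def)

text \<open>The product of t_3(\<tau>) and t_3(3 \<tau>) is y^4 by the expected relations and t_9^4
  by the eta quotients.\<close>

theorem level_9:
  assumes \<tau>: "Im \<tau> > 0"
  shows "hauptmodul 3 \<tau> = hauptmodul 9 \<tau> * (hauptmodul 9 \<tau> ^ 2 + 9 * hauptmodul 9 \<tau> + 27)"
proof -
  have lv: "3 \<in> genus0_levels" "9 \<in> genus0_levels" by (auto simp: genus0_levels_def)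
  obtain y where y: "(y \<longlongrightarrow> 0) cusp" "eventually (\<lambda>\<tau>. y \<tau> * (y \<tau> ^ 2 + 9 * y \<tau> + 27) = hauptmodul 3 \<tau>) cusp"
  proof (rule local_solution[of "\<lambda>z. z * (z ^ 2 + 9 * z + 27)" 27 "hauptmodul 3" cusp])
    show "((\<lambda>z. z * (z ^ 2 + 9 * z + 27)) has_field_derivative 27) (at (0::complex))"
      by (auto intro!: derivative_eq_intros)
  qed (auto intro!: holomorphic_intros hauptmodul_tendsto_0 lv)
  have w: "((\<lambda>\<tau>. y \<tau> ^ 2 + 9 * y \<tau> + 27) \<longlongrightarrow> 0 ^ 2 + 9 * 0 + 27) cusp" by (intro tendsto_intros y(1))
  have yn: "eventually (\<lambda>\<tau>. y \<tau> ^ 2 + 9 * y \<tau> + 27 \<noteq> 0) cusp"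
    by (rule tendsto_imp_eventually_ne[OF w]) simp
  have b: "eventually (\<lambda>\<tau>. y \<tau> ^ 3 / (y \<tau> ^ 2 + 9 * y \<tau> + 27) = hauptmodul 3 (of_nat 3 * \<tau>)) cusp"
  proof (rule eventually_eq_hauptmodul_prime)
    have "((\<lambda>\<tau>. y \<tau> ^ 3 / (y \<tau> ^ 2 + 9 * y \<tau> + 27)) \<longlongrightarrow> 0 ^ 3 / (0 ^ 2 + 9 * 0 + 27)) cusp"
      by (intro tendsto_intros y(1) w) auto
    thus "((\<lambda>\<tau>. y \<tau> ^ 3 / (y \<tau> ^ 2 + 9 * y \<tau> + 27)) \<longlongrightarrow> 0) cusp" by simp
    show "eventually (\<lambda>\<tau>. inv_j 3 (y \<tau> ^ 3 / (y \<tau> ^ 2 + 9 * y \<tau> + 27)) = 1 / modular_j (of_nat 3 * \<tau>)) cusp"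
      using y(2) yn eventually_small[OF y(1)] eventually_cusp_uhp[of 0]
      by eventually_elim (use inv_j_Fricke[of 3] in \<open>simp add: level_9_aux\<close>)
  qed auto
  have y9: "eventually (\<lambda>\<tau>. y \<tau> = hauptmodul 9 \<tau>) cusp"
  proof (rule eventually_eq_hauptmodul[OF lv(2)])
    have "((\<lambda>\<tau>. hauptmodul 3 \<tau> / nome \<tau> / (y \<tau> ^ 2 + 9 * y \<tau> + 27)) \<longlongrightarrow> haupt_u 3 0 / (0 ^ 2 + 9 * 0 + 27)) cusp"
      by (intro tendsto_intros hauptmodul_over_nome lv w) auto
    moreover have "eventually (\<lambda>\<tau>. hauptmodul 3 \<tau> / nome \<tau> / (y \<tau> ^ 2 + 9 * y \<tau> + 27) = y \<tau> / nome \<tau>) cusp"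
      using y(2) yn
    proof eventually_elim
      case (elim \<tau>)
      show ?case unfolding elim(1)[symmetric] using elim(2) by simp
    qed
    ultimately show "((\<lambda>\<tau>. y \<tau> / nome \<tau>) \<longlongrightarrow> haupt_u 9 0) cusp"
      using Lim_transform_eventually by (fastforce simp: haupt_u_def eta_quot_def)
    show "eventually (\<lambda>\<tau>. y \<tau> ^ 24 = hauptmodul 9 \<tau> ^ 24) cusp"
      using y(2) yn b eventually_cusp_uhp[of 0]
    proof eventually_elim
      case (elim \<tau>)
      have "y \<tau> ^ 4 = hauptmodul 3 \<tau> * hauptmodul 3 (of_nat 3 * \<tau>)"
        unfolding elim(1)[symmetric] elim(3)[symmetric] using elim(2) by (simp add: eval_nat_numeral)
      also have "\<dots> = hauptmodul 9 \<tau> ^ 4"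
        using eta_nonzero[of \<tau>] eta_nonzero[of "3 * \<tau>"] elim(4)
        by (simp add: hauptmodul_def Let_def power_divide power_mult_distrib mult.assoc[symmetric] flip: power_mult)
      finally have "(y \<tau> ^ 4) ^ 6 = (hauptmodul 9 \<tau> ^ 4) ^ 6" by simp
      thus ?case by (simp flip: power_mult)
    qed
  qed
  have ev: "eventually (\<lambda>\<tau>. hauptmodul 3 \<tau> - hauptmodul 9 \<tau> * (hauptmodul 9 \<tau> ^ 2 + 9 * hauptmodul 9 \<tau> + 27) = 0) cusp"
    using y9 y(2) by eventually_elim simp
  show ?thesis
    using uhp_zero_if_eventually_zero[OF _ ev \<tau>] by (simp add: holomorphic_intros hauptmodul_holomorphic lv)
qed

text \<open>Here t_2(2 \<tau>) takes the place of j(2 \<tau>): by level 4 it is the value of z (z +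
  16) at t_4(2 \<tau>), and this polynomial is injective near 0, which identifies y^2/(y + 4) with
  t_4(2 \<tau>).\<close>

theorem level_8:
  assumes \<tau>: "Im \<tau> > 0"
  shows "hauptmodul 4 \<tau> = hauptmodul 8 \<tau> * (hauptmodul 8 \<tau> + 8)"
proof -
  have lv: "2 \<in> genus0_levels" "4 \<in> genus0_levels" "8 \<in> genus0_levels" by (auto simp: genus0_levels_def)
  obtain y where y: "(y \<longlongrightarrow> 0) cusp" "eventually (\<lambda>\<tau>. y \<tau> * (y \<tau> + 8) = hauptmodul 4 \<tau>) cusp"
  proof (rule local_solution[of "\<lambda>z. z * (z + 8)" 8 "hauptmodul 4" cusp])
    show "((\<lambda>z. z * (z + 8)) has_field_derivative 8) (at (0::complex))"
      by (auto intro!: derivative_eq_intros)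
  qed (auto intro!: holomorphic_intros hauptmodul_tendsto_0 lv)
  have nz: "eventually (\<lambda>\<tau>. y \<tau> + 4 \<noteq> 0) cusp" "eventually (\<lambda>\<tau>. y \<tau> + 8 \<noteq> 0) cusp"
    by (rule eventually_mono[OF eventually_small[OF y(1)] add_numeral_nonzero], assumption)
       (rule eventually_mono[OF eventually_small[OF y(1)] add_numeral_nonzero], assumption)
  have b: "eventually (\<lambda>\<tau>. y \<tau> ^ 2 / (y \<tau> + 4) = hauptmodul 4 (of_nat 2 * \<tau>)) cusp"
  proof (rule local_injective[of "\<lambda>z. z * (z + 16)" 16])
    show "((\<lambda>z. z * (z + 16)) has_field_derivative 16) (at (0::complex))"
      by (auto intro!: derivative_eq_intros)
    have "((\<lambda>\<tau>. y \<tau> ^ 2 / (y \<tau> + 4)) \<longlongrightarrow> 0 ^ 2 / (0 + 4)) cusp" by (intro tendsto_intros y(1)) auto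
    thus "((\<lambda>\<tau>. y \<tau> ^ 2 / (y \<tau> + 4)) \<longlongrightarrow> 0) cusp" by simp
    show "((\<lambda>\<tau>. hauptmodul 4 (of_nat 2 * \<tau>)) \<longlongrightarrow> 0) cusp"
      by (rule tendsto_cusp_rescale(2)[OF hauptmodul_tendsto_0[OF lv(2)]]) simp
    show "eventually (\<lambda>\<tau>. y \<tau> ^ 2 / (y \<tau> + 4) * (y \<tau> ^ 2 / (y \<tau> + 4) + 16) =
      hauptmodul 4 (of_nat 2 * \<tau>) * (hauptmodul 4 (of_nat 2 * \<tau>) + 16)) cusp"
      using y(2) nz(1) eventually_cusp_uhp[of 0]
    proof eventually_elim
      case (elim \<tau>)
      have s: "hauptmodul 4 \<tau> + 16 = (y \<tau> + 4) ^ 2"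
        unfolding elim(1)[symmetric] by (simp add: algebra_simps power2_eq_square)
      have "hauptmodul 4 (of_nat 2 * \<tau>) * (hauptmodul 4 (of_nat 2 * \<tau>) + 16) = hauptmodul 2 (2 * \<tau>)"
        using level_4(1)[of "2 * \<tau>"] elim(3) by simp
      also have "\<dots> = hauptmodul 4 \<tau> ^ 2 / (y \<tau> + 4) ^ 2"
        using level_4(2)[OF elim(3)] elim(2) unfolding s by (simp add: field_simps)
      also have "\<dots> = (y \<tau> * (y \<tau> + 8)) ^ 2 / (y \<tau> + 4) ^ 2" unfolding elim(1) ..
      also have "\<dots> = y \<tau> ^ 2 / (y \<tau> + 4) * ((y \<tau> ^ 2 + 16 * (y \<tau> + 4)) / (y \<tau> + 4))"
      proof -
        have "(y \<tau> * (y \<tau> + 8)) ^ 2 = y \<tau> ^ 2 * (y \<tau> ^ 2 + 16 * (y \<tau> + 4))"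
          by (simp add: power2_eq_square algebra_simps)
        thus ?thesis by (simp only: times_divide_times_eq power2_eq_square[of "y \<tau> + 4"])
      qed
      also have "(y \<tau> ^ 2 + 16 * (y \<tau> + 4)) / (y \<tau> + 4) = y \<tau> ^ 2 / (y \<tau> + 4) + 16"
        by (simp only: add_divide_distrib nonzero_mult_div_cancel_right[OF elim(2)])
      finally show ?case ..
    qed
  qed (auto intro!: holomorphic_intros)
  have y8: "eventually (\<lambda>\<tau>. y \<tau> = hauptmodul 8 \<tau>) cusp"
  proof (rule eventually_eq_hauptmodul[OF lv(3)])
    have "((\<lambda>\<tau>. hauptmodul 4 \<tau> / nome \<tau> / (y \<tau> + 8)) \<longlongrightarrow> haupt_u 4 0 / (0 + 8)) cusp"
      by (intro tendsto_intros hauptmodul_over_nome lv y(1)) auto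
    moreover have "eventually (\<lambda>\<tau>. hauptmodul 4 \<tau> / nome \<tau> / (y \<tau> + 8) = y \<tau> / nome \<tau>) cusp"
      using y(2) nz(2)
    proof eventually_elim
      case (elim \<tau>)
      show ?case unfolding elim(1)[symmetric] using elim(2) by simp
    qed
    ultimately show "((\<lambda>\<tau>. y \<tau> / nome \<tau>) \<longlongrightarrow> haupt_u 8 0) cusp"
      using Lim_transform_eventually by (fastforce simp: haupt_u_def eta_quot_def)
    show "eventually (\<lambda>\<tau>. y \<tau> ^ 24 = hauptmodul 8 \<tau> ^ 24) cusp"
      using y(2) b nz(1) eventually_cusp_uhp[of 0]
    proof eventually_elim
      case (elim \<tau>)
      have s: "hauptmodul 4 \<tau> + 16 = (y \<tau> + 4) ^ 2"
        unfolding elim(1)[symmetric] by (simp add: algebra_simps power2_eq_square)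
      \<comment> \<open>The factor t_4 + 16 is not visibly an eta quotient; level 4 identifies it
        with t_2 / t_4.\<close>
      have "y \<tau> ^ 4 = hauptmodul 4 (of_nat 2 * \<tau>) ^ 2 * (hauptmodul 4 \<tau> + 16)"
        unfolding s elim(2)[symmetric] using elim(3) by (simp add: power_divide flip: power_mult)
      also have "\<dots> = hauptmodul 4 (of_nat 2 * \<tau>) ^ 2 * (hauptmodul 2 \<tau> / hauptmodul 4 \<tau>)"
        using level_4(1)[OF elim(4)] hauptmodul_nonzero[OF lv(2) elim(4)] by simp
      also have "\<dots> = hauptmodul 8 \<tau> ^ 4"
        using eta_nonzero[of \<tau>] eta_nonzero[of "2 * \<tau>"] eta_nonzero[of "4 * \<tau>"] elim(4)
        by (simp add: hauptmodul_def Let_def power_divide power_mult_distrib mult.assoc[symmetric] flip: power_mult)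
           (simp add: divide_simps flip: power_add)
      finally have "(y \<tau> ^ 4) ^ 6 = (hauptmodul 8 \<tau> ^ 4) ^ 6" by simp
      thus ?case by (simp flip: power_mult)
    qed
  qed
  have ev: "eventually (\<lambda>\<tau>. hauptmodul 4 \<tau> - hauptmodul 8 \<tau> * (hauptmodul 8 \<tau> + 8) = 0) cusp"
    using y8 y(2) by eventually_elim simp
  show ?thesis
    using uhp_zero_if_eventually_zero[OF _ ev \<tau>] by (simp add: holomorphic_intros hauptmodul_holomorphic lv)
qed

lemma inv_j_divide:
  assumes "p \<in> {2, 3, 5}" "d \<noteq> 0"
  shows "inv_j p (n / d) = n * d ^ p / j_num p n d"
  unfolding inv_j_def j_num_scale[OF assms] using assms(2) by simp

text \<open>For y = t_6 the expected values are t_2 = y (y + 8)^3/(y + 9), t_3 = y (y + 9)^2/(y +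
  8), t_3(2 \<tau>) = y^2 (y + 9)/(y + 8)^2 and t_2(3 \<tau>) = y^3 (y + 8)/(y + 9)^3. The
  identities compare the two resulting expressions for each of 1/j(\<tau>), 1/j(2 \<tau>) and 1/j(3
  \<tau>).\<close>

lemma level_6_aux:
  assumes "norm (y::complex) < 1"
  shows "inv_j 3 (y * (y + 9) ^ 2 / (y + 8)) = inv_j 2 (y * (y + 8) ^ 3 / (y + 9))"
    and "inv_j 3 (y ^ 2 * (y + 9) / (y + 8) ^ 2) = inv_j 2 (4096 / (y * (y + 8) ^ 3 / (y + 9)))"
    and "inv_j 2 (y ^ 3 * (y + 8) / (y + 9) ^ 3) = inv_j 3 (729 / (y * (y + 9) ^ 2 / (y + 8)))"
proof -
  have nz: "y + 8 \<noteq> 0" "y + 9 \<noteq> 0" using add_numeral_nonzero[OF assms] by blast+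
  \<comment> \<open>a and b, and later c, e and f, are the irreducible building blocks seen in the
    numerators; the two sides of each identity share them.\<close>
  define a where "a = y + 6"
  define b where "b = y ^ 3 + 18 * y ^ 2 + 84 * y + 24"
  have j: "j_num 3 (y * (y + 9) ^ 2) (y + 8) = a ^ 3 * b ^ 3" "j_num 2 (y * (y + 8) ^ 3) (y + 9) = (a * b) ^ 3"
  proof -
    have "y * (y + 9) ^ 2 + 27 * (y + 8) = a ^ 3" "y * (y + 9) ^ 2 + 3 * (y + 8) = b"
      "y * (y + 8) ^ 3 + 16 * (y + 9) = a * b"
      by (simp_all add: a_def b_def algebra_simps eval_nat_numeral)
    thus "j_num 3 (y * (y + 9) ^ 2) (y + 8) = a ^ 3 * b ^ 3" "j_num 2 (y * (y + 8) ^ 3) (y + 9) = (a * b) ^ 3"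
      by (simp_all add: j_num_def)
  qed
  show "inv_j 3 (y * (y + 9) ^ 2 / (y + 8)) = inv_j 2 (y * (y + 8) ^ 3 / (y + 9))"
    using nz by (simp add: inv_j_divide j power_mult_distrib mult_ac)
  define c where "c = y + 12"
  define e where "e = y ^ 3 + 12 * y ^ 2 + 48 * y + 192"
  have k: "j_num 3 (y ^ 2 * (y + 9)) ((y + 8) ^ 2) = c ^ 3 * e ^ 3"
    "j_num 2 (4096 * (y + 9)) (y * (y + 8) ^ 3) = 4096 * (c * e) ^ 3"
  proof -
    have "y ^ 2 * (y + 9) + 27 * (y + 8) ^ 2 = c ^ 3" "y ^ 2 * (y + 9) + 3 * (y + 8) ^ 2 = e"
      "4096 * (y + 9) + 16 * (y * (y + 8) ^ 3) = 16 * (c * e)"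
      by (simp_all add: c_def e_def algebra_simps eval_nat_numeral)
    thus "j_num 3 (y ^ 2 * (y + 9)) ((y + 8) ^ 2) = c ^ 3 * e ^ 3"
      "j_num 2 (4096 * (y + 9)) (y * (y + 8) ^ 3) = 4096 * (c * e) ^ 3"
      by (simp_all add: j_num_def power_mult_distrib)
  qed
  define f where "f = y ^ 3 + 18 * y ^ 2 + 324 * y + 1944"
  have l: "j_num 2 (y ^ 3 * (y + 8)) ((y + 9) ^ 3) = (a * f) ^ 3"
    "j_num 3 (729 * (y + 8)) (y * (y + 9) ^ 2) = 729 * (a ^ 3 * f ^ 3)"
  proof -
    have "y ^ 3 * (y + 8) + 16 * (y + 9) ^ 3 = a * f" "729 * (y + 8) + 27 * (y * (y + 9) ^ 2) = 27 * a ^ 3"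
      "729 * (y + 8) + 3 * (y * (y + 9) ^ 2) = 3 * f"
      by (simp_all add: a_def f_def algebra_simps eval_nat_numeral)
    thus "j_num 2 (y ^ 3 * (y + 8)) ((y + 9) ^ 3) = (a * f) ^ 3"
      "j_num 3 (729 * (y + 8)) (y * (y + 9) ^ 2) = 729 * (a ^ 3 * f ^ 3)"
      by (simp_all add: j_num_def power_mult_distrib)
  qed
  have "inv_j 3 (y ^ 2 * (y + 9) / (y + 8) ^ 2) = inv_j 2 (4096 * (y + 9) / (y * (y + 8) ^ 3)) \<and>
    inv_j 2 (y ^ 3 * (y + 8) / (y + 9) ^ 3) = inv_j 3 (729 * (y + 8) / (y * (y + 9) ^ 2))"
  proof (cases "y = 0")
    case False
    have gen: "K * n * (y * m ^ 3) ^ 2 / (K * (c * e) ^ 3) = y ^ 2 * n * (m ^ 2) ^ 3 / (c ^ 3 * e ^ 3)"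
      "K * n * (y * m ^ 2) ^ 3 / (K * (a ^ 3 * f ^ 3)) = y ^ 3 * n * (m ^ 3) ^ 2 / (a * f) ^ 3" if "K \<noteq> 0" for K n m
      using that by (simp_all add: power_mult_distrib mult_ac flip: power_mult)
    show ?thesis
    proof
      have "inv_j 2 (4096 * (y + 9) / (y * (y + 8) ^ 3)) = 4096 * (y + 9) * (y * (y + 8) ^ 3) ^ 2 / (4096 * (c * e) ^ 3)"
        using inv_j_divide[of 2 "y * (y + 8) ^ 3" "4096 * (y + 9)"] nz False unfolding k by simp
      also have "\<dots> = y ^ 2 * (y + 9) * ((y + 8) ^ 2) ^ 3 / (c ^ 3 * e ^ 3)"
        by (rule gen) simp
      also have "\<dots> = inv_j 3 (y ^ 2 * (y + 9) / (y + 8) ^ 2)" using nz by (simp add: inv_j_divide k)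
      finally show "inv_j 3 (y ^ 2 * (y + 9) / (y + 8) ^ 2) = inv_j 2 (4096 * (y + 9) / (y * (y + 8) ^ 3))" ..
      have "inv_j 3 (729 * (y + 8) / (y * (y + 9) ^ 2)) = 729 * (y + 8) * (y * (y + 9) ^ 2) ^ 3 / (729 * (a ^ 3 * f ^ 3))"
        using inv_j_divide[of 3 "y * (y + 9) ^ 2" "729 * (y + 8)"] nz False unfolding l by simp
      also have "\<dots> = y ^ 3 * (y + 8) * ((y + 9) ^ 3) ^ 2 / (a * f) ^ 3"
        by (rule gen) simp
      also have "\<dots> = inv_j 2 (y ^ 3 * (y + 8) / (y + 9) ^ 3)" using nz by (simp add: inv_j_divide l)
      finally show "inv_j 2 (y ^ 3 * (y + 8) / (y + 9) ^ 3) = inv_j 3 (729 * (y + 8) / (y * (y + 9) ^ 2))" ..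
    qed
  qed (simp add: inv_j_def)
  thus "inv_j 3 (y ^ 2 * (y + 9) / (y + 8) ^ 2) = inv_j 2 (4096 / (y * (y + 8) ^ 3 / (y + 9)))"
    "inv_j 2 (y ^ 3 * (y + 8) / (y + 9) ^ 3) = inv_j 3 (729 / (y * (y + 9) ^ 2 / (y + 8)))"
    by (simp_all only: divide_divide_eq_right)
qed

text \<open>The two products are E^4 and F^3 with the eta quotients E and F below, and t_6^2 = E F.
  The exponents 3 and 4 bring both to the power 12.\<close>

lemma level_6_eta:
  assumes \<tau>: "Im \<tau> > 0"
  shows "(hauptmodul 2 \<tau> * hauptmodul 2 (of_nat 3 * \<tau>)) ^ 3 * (hauptmodul 3 \<tau> * hauptmodul 3 (of_nat 2 * \<tau>)) ^ 4
    = hauptmodul 6 \<tau> ^ 24"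
proof -
  define e1 e2 e3 e6 where "e1 = dedekind_eta \<tau>" and "e2 = dedekind_eta (2 * \<tau>)"
    and "e3 = dedekind_eta (3 * \<tau>)" and "e6 = dedekind_eta (6 * \<tau>)"
  have nz: "e1 \<noteq> 0" "e2 \<noteq> 0" "e3 \<noteq> 0" "e6 \<noteq> 0"
    using \<tau> eta_nonzero[of \<tau>] eta_nonzero[of "2 * \<tau>"] eta_nonzero[of "3 * \<tau>"] eta_nonzero[of "6 * \<tau>"]
    by (simp_all add: e1_def e2_def e3_def e6_def)
  define E where "E = 64 * ((e2 * e6) / (e1 * e3)) ^ 6"
  define F where "F = 81 * ((e3 * e6) / (e1 * e2)) ^ 4"
  have "hauptmodul 2 \<tau> * hauptmodul 2 (of_nat 3 * \<tau>) = E ^ 4"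
    by (simp add: hauptmodul_def Let_def E_def e1_def e2_def e3_def e6_def power_mult_distrib power_divide flip: power_mult)
  moreover have "hauptmodul 3 \<tau> * hauptmodul 3 (of_nat 2 * \<tau>) = F ^ 3"
    by (simp add: hauptmodul_def Let_def F_def e1_def e2_def e3_def e6_def power_mult_distrib power_divide mult_ac flip: power_mult)
  moreover have "hauptmodul 6 \<tau> ^ 2 = E * F"
  proof -
    have "hauptmodul 6 \<tau> = 72 * (e2 * e6 ^ 5) / (e1 ^ 5 * e3)"
      by (simp add: hauptmodul_def Let_def e1_def e2_def e3_def e6_def)
    thus ?thesis using nz by (simp add: E_def F_def power_mult_distrib power_divide) (simp add: divide_simps flip: power_mult, simp add: eval_nat_numeral)
  qed
  ultimately have "(hauptmodul 2 \<tau> * hauptmodul 2 (of_nat 3 * \<tau>)) ^ 3 * (hauptmodul 3 \<tau> * hauptmodul 3 (of_nat 2 * \<tau>)) ^ 4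
     = (hauptmodul 6 \<tau> ^ 2) ^ 12"
    by (simp add: power_mult_distrib flip: power_mult)
  thus ?thesis by (simp flip: power_mult)
qed

text \<open>With t_2 prescribed through y, the other values follow in turn: t_3(\<tau>) from
  j(\<tau>), then t_3(2 \<tau>) by Fricke from t_2, then t_2(3 \<tau>) by Fricke from t_3. By
  \<open>level_6_eta\<close> all four together determine y^24.\<close>

theorem level_6:
  assumes \<tau>: "Im \<tau> > 0"
  shows "hauptmodul 2 \<tau> * (hauptmodul 6 \<tau> + 9) = hauptmodul 6 \<tau> * (hauptmodul 6 \<tau> + 8) ^ 3"
proof -
  have lv: "2 \<in> genus0_levels" "3 \<in> genus0_levels" "6 \<in> genus0_levels" by (auto simp: genus0_levels_def)
  obtain y where y: "(y \<longlongrightarrow> 0) cusp" "eventually (\<lambda>\<tau>. y \<tau> * (y \<tau> + 8) ^ 3 / (y \<tau> + 9) = hauptmodul 2 \<tau>) cusp"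
  proof (rule local_solution[of "\<lambda>z. z * (z + 8) ^ 3 / (z + 9)" "512 / 9" "hauptmodul 2" cusp])
    show "((\<lambda>z. z * (z + 8) ^ 3 / (z + 9)) has_field_derivative 512 / 9) (at (0::complex))"
      by (auto intro!: derivative_eq_intros)
    show "(\<lambda>z. z * (z + 8) ^ 3 / (z + 9)) holomorphic_on ball (0::complex) 1"
      by (intro holomorphic_intros) (use add_numeral_nonzero in auto)
  qed (auto intro!: hauptmodul_tendsto_0 lv)
  have nz: "eventually (\<lambda>\<tau>. y \<tau> + 8 \<noteq> 0) cusp" "eventually (\<lambda>\<tau>. y \<tau> + 9 \<noteq> 0) cusp"
    by (rule eventually_mono[OF eventually_small[OF y(1)] add_numeral_nonzero], assumption)
       (rule eventually_mono[OF eventually_small[OF y(1)] add_numeral_nonzero], assumption)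
  have "((\<lambda>\<tau>. y \<tau> * (y \<tau> + 9) ^ 2 / (y \<tau> + 8)) \<longlongrightarrow> 0 * (0 + 9) ^ 2 / (0 + 8)) cusp" by (intro tendsto_intros y(1)) auto
  hence t3: "eventually (\<lambda>\<tau>. y \<tau> * (y \<tau> + 9) ^ 2 / (y \<tau> + 8) = hauptmodul 3 (of_nat 1 * \<tau>)) cusp"
  proof (intro eventually_eq_hauptmodul_prime)
    show "eventually (\<lambda>\<tau>. inv_j 3 (y \<tau> * (y \<tau> + 9) ^ 2 / (y \<tau> + 8)) = 1 / modular_j (of_nat 1 * \<tau>)) cusp"
      using y(2) eventually_small[OF y(1)] eventually_cusp_uhp[of 0]
      by eventually_elim (use inv_j_hauptmodul[of 2] in \<open>simp add: level_6_aux(1)\<close>)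
  qed auto
  have "((\<lambda>\<tau>. y \<tau> ^ 2 * (y \<tau> + 9) / (y \<tau> + 8) ^ 2) \<longlongrightarrow> 0 ^ 2 * (0 + 9) / (0 + 8) ^ 2) cusp" by (intro tendsto_intros y(1)) auto
  hence t32: "eventually (\<lambda>\<tau>. y \<tau> ^ 2 * (y \<tau> + 9) / (y \<tau> + 8) ^ 2 = hauptmodul 3 (of_nat 2 * \<tau>)) cusp"
  proof (intro eventually_eq_hauptmodul_prime)
    show "eventually (\<lambda>\<tau>. inv_j 3 (y \<tau> ^ 2 * (y \<tau> + 9) / (y \<tau> + 8) ^ 2) = 1 / modular_j (of_nat 2 * \<tau>)) cusp"
      using y(2) eventually_small[OF y(1)] eventually_cusp_uhp[of 0]
    proof eventually_elim
      case (elim \<tau>)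
      show ?case using inv_j_Fricke[of 2, OF _ elim(3)] unfolding level_6_aux(2)[OF elim(2)] elim(1) by simp
    qed
  qed auto
  have "((\<lambda>\<tau>. y \<tau> ^ 3 * (y \<tau> + 8) / (y \<tau> + 9) ^ 3) \<longlongrightarrow> 0 ^ 3 * (0 + 8) / (0 + 9) ^ 3) cusp" by (intro tendsto_intros y(1)) auto
  hence t23: "eventually (\<lambda>\<tau>. y \<tau> ^ 3 * (y \<tau> + 8) / (y \<tau> + 9) ^ 3 = hauptmodul 2 (of_nat 3 * \<tau>)) cusp"
  proof (intro eventually_eq_hauptmodul_prime)
    show "eventually (\<lambda>\<tau>. inv_j 2 (y \<tau> ^ 3 * (y \<tau> + 8) / (y \<tau> + 9) ^ 3) = 1 / modular_j (of_nat 3 * \<tau>)) cusp"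
      using t3 eventually_small[OF y(1)] eventually_cusp_uhp[of 0]
    proof eventually_elim
      case (elim \<tau>)
      show ?case using inv_j_Fricke[of 3, OF _ elim(3)] unfolding level_6_aux(3)[OF elim(2)] elim(1) by simp
    qed
  qed auto
  have y6: "eventually (\<lambda>\<tau>. y \<tau> = hauptmodul 6 \<tau>) cusp"
  proof (rule eventually_eq_hauptmodul[OF lv(3)])
    have "((\<lambda>\<tau>. hauptmodul 2 \<tau> / nome \<tau> * (y \<tau> + 9) / (y \<tau> + 8) ^ 3) \<longlongrightarrow> haupt_u 2 0 * (0 + 9) / (0 + 8) ^ 3) cusp"
      by (intro tendsto_intros hauptmodul_over_nome lv y(1)) auto
    moreover have "eventually (\<lambda>\<tau>. hauptmodul 2 \<tau> / nome \<tau> * (y \<tau> + 9) / (y \<tau> + 8) ^ 3 = y \<tau> / nome \<tau>) cusp"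
      using y(2) nz
    proof eventually_elim
      case (elim \<tau>)
      show ?case unfolding elim(1)[symmetric] using elim(2,3) by simp
    qed
    ultimately show "((\<lambda>\<tau>. y \<tau> / nome \<tau>) \<longlongrightarrow> haupt_u 6 0) cusp"
      using Lim_transform_eventually by (fastforce simp: haupt_u_def eta_quot_def)
    show "eventually (\<lambda>\<tau>. y \<tau> ^ 24 = hauptmodul 6 \<tau> ^ 24) cusp"
      using y(2) nz t3 t32 t23 eventually_cusp_uhp[of 0]
    proof eventually_elim
      case (elim \<tau>)
      let ?y = "y \<tau>" and ?a = "y \<tau> + 8" and ?b = "y \<tau> + 9"
      have "(hauptmodul 2 \<tau> * hauptmodul 2 (of_nat 3 * \<tau>)) = (?y * ?a / ?b) ^ 4"
        unfolding elim(1)[symmetric] elim(6)[symmetric] using elim(2,3) by (simp add: power_mult_distrib power_divide eval_nat_numeral)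
      moreover have "(hauptmodul 3 \<tau> * hauptmodul 3 (of_nat 2 * \<tau>)) = (?y * ?b / ?a) ^ 3"
        using elim(4)[symmetric] unfolding elim(5)[symmetric] using elim(2,3) by (simp add: power_mult_distrib power_divide eval_nat_numeral)
      ultimately have "hauptmodul 6 \<tau> ^ 24 = ((?y * ?a / ?b) ^ 4) ^ 3 * ((?y * ?b / ?a) ^ 3) ^ 4"
        using level_6_eta[OF elim(7)] by simp
      also have "\<dots> = ((?y * ?a / ?b) * (?y * ?b / ?a)) ^ 12" by (simp only: power_mult_distrib flip: power_mult) simp
      also have "(?y * ?a / ?b) * (?y * ?b / ?a) = ?y ^ 2" using elim(2,3) by (simp add: power2_eq_square)
      finally show ?case by (simp flip: power_mult)
    qed
  qed
  have ev: "eventually (\<lambda>\<tau>. hauptmodul 2 \<tau> * (hauptmodul 6 \<tau> + 9) - hauptmodul 6 \<tau> * (hauptmodul 6 \<tau> + 8) ^ 3 = 0) cusp"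
    using y6 y(2) nz
  proof eventually_elim
    case (elim \<tau>)
    show ?case unfolding elim(2)[symmetric] elim(1)[symmetric] using elim(4) by simp
  qed
  show ?thesis
    using uhp_zero_if_eventually_zero[OF _ ev \<tau>] by (simp add: holomorphic_intros hauptmodul_holomorphic lv)
qed

section \<open>Transformations of h\<close>

text \<open>If t_p = V(t) with a polynomial V, then j = J(V)/V. This is in lowest terms because J
  does not vanish at 0, and the numerator has degree (p + 1) deg V.\<close>

lemma lowest_terms_via_prime:
  assumes p: "p \<in> {2, 3, 5}" and e: "degree V = e" "e > 0"
    and V: "\<And>\<tau>. Im \<tau> > 0 \<Longrightarrow> hauptmodul p \<tau> = poly V (t \<tau>)"
  shows "\<exists>A B. lowest_terms modular_j t A B \<and> degree A = (p + 1) * e \<and> degree B < (p + 1) * e"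
proof -
  define J :: "complex poly" where "J = (if p = 2 then [:16, 1:] ^ 3 else if p = 3 then [:27, 1:] * [:3, 1:] ^ 3 else [:5, 10, 1:] ^ 3)"
  have J: "poly J x = j_num p x 1" for x
    using p by (elim insertE emptyE) (simp_all add: J_def j_num_def algebra_simps power2_eq_square)
  have "degree ([:27, 1:] * [:3, 1:] ^ 3 :: complex poly) = 4" by (subst degree_mult_eq) (simp_all add: degree_power_eq)
  hence dJ: "degree J = p + 1"
    using p by (elim insertE emptyE) (simp_all add: J_def degree_power_eq del: mult_pCons_left)
  have "lowest_terms modular_j t (pcompose J V) V" unfolding lowest_terms_def
  proof (intro conjI allI impI)
    show "coprime (pcompose J V) V"
      unfolding coprime_iff_no_common_root poly_pcompose J using p by (auto simp: j_num_def)
    fix \<tau> :: complex assume \<tau>: "Im \<tau> > 0"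
    show "poly V (t \<tau>) \<noteq> 0" using hauptmodul_nonzero[OF prime_in_levels[OF p] \<tau>] V[OF \<tau>] by simp
    show "modular_j \<tau> = poly (pcompose J V) (t \<tau>) / poly V (t \<tau>)"
      unfolding modular_j_level_prime[OF p \<tau>] V[OF \<tau>] poly_pcompose J ..
  qed
  moreover have "degree (pcompose J V) = (p + 1) * e" by (simp add: degree_pcompose dJ e)
  moreover have "degree V < (p + 1) * e" using e p by auto
  ultimately show ?thesis by blast
qed

text \<open>t_2 is not a polynomial in t_6, so its denominator t_6 + 9 has to be cleared
  explicitly.\<close>

lemma lowest_terms_level_6:
  "\<exists>A B. lowest_terms modular_j (hauptmodul 6) A B \<and> degree A = 12 \<and> degree B < 12"
proof -
  define A0 :: "complex poly" where "A0 = [:0, 1:] * [:8, 1:] ^ 3 + 16 * [:9, 1:]"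
  define B :: "complex poly" where "B = [:0, 1:] * [:8, 1:] ^ 3 * [:9, 1:] ^ 2"
  have pA: "poly (A0 ^ 3) x = (x * (x + 8) ^ 3 + 16 * (x + 9)) ^ 3" for x
    by (simp add: A0_def poly_power add.commute algebra_simps)
  have pB: "poly B x = x * (x + 8) ^ 3 * (x + 9) ^ 2" for x by (simp add: B_def poly_power add.commute)
  have "lowest_terms modular_j (hauptmodul 6) (A0 ^ 3) B" unfolding lowest_terms_def
  proof (intro conjI allI impI)
    show "coprime (A0 ^ 3) B"
      unfolding coprime_iff_no_common_root pA pB by (auto simp: add_eq_0_iff2)
    fix \<tau> :: complex assume \<tau>: "Im \<tau> > 0"
    let ?t = "hauptmodul 6 \<tau>"
    have lv: "2 \<in> genus0_levels" "6 \<in> genus0_levels" by (auto simp: genus0_levels_def)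
    note l = level_6[OF \<tau>]
    have t0: "?t \<noteq> 0" "hauptmodul 2 \<tau> \<noteq> 0" using hauptmodul_nonzero \<tau> lv by blast+
    \<comment> \<open>The relation of level 6 is free of division; at the value -9 it would read 0 =
      9.\<close>
    have t9: "?t + 9 \<noteq> 0"
    proof
      assume "?t + 9 = 0"
      hence "?t = -9" by (simp add: add_eq_0_iff2)
      thus False using l by simp
    qed
    have t8: "?t + 8 \<noteq> 0" using l t9 t0 by auto
    show "poly B ?t \<noteq> 0" unfolding pB using t0 t8 t9 by simp
    have h2: "hauptmodul 2 \<tau> = ?t * (?t + 8) ^ 3 / (?t + 9)" using l t9 by (simp add: field_simps)
    have "modular_j \<tau> = j_num 2 (?t * (?t + 8) ^ 3 / (?t + 9)) 1 / (?t * (?t + 8) ^ 3 / (?t + 9))"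
      using modular_j_level_prime[of 2, OF _ \<tau>] unfolding h2 by simp
    also have "\<dots> = j_num 2 (?t * (?t + 8) ^ 3) (?t + 9) / (?t * (?t + 8) ^ 3 * (?t + 9) ^ 2)"
      using j_num_scale[of 2 "?t + 9" "?t * (?t + 8) ^ 3"] t9 by (simp add: eval_nat_numeral)
    finally show "modular_j \<tau> = poly (A0 ^ 3) ?t / poly B ?t" unfolding pA pB by (simp add: j_num_def)
  qed
  moreover have "degree A0 = 4"
  proof -
    have "degree ([:0, 1:] * [:8, 1:] ^ 3 :: complex poly) = 4" by (simp add: degree_mult_eq degree_power_eq)
    moreover have "degree (16 * [:9, 1:] :: complex poly) \<le> 1"
      using degree_mult_le[of "16 :: complex poly" "[:9, 1:]"] by simp
    ultimately show ?thesis unfolding A0_def by (subst degree_add_eq_left) auto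
  qed
  hence "degree (A0 ^ 3) = 12" by (subst degree_power_eq) auto
  moreover have "degree B = 6" by (simp add: B_def degree_mult_eq degree_power_eq)
  ultimately show ?thesis by (intro exI[of _ "A0 ^ 3"] exI[of _ B]) simp
qed

section \<open>The index psi and the degrees of the expressions for j\<close>

lemma prime_factors_of_prime_power:
  "prime p \<Longrightarrow> k > 0 \<Longrightarrow> {q. prime q \<and> q dvd p ^ k} = {p::nat}"
  by (auto intro: primes_dvd_imp_eq prime_dvd_power dvd_power)

lemma dedekind_psi_prime_power:
  assumes "prime p" "k > 0"
  shows "dedekind_psi (p ^ k) = real (p ^ (k - 1) * (p + 1))"
proof -
  have "real p > 0" using assms(1) prime_gt_0_nat by simp
  thus ?thesis using assms(2) power_Suc[of "real p" "k - 1"]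
    by (simp add: dedekind_psi_def prime_factors_of_prime_power[OF assms] field_simps)
qed

lemma dedekind_psi_6: "dedekind_psi 6 = 12"
proof -
  have "prime (3::nat)" by simp
  have "q = 2 \<or> q = 3" if "prime q" "q dvd 6" for q :: nat
  proof -
    have "q dvd 2 * 3" using that(2) by simp
    hence "q dvd 2 \<or> q dvd 3" using that(1) prime_dvd_mult_iff by blast
    thus ?thesis using that(1) primes_dvd_imp_eq two_is_prime_nat \<open>prime 3\<close> by metis
  qed
  hence "{q::nat. prime q \<and> q dvd 6} = {2, 3}" by auto
  thus ?thesis by (simp add: dedekind_psi_def)
qed

text \<open>These are the M in S for which some N M with N >= 2 is again in S.\<close>

lemma level_data:
  assumes "M \<in> {2, 3, 4, 5, 6, 8, 9}"
  obtains d A B where "dedekind_psi M = of_nat d" "lowest_terms modular_j (hauptmodul M) A B" "degree A = d" "degree B < d"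
proof -
  note psi = dedekind_psi_prime_power
  note via = lowest_terms_via_prime
  have X: "degree [:0, 1 :: complex:] = 1" by simp
  show ?thesis using assms
  proof (elim insertE emptyE)
    assume "M = 2"
    thus ?thesis using that[of 3] psi[of 2 1] via[of 2 "[:0, 1:]" 1 "hauptmodul 2"] by auto
  next
    assume "M = 3"
    thus ?thesis using that[of 4] psi[of 3 1] via[of 3 "[:0, 1:]" 1 "hauptmodul 3"] by auto
  next
    assume "M = 5"
    thus ?thesis using that[of 6] psi[of 5 1] via[of 5 "[:0, 1:]" 1 "hauptmodul 5"] by auto
  next
    assume "M = 4"
    thus ?thesis using that[of 6] psi[of 2 2] via[of 2 "[:0, 16, 1:]" 2 "hauptmodul 4"] level_4(1)
      by (auto simp: algebra_simps)
  next
    assume "M = 6"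
    thus ?thesis using that[of 12] dedekind_psi_6 lowest_terms_level_6 by auto
  next
    assume "M = 8"
    \<comment> \<open>t_2 has degree 2 in t_4 and t_4 has degree 2 in t_8, whence the degree 4, and
      (2 + 1) * 4 = 12 = psi(8).\<close>
    moreover have "hauptmodul 2 \<tau> = poly (pcompose [:0, 16, 1:] [:0, 8, 1:]) (hauptmodul 8 \<tau>)" if "Im \<tau> > 0" for \<tau>
      using level_4(1)[OF that] unfolding level_8[OF that] by (simp add: poly_pcompose algebra_simps)
    ultimately show ?thesis using that[of 12] psi[of 2 3] via[of 2 "pcompose [:0, 16, 1:] [:0, 8, 1:]" 4 "hauptmodul 8"]
      by (auto simp: degree_pcompose)
  next
    assume "M = 9"
    thus ?thesis using that[of 12] psi[of 3 2] via[of 3 "[:0, 27, 9, 1:]" 3 "hauptmodul 9"] level_9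
      by (auto simp: algebra_simps power2_eq_square)
  qed
qed

lemma hauptmodul_nonconstant:
  assumes N: "N \<in> genus0_levels"
  shows "\<not> hauptmodul N constant_on uhp"
proof
  assume "hauptmodul N constant_on uhp"
  then obtain c where c: "\<And>\<tau>. Im \<tau> > 0 \<Longrightarrow> hauptmodul N \<tau> = c" unfolding constant_on_def by auto
  hence "((\<lambda>_. c) \<longlongrightarrow> 0) cusp"
    by (intro Lim_transform_eventually[OF hauptmodul_tendsto_0[OF N]]) (auto intro!: eventually_mono[OF eventually_cusp_uhp[of 0]])
  hence "c = 0" by (simp add: tendsto_const_iff)
  thus False using hauptmodul_nonzero[OF N, of \<i>] c[of \<i>] by simp
qed

text \<open>The case N = 1 of part (2): the only coprime fractions for x are c x / c. It covers the
  levels whose expression for j is not made explicit.\<close>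

lemma lowest_terms_self:
  assumes t: "q_holomorphic t" "\<not> t constant_on uhp" and lt: "lowest_terms t t P Q"
  obtains c where "c \<noteq> 0" "\<And>x. poly Q x = c" "\<And>x. poly P x = c * x"
proof -
  have inf: "infinite (t ` uhp)"
    using continuous_finite_range_constant[OF connected_uhp holomorphic_on_imp_continuous_on[OF q_holomorphicD(1)[OF t(1)]]] t(2) by blast
  have "poly (P - [:0, 1:] * Q) x = 0" if "x \<in> t ` uhp" for x
  proof -
    from that obtain \<tau> where \<tau>: "x = t \<tau>" "Im \<tau> > 0" by auto
    hence "poly Q x \<noteq> 0" "x = poly P x / poly Q x" using lt unfolding lowest_terms_def by auto
    hence "poly P x = x * poly Q x" by (metis nonzero_eq_divide_eq)
    thus ?thesis by simp
  qed
  hence "t ` uhp \<subseteq> {x. poly (P - [:0, 1:] * Q) x = 0}" by blast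
  hence "P - [:0, 1:] * Q = 0" using inf finite_subset poly_roots_finite by metis
  hence P: "P = [:0, 1:] * Q" by simp
  have "coprime P Q" using lt unfolding lowest_terms_def by blast
  hence "is_unit Q" using coprime_common_divisor[of P Q Q] P by (metis dvd_refl dvd_triv_right)
  then obtain c where "Q = [:c:]" "c \<noteq> 0" unfolding is_unit_poly_iff by (metis dvd_0_left zero_neq_one)
  thus ?thesis using P that[of c] by (simp add: mult.commute)
qed

theorem theorem8p1:
  shows "(\<forall>M \<in> genus0_levels. \<forall>P Q P' Q'.
      lowest_terms modular_j (hauptmodul M) P Q \<longrightarrow>
      lowest_terms (\<lambda>\<tau>. modular_j (of_nat M * \<tau>)) (hauptmodul M) P' Q' \<longrightarrow>
      (\<forall>\<^sub>F t in nhds 0.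
         h_fun M t = (poly P t / poly P 0) powr (-1/12)
                       * h1_hat (12^3 * poly Q t / poly P t) \<and>
         h_fun M t = (poly P' t / poly P' 0) powr (-1/12)
                       * h1_hat (12^3 * poly Q' t / poly P' t)))
    \<and>
    (\<forall>M N. N > 0 \<longrightarrow> M \<in> genus0_levels \<longrightarrow> N * M \<in> genus0_levels \<longrightarrow> (\<forall>P Q P' Q'.
      lowest_terms (hauptmodul M) (hauptmodul (N * M)) P Q \<longrightarrow>
      lowest_terms (\<lambda>\<tau>. hauptmodul M (of_nat N * \<tau>)) (hauptmodul (N * M)) P' Q' \<longrightarrow>
      (\<forall>\<^sub>F t in nhds 0.
         h_fun (N * M) t = (poly Q t / poly Q 0) powr (- of_real (dedekind_psi M) / 12)
                             * h_fun M (poly P t / poly Q t) \<and>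
         h_fun (N * M) t = (poly Q' t / poly Q' 0) powr (- of_real (dedekind_psi M) / 12)
                             * h_fun M (poly P' t / poly Q' t))))"
proof (intro conjI ballI allI impI)
  fix M P Q P' Q'
  assume M: "M \<in> genus0_levels" and lt: "lowest_terms modular_j (hauptmodul M) P Q"
    and lt': "lowest_terms (\<lambda>\<tau>. modular_j (of_nat M * \<tau>)) (hauptmodul M) P' Q'"
  note t = hauptmodul_q_holomorphic[OF M]
  have "M > 0" using M by (auto simp: genus0_levels_def)
  \<comment> \<open>The two formulas of part (1) are the cases n = 1 and n = M of
    \<open>h_fun_eventually\<close>.\<close>
  have lt1: "lowest_terms (\<lambda>\<tau>. modular_j (of_nat 1 * \<tau>)) (hauptmodul M) P Q" using lt by simp
  show "\<forall>\<^sub>F t in nhds 0.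
         h_fun M t = (poly P t / poly P 0) powr (-1/12) * h1_hat (12^3 * poly Q t / poly P t) \<and>
         h_fun M t = (poly P' t / poly P' 0) powr (-1/12) * h1_hat (12^3 * poly Q' t / poly P' t)"
    using h_fun_eventually[OF t lt zero_less_one lt1] h_fun_eventually[OF t lt \<open>M > 0\<close> lt']
    unfolding h_form_def by (rule eventually_conj)
next
  fix M N :: nat and P Q P' Q'
  assume N: "N > 0" and M: "M \<in> genus0_levels" and L: "N * M \<in> genus0_levels"
    and lt: "lowest_terms (hauptmodul M) (hauptmodul (N * M)) P Q"
    and lt': "lowest_terms (\<lambda>\<tau>. hauptmodul M (of_nat N * \<tau>)) (hauptmodul (N * M)) P' Q'"
  show "\<forall>\<^sub>F t in nhds 0.
         h_fun (N * M) t = (poly Q t / poly Q 0) powr (- of_real (dedekind_psi M) / 12) * h_fun M (poly P t / poly Q t) \<and>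
         h_fun (N * M) t = (poly Q' t / poly Q' 0) powr (- of_real (dedekind_psi M) / 12) * h_fun M (poly P' t / poly Q' t)"
  proof (cases "N = 1")
    case True
    note s = lowest_terms_self[OF hauptmodul_q_holomorphic[OF M] hauptmodul_nonconstant[OF M]]
    obtain c where "c \<noteq> 0" "\<And>x. poly Q x = c" "\<And>x. poly P x = c * x" using s[of P Q] lt True by auto
    moreover obtain c' where "c' \<noteq> 0" "\<And>x. poly Q' x = c'" "\<And>x. poly P' x = c' * x" using s[of P' Q'] lt' True by auto
    ultimately show ?thesis using True by simp
  next
    case False
    \<comment> \<open>Some proper multiple of M is at most 25 and lies in S, while 14, 21, 20 and 24
      do not; this excludes 7, 10 and 12 along with all M above 12.\<close>
    hence "M \<in> {2, 3, 4, 5, 6, 8, 9}"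
    proof -
      have "N \<ge> 2" using N False by simp
      hence "2 * M \<le> N * M" by (rule mult_le_mono1)
      moreover have "N * M \<le> 25" using L by (auto simp: genus0_levels_def)
      ultimately have "M \<le> 12" by linarith
      moreover have "N \<noteq> 2 \<and> N \<noteq> 3" if "M = 7" using that L by (auto simp: genus0_levels_def)
      moreover have "N \<noteq> 2" if "M = 10 \<or> M = 12" using that L by (auto simp: genus0_levels_def)
      ultimately show ?thesis using M \<open>N \<ge> 2\<close> \<open>N * M \<le> 25\<close> by (auto simp: genus0_levels_def)
    qed
    then obtain d A B where d: "dedekind_psi M = of_nat d" "lowest_terms modular_j (hauptmodul M) A B" "degree A = d" "degree B < d"
      by (rule level_data)
    note hol = hauptmodul_q_holomorphic[OF L] hauptmodul_q_holomorphic[OF M]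
    have lt1: "lowest_terms (\<lambda>\<tau>. hauptmodul M (of_nat 1 * \<tau>)) (hauptmodul (N * M)) P Q" using lt by simp
    \<comment> \<open>Part (2) assumes no expression for j in t_(NM). Substitution into the one at
      level M supplies it, as the choice in \<open>j_frac\<close> requires.\<close>
    have ex: "lowest_terms modular_j (hauptmodul (N * M)) (homogenize d A P Q) (homogenize d B P Q)"
      using lowest_terms_compose[OF d(2-4) zero_less_one lt1] by simp
    have psi: "- of_real (dedekind_psi M) / 12 = (- of_nat d / 12 :: complex)" by (simp add: d(1))
    show ?thesis unfolding psi
      by (rule eventually_conj[OF h_fun_compose[OF hol zero_less_one d(2-4) ex lt1] h_fun_compose[OF hol N d(2-4) ex lt']])
  qed
qed

end
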